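(* Let $(M,\mathbf p)$ be an oriented projective manifold of dimension $n$, let $\mathbf c$ be the induced conformal Patterson--Walker metric on $\widetilde M=T^*M(2)$ and let $k$ be its Euler-type field $k=2p_A\partial/\partial p_A$. Let $D\in\mathbf p$ be a special connection. (a) Any infinitesimal symmetry $v^A$ of $\mathbf p$ induces (by the lift $\tilde v_0$ defined in the context) a conformal Killing field $\tilde v_0$ of $\mathbf c$. (b) Any skew-symmetric bivector $w^{AB}\in\mathcal E^{[AB]}(-2)$ satisfying the projectively invariant equation $D_Cw^{AB}=-\frac{2}{n-1}\delta_C^{[A}D_Pw^{B]P}$ and the integrability condition $w^{B(A}W_{B(C}{}^{D)}{}_{E)}=0$ induces (by the lift $\tilde v_+$) a conformal Killing field $\tilde v_+$ of $\mathbf c$. (c) Any Killing $1$-form, i.e. $\alpha_A\in\mathcal E_A(2)$ with $D_{(A}\alpha_{B)}=0$, induces (by the lift $\tilde v_-$) a conformal Killing field $\tilde v_-$ of $\mathbf c$. In fact, any conformal Killing field of $\mathbf c$ can be uniquely decomposed as a direct sum $\tilde v_++\tilde v_0+\tilde v_-+c\,k$, where $\tilde v_+,\tilde v_0,\tilde v_-$ are the lifts of solutions as in (b), (a), (c) respectively and $c\,k$ is a constant multiple of $k$.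
   Context: A projective structure $\mathbf p$ is a class of torsion-free affine connections related by $\widehat D_A\xi^B=D_A\xi^B+\Upsilon_A\xi^B+\delta_A^B\Upsilon_C\xi^C$; a connection is special if it preserves a volume form. $\mathcal E(w)=(\wedge^nTM)^{-w/(n+1)}$; $\mathcal E^{[AB]}(w)$, $\mathcal E_A(w)$ are the tensor bundles tensored with $\mathcal E(w)$; $T^*M(2)=T^*M\otimes\mathcal E(2)$. For a special $D\in\mathbf p$, a positive section $\sigma_D$ of $\mathcal E(1)$ with $D\sigma_D=0$ trivializes all density bundles and identifies $T^*M(2)$ with $T^*M$. Curvature: $R_{AB}{}^C{}_Dv^D=2D_{[A}D_{B]}v^C$, $\mathsf P_{AB}=\frac{1}{n-1}R_{PA}{}^P{}_B$, $W_{AB}{}^C{}_D=R_{AB}{}^C{}_D+\mathsf P_{AD}\delta^C_B-\mathsf P_{BD}\delta^C_A$. In local coordinates $x^A$ in which the volume form preserved by $D$ is a constant multiple of $dx^1\wedge\dots\wedge dx^n$, with canonical fibre coordinates $p_A$, the Patterson--Walker metric of $D$ is $g=2\,dx^A\odot dp_A-2\,\Gamma_A{}^C{}_B\,p_C\,dx^A\odot dx^B$, where $\Gamma_A{}^C{}_B$ are the Christoffel symbols of $D$ and $\alpha\odot\beta=\frac12(\alpha\otimes\beta+\beta\otimes\alpha)$. Its conformal class $\mathbf c$ on $T^*M(2)$ is independent of the choice of special $D\in\mathbf p$. Put $h_A=\frac{\partial}{\partial x^A}+\Gamma_A{}^C{}_Bp_C\frac{\partial}{\partial p_B}$. An infinitesimal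 symmetry of $\mathbf p$ is a vector field $v^A$ such that for $D\in\mathbf p$ there is a $1$-form $\Upsilon$ with $\mathcal L_vD_AX^B-D_A\mathcal L_vX^B=(\delta_A^B\Upsilon_C+\delta_C^B\Upsilon_A)X^C$ for all $X$. Lifts (independent of the choice of special $D\in\mathbf p$): with $\psi=\frac1nD_Cv^C$, $\phi_A^B=D_Av^B-\frac1n\delta_A^BD_Cv^C$ and $\nu^A=\frac{1}{n-1}D_Cw^{CA}$, $\tilde v_0=v^Ah_A-\phi_B^Ap_A\frac{\partial}{\partial p_B}+\frac{n-1}{2(n+1)}\psi\,k$, $\quad\tilde v_+=w^{AB}p_Ah_B-\frac12(\nu^Bp_B)k$, $\quad\tilde v_-=\alpha_A\frac{\partial}{\partial p_A}$.
   Formalization: Stated for n ≥ 2; (b) only for n ≥ 3, since it fails for n = 2 (flat plane, w = (x^1)^2 times the area bivector); the decomposition only for M nonempty and connected, since it fails otherwise; E(w) has the opposite sign of weight, which projective invariance of c requires. *)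

theory Defs
  imports "HOL-Analysis.Analysis"
begin

section \<open>Smooth manifolds and tensor fields through indexed atlases\<close>

text \<open>
  A manifold modelled on \<open>'e\<close> is an indexed family of charts \<open>A i = (U\<^sub>i, \<phi>\<^sub>i)\<close>; its points are
  \<open>\<Union>i. U\<^sub>i\<close> and its topology is the one generated by the charts. A tensor field is the
  family of its component functions \<open>T i\<close> in the charts, as functions of the coordinates
  \<open>x \<in> \<phi>\<^sub>i(U\<^sub>i)\<close>, related by the usual transformation law. Components are required to vanish off
  \<open>\<phi>\<^sub>i(U\<^sub>i)\<close>, so that a tensor field is determined by its HOL representation.
\<close>

type_synonym ('i, 'a, 'e) atlas = "'i \<Rightarrow> 'a set \<times> ('a \<Rightarrow> 'e)"

primrec Ck_on :: "nat \<Rightarrow> ('e::real_normed_vector \<Rightarrow> 'f::real_normed_vector) \<Rightarrow> 'e set \<Rightarrow> bool" where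
  "Ck_on 0 f S \<longleftrightarrow> continuous_on S f"
| "Ck_on (Suc k) f S \<longleftrightarrow> (\<forall>x\<in>S. f differentiable at x) \<and>
     (\<forall>u. Ck_on k (\<lambda>x. frechet_derivative f (at x) u) S)"

text \<open>Only meant for open \<open>S\<close>.\<close>
definition smooth_on :: "('e::real_normed_vector \<Rightarrow> 'f::real_normed_vector) \<Rightarrow> 'e set \<Rightarrow> bool" where
  "smooth_on f S \<longleftrightarrow> (\<forall>k. Ck_on k f S)"

definition chart_image :: "('i, 'a, 'e) atlas \<Rightarrow> 'i \<Rightarrow> 'e set" where
  "chart_image A i = snd (A i) ` fst (A i)"

definition overlap :: "('i, 'a, 'e) atlas \<Rightarrow> 'i \<Rightarrow> 'i \<Rightarrow> 'e set" where
  "overlap A i j = snd (A i) ` (fst (A i) \<inter> fst (A j))"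

definition transition :: "('i, 'a, 'e) atlas \<Rightarrow> 'i \<Rightarrow> 'i \<Rightarrow> 'e \<Rightarrow> 'e" where
  "transition A i j x = snd (A j) (inv_into (fst (A i)) (snd (A i)) x)"

definition points :: "('i, 'a, 'e) atlas \<Rightarrow> 'a set" where
  "points A = (\<Union>i. fst (A i))"

definition atlas_topology :: "('i, 'a, 'e::topological_space) atlas \<Rightarrow> 'a topology" where
  "atlas_topology A = topology_generated_by {fst (A i) \<inter> snd (A i) -` W | i W. open W}"

definition smooth_atlas :: "('i, 'a, 'e::euclidean_space) atlas \<Rightarrow> bool" where
  "smooth_atlas A \<longleftrightarrow>
     (\<forall>i. inj_on (snd (A i)) (fst (A i)) \<and> open (chart_image A i)) \<and>
     (\<forall>i j. open (overlap A i j) \<and> smooth_on (transition A i j) (overlap A i j))"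

definition smooth_manifold :: "('i, 'a, 'e::euclidean_space) atlas \<Rightarrow> bool" where
  "smooth_manifold A \<longleftrightarrow> smooth_atlas A \<and>
     Hausdorff_space (atlas_topology A) \<and> second_countable (atlas_topology A)"

text \<open>\<open>D\<tau>\<^sub>i\<^sub>j(x)\<close>, that is, \<open>\<partial>x'/\<partial>x\<close> for \<open>x' = \<tau>\<^sub>i\<^sub>j(x)\<close>.\<close>
definition dtrans :: "('i, 'a, 'e::euclidean_space) atlas \<Rightarrow> 'i \<Rightarrow> 'i \<Rightarrow> 'e \<Rightarrow> 'e \<Rightarrow> 'e" where
  "dtrans A i j x = frechet_derivative (transition A i j) (at x)"

definition smooth_components ::
  "('i, 'a, 'e::euclidean_space) atlas \<Rightarrow> ('i \<Rightarrow> 'e \<Rightarrow> 'f::real_normed_vector) \<Rightarrow> bool" where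
  "smooth_components A T \<longleftrightarrow>
     (\<forall>i. smooth_on (T i) (chart_image A i) \<and> (\<forall>x. x \<notin> chart_image A i \<longrightarrow> T i x = 0))"

definition scalar_field :: "('i, 'a, 'e::euclidean_space) atlas \<Rightarrow> ('i \<Rightarrow> 'e \<Rightarrow> real) \<Rightarrow> bool" where
  "scalar_field A f \<longleftrightarrow> smooth_components A f \<and>
     (\<forall>i j. \<forall>x\<in>overlap A i j. f j (transition A i j x) = f i x)"

definition vector_field :: "('i, 'a, 'e::euclidean_space) atlas \<Rightarrow> ('i \<Rightarrow> 'e \<Rightarrow> 'e) \<Rightarrow> bool" where
  "vector_field A X \<longleftrightarrow> smooth_components A X \<and>
     (\<forall>i j. \<forall>x\<in>overlap A i j. X j (transition A i j x) = dtrans A i j x (X i x))"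

definition restrict_chart ::
  "('i, 'a, 'e) atlas \<Rightarrow> ('i \<Rightarrow> 'e \<Rightarrow> 'f::zero) \<Rightarrow> 'i \<Rightarrow> 'e \<Rightarrow> 'f" where
  "restrict_chart A T i x = (if x \<in> chart_image A i then T i x else 0)"

section \<open>Conformal Killing fields\<close>

text \<open>Pseudo-Riemannian metrics of arbitrary signature.\<close>
definition metric ::
  "('i, 'a, 'e::euclidean_space) atlas \<Rightarrow> ('i \<Rightarrow> 'e \<Rightarrow> 'e \<Rightarrow> 'e \<Rightarrow> real) \<Rightarrow> bool" where
  "metric A g \<longleftrightarrow>
     (\<forall>i u v. smooth_on (\<lambda>x. g i x u v) (chart_image A i)) \<and>
     (\<forall>i. \<forall>x\<in>chart_image A i.
        bilinear (g i x) \<and> (\<forall>u v. g i x u v = g i x v u) \<and>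
        (\<forall>u. (\<forall>v. g i x u v = 0) \<longrightarrow> u = 0)) \<and>
     (\<forall>i j. \<forall>x\<in>overlap A i j. \<forall>u v.
        g j (transition A i j x) (dtrans A i j x u) (dtrans A i j x v) = g i x u v)"

definition conformal_to ::
  "('i, 'a, 'e::euclidean_space) atlas \<Rightarrow> ('i \<Rightarrow> 'e \<Rightarrow> 'e \<Rightarrow> 'e \<Rightarrow> real) \<Rightarrow>
     ('i \<Rightarrow> 'e \<Rightarrow> 'e \<Rightarrow> 'e \<Rightarrow> real) \<Rightarrow> bool" where
  "conformal_to A g g' \<longleftrightarrow>
     (\<exists>f. scalar_field A f \<and>
       (\<forall>i. \<forall>x\<in>chart_image A i. f i x > 0 \<and> (\<forall>u v. g' i x u v = f i x * g i x u v)))"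

definition lie_metric ::
  "('e::euclidean_space \<Rightarrow> 'e) \<Rightarrow> ('e \<Rightarrow> 'e \<Rightarrow> 'e \<Rightarrow> real) \<Rightarrow> 'e \<Rightarrow> 'e \<Rightarrow> 'e \<Rightarrow> real" where
  "lie_metric X g x u v =
     frechet_derivative (\<lambda>y. g y u v) (at x) (X x)
     + g x (frechet_derivative X (at x) u) v + g x u (frechet_derivative X (at x) v)"

definition conformal_killing ::
  "('i, 'a, 'e::euclidean_space) atlas \<Rightarrow> ('i \<Rightarrow> 'e \<Rightarrow> 'e \<Rightarrow> 'e \<Rightarrow> real) set \<Rightarrow>
     ('i \<Rightarrow> 'e \<Rightarrow> 'e) \<Rightarrow> bool" where
  "conformal_killing A C X \<longleftrightarrow> vector_field A X \<and>
     (\<forall>g\<in>C. \<exists>l. scalar_field A l \<and>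
       (\<forall>i. \<forall>x\<in>chart_image A i. \<forall>u v. lie_metric (X i) (g i) x u v = l i x * g i x u v))"

section \<open>Oriented manifolds, densities and weighted tensors\<close>

type_synonym ('i, 'a, 'n) natlas = "('i, 'a, real^'n) atlas"

definition jacobian :: "('i, 'a, 'n::finite) natlas \<Rightarrow> 'i \<Rightarrow> 'i \<Rightarrow> real^'n \<Rightarrow> real^'n^'n" where
  "jacobian A i j x = matrix (dtrans A i j x)"

definition oriented_manifold :: "('i, 'a, 'n::finite) natlas \<Rightarrow> bool" where
  "oriented_manifold A \<longleftrightarrow> smooth_manifold A \<and>
     (\<forall>i j. \<forall>x\<in>overlap A i j. det (jacobian A i j x) > 0)"

text \<open>
  Transition function of \<open>\<E>(w)\<close>, normalised by \<open>\<E>(-n-1) = \<Lambda>\<^sup>n T\<^sup>*M\<close>. With this sign a change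
  \<open>\<Gamma>\<^sub>A\<^sup>B\<^sub>C + \<Upsilon>\<^sub>A \<delta>\<^sup>B\<^sub>C + \<delta>\<^sup>B\<^sub>A \<Upsilon>\<^sub>C\<close> of the connection adds \<open>w \<Upsilon>\<^sub>A s\<close> to \<open>D\<^sub>A s\<close> for \<open>s \<in> \<E>(w)\<close>, which is
  what makes the equations below, and the conformal class on \<open>T\<^sup>*M(2)\<close>, projectively invariant.
\<close>
definition weight_factor :: "('i, 'a, 'n::finite) natlas \<Rightarrow> real \<Rightarrow> 'i \<Rightarrow> 'i \<Rightarrow> real^'n \<Rightarrow> real" where
  "weight_factor A w i j x = det (jacobian A i j x) powr (w / (real CARD('n) + 1))"

definition density :: "('i, 'a, 'n::finite) natlas \<Rightarrow> real \<Rightarrow> ('i \<Rightarrow> real^'n \<Rightarrow> real) \<Rightarrow> bool" where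
  "density A w s \<longleftrightarrow> smooth_components A s \<and>
     (\<forall>i j. \<forall>x\<in>overlap A i j. s j (transition A i j x) = weight_factor A w i j x * s i x)"

text \<open>Sections \<open>\<alpha>\<^sub>A\<close> of \<open>\<E>\<^sub>A(w)\<close>.\<close>
definition one_form :: "('i, 'a, 'n::finite) natlas \<Rightarrow> real \<Rightarrow> ('i \<Rightarrow> real^'n \<Rightarrow> real^'n) \<Rightarrow> bool" where
  "one_form A w \<alpha> \<longleftrightarrow> smooth_components A \<alpha> \<and>
     (\<forall>i j. \<forall>x\<in>overlap A i j.
        transpose (jacobian A i j x) *v \<alpha> j (transition A i j x) = weight_factor A w i j x *\<^sub>R \<alpha> i x)"

text \<open>Sections \<open>w\<^sup>A\<^sup>B\<close> of the bundle of skew bivectors of weight \<open>wt\<close>; \<open>w i x $ A $ B\<close> is \<open>w\<^sup>A\<^sup>B\<close>.\<close>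
definition bivector ::
  "('i, 'a, 'n::finite) natlas \<Rightarrow> real \<Rightarrow> ('i \<Rightarrow> real^'n \<Rightarrow> real^'n^'n) \<Rightarrow> bool" where
  "bivector A wt w \<longleftrightarrow> smooth_components A w \<and> (\<forall>i x. transpose (w i x) = - w i x) \<and>
     (\<forall>i j. \<forall>x\<in>overlap A i j.
        w j (transition A i j x) =
        weight_factor A wt i j x *\<^sub>R (jacobian A i j x ** w i x ** transpose (jacobian A i j x)))"

section \<open>Affine connections and projective structures\<close>

definition pd :: "'n::finite \<Rightarrow> (real^'n \<Rightarrow> 'f::real_normed_vector) \<Rightarrow> real^'n \<Rightarrow> 'f" where
  "pd A f x = frechet_derivative f (at x) (axis A 1)"

definition kd :: "'n \<Rightarrow> 'n \<Rightarrow> real" where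
  "kd A B = (if A = B then 1 else 0)"

text \<open>
  A connection is given by its Christoffel symbols: \<open>D i x $ A $ C $ B\<close> is \<open>\<Gamma>\<^sub>A\<^sup>C\<^sub>B\<close>, with
  \<open>D\<^sub>A v\<^sup>C = \<partial>\<^sub>A v\<^sup>C + \<Gamma>\<^sub>A\<^sup>C\<^sub>B v\<^sup>B\<close>.
\<close>
type_synonym ('i, 'n) conn = "'i \<Rightarrow> real^'n \<Rightarrow> real^'n^'n^'n"

definition connection :: "('i, 'a, 'n::finite) natlas \<Rightarrow> ('i, 'n) conn \<Rightarrow> bool" where
  "connection M D \<longleftrightarrow> smooth_components M D \<and>
     (\<forall>i j. \<forall>x\<in>overlap M i j. \<forall>A B E.
        (\<Sum>C\<in>UNIV. jacobian M i j x $ E $ C * D i x $ A $ C $ B) =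
        pd A (\<lambda>y. pd B (\<lambda>z. transition M i j z $ E) y) x
        + (\<Sum>C\<in>UNIV. \<Sum>F\<in>UNIV. jacobian M i j x $ C $ A * jacobian M i j x $ F $ B
             * D j (transition M i j x) $ C $ E $ F))"

definition torsion_free_connection :: "('i, 'a, 'n::finite) natlas \<Rightarrow> ('i, 'n) conn \<Rightarrow> bool" where
  "torsion_free_connection M D \<longleftrightarrow> connection M D \<and> (\<forall>i x A B C. D i x $ A $ C $ B = D i x $ B $ C $ A)"

definition projectively_equivalent ::
  "('i, 'a, 'n::finite) natlas \<Rightarrow> ('i, 'n) conn \<Rightarrow> ('i, 'n) conn \<Rightarrow> bool" where
  "projectively_equivalent M D D' \<longleftrightarrow> (\<exists>\<Upsilon>. one_form M 0 \<Upsilon> \<and>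
     (\<forall>i. \<forall>x\<in>chart_image M i. \<forall>A B C.
        D' i x $ A $ B $ C = D i x $ A $ B $ C + \<Upsilon> i x $ A * kd B C + kd A B * \<Upsilon> i x $ C))"

definition projective_structure :: "('i, 'a, 'n::finite) natlas \<Rightarrow> ('i, 'n) conn set \<Rightarrow> bool" where
  "projective_structure M P \<longleftrightarrow> (\<exists>D. torsion_free_connection M D \<and>
     P = {D'. torsion_free_connection M D' \<and> projectively_equivalent M D D'})"

definition nabla_density ::
  "real \<Rightarrow> ('i, 'n::finite) conn \<Rightarrow> 'i \<Rightarrow> (real^'n \<Rightarrow> real) \<Rightarrow> real^'n \<Rightarrow> real^'n" where
  "nabla_density w D i s x =
     (\<chi> A. pd A s x + w / (real CARD('n) + 1) * (\<Sum>C\<in>UNIV. D i x $ A $ C $ C) * s x)"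

text \<open>A volume form is a nowhere vanishing section of \<open>\<Lambda>\<^sup>n T\<^sup>*M = \<E>(-n-1)\<close>.\<close>
definition special_connection :: "('i, 'a, 'n::finite) natlas \<Rightarrow> ('i, 'n) conn \<Rightarrow> bool" where
  "special_connection M D \<longleftrightarrow> (\<exists>\<theta>. density M (- (real CARD('n) + 1)) \<theta> \<and>
     (\<forall>i. \<forall>x\<in>chart_image M i. \<theta> i x \<noteq> 0 \<and> nabla_density (- (real CARD('n) + 1)) D i (\<theta> i) x = 0))"

definition parallel_scale ::
  "('i, 'a, 'n::finite) natlas \<Rightarrow> ('i, 'n) conn \<Rightarrow> ('i \<Rightarrow> real^'n \<Rightarrow> real) \<Rightarrow> bool" where
  "parallel_scale M D \<sigma> \<longleftrightarrow> density M 1 \<sigma> \<and>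
     (\<forall>i. \<forall>x\<in>chart_image M i. \<sigma> i x > 0 \<and> nabla_density 1 D i (\<sigma> i) x = 0)"

text \<open>The unweighted tensor field corresponding to a field of weight \<open>w\<close> in the scale \<open>\<sigma>\<close>.\<close>
definition trivialize ::
  "('i \<Rightarrow> real^'n \<Rightarrow> real) \<Rightarrow> real \<Rightarrow> ('i \<Rightarrow> real^'n \<Rightarrow> 'f::real_vector) \<Rightarrow> 'i \<Rightarrow> real^'n \<Rightarrow> 'f" where
  "trivialize \<sigma> w T i x = (\<sigma> i x powr (- w)) *\<^sub>R T i x"

text \<open>In each of the covariant derivatives below the first index is the index of \<open>D\<^sub>A\<close>.\<close>

definition nabla_vec :: "('i, 'n::finite) conn \<Rightarrow> 'i \<Rightarrow> (real^'n \<Rightarrow> real^'n) \<Rightarrow> real^'n \<Rightarrow> real^'n^'n" where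
  "nabla_vec D i v x = (\<chi> A B. pd A v x $ B + (\<Sum>C\<in>UNIV. D i x $ A $ B $ C * v x $ C))"

definition nabla_form ::
  "real \<Rightarrow> ('i, 'n::finite) conn \<Rightarrow> 'i \<Rightarrow> (real^'n \<Rightarrow> real^'n) \<Rightarrow> real^'n \<Rightarrow> real^'n^'n" where
  "nabla_form w D i \<alpha> x =
     (\<chi> A B. pd A \<alpha> x $ B - (\<Sum>C\<in>UNIV. D i x $ A $ C $ B * \<alpha> x $ C)
        + w / (real CARD('n) + 1) * (\<Sum>E\<in>UNIV. D i x $ A $ E $ E) * \<alpha> x $ B)"

definition nabla_biv ::
  "real \<Rightarrow> ('i, 'n::finite) conn \<Rightarrow> 'i \<Rightarrow> (real^'n \<Rightarrow> real^'n^'n) \<Rightarrow> real^'n \<Rightarrow> real^'n^'n^'n" where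
  "nabla_biv wt D i w x =
     (\<chi> C A B. pd C w x $ A $ B
        + (\<Sum>E\<in>UNIV. D i x $ C $ A $ E * w x $ E $ B) + (\<Sum>E\<in>UNIV. D i x $ C $ B $ E * w x $ A $ E)
        + wt / (real CARD('n) + 1) * (\<Sum>E\<in>UNIV. D i x $ C $ E $ E) * w x $ A $ B)"

text \<open>\<open>R\<^sub>A\<^sub>B\<^sup>C\<^sub>E v\<^sup>E = D\<^sub>A D\<^sub>B v\<^sup>C - D\<^sub>B D\<^sub>A v\<^sup>C\<close>, for torsion-free \<open>D\<close>.\<close>
definition curv :: "('i, 'n::finite) conn \<Rightarrow> 'i \<Rightarrow> real^'n \<Rightarrow> 'n \<Rightarrow> 'n \<Rightarrow> 'n \<Rightarrow> 'n \<Rightarrow> real" where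
  "curv D i x A B C E =
     pd A (\<lambda>y. D i y $ B $ C $ E) x - pd B (\<lambda>y. D i y $ A $ C $ E) x
     + (\<Sum>F\<in>UNIV. D i x $ A $ C $ F * D i x $ B $ F $ E - D i x $ B $ C $ F * D i x $ A $ F $ E)"

definition schouten :: "('i, 'n::finite) conn \<Rightarrow> 'i \<Rightarrow> real^'n \<Rightarrow> 'n \<Rightarrow> 'n \<Rightarrow> real" where
  "schouten D i x A B = 1 / (real CARD('n) - 1) * (\<Sum>Q\<in>UNIV. curv D i x Q A Q B)"

definition proj_weyl :: "('i, 'n::finite) conn \<Rightarrow> 'i \<Rightarrow> real^'n \<Rightarrow> 'n \<Rightarrow> 'n \<Rightarrow> 'n \<Rightarrow> 'n \<Rightarrow> real" where
  "proj_weyl D i x A B C E =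
     curv D i x A B C E + schouten D i x A E * kd C B - schouten D i x B E * kd C A"

section \<open>The equations on the base\<close>

definition lie_vec :: "(real^'n \<Rightarrow> real^'n) \<Rightarrow> (real^'n \<Rightarrow> real^'n) \<Rightarrow> real^'n::finite \<Rightarrow> real^'n" where
  "lie_vec v X x = frechet_derivative X (at x) (v x) - frechet_derivative v (at x) (X x)"

text \<open>Lie derivative of a tensor \<open>T\<^sub>A\<^sup>B\<close>, where \<open>T x $ A $ B\<close> is \<open>T\<^sub>A\<^sup>B\<close>.\<close>
definition lie_tensor ::
  "(real^'n \<Rightarrow> real^'n) \<Rightarrow> (real^'n \<Rightarrow> real^'n^'n) \<Rightarrow> real^'n::finite \<Rightarrow> real^'n^'n" where
  "lie_tensor v T x =
     (\<chi> A B. (\<Sum>C\<in>UNIV. v x $ C * pd C T x $ A $ B)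
        + (\<Sum>C\<in>UNIV. pd A v x $ C * T x $ C $ B) - (\<Sum>C\<in>UNIV. pd C v x $ B * T x $ A $ C))"

text \<open>The test fields \<open>X\<close> range over the local vector fields defined on a chart domain.\<close>
definition infinitesimal_symmetry ::
  "('i, 'a, 'n::finite) natlas \<Rightarrow> ('i, 'n) conn set \<Rightarrow> ('i \<Rightarrow> real^'n \<Rightarrow> real^'n) \<Rightarrow> bool" where
  "infinitesimal_symmetry M P v \<longleftrightarrow> vector_field M v \<and>
     (\<forall>D\<in>P. \<exists>\<Upsilon>. one_form M 0 \<Upsilon> \<and>
       (\<forall>i X. smooth_on X (chart_image M i) \<longrightarrow>
         (\<forall>x\<in>chart_image M i. \<forall>A B.
           lie_tensor (v i) (nabla_vec D i X) x $ A $ B - nabla_vec D i (lie_vec (v i) X) x $ A $ B =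
           (\<Sum>C\<in>UNIV. (kd A B * \<Upsilon> i x $ C + kd C B * \<Upsilon> i x $ A) * X x $ C))))"

text \<open>\<open>D\<^sub>C w\<^sup>A\<^sup>B = -2/(n-1) \<delta>\<^sub>C\<^sup>[\<^sup>A D\<^sub>Q w\<^sup>B\<^sup>]\<^sup>Q\<close> and \<open>w\<^sup>B\<^sup>(\<^sup>A W\<^sub>B\<^sub>(\<^sub>C\<^sup>E\<^sup>)\<^sub>F\<^sub>) = 0\<close>.\<close>
definition bivector_solution ::
  "('i, 'a, 'n::finite) natlas \<Rightarrow> ('i, 'n) conn \<Rightarrow> ('i \<Rightarrow> real^'n \<Rightarrow> real^'n^'n) \<Rightarrow> bool" where
  "bivector_solution M D w \<longleftrightarrow> bivector M (-2) w \<and>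
     (\<forall>i. \<forall>x\<in>chart_image M i.
       (let Dw = nabla_biv (-2) D i (w i) x in
         \<forall>A B C. Dw $ C $ A $ B =
           - (2 / (real CARD('n) - 1)) *
             ((kd C A * (\<Sum>Q\<in>UNIV. Dw $ Q $ B $ Q) - kd C B * (\<Sum>Q\<in>UNIV. Dw $ Q $ A $ Q)) / 2)) \<and>
       (\<forall>A C E F.
          (\<Sum>B\<in>UNIV.
             w i x $ B $ A * proj_weyl D i x B C E F + w i x $ B $ E * proj_weyl D i x B C A F
           + w i x $ B $ A * proj_weyl D i x B F E C + w i x $ B $ E * proj_weyl D i x B F A C) / 4 = 0))"

definition killing_form ::
  "('i, 'a, 'n::finite) natlas \<Rightarrow> ('i, 'n) conn \<Rightarrow> ('i \<Rightarrow> real^'n \<Rightarrow> real^'n) \<Rightarrow> bool" where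
  "killing_form M D \<alpha> \<longleftrightarrow> one_form M 2 \<alpha> \<and>
     (\<forall>i. \<forall>x\<in>chart_image M i. \<forall>A B.
        (nabla_form 2 D i (\<alpha> i) x $ A $ B + nabla_form 2 D i (\<alpha> i) x $ B $ A) / 2 = 0)"

section \<open>The manifold $T^*M(2)$ and its conformal class\<close>

definition weighted_covector ::
  "('i, 'a, 'n::finite) natlas \<Rightarrow> real \<Rightarrow> 'a \<Rightarrow> ('i \<Rightarrow> real^'n) \<Rightarrow> bool" where
  "weighted_covector A w m \<xi> \<longleftrightarrow> (\<forall>i. m \<notin> fst (A i) \<longrightarrow> \<xi> i = 0) \<and>
     (\<forall>i j. m \<in> fst (A i) \<inter> fst (A j) \<longrightarrow>
        transpose (jacobian A i j (snd (A i) m)) *v \<xi> j = weight_factor A w i j (snd (A i) m) *\<^sub>R \<xi> i)"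

text \<open>
  A point of \<open>T\<^sup>*M(2)\<close> is a pair of a point \<open>m\<close> and the family \<open>\<xi>\<close> of components, in all charts around
  \<open>m\<close>, of a covector of weight 2; \<open>A i\<close> induces the chart with fibre coordinates \<open>\<xi> i\<close>.
\<close>
definition cotangent2 ::
  "('i, 'a, 'n::finite) natlas \<Rightarrow> ('i, 'a \<times> ('i \<Rightarrow> real^'n), (real^'n) \<times> (real^'n)) atlas" where
  "cotangent2 A i =
     ({(m, \<xi>). m \<in> fst (A i) \<and> weighted_covector A 2 m \<xi>}, \<lambda>(m, \<xi>). (snd (A i) m, \<xi> i))"

text \<open>
  Coordinate expressions of the identification of \<open>T\<^sup>*M(2)\<close> with \<open>T\<^sup>*M\<close> in the scale \<open>\<sigma>\<close> and of its
  inverse. The Patterson--Walker metric and the lifts are written down on \<open>T\<^sup>*M\<close>, in canonical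
  coordinates \<open>(x\<^sup>A, p\<^sub>A)\<close>, and transported to \<open>T\<^sup>*M(2)\<close>. On \<open>T\<^sup>*M\<close> these expressions have the same
  form in all charts, so there is no need to single out the charts whose coordinate volume form is
  parallel.
\<close>
definition to_cotangent ::
  "('i \<Rightarrow> real^'n \<Rightarrow> real) \<Rightarrow> 'i \<Rightarrow> (real^'n) \<times> (real^'n::finite) \<Rightarrow> (real^'n) \<times> (real^'n)" where
  "to_cotangent \<sigma> i = (\<lambda>(x, p). (x, (\<sigma> i x powr (-2)) *\<^sub>R p))"

definition from_cotangent ::
  "('i \<Rightarrow> real^'n \<Rightarrow> real) \<Rightarrow> 'i \<Rightarrow> (real^'n) \<times> (real^'n::finite) \<Rightarrow> (real^'n) \<times> (real^'n)" where
  "from_cotangent \<sigma> i = (\<lambda>(x, p). (x, (\<sigma> i x powr 2) *\<^sub>R p))"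

text \<open>\<open>2 dx\<^sup>A \<odot> dp\<^sub>A - 2 \<Gamma>\<^sub>A\<^sup>C\<^sub>B p\<^sub>C dx\<^sup>A \<odot> dx\<^sup>B\<close>.\<close>
definition pw_formula ::
  "('i, 'n::finite) conn \<Rightarrow> 'i \<Rightarrow> (real^'n) \<times> (real^'n) \<Rightarrow> (real^'n) \<times> (real^'n) \<Rightarrow> (real^'n) \<times> (real^'n) \<Rightarrow> real"
where
  "pw_formula D i = (\<lambda>(x, p) (u, q) (u', q').
     (\<Sum>A\<in>UNIV. u $ A * q' $ A + q $ A * u' $ A)
     - 2 * (\<Sum>A\<in>UNIV. \<Sum>B\<in>UNIV. \<Sum>C\<in>UNIV.
              D i x $ A $ C $ B * p $ C * ((u $ A * u' $ B + u $ B * u' $ A) / 2)))"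

definition pw_metric ::
  "('i, 'n::finite) conn \<Rightarrow> ('i \<Rightarrow> real^'n \<Rightarrow> real) \<Rightarrow> 'i \<Rightarrow>
     (real^'n) \<times> (real^'n) \<Rightarrow> (real^'n) \<times> (real^'n) \<Rightarrow> (real^'n) \<times> (real^'n) \<Rightarrow> real" where
  "pw_metric D \<sigma> i z a b =
     (let J = frechet_derivative (to_cotangent \<sigma> i) (at z)
      in pw_formula D i (to_cotangent \<sigma> i z) (J a) (J b))"

text \<open>The conformal class \<open>c\<close> of the projective class \<open>P\<close>.\<close>
definition pw_class ::
  "('i, 'a, 'n::finite) natlas \<Rightarrow> ('i, 'n) conn set \<Rightarrow>
     ('i \<Rightarrow> (real^'n) \<times> (real^'n) \<Rightarrow> (real^'n) \<times> (real^'n) \<Rightarrow> (real^'n) \<times> (real^'n) \<Rightarrow> real) set" where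
  "pw_class M P = {g. metric (cotangent2 M) g \<and>
     (\<exists>D\<in>P. \<exists>\<sigma>. special_connection M D \<and> parallel_scale M D \<sigma> \<and>
        conformal_to (cotangent2 M) (pw_metric D \<sigma>) g)}"

section \<open>The lifts\<close>

definition euler_field ::
  "('i, 'a, 'n::finite) natlas \<Rightarrow> 'i \<Rightarrow> (real^'n) \<times> (real^'n) \<Rightarrow> (real^'n) \<times> (real^'n)" where
  "euler_field M = restrict_chart (cotangent2 M) (\<lambda>i (x, p). (0, 2 *\<^sub>R p))"

definition transport ::
  "('i, 'a, 'n::finite) natlas \<Rightarrow> ('i \<Rightarrow> real^'n \<Rightarrow> real) \<Rightarrow>
     ('i \<Rightarrow> (real^'n) \<times> (real^'n) \<Rightarrow> (real^'n) \<times> (real^'n)) \<Rightarrow>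
     'i \<Rightarrow> (real^'n) \<times> (real^'n) \<Rightarrow> (real^'n) \<times> (real^'n)" where
  "transport M \<sigma> X = restrict_chart (cotangent2 M)
     (\<lambda>i z. frechet_derivative (from_cotangent \<sigma> i) (at (to_cotangent \<sigma> i z)) (X i (to_cotangent \<sigma> i z)))"

text \<open>\<open>h\<^sub>A = \<partial>/\<partial>x\<^sup>A + \<Gamma>\<^sub>A\<^sup>C\<^sub>B p\<^sub>C \<partial>/\<partial>p\<^sub>B\<close>.\<close>
definition hor ::
  "('i, 'n::finite) conn \<Rightarrow> 'i \<Rightarrow> (real^'n) \<times> (real^'n) \<Rightarrow> 'n \<Rightarrow> (real^'n) \<times> (real^'n)" where
  "hor D i = (\<lambda>(x, p) A. (axis A 1, \<chi> B. \<Sum>C\<in>UNIV. D i x $ A $ C $ B * p $ C))"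

definition lift_zero ::
  "('i, 'a, 'n::finite) natlas \<Rightarrow> ('i, 'n) conn \<Rightarrow> ('i \<Rightarrow> real^'n \<Rightarrow> real) \<Rightarrow>
     ('i \<Rightarrow> real^'n \<Rightarrow> real^'n) \<Rightarrow> 'i \<Rightarrow> (real^'n) \<times> (real^'n) \<Rightarrow> (real^'n) \<times> (real^'n)" where
  "lift_zero M D \<sigma> v = transport M \<sigma> (\<lambda>i (x, p).
     let n = real CARD('n);
         Dv = nabla_vec D i (v i) x;
         \<psi> = (1 / n) * (\<Sum>C\<in>UNIV. Dv $ C $ C);
         \<phi> = (\<lambda>A B. Dv $ A $ B - kd A B * \<psi>)
     in (\<Sum>A\<in>UNIV. v i x $ A *\<^sub>R hor D i (x, p) A)
        - (0, \<chi> B. \<Sum>A\<in>UNIV. \<phi> B A * p $ A)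
        + ((n - 1) / (2 * (n + 1)) * \<psi>) *\<^sub>R (0, 2 *\<^sub>R p))"

definition lift_plus ::
  "('i, 'a, 'n::finite) natlas \<Rightarrow> ('i, 'n) conn \<Rightarrow> ('i \<Rightarrow> real^'n \<Rightarrow> real) \<Rightarrow>
     ('i \<Rightarrow> real^'n \<Rightarrow> real^'n^'n) \<Rightarrow> 'i \<Rightarrow> (real^'n) \<times> (real^'n) \<Rightarrow> (real^'n) \<times> (real^'n)" where
  "lift_plus M D \<sigma> w = transport M \<sigma> (\<lambda>i (x, p).
     let w' = trivialize \<sigma> (-2) w;
         \<nu> = (\<lambda>A. 1 / (real CARD('n) - 1) * (\<Sum>C\<in>UNIV. nabla_biv 0 D i (w' i) x $ C $ C $ A))
     in (\<Sum>A\<in>UNIV. \<Sum>B\<in>UNIV. (w' i x $ A $ B * p $ A) *\<^sub>R hor D i (x, p) B)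
        - ((1 / 2) * (\<Sum>B\<in>UNIV. \<nu> B * p $ B)) *\<^sub>R (0, 2 *\<^sub>R p))"

definition lift_minus ::
  "('i, 'a, 'n::finite) natlas \<Rightarrow> ('i \<Rightarrow> real^'n \<Rightarrow> real) \<Rightarrow>
     ('i \<Rightarrow> real^'n \<Rightarrow> real^'n) \<Rightarrow> 'i \<Rightarrow> (real^'n) \<times> (real^'n) \<Rightarrow> (real^'n) \<times> (real^'n)" where
  "lift_minus M \<sigma> \<alpha> = transport M \<sigma> (\<lambda>i (x, p). (0, trivialize \<sigma> 2 \<alpha> i x))"

end

theory Submission
  imports Defs
begin

text \<open>
  The parallel scale \<open>\<sigma>\<close> carries the problem to \<open>T\<^sup>*M\<close> with \<open>g = 2 dx dp - 2 \<Gamma>p dx dx\<close>. The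
  vertical-vertical part of the conformal Killing equation says that the derivative along the fibre
  of the base component of the field is skew; a map \<open>f\<close> with skew derivative satisfies
  \<open>(f p - f q) \<bullet> (p - q) = 0\<close>, hence is affine with skew linear part, so the base component is
  \<open>v + w(p)\<close>. The mixed part then determines the derivative along the fibre of the other component;
  symmetry of its second derivative forces \<open>D w\<close> to be pure trace and makes this component quadratic
  in \<open>p\<close>. What is left, the horizontal part, splits by degree in \<open>p\<close>: in degree 0 it is the Killing
  equation for \<open>\<alpha>\<close>; in degree 1 it says that the Lie derivative of \<open>\<Gamma>\<close> along \<open>v\<close> is pure trace, and its
  trace fixes the conformal factor up to the constant \<open>c\<close>; in degree 2 it is a condition on \<open>w\<close> and the
  curvature, which the integrability condition of the equation for \<open>w\<close> turns into the Weyl condition.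
  The same computation read backwards shows that the lifts are conformal Killing fields.
\<close>

text \<open>Dimension 2 shapes the statement. There the projective Weyl tensor vanishes, so the Weyl
  condition is empty, while the degree 2 part of the horizontal equation still restricts the
  derivative of \<open>\<nu>\<close>; hence (b) asks for \<open>n \<ge> 3\<close>. The decomposition
  passes from the quadratic condition to the Weyl condition, where the decisive trace has the factor
  \<open>4n - 4\<close>; the converse meets the factor \<open>n - 2\<close>. Local computations
  avoid indices: Christoffel symbols act as the bilinear map \<open>cm (G x) u *v a\<close>, and all
  fields in question share the normal form \<open>std_field\<close>, whose Lie derivative of the
  metric is computed once for both directions of the theorem. The scale enters them only as a
  potential for the trace of the connection, which makes the Ricci tensor symmetric. Globally, one
  metric of the class is tested, point by point: a metric is nonzero at every point, so the
  pointwise factors are unique, hence smooth and consistent on overlaps. The constant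
  \<open>c\<close> is obtained as a locally constant function, and this is where a connected
  nonempty base enters.\<close>

section \<open>Derivatives and germs of functions\<close>

abbreviation fd :: "('e::real_normed_vector \<Rightarrow> 'f::real_normed_vector) \<Rightarrow> 'e \<Rightarrow> 'e \<Rightarrow> 'f" where
  "fd f x \<equiv> frechet_derivative f (at x)"

lemma fd_eq: "(f has_derivative f') (at x) \<Longrightarrow> fd f x = f'"
  using frechet_derivative_at by metis

lemma has_derivative_fd: "f differentiable at x \<Longrightarrow> (f has_derivative fd f x) (at x)"
  using frechet_derivative_works by blast

lemma linear_fd: "f differentiable at x \<Longrightarrow> linear (fd f x)"
  by (rule linear_frechet_derivative)

text \<open>\<open>frechet_derivative\<close> is a choice operator, so it is enough that both
  functions have the same set of derivatives at \<open>x\<close>; this settles the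
  non-differentiable case as well.\<close>

lemma fd_cong:
  assumes "open S" "x \<in> S" "\<And>y. y \<in> S \<Longrightarrow> f y = g y"
  shows "fd f x = fd g x"
proof -
  have "(f has_derivative D) (at x) \<longleftrightarrow> (g has_derivative D) (at x)" for D
    using has_derivative_transform_within_open[of f D x UNIV S g]
      has_derivative_transform_within_open[of g D x UNIV S f] assms by auto
  then show ?thesis unfolding frechet_derivative_def by presburger
qed

lemma differentiable_cong_open:
  assumes "open S" "x \<in> S" "\<And>y. y \<in> S \<Longrightarrow> f y = g y" "f differentiable at x"
  shows "g differentiable at x"
  using assms has_derivative_transform_within_open[of f _ x UNIV S g]
  unfolding differentiable_def by blast

subsection \<open>Calculus of smooth maps\<close>

lemma Ck_on_cong:
  assumes "open S" "\<And>y. y \<in> S \<Longrightarrow> f y = g y" "Ck_on k f S"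
  shows "Ck_on k g S"
  using assms(2,3)
proof (induction k arbitrary: f g)
  case 0
  then show ?case using continuous_on_eq by (metis Ck_on.simps(1))
next
  case (Suc k)
  have "g differentiable at x" if "x \<in> S" for x
    using Suc that differentiable_cong_open[OF assms(1) that] by (metis Ck_on.simps(2))
  moreover have "Ck_on k (\<lambda>x. fd g x u) S" for u
  proof (rule Suc.IH)
    show "Ck_on k (\<lambda>x. fd f x u) S" using Suc by simp
    show "fd f y u = fd g y u" if "y \<in> S" for y
      using fd_cong[OF assms(1) that, of f g] Suc.prems by simp
  qed
  ultimately show ?case by simp
qed

lemma Ck_on_mono: "Ck_on k f S \<Longrightarrow> T \<subseteq> S \<Longrightarrow> Ck_on k f T"
  by (induction k arbitrary: f) (auto intro: continuous_on_subset)

lemma Ck_on_SucD: "Ck_on (Suc k) f S \<Longrightarrow> Ck_on k f S"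
proof (induction k arbitrary: f)
  case 0
  then show ?case
    by (auto intro!: continuous_at_imp_continuous_on differentiable_imp_continuous_within)
next
  case (Suc k)
  then show ?case by (metis Ck_on.simps(2))
qed

lemma Ck_on_local:
  assumes "\<And>x. x \<in> S \<Longrightarrow> \<exists>T. open T \<and> x \<in> T \<and> Ck_on k f T"
  shows "Ck_on k f S"
  using assms
proof (induction k arbitrary: f)
  case 0
  then show ?case
    by (metis Ck_on.simps(1) continuous_at_imp_continuous_on continuous_on_eq_continuous_at)
next
  case (Suc k)
  have "f differentiable at x" if "x \<in> S" for x using Suc.prems[OF that] by auto
  moreover have "Ck_on k (\<lambda>x. fd f x u) S" for u
    using Suc.prems by (intro Suc.IH) fastforce
  ultimately show ?case by simp
qed

lemma Ck_on_const [simp]: "Ck_on k (\<lambda>x. c) S"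
  by (induction k arbitrary: c) auto

lemma Ck_on_linear:
  assumes "bounded_linear L"
  shows "Ck_on k L S"
proof (cases k)
  case 0
  then show ?thesis using assms by (auto intro: linear_continuous_on)
next
  case (Suc m)
  then show ?thesis
    using assms by (auto simp: bounded_linear_imp_differentiable fd_eq[OF bounded_linear_imp_has_derivative])
qed

lemma Ck_on_bounded_linear:
  assumes "bounded_linear L" "open S" "Ck_on k f S"
  shows "Ck_on k (\<lambda>x. L (f x)) S"
  using assms(3)
proof (induction k arbitrary: f)
  case 0
  then show ?case using assms(1) by (simp add: bounded_linear.continuous_on)
next
  case (Suc k)
  have d: "((\<lambda>x. L (f x)) has_derivative (\<lambda>u. L (fd f x u))) (at x)" if "x \<in> S" for x
    using Suc.prems that by (intro bounded_linear.has_derivative[OF assms(1)] has_derivative_fd) auto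
  have "Ck_on k (\<lambda>x. fd (\<lambda>x. L (f x)) x u) S" for u
    by (rule Ck_on_cong[OF assms(2), of "\<lambda>x. L (fd f x u)"])
       (use Suc in \<open>auto simp: fd_eq[OF d]\<close>)
  then show ?case using differentiableI[OF d] by simp
qed

lemma Ck_on_add:
  assumes "open S" "Ck_on k f S" "Ck_on k g S"
  shows "Ck_on k (\<lambda>x. f x + g x) S"
  using assms(2,3)
proof (induction k arbitrary: f g)
  case 0
  then show ?case by (simp add: continuous_on_add)
next
  case (Suc k)
  have d: "((\<lambda>x. f x + g x) has_derivative (\<lambda>u. fd f x u + fd g x u)) (at x)" if "x \<in> S" for x
    using Suc.prems that by (intro has_derivative_add has_derivative_fd) auto
  have "Ck_on k (\<lambda>x. fd (\<lambda>x. f x + g x) x u) S" for u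
    by (rule Ck_on_cong[OF assms(1), of "\<lambda>x. fd f x u + fd g x u"])
       (use Suc in \<open>auto simp: fd_eq[OF d]\<close>)
  then show ?case using differentiableI[OF d] by simp
qed

text \<open>One Leibniz argument for every product in use: scalar multiplication, inner product, a
  matrix on a vector or covector, Christoffel symbols on a vector. Each term of the product rule has
  one undifferentiated factor, which \<open>Ck_on_SucD\<close> lowers to the level of the induction
  hypothesis.\<close>

lemma Ck_on_bilinear:
  assumes B: "bounded_bilinear B" and S: "open S" "Ck_on k f S" "Ck_on k g S"
  shows "Ck_on k (\<lambda>x. B (f x) (g x)) S"
  using S(2,3)
proof (induction k arbitrary: f g)
  case 0
  then show ?case using B by (simp add: bounded_bilinear.continuous_on)
next
  case (Suc k)
  have d: "((\<lambda>x. B (f x) (g x)) has_derivative (\<lambda>u. B (f x) (fd g x u) + B (fd f x u) (g x))) (at x)"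
    if "x \<in> S" for x
    using Suc.prems that by (intro bounded_bilinear.FDERIV[OF B] has_derivative_fd) auto
  have c: "Ck_on k (\<lambda>x. B (f x) (fd g x u) + B (fd f x u) (g x)) S" for u
    using Suc.prems Ck_on_SucD[of k f S] Ck_on_SucD[of k g S]
    by (intro Ck_on_add S Suc.IH) auto
  have "Ck_on k (\<lambda>x. fd (\<lambda>x. B (f x) (g x)) x u) S" for u
    by (rule Ck_on_cong[OF S(1) _ c[of u]]) (simp add: fd_eq[OF d])
  then show ?case using differentiableI[OF d] by simp
qed

lemma Ck_on_sum:
  assumes "open S" "\<And>i. i \<in> I \<Longrightarrow> Ck_on k (f i) S"
  shows "Ck_on k (\<lambda>x. \<Sum>i\<in>I. f i x) S"
  using assms(2)
proof (induction I rule: infinite_finite_induct)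
  case (insert i I)
  then show ?case by (simp, intro Ck_on_add assms(1)) auto
qed simp_all

text \<open>\<open>Ck_on\<close> differentiates in a fixed direction, whereas the chain rule has the
  moving direction \<open>fd f x u\<close>. Expanding it in the basis leaves a finite sum of
  products, with the induction hypothesis applied to the functions \<open>fd g _ b\<close>.\<close>

lemma Ck_on_compose:
  fixes f :: "'e::real_normed_vector \<Rightarrow> 'f::euclidean_space"
  assumes "open S" "open T" "Ck_on k f S" "Ck_on k g T" "f ` S \<subseteq> T"
  shows "Ck_on k (\<lambda>x. g (f x)) S"
  using assms(3,4)
proof (induction k arbitrary: g)
  case 0
  then show ?case using assms(5) continuous_on_compose2[of T g S f] by simp
next
  case (Suc k)
  have d: "((\<lambda>x. g (f x)) has_derivative (\<lambda>u. fd g (f x) (fd f x u))) (at x)" if "x \<in> S" for x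
    using Suc.prems that assms(5)
    by (intro has_derivative_compose[of f "fd f x" x UNIV g "fd g (f x)"] has_derivative_fd)
       (auto simp: image_subset_iff)
  have e: "fd g (f x) (fd f x u) = (\<Sum>b\<in>Basis. (fd f x u \<bullet> b) *\<^sub>R fd g (f x) b)" if "x \<in> S" for x u
  proof -
    have l: "linear (fd g (f x))"
      using Suc.prems that assms(5) by (intro linear_fd) (auto simp: image_subset_iff)
    show ?thesis
      using linear_sum[OF l, of "\<lambda>b. (fd f x u \<bullet> b) *\<^sub>R b" Basis]
      by (simp add: euclidean_representation linear_scale[OF l])
  qed
  have "Ck_on k (\<lambda>x. fd f x u \<bullet> b) S" for u b
    using Suc.prems by (intro Ck_on_bounded_linear[OF bounded_linear_inner_left] assms(1)) auto
  moreover have "Ck_on k (\<lambda>x. fd g (f x) b) S" for b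
    using Suc.IH[of "\<lambda>y. fd g y b"] Suc.prems Ck_on_SucD[OF Suc.prems(1)] by simp
  ultimately have c: "Ck_on k (\<lambda>x. \<Sum>b\<in>Basis. (fd f x u \<bullet> b) *\<^sub>R fd g (f x) b) S" for u
    by (intro Ck_on_sum[OF assms(1)] Ck_on_bilinear[OF bounded_bilinear_scaleR assms(1)])
  have "Ck_on k (\<lambda>x. fd (\<lambda>x. g (f x)) x u) S" for u
    by (rule Ck_on_cong[OF assms(1) _ c[of u]]) (simp add: fd_eq[OF d] e)
  then show ?case using differentiableI[OF d] by simp
qed

lemma smooth_on_cong:
  "open S \<Longrightarrow> (\<And>y. y \<in> S \<Longrightarrow> f y = g y) \<Longrightarrow> smooth_on f S \<Longrightarrow> smooth_on g S"
  unfolding smooth_on_def by (intro allI, rule Ck_on_cong[of S f g]) auto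

lemma smooth_on_subset: "smooth_on f S \<Longrightarrow> T \<subseteq> S \<Longrightarrow> smooth_on f T"
  unfolding smooth_on_def by (intro allI, rule Ck_on_mono) auto

lemma smooth_on_local:
  "(\<And>x. x \<in> S \<Longrightarrow> \<exists>T. open T \<and> x \<in> T \<and> smooth_on f T) \<Longrightarrow> smooth_on f S"
  unfolding smooth_on_def by (intro allI, rule Ck_on_local) metis

lemma smooth_on_const [simp]: "smooth_on (\<lambda>x. c) S"
  unfolding smooth_on_def by simp

lemma smooth_on_linear: "bounded_linear L \<Longrightarrow> smooth_on L S"
  unfolding smooth_on_def by (intro allI, rule Ck_on_linear) auto

lemma smooth_on_bounded_linear:
  "bounded_linear L \<Longrightarrow> open S \<Longrightarrow> smooth_on f S \<Longrightarrow> smooth_on (\<lambda>x. L (f x)) S"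
  unfolding smooth_on_def by (intro allI, rule Ck_on_bounded_linear) auto

lemma smooth_on_add:
  "open S \<Longrightarrow> smooth_on f S \<Longrightarrow> smooth_on g S \<Longrightarrow> smooth_on (\<lambda>x. f x + g x) S"
  unfolding smooth_on_def by (intro allI, rule Ck_on_add) auto

lemma smooth_on_bilinear:
  "bounded_bilinear B \<Longrightarrow> open S \<Longrightarrow> smooth_on f S \<Longrightarrow> smooth_on g S \<Longrightarrow> smooth_on (\<lambda>x. B (f x) (g x)) S"
  unfolding smooth_on_def by (intro allI, rule Ck_on_bilinear) auto

lemma smooth_on_sum:
  "open S \<Longrightarrow> (\<And>i. i \<in> I \<Longrightarrow> smooth_on (f i) S) \<Longrightarrow> smooth_on (\<lambda>x. \<Sum>i\<in>I. f i x) S"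
  unfolding smooth_on_def by (intro allI, rule Ck_on_sum) auto

lemma smooth_on_compose:
  fixes f :: "'e::real_normed_vector \<Rightarrow> 'f::euclidean_space"
  shows "smooth_on g T \<Longrightarrow> smooth_on f S \<Longrightarrow> open S \<Longrightarrow> open T \<Longrightarrow> f ` S \<subseteq> T \<Longrightarrow>
    smooth_on (\<lambda>x. g (f x)) S"
  unfolding smooth_on_def by (intro allI, rule Ck_on_compose[where T = T]) auto

lemma smooth_on_minus: "open S \<Longrightarrow> smooth_on f S \<Longrightarrow> smooth_on (\<lambda>x. - f x) S"
  by (rule smooth_on_bounded_linear[OF bounded_linear_minus[OF bounded_linear_ident]])

lemma smooth_on_diff:
  "open S \<Longrightarrow> smooth_on f S \<Longrightarrow> smooth_on g S \<Longrightarrow> smooth_on (\<lambda>x. f x - g x) S"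
  using smooth_on_add[of S f "\<lambda>x. - g x"] smooth_on_minus[of S g] by simp

lemmas smooth_on_scaleR = smooth_on_bilinear[OF bounded_bilinear_scaleR]
lemmas smooth_on_inner = smooth_on_bilinear[OF bounded_bilinear_inner]
lemmas smooth_on_mult = smooth_on_bilinear[OF bounded_bilinear_mult]

lemma smooth_on_ident: "smooth_on (\<lambda>x. x) S"
  by (simp add: smooth_on_linear)

lemma smooth_on_prod:
  fixes f :: "'j \<Rightarrow> 'e::real_normed_vector \<Rightarrow> real"
  assumes "open S" "\<And>i. i \<in> I \<Longrightarrow> smooth_on (f i) S"
  shows "smooth_on (\<lambda>x. \<Prod>i\<in>I. f i x) S"
  using assms(2)
proof (induction I rule: infinite_finite_induct)
  case (insert i I)
  then show ?case by (simp, intro smooth_on_mult assms(1)) auto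
qed simp_all

lemma smooth_on_vec:
  fixes f :: "'e::real_normed_vector \<Rightarrow> 'f::euclidean_space ^ 'm"
  assumes "open S" "\<And>i. smooth_on (\<lambda>x. f x $ i) S"
  shows "smooth_on f S"
proof -
  have bl: "bounded_linear (\<lambda>y::'f. axis i y :: 'f^'m)" for i
    by (rule linear_conv_bounded_linear[THEN iffD1]) (simp add: linear_iff axis_def vec_eq_iff)
  have "f x = (\<Sum>i\<in>UNIV. axis i (f x $ i))" for x
    by (simp add: vec_eq_iff axis_def if_distrib cong: if_cong)
  moreover have "smooth_on (\<lambda>x. \<Sum>i\<in>UNIV. axis i (f x $ i) :: 'f^'m) S"
    by (intro smooth_on_sum assms smooth_on_bounded_linear[OF bl])
  ultimately show ?thesis by simp
qed

lemma smooth_on_nth: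
  fixes f :: "'e::real_normed_vector \<Rightarrow> 'f::real_normed_vector ^ 'm"
  shows "open S \<Longrightarrow> smooth_on f S \<Longrightarrow> smooth_on (\<lambda>x. f x $ i) S"
  by (rule smooth_on_bounded_linear[OF bounded_linear_vec_nth])

lemma smooth_on_Pair:
  assumes "open S" "smooth_on f S" "smooth_on g S"
  shows "smooth_on (\<lambda>x. (f x, g x)) S"
proof -
  have "smooth_on (\<lambda>x. (f x, 0) + (0, g x)) S"
    using smooth_on_bounded_linear[of "\<lambda>y. (y, 0)" S f] smooth_on_bounded_linear[of "\<lambda>y. (0, y)" S g]
    by (intro smooth_on_add) (auto simp: assms bounded_linear_Pair)
  then show ?thesis by simp
qed

lemmas smooth_on_fst = smooth_on_bounded_linear[OF bounded_linear_fst]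
lemmas smooth_on_snd = smooth_on_bounded_linear[OF bounded_linear_snd]

lemma smooth_on_differentiable: "smooth_on f S \<Longrightarrow> x \<in> S \<Longrightarrow> f differentiable at x"
  unfolding smooth_on_def by (metis Ck_on.simps(2))

lemma smooth_on_has_derivative: "smooth_on f S \<Longrightarrow> x \<in> S \<Longrightarrow> (f has_derivative fd f x) (at x)"
  using has_derivative_fd smooth_on_differentiable by blast

lemma smooth_on_fd: "smooth_on f S \<Longrightarrow> smooth_on (\<lambda>x. fd f x u) S"
  unfolding smooth_on_def by (metis Ck_on.simps(2))

lemma smooth_on_continuous_on: "smooth_on f S \<Longrightarrow> continuous_on S f"
  unfolding smooth_on_def by (metis Ck_on.simps(1))

lemma linear_euclidean_expand:
  fixes f :: "'e::euclidean_space \<Rightarrow> 'f::real_vector"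
  assumes "linear f"
  shows "f u = (\<Sum>b\<in>Basis. (u \<bullet> b) *\<^sub>R f b)"
  using linear_sum[OF assms, of "\<lambda>b. (u \<bullet> b) *\<^sub>R b" Basis]
  by (simp add: euclidean_representation linear_scale[OF assms])

text \<open>Smoothness is given for fixed arguments \<open>u\<close> only; linearity carries it over
  to a moving argument through the basis expansion.\<close>

lemma smooth_on_apply_linear:
  fixes a :: "'e::real_normed_vector \<Rightarrow> 'f::euclidean_space"
  assumes S: "open S" and "smooth_on a S" "\<And>u. smooth_on (\<lambda>x. f x u) S" "\<And>x. x \<in> S \<Longrightarrow> linear (f x)"
  shows "smooth_on (\<lambda>x. f x (a x)) S"
proof (rule smooth_on_cong[OF S])
  show "smooth_on (\<lambda>x. \<Sum>b\<in>Basis. (a x \<bullet> b) *\<^sub>R f x b) S"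
    by (intro smooth_on_sum S smooth_on_scaleR smooth_on_inner assms smooth_on_const)
  show "(\<Sum>b\<in>Basis. (a x \<bullet> b) *\<^sub>R f x b) = f x (a x)" if "x \<in> S" for x
    using linear_euclidean_expand[OF assms(4)[OF that], of "a x"] by simp
qed

lemma smooth_on_fd_apply:
  fixes a :: "'e::euclidean_space \<Rightarrow> 'e"
  assumes "open S" "smooth_on a S" "smooth_on f S"
  shows "smooth_on (\<lambda>x. fd f x (a x)) S"
  by (rule smooth_on_apply_linear)
     (use assms smooth_on_fd[OF assms(3)] linear_fd[OF smooth_on_differentiable[OF assms(3)]] in auto)

text \<open>The derivative of \<open>inverse\<close> is a product of copies of
  \<open>inverse\<close>, so the product rule closes the induction.\<close>

lemma smooth_on_inverse: "smooth_on (inverse :: real \<Rightarrow> real) (- {0})"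
proof -
  have "Ck_on k (inverse :: real \<Rightarrow> real) (- {0})" for k
  proof (induction k)
    case 0
    then show ?case by (auto intro: continuous_intros)
  next
    case (Suc k)
    have d: "(inverse has_derivative (\<lambda>u. - (inverse x * u * inverse x))) (at x)" if "x \<in> - {0}" for x :: real
      using that by (auto intro!: derivative_eq_intros)
    have c: "Ck_on k (\<lambda>x::real. (- u) * (inverse x * inverse x)) (- {0})" for u
      by (intro Ck_on_bilinear[OF bounded_bilinear_mult] Suc Ck_on_const) auto
    have "Ck_on k (\<lambda>x::real. fd inverse x u) (- {0})" for u
      by (rule Ck_on_cong[OF _ _ c[of u]]) (auto simp: fd_eq[OF d])
    then show ?case using differentiableI[OF d] by simp
  qed
  then show ?thesis unfolding smooth_on_def by blast
qed

lemma smooth_on_ln: "smooth_on (ln :: real \<Rightarrow> real) {0<..}"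
  unfolding smooth_on_def
proof
  fix k show "Ck_on k (ln :: real \<Rightarrow> real) {0<..}"
  proof (cases k)
    case 0
    then show ?thesis by (auto intro: continuous_intros)
  next
    case (Suc m)
    have d: "(ln has_derivative (\<lambda>u. u * inverse x)) (at x)" if "x \<in> {0<..}" for x :: real
      using that by (auto intro!: derivative_eq_intros simp: field_simps)
    have c: "Ck_on m (\<lambda>x::real. u * inverse x) {0<..}" for u
      using smooth_on_subset[OF smooth_on_inverse, of "{0<..}"]
      by (intro Ck_on_bilinear[OF bounded_bilinear_mult]) (auto simp: smooth_on_def)
    have "Ck_on m (\<lambda>x::real. fd ln x u) {0<..}" for u
      by (rule Ck_on_cong[OF _ _ c[of u]]) (auto simp: fd_eq[OF d])
    then show ?thesis using differentiableI[OF d] Suc by simp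
  qed
qed

text \<open>The induction covers all exponents at once because differentiation lowers
  \<open>c\<close> by 1.\<close>

lemma smooth_on_powr_real: "smooth_on (\<lambda>x::real. x powr c) {0<..}"
proof -
  have "Ck_on k (\<lambda>x::real. x powr c) {0<..}" for k c
  proof (induction k arbitrary: c)
    case 0
    then show ?case by (auto intro!: continuous_intros)
  next
    case (Suc k)
    have d: "((\<lambda>x. x powr c) has_derivative (\<lambda>u. (u * c) * x powr (c - 1))) (at x)" if "x \<in> {0<..}" for x :: real
      using that by (auto intro!: derivative_eq_intros simp: field_simps powr_diff)
    have c: "Ck_on k (\<lambda>x::real. (u * c) * x powr (c - 1)) {0<..}" for u
      by (intro Ck_on_bilinear[OF bounded_bilinear_mult] Suc Ck_on_const) auto
    have "Ck_on k (\<lambda>x::real. fd (\<lambda>x. x powr c) x u) {0<..}" for u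
      by (rule Ck_on_cong[OF _ _ c[of u]]) (auto simp: fd_eq[OF d])
    then show ?case using differentiableI[OF d] by simp
  qed
  then show ?thesis unfolding smooth_on_def by blast
qed

lemma smooth_on_powr:
  "open S \<Longrightarrow> smooth_on f S \<Longrightarrow> (\<And>x. x \<in> S \<Longrightarrow> f x > 0) \<Longrightarrow> smooth_on (\<lambda>x. f x powr c :: real) S"
  by (rule smooth_on_compose[OF smooth_on_powr_real]) auto

lemma smooth_on_ln_compose:
  "open S \<Longrightarrow> smooth_on f S \<Longrightarrow> (\<And>x. x \<in> S \<Longrightarrow> f x > 0) \<Longrightarrow> smooth_on (\<lambda>x. ln (f x) :: real) S"
  by (rule smooth_on_compose[OF smooth_on_ln]) auto

lemma smooth_on_divide:
  assumes "open S" "smooth_on f S" "smooth_on g S" "\<And>x. x \<in> S \<Longrightarrow> g x \<noteq> 0"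
  shows "smooth_on (\<lambda>x. f x / g x :: real) S"
  unfolding divide_inverse
  by (intro smooth_on_mult assms smooth_on_compose[OF smooth_on_inverse]) (use assms in auto)

subsection \<open>Symmetry of second derivatives\<close>

text \<open>The mixed second difference is symmetric in \<open>u\<close> and \<open>v\<close>; letting \<open>h\<close> tend to 0 exchanges the two
  derivatives.\<close>
lemma second_difference_mvt:
  fixes f :: "'e::real_normed_vector \<Rightarrow> real"
  assumes f: "smooth_on f S" and h: "h > 0"
    and sub: "\<And>s t. 0 \<le> s \<Longrightarrow> s \<le> h \<Longrightarrow> 0 \<le> t \<Longrightarrow> t \<le> h \<Longrightarrow> x + s *\<^sub>R u + t *\<^sub>R v \<in> S"
  shows "\<exists>s t. 0 \<le> s \<and> s \<le> h \<and> 0 \<le> t \<and> t \<le> h \<and>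
    f (x + h *\<^sub>R u + h *\<^sub>R v) - f (x + h *\<^sub>R u) - f (x + h *\<^sub>R v) + f x
      = h * (h * fd (\<lambda>y. fd f y u) (x + s *\<^sub>R u + t *\<^sub>R v) v)"
proof -
  define F where "F s = f (x + s *\<^sub>R u + h *\<^sub>R v) - f (x + s *\<^sub>R u)" for s
  have lin: "linear (fd f y)" if "y \<in> S" for y using that f linear_fd smooth_on_differentiable by blast
  have der: "((\<lambda>s. f (x + s *\<^sub>R u + t *\<^sub>R v)) has_derivative (\<lambda>r. r * fd f (x + s *\<^sub>R u + t *\<^sub>R v) u)) (at s)"
    if "0 \<le> s" "s \<le> h" "0 \<le> t" "t \<le> h" for s t
  proof -
    have "((\<lambda>s. f (x + s *\<^sub>R u + t *\<^sub>R v)) has_derivative (\<lambda>r. fd f (x + s *\<^sub>R u + t *\<^sub>R v) (r *\<^sub>R u))) (at s)"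
      by (rule has_derivative_compose[where f = "\<lambda>s. x + s *\<^sub>R u + t *\<^sub>R v",
            OF _ smooth_on_has_derivative[OF f sub[OF that]]])
         (auto intro!: derivative_eq_intros)
    then show ?thesis using linear_scale[OF lin[OF sub[OF that]]] by simp
  qed
  have F: "(F has_derivative (\<lambda>r. r * (fd f (x + s *\<^sub>R u + h *\<^sub>R v) u - fd f (x + s *\<^sub>R u) u))) (at s)"
    if "0 \<le> s" "s \<le> h" for s
    unfolding F_def using has_derivative_diff[OF der[OF that, of h] der[OF that, of 0]] h
    by (simp add: algebra_simps)
  obtain s where s: "s \<in> {0<..<h}" "F h - F 0 = (h - 0) * (fd f (x + s *\<^sub>R u + h *\<^sub>R v) u - fd f (x + s *\<^sub>R u) u)"
    using mvt_simple[of 0 h F "\<lambda>s r. r * (fd f (x + s *\<^sub>R u + h *\<^sub>R v) u - fd f (x + s *\<^sub>R u) u)"]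
      h F has_derivative_at_withinI by fastforce
  define K where "K t = fd f (x + s *\<^sub>R u + t *\<^sub>R v) u" for t
  have K: "(K has_derivative (\<lambda>r. r * fd (\<lambda>y. fd f y u) (x + s *\<^sub>R u + t *\<^sub>R v) v)) (at t)"
    if "0 \<le> t" "t \<le> h" for t
  proof -
    have m: "x + s *\<^sub>R u + t *\<^sub>R v \<in> S" using sub s that by auto
    have g: "smooth_on (\<lambda>y. fd f y u) S" using f smooth_on_fd by blast
    have "((\<lambda>t. fd f (x + s *\<^sub>R u + t *\<^sub>R v) u) has_derivative
        (\<lambda>r. fd (\<lambda>y. fd f y u) (x + s *\<^sub>R u + t *\<^sub>R v) (r *\<^sub>R v))) (at t)"
      by (rule has_derivative_compose[where f = "\<lambda>t. x + s *\<^sub>R u + t *\<^sub>R v",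
            OF _ smooth_on_has_derivative[OF g m]])
         (auto intro!: derivative_eq_intros)
    then show ?thesis
      using linear_scale[OF linear_fd[OF smooth_on_differentiable[OF g m]]] by (simp add: K_def[abs_def])
  qed
  obtain t where t: "t \<in> {0<..<h}" "K h - K 0 = (h - 0) * fd (\<lambda>y. fd f y u) (x + s *\<^sub>R u + t *\<^sub>R v) v"
    using mvt_simple[of 0 h K "\<lambda>t r. r * fd (\<lambda>y. fd f y u) (x + s *\<^sub>R u + t *\<^sub>R v) v"]
      h K has_derivative_at_withinI by fastforce
  have "F h - F 0 = h * (h * fd (\<lambda>y. fd f y u) (x + s *\<^sub>R u + t *\<^sub>R v) v)"
    using s(2) t(2) by (simp add: K_def)
  then show ?thesis
    by (intro exI[of _ s] exI[of _ t]) (use s(1) t(1) in \<open>auto simp: F_def\<close>)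
qed

text \<open>By \<open>second_difference_mvt\<close> the same second difference is
  \<open>h * h\<close> times each of the two mixed derivatives, taken at two points near
  \<open>x\<close>. Continuity keeps both within half of their alleged gap at \<open>x\<close>,
  which is a contradiction.\<close>

lemma fd_commute_real:
  fixes f :: "'e::real_normed_vector \<Rightarrow> real"
  assumes S: "open S" "x \<in> S" and f: "smooth_on f S"
  shows "fd (\<lambda>y. fd f y u) x v = fd (\<lambda>y. fd f y v) x u"
proof (rule ccontr)
  assume ne: "fd (\<lambda>y. fd f y u) x v \<noteq> fd (\<lambda>y. fd f y v) x u"
  define P where "P y = fd (\<lambda>y. fd f y u) y v" for y
  define Q where "Q y = fd (\<lambda>y. fd f y v) y u" for y
  define e where "e = \<bar>P x - Q x\<bar> / 2"
  have e: "e > 0" using ne by (simp add: e_def P_def Q_def)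
  have cP: "continuous (at x) P" and cQ: "continuous (at x) Q"
    using S f smooth_on_fd smooth_on_continuous_on continuous_on_eq_continuous_at
    unfolding P_def Q_def by blast+
  obtain d1 where d1: "d1 > 0" "\<And>y. dist y x < d1 \<Longrightarrow> dist (P y) (P x) < e"
    using cP e unfolding continuous_at_eps_delta by blast
  obtain d2 where d2: "d2 > 0" "\<And>y. dist y x < d2 \<Longrightarrow> dist (Q y) (Q x) < e"
    using cQ e unfolding continuous_at_eps_delta by blast
  obtain d3 where d3: "d3 > 0" "ball x d3 \<subseteq> S" using S openE by blast
  define d where "d = min d1 (min d2 d3)"
  \<comment> \<open>With this \<open>h\<close> the parallelogram spanned by \<open>h u\<close> and
    \<open>h v\<close> at \<open>x\<close> stays within \<open>d / 2\<close> of \<open>x\<close>;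
    the summand 1 keeps \<open>N\<close> positive when \<open>u\<close> and \<open>v\<close>
    vanish.\<close>
  define N where "N = norm u + norm v + 1"
  define h where "h = d / (2 * N)"
  have dpos: "d > 0" using d1 d2 d3 by (simp add: d_def)
  have npos: "N > 0" by (simp add: N_def add_nonneg_pos)
  have h: "h > 0" using dpos npos by (simp add: h_def)
  have near: "dist (x + s *\<^sub>R u + t *\<^sub>R v) x < d" if "0 \<le> s" "s \<le> h" "0 \<le> t" "t \<le> h" for s t
  proof -
    have "dist (x + s *\<^sub>R u + t *\<^sub>R v) x \<le> s * norm u + t * norm v"
      using that norm_triangle_ineq[of "s *\<^sub>R u" "t *\<^sub>R v"] by (simp add: dist_norm)
    also have "\<dots> \<le> h * norm u + h * norm v"
      using that by (intro add_mono mult_right_mono) auto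
    also have "\<dots> \<le> h * N" using h by (simp add: N_def algebra_simps)
    also have "\<dots> = d / 2"
      using npos by (simp add: h_def)
    also have "\<dots> < d" using dpos by simp
    finally show ?thesis .
  qed
  have sub: "x + s *\<^sub>R u + t *\<^sub>R v \<in> S" if "0 \<le> s" "s \<le> h" "0 \<le> t" "t \<le> h" for s t
    using near[OF that] d3 by (auto simp: d_def dist_commute)
  obtain s t where 1: "0 \<le> s" "s \<le> h" "0 \<le> t" "t \<le> h"
    "f (x + h *\<^sub>R u + h *\<^sub>R v) - f (x + h *\<^sub>R u) - f (x + h *\<^sub>R v) + f x
      = h * (h * P (x + s *\<^sub>R u + t *\<^sub>R v))"
    unfolding P_def using second_difference_mvt[OF f h sub] by blast
  have "x + s *\<^sub>R v + t *\<^sub>R u \<in> S" if "0 \<le> s" "s \<le> h" "0 \<le> t" "t \<le> h" for s t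
    using sub[of t s] that by (simp add: algebra_simps)
  from second_difference_mvt[OF f h this]
  obtain s' t' where 2: "0 \<le> s'" "s' \<le> h" "0 \<le> t'" "t' \<le> h"
    "f (x + h *\<^sub>R v + h *\<^sub>R u) - f (x + h *\<^sub>R v) - f (x + h *\<^sub>R u) + f x
      = h * (h * Q (x + s' *\<^sub>R v + t' *\<^sub>R u))"
    unfolding Q_def by blast
  have sw: "x + s' *\<^sub>R v + t' *\<^sub>R u = x + t' *\<^sub>R u + s' *\<^sub>R v"
    "x + h *\<^sub>R v + h *\<^sub>R u = x + h *\<^sub>R u + h *\<^sub>R v" by simp_all
  have "h * (h * P (x + s *\<^sub>R u + t *\<^sub>R v)) = h * (h * Q (x + t' *\<^sub>R u + s' *\<^sub>R v))"
    using 1(5) 2(5) unfolding sw by linarith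
  then have "P (x + s *\<^sub>R u + t *\<^sub>R v) = Q (x + t' *\<^sub>R u + s' *\<^sub>R v)" using h by simp
  moreover have "dist (P (x + s *\<^sub>R u + t *\<^sub>R v)) (P x) < e"
    using d1 near[OF 1(1-4)] by (simp add: d_def)
  moreover have "dist (Q (x + t' *\<^sub>R u + s' *\<^sub>R v)) (Q x) < e"
    using d2 near[OF 2(3,4,1,2)] by (simp add: d_def)
  ultimately show False by (simp add: e_def dist_real_def abs_if split: if_splits)
qed

lemma fd_commute:
  fixes f :: "'e::real_normed_vector \<Rightarrow> 'f::euclidean_space"
  assumes S: "open S" "x \<in> S" and f: "smooth_on f S"
  shows "fd (\<lambda>y. fd f y u) x v = fd (\<lambda>y. fd f y v) x u"
proof (rule euclidean_eqI)
  fix b :: 'f assume "b \<in> Basis"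
  have sm: "smooth_on (\<lambda>y. f y \<bullet> b) S"
    by (rule smooth_on_bounded_linear[OF bounded_linear_inner_left S(1) f])
  have 1: "fd (\<lambda>y. f y \<bullet> b) y w = fd f y w \<bullet> b" if "y \<in> S" for y w
    using fd_eq[OF bounded_linear.has_derivative[OF bounded_linear_inner_left smooth_on_has_derivative[OF f that]]]
    by metis
  have 2: "fd (\<lambda>y. fd (\<lambda>y. f y \<bullet> b) y w) x z = fd (\<lambda>y. fd f y w) x z \<bullet> b" for w z
  proof -
    have "fd (\<lambda>y. fd (\<lambda>y. f y \<bullet> b) y w) x = fd (\<lambda>y. fd f y w \<bullet> b) x"
      by (rule fd_cong[OF S]) (simp add: 1)
    also have "\<dots> = (\<lambda>z. fd (\<lambda>y. fd f y w) x z \<bullet> b)"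
      by (rule fd_eq[OF bounded_linear.has_derivative[OF bounded_linear_inner_left]])
         (rule smooth_on_has_derivative[OF smooth_on_fd[OF f] S(2)])
    finally show ?thesis by simp
  qed
  show "fd (\<lambda>y. fd f y u) x v \<bullet> b = fd (\<lambda>y. fd f y v) x u \<bullet> b"
    using fd_commute_real[OF S sm, of u v] by (simp add: 2)
qed

subsection \<open>Lie derivatives of metrics\<close>

text \<open>A product rule for a linear map depending on a parameter. Expanding the argument in the
  basis reduces it to the functions \<open>L y b\<close> with fixed \<open>b\<close>, so no norm on
  the space of linear maps is involved.\<close>

lemma has_derivative_linear_family:
  fixes a :: "'e::real_normed_vector \<Rightarrow> 'f::euclidean_space" and L :: "'e \<Rightarrow> 'f \<Rightarrow> 'g::real_normed_vector"
  assumes S: "open S" "z \<in> S" and lin: "\<And>y. y \<in> S \<Longrightarrow> linear (L y)"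
    and L: "\<And>u. (\<lambda>y. L y u) differentiable at z" and a: "(a has_derivative a') (at z)"
  shows "((\<lambda>y. L y (a y)) has_derivative (\<lambda>r. fd (\<lambda>y. L y (a z)) z r + L z (a' r))) (at z)"
proof -
  have ex: "L y c = (\<Sum>b\<in>Basis. (c \<bullet> b) *\<^sub>R L y b)" if "y \<in> S" for y c
    by (rule linear_euclidean_expand[OF lin[OF that]])
  have d: "((\<lambda>y. L y c) has_derivative (\<lambda>r. \<Sum>b\<in>Basis. (c \<bullet> b) *\<^sub>R fd (\<lambda>y. L y b) z r)) (at z)" for c
    by (rule has_derivative_transform_within_open[OF _ S, where f = "\<lambda>y. \<Sum>b\<in>Basis. (c \<bullet> b) *\<^sub>R L y b"])
       (auto simp: ex[symmetric] intro!: derivative_eq_intros has_derivative_fd[OF L])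
  have "((\<lambda>y. L y (a y)) has_derivative
      (\<lambda>r. \<Sum>b\<in>Basis. (a z \<bullet> b) *\<^sub>R fd (\<lambda>y. L y b) z r + (a' r \<bullet> b) *\<^sub>R L z b)) (at z)"
    by (rule has_derivative_transform_within_open[OF _ S, where f = "\<lambda>y. \<Sum>b\<in>Basis. (a y \<bullet> b) *\<^sub>R L y b"])
       (auto simp: ex[symmetric] intro!: derivative_eq_intros has_derivative_fd[OF L] a)
  then show ?thesis
    unfolding fd_eq[OF d[of "a z"]] ex[OF S(2), of "a' _"] by (simp add: sum.distrib)
qed

lemma has_derivative_bilinear_family:
  fixes a b :: "'e::real_normed_vector \<Rightarrow> 'f::euclidean_space" and G :: "'h::real_normed_vector \<Rightarrow> 'f \<Rightarrow> 'f \<Rightarrow> real"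
  assumes S: "open S" "z \<in> S" and bil: "\<And>y. y \<in> S \<Longrightarrow> bilinear (G (\<Phi> y))"
    and \<Phi>: "(\<Phi> has_derivative \<Phi>') (at z)"
    and G: "\<And>u v. (\<lambda>y. G y u v) differentiable at (\<Phi> z)"
    and a: "(a has_derivative a') (at z)" and b: "(b has_derivative b') (at z)"
  shows "((\<lambda>y. G (\<Phi> y) (a y) (b y)) has_derivative
    (\<lambda>r. fd (\<lambda>y. G y (a z) (b z)) (\<Phi> z) (\<Phi>' r) + G (\<Phi> z) (a' r) (b z) + G (\<Phi> z) (a z) (b' r))) (at z)"
proof -
  have d: "((\<lambda>y. G (\<Phi> y) u v) has_derivative (\<lambda>r. fd (\<lambda>y. G y u v) (\<Phi> z) (\<Phi>' r))) (at z)" for u v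
    by (rule has_derivative_compose[OF \<Phi> has_derivative_fd[OF G]])
  have l1: "linear (\<lambda>u. G (\<Phi> y) u v)" and l2: "linear (G (\<Phi> y) u)" if "y \<in> S" for y u v
    using bil[OF that] by (auto simp: bilinear_def)
  have 1: "((\<lambda>y. G (\<Phi> y) (a y) v) has_derivative
      (\<lambda>r. fd (\<lambda>y. G y (a z) v) (\<Phi> z) (\<Phi>' r) + G (\<Phi> z) (a' r) v)) (at z)" for v
    using has_derivative_linear_family[OF S, where L = "\<lambda>y u. G (\<Phi> y) u v", OF l1 differentiableI[OF d] a]
    by (simp add: fd_eq[OF d])
  show ?thesis
    using has_derivative_linear_family[OF S, where L = "\<lambda>y. G (\<Phi> y) (a y)", OF l2 differentiableI[OF 1] b]
    by (simp add: fd_eq[OF 1])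
qed

text \<open>Differentiating \<open>Y (\<Phi> y) = fd \<Phi> y (X y)\<close> produces the second
  derivative of \<open>\<Phi>\<close>, and so does differentiating the pulled-back metric; its
  symmetry makes these terms cancel. Used for changes of charts and for the scale map in both
  directions.\<close>

lemma lie_metric_natural:
  fixes X Y \<Phi> :: "'e::euclidean_space \<Rightarrow> 'e"
  assumes S: "open S" "z \<in> S" and \<Phi>: "smooth_on \<Phi> S"
    and X: "X differentiable at z" and Y: "Y differentiable at (\<Phi> z)"
    and XY: "\<And>y. y \<in> S \<Longrightarrow> Y (\<Phi> y) = fd \<Phi> y (X y)"
    and h: "\<And>y u v. y \<in> S \<Longrightarrow> h y u v = g (\<Phi> y) (fd \<Phi> y u) (fd \<Phi> y v)"
    and bil: "\<And>y. y \<in> S \<Longrightarrow> bilinear (g (\<Phi> y))"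
    and g: "\<And>u v. (\<lambda>y. g y u v) differentiable at (\<Phi> z)"
  shows "lie_metric X h z u v = lie_metric Y g (\<Phi> z) (fd \<Phi> z u) (fd \<Phi> z v)"
proof -
  have d\<Phi>: "(\<Phi> has_derivative fd \<Phi> z) (at z)" by (rule smooth_on_has_derivative[OF \<Phi> S(2)])
  have d2: "((\<lambda>y. fd \<Phi> y w) has_derivative fd (\<lambda>y. fd \<Phi> y w) z) (at z)" for w
    by (rule smooth_on_has_derivative[OF smooth_on_fd[OF \<Phi>] S(2)])
  have lin: "linear (fd \<Phi> y)" if "y \<in> S" for y by (intro linear_fd smooth_on_differentiable[OF \<Phi> that])
  have 1: "fd (\<lambda>y. h y u v) z = (\<lambda>r. fd (\<lambda>y. g y (fd \<Phi> z u) (fd \<Phi> z v)) (\<Phi> z) (fd \<Phi> z r)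
      + g (\<Phi> z) (fd (\<lambda>y. fd \<Phi> y u) z r) (fd \<Phi> z v) + g (\<Phi> z) (fd \<Phi> z u) (fd (\<lambda>y. fd \<Phi> y v) z r))"
  proof -
    have "fd (\<lambda>y. h y u v) z = fd (\<lambda>y. g (\<Phi> y) (fd \<Phi> y u) (fd \<Phi> y v)) z"
      by (rule fd_cong[OF S]) (rule h)
    then show ?thesis using fd_eq[OF has_derivative_bilinear_family[OF S bil d\<Phi> g d2 d2]] by simp
  qed
  have "((\<lambda>y. fd \<Phi> y (X y)) has_derivative (\<lambda>r. fd (\<lambda>y. fd \<Phi> y (X z)) z r + fd \<Phi> z (fd X z r))) (at z)"
    by (rule has_derivative_linear_family[OF S lin _ has_derivative_fd[OF X]])
       (auto intro: differentiableI[OF d2])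
  then have "((\<lambda>y. Y (\<Phi> y)) has_derivative (\<lambda>r. fd (\<lambda>y. fd \<Phi> y (X z)) z r + fd \<Phi> z (fd X z r))) (at z)"
    by (rule has_derivative_transform_within_open[OF _ S]) (simp add: XY)
  moreover have "((\<lambda>y. Y (\<Phi> y)) has_derivative (\<lambda>r. fd Y (\<Phi> z) (fd \<Phi> z r))) (at z)"
    by (rule has_derivative_compose[OF d\<Phi> has_derivative_fd[OF Y]])
  ultimately have "fd Y (\<Phi> z) (fd \<Phi> z r) = fd (\<lambda>y. fd \<Phi> y (X z)) z r + fd \<Phi> z (fd X z r)" for r
    using has_derivative_unique by (metis (no_types, lifting))
  then have 2: "fd \<Phi> z (fd X z r) = fd Y (\<Phi> z) (fd \<Phi> z r) - fd (\<lambda>y. fd \<Phi> y r) z (X z)" for r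
    using fd_commute[OF S \<Phi>, of "X z" r] by simp
  show ?thesis
    unfolding lie_metric_def 1 h[OF S(2)] 2 XY[OF S(2)]
    using bil[OF S(2)] by (simp add: bilinear_lsub bilinear_rsub)
qed

text \<open>The reason why being conformal Killing depends on the conformal class only.\<close>

lemma lie_metric_scale:
  assumes f: "f differentiable at x" and g: "\<And>u v. (\<lambda>y. g y u v) differentiable at x"
  shows "lie_metric X (\<lambda>y u v. f y * g y u v) x u v = fd f x (X x) * g x u v + f x * lie_metric X g x u v"
proof -
  have "fd (\<lambda>y. f y * g y u v) x = (\<lambda>r. f x * fd (\<lambda>y. g y u v) x r + fd f x r * g x u v)"
    by (rule fd_eq[OF has_derivative_mult[OF has_derivative_fd[OF f] has_derivative_fd[OF g]]])
  then show ?thesis unfolding lie_metric_def by (simp add: algebra_simps)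
qed

lemma lie_metric_cong:
  assumes S: "open S" "x \<in> S" and "\<And>y. y \<in> S \<Longrightarrow> X y = X' y" "\<And>y u v. y \<in> S \<Longrightarrow> g y u v = g' y u v"
  shows "lie_metric X g x u v = lie_metric X' g' x u v"
proof -
  have "fd X x = fd X' x" by (rule fd_cong[OF S]) (rule assms(3))
  moreover have "fd (\<lambda>y. g y u v) x = fd (\<lambda>y. g' y u v) x" by (rule fd_cong[OF S]) (rule assms(4))
  ultimately show ?thesis unfolding lie_metric_def using assms by simp
qed

lemma smooth_on_lie_metric:
  fixes X :: "'e::euclidean_space \<Rightarrow> 'e"
  assumes S: "open S" and X: "smooth_on X S" and g: "\<And>u v. smooth_on (\<lambda>x. g x u v) S"
    and bil: "\<And>x. x \<in> S \<Longrightarrow> bilinear (g x)"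
  shows "smooth_on (\<lambda>x. lie_metric X g x u v) S"
  unfolding lie_metric_def
proof (intro smooth_on_add[OF S])
  show "smooth_on (\<lambda>x. fd (\<lambda>y. g y u v) x (X x)) S" by (rule smooth_on_fd_apply[OF S X g])
  show "smooth_on (\<lambda>x. g x (fd X x u) v) S"
    by (rule smooth_on_apply_linear[OF S smooth_on_fd[OF X], where f = "\<lambda>x u. g x u v"])
       (use bil g in \<open>auto simp: bilinear_def\<close>)
  show "smooth_on (\<lambda>x. g x u (fd X x v)) S"
    by (rule smooth_on_apply_linear[OF S smooth_on_fd[OF X]])
       (use bil g in \<open>auto simp: bilinear_def\<close>)
qed

subsection \<open>Conformal Killing fields on an atlas\<close>

lemma transition_apply:
  assumes "smooth_atlas A" "m \<in> fst (A i)"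
  shows "transition A i j (snd (A i) m) = snd (A j) m"
  using assms unfolding smooth_atlas_def transition_def by (simp add: inv_into_f_f)

lemma overlap_subset: "overlap A i j \<subseteq> chart_image A i"
  unfolding overlap_def chart_image_def by auto

lemma transition_overlap: "smooth_atlas A \<Longrightarrow> x \<in> overlap A i j \<Longrightarrow> transition A i j x \<in> overlap A j i"
  unfolding overlap_def using transition_apply by fastforce

lemma open_chart_image: "smooth_atlas A \<Longrightarrow> open (chart_image A i)"
  and open_overlap: "smooth_atlas A \<Longrightarrow> open (overlap A i j)"
  and smooth_transition: "smooth_atlas A \<Longrightarrow> smooth_on (transition A i j) (overlap A i j)"
  by (auto simp: smooth_atlas_def)

lemma linear_dtrans: "smooth_atlas A \<Longrightarrow> x \<in> overlap A i j \<Longrightarrow> linear (dtrans A i j x)"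
  unfolding dtrans_def by (intro linear_fd smooth_on_differentiable[OF smooth_transition])

lemma metric_nonzero:
  fixes g :: "'i \<Rightarrow> 'e \<Rightarrow> 'e \<Rightarrow> 'e::euclidean_space \<Rightarrow> real"
  assumes "metric A g" "x \<in> chart_image A i"
  obtains u v where "g i x u v \<noteq> 0"
proof -
  obtain b :: 'e where "b \<in> Basis" using nonempty_Basis by blast
  then have "b \<noteq> 0" using nonzero_Basis by blast
  moreover have "(\<forall>v. g i x b v = 0) \<longrightarrow> b = 0" using assms unfolding metric_def by blast
  ultimately obtain v where "g i x b v \<noteq> 0" by blast
  then show ?thesis by (rule that)
qed

lemma metricD:
  assumes "metric A g"
  shows "smooth_on (\<lambda>x. g i x u v) (chart_image A i)"
    and "x \<in> chart_image A i \<Longrightarrow> bilinear (g i x)"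
    and "x \<in> overlap A i j \<Longrightarrow> g j (transition A i j x) (dtrans A i j x u) (dtrans A i j x v) = g i x u v"
proof -
  note m = assms[unfolded metric_def]
  show "smooth_on (\<lambda>x. g i x u v) (chart_image A i)" using m[THEN conjunct1] by blast
  show "bilinear (g i x)" if "x \<in> chart_image A i"
    using m[THEN conjunct2, THEN conjunct1] that by blast
  show "g j (transition A i j x) (dtrans A i j x u) (dtrans A i j x v) = g i x u v" if "x \<in> overlap A i j"
    using m[THEN conjunct2, THEN conjunct2] that by blast
qed

lemma vector_fieldD:
  assumes "vector_field A X"
  shows "smooth_on (X i) (chart_image A i)" and "x \<notin> chart_image A i \<Longrightarrow> X i x = 0"
    and "x \<in> overlap A i j \<Longrightarrow> X j (transition A i j x) = dtrans A i j x (X i x)"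
proof -
  have m1: "smooth_components A X" using assms unfolding vector_field_def by (rule conjunct1)
  have m2: "\<forall>i. smooth_on (X i) (chart_image A i) \<and> (\<forall>x. x \<notin> chart_image A i \<longrightarrow> X i x = 0)"
     using m1 unfolding smooth_components_def .
  show "smooth_on (X i) (chart_image A i)" by (rule m2[THEN spec, THEN conjunct1])
  show "x \<notin> chart_image A i \<Longrightarrow> X i x = 0" using m2[THEN spec, THEN conjunct2] by blast
  show "x \<in> overlap A i j \<Longrightarrow> X j (transition A i j x) = dtrans A i j x (X i x)"
    using assms[unfolded vector_field_def, THEN conjunct2] by blast
qed

text \<open>A factor at each point is enough. Near \<open>x\<close> it is the quotient of the Lie
  derivative by the metric on a fixed pair \<open>u\<close>, \<open>v\<close> with
  \<open>g i x u v \<noteq> 0\<close>, hence smooth. On overlaps the factors agree by naturality of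
  the Lie derivative, again tested on such a pair.\<close>

lemma conformal_factor_scalar_field:
  fixes A :: "('i, 'a, 'e::euclidean_space) atlas"
  assumes A: "smooth_atlas A" and g: "metric A g" and X: "vector_field A X"
    and ex: "\<And>i x. x \<in> chart_image A i \<Longrightarrow> \<exists>c. \<forall>u v. lie_metric (X i) (g i) x u v = c * g i x u v"
  shows "\<exists>l. scalar_field A l \<and>
    (\<forall>i. \<forall>x\<in>chart_image A i. \<forall>u v. lie_metric (X i) (g i) x u v = l i x * g i x u v)"
proof -
  define l where "l i x = (if x \<in> chart_image A i
    then SOME c. \<forall>u v. lie_metric (X i) (g i) x u v = c * g i x u v else 0)" for i x
  have l: "lie_metric (X i) (g i) x u v = l i x * g i x u v" if "x \<in> chart_image A i" for i x u v
  proof -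
    have "l i x = (SOME c. \<forall>u v. lie_metric (X i) (g i) x u v = c * g i x u v)"
      using that by (simp only: l_def if_True)
    then show ?thesis using someI_ex[OF ex[OF that]] by metis
  qed
  have "smooth_on (l i) (chart_image A i)" for i
  proof (rule smooth_on_local)
    fix x assume x: "x \<in> chart_image A i"
    obtain u v where uv: "g i x u v \<noteq> 0" using metric_nonzero[OF g x] .
    define T where "T = chart_image A i \<inter> (\<lambda>y. g i y u v) -` (- {0})"
    have T: "open T" unfolding T_def
      by (rule continuous_open_preimage[OF smooth_on_continuous_on[OF metricD(1)[OF g]] open_chart_image[OF A]])
         auto
    have "T \<subseteq> chart_image A i" by (auto simp: T_def)
    then have "smooth_on (\<lambda>y. lie_metric (X i) (g i) y u v / g i y u v) T"
      by (intro smooth_on_divide T smooth_on_lie_metric)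
         (auto intro: smooth_on_subset metricD[OF g] vector_fieldD[OF X] simp: T_def)
    moreover have "lie_metric (X i) (g i) y u v / g i y u v = l i y" if "y \<in> T" for y
    proof -
      have "y \<in> chart_image A i" "g i y u v \<noteq> 0" using that by (simp_all add: T_def)
      then show ?thesis by (simp add: l[of y i u v])
    qed
    ultimately have "smooth_on (l i) T"
      using smooth_on_cong[OF T, of "\<lambda>y. lie_metric (X i) (g i) y u v / g i y u v" "l i"] by simp
    moreover have "x \<in> T" using x uv by (simp add: T_def)
    ultimately show "\<exists>T. open T \<and> x \<in> T \<and> smooth_on (l i) T" using T by blast
  qed
  moreover have "l j (transition A i j x) = l i x" if x: "x \<in> overlap A i j" for i j x
  proof -
    have xi: "x \<in> chart_image A i" by (rule subsetD[OF overlap_subset x])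
    have tj: "transition A i j y \<in> chart_image A j" if "y \<in> overlap A i j" for y
      by (rule subsetD[OF overlap_subset transition_overlap[OF A that]])
    obtain u v where uv: "g i x u v \<noteq> 0" using metric_nonzero[OF g xi] .
    have "lie_metric (X i) (g i) x u v
        = lie_metric (X j) (g j) (transition A i j x) (fd (transition A i j) x u) (fd (transition A i j) x v)"
    proof (rule lie_metric_natural[OF open_overlap[OF A] x smooth_transition[OF A]])
      show "X i differentiable at x" by (rule smooth_on_differentiable[OF vector_fieldD(1)[OF X] xi])
      show "X j differentiable at (transition A i j x)"
        by (rule smooth_on_differentiable[OF vector_fieldD(1)[OF X] tj[OF x]])
      show "(\<lambda>y. g j y u v) differentiable at (transition A i j x)" for u v
        by (rule smooth_on_differentiable[OF metricD(1)[OF g] tj[OF x]])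
      show "X j (transition A i j y) = fd (transition A i j) y (X i y)" if "y \<in> overlap A i j" for y
        using vector_fieldD(3)[OF X that] by (simp only: dtrans_def)
      show "g i y u v = g j (transition A i j y) (fd (transition A i j) y u) (fd (transition A i j) y v)"
        if "y \<in> overlap A i j" for y u v
        using metricD(3)[OF g that] by (simp only: dtrans_def)
      show "bilinear (g j (transition A i j y))" if "y \<in> overlap A i j" for y
        using metricD(2)[OF g tj[OF that]] .
    qed
    then have "l i x * g i x u v = l j (transition A i j x) * g i x u v"
      using l[OF xi] l[OF tj[OF x]] metricD(3)[OF g x] by (simp only: dtrans_def)
    then show ?thesis using uv by simp
  qed
  ultimately have "scalar_field A l"
    by (simp add: scalar_field_def smooth_components_def l_def)
  then show ?thesis using l by blast
qed

text \<open>Only the reference \<open>g0\<close> has to be tested: replacing it by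
  \<open>F * g0\<close> turns the factor \<open>c\<close> into \<open>c\<close> plus the logarithmic
  derivative of \<open>F\<close> along \<open>X\<close>.\<close>

lemma conformal_killingI:
  fixes A :: "('i, 'a, 'e::euclidean_space) atlas"
  assumes A: "smooth_atlas A" and X: "vector_field A X"
    and C: "\<And>g. g \<in> C \<Longrightarrow> metric A g \<and> (\<forall>i. \<exists>F. smooth_on F (chart_image A i) \<and>
      (\<forall>x\<in>chart_image A i. F x > 0 \<and> (\<forall>u v. g i x u v = F x * g0 i x u v)))"
    and g0: "\<And>i u v. smooth_on (\<lambda>x. g0 i x u v) (chart_image A i)"
    and lie: "\<And>i x. x \<in> chart_image A i \<Longrightarrow> \<exists>c. \<forall>u v. lie_metric (X i) (g0 i) x u v = c * g0 i x u v"
  shows "conformal_killing A C X"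
  unfolding conformal_killing_def
proof (intro conjI X ballI conformal_factor_scalar_field[OF A])
  fix g assume g: "g \<in> C"
  then show "metric A g" using C by blast
  fix i x assume x: "x \<in> chart_image A i"
  obtain F where F: "smooth_on F (chart_image A i)"
    "\<And>x u v. x \<in> chart_image A i \<Longrightarrow> g i x u v = F x * g0 i x u v"
    "\<And>x. x \<in> chart_image A i \<Longrightarrow> F x > 0" using C[OF g] by metis
  obtain c where c: "\<And>u v. lie_metric (X i) (g0 i) x u v = c * g0 i x u v" using lie[OF x] by blast
  have "lie_metric (X i) (g i) x u v = (fd F x (X i x) / F x + c) * g i x u v" for u v
  proof -
    have "lie_metric (X i) (g i) x u v = lie_metric (X i) (\<lambda>y u v. F y * g0 i y u v) x u v"
      by (rule lie_metric_cong[OF open_chart_image[OF A] x]) (auto simp: F)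
    also have "\<dots> = fd F x (X i x) * g0 i x u v + F x * lie_metric (X i) (g0 i) x u v"
      by (rule lie_metric_scale[OF smooth_on_differentiable[OF F(1) x] smooth_on_differentiable[OF g0 x]])
    also have "\<dots> = (fd F x (X i x) / F x + c) * g i x u v"
      using F(3)[OF x] by (simp add: c F(2)[OF x] field_simps)
    finally show ?thesis .
  qed
  then show "\<exists>c. \<forall>u v. lie_metric (X i) (g i) x u v = c * g i x u v" by blast
qed

subsection \<open>Traces and algebraic curvature tensors\<close>

lemma sum_Basis_inner: "linear f \<Longrightarrow> (\<Sum>b\<in>Basis. f b * (u \<bullet> b)) = (f u :: real)" for u :: "'e::euclidean_space"
  using linear_euclidean_expand[of f u] by (simp add: mult.commute)

lemma sum_Basis_skew:
  fixes w :: "'e::euclidean_space \<Rightarrow> 'e" and B :: "'e \<Rightarrow> 'e \<Rightarrow> real"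
  assumes w: "\<And>p q. w p \<bullet> q = - (w q \<bullet> p)"
    and B: "\<And>u. linear (B u)" "\<And>v. linear (\<lambda>u. B u v)"
  shows "(\<Sum>b\<in>Basis. B b (w b)) = - (\<Sum>b\<in>Basis. B (w b) b)"
proof -
  have "(\<Sum>b\<in>Basis. B b (w b)) = (\<Sum>b\<in>Basis. \<Sum>c\<in>Basis. (w b \<bullet> c) * B b c)"
    by (rule sum.cong[OF refl]) (subst linear_euclidean_expand[OF B(1)], simp)
  also have "\<dots> = (\<Sum>b\<in>Basis. \<Sum>c\<in>Basis. (w c \<bullet> b) * B c b)"
    by (rule sum.swap)
  also have "\<dots> = - (\<Sum>b\<in>Basis. \<Sum>c\<in>Basis. (w b \<bullet> c) * B c b)"
  proof -
    have "(w c \<bullet> b) * B c b = - ((w b \<bullet> c) * B c b)" for b c using w[of c b] by simp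
    then show ?thesis by (simp add: sum_negf)
  qed
  also have "(\<Sum>b\<in>Basis. \<Sum>c\<in>Basis. (w b \<bullet> c) * B c b) = (\<Sum>b\<in>Basis. B (w b) b)"
    by (rule sum.cong[OF refl]) (subst (2) linear_euclidean_expand[OF B(2)], simp)
  finally show ?thesis .
qed

text \<open>The data at one point that enter the degree 2 equation. \<open>R\<close> is the
  curvature, \<open>trR\<close> reflects the parallel volume form, \<open>ric\<close> makes
  \<open>P\<close> the Schouten tensor, and \<open>N u p\<close> stands for \<open>p\<close> paired
  with the covariant derivative of \<open>\<nu>\<close> along \<open>u\<close>. Assumption
  \<open>integ\<close> is the Ricci identity for the equation satisfied by \<open>w\<close>.\<close>

locale projective_curvature =
  fixes R :: "'e::euclidean_space \<Rightarrow> 'e \<Rightarrow> 'e \<Rightarrow> 'e" and P :: "'e \<Rightarrow> 'e \<Rightarrow> real"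
    and w :: "'e \<Rightarrow> 'e" and N :: "'e \<Rightarrow> 'e \<Rightarrow> real"
  assumes dim: "DIM('e) \<ge> 2"
    and linR: "\<And>v a. linear (\<lambda>u. R u v a)" "\<And>u a. linear (\<lambda>v. R u v a)" "\<And>u v. linear (R u v)"
    and skewR: "\<And>u v a. R u v a = - R v u a"
    and bianchi: "\<And>u v a. R u v a + R v a u + R a u v = 0"
    and trR: "\<And>u v. (\<Sum>b\<in>Basis. R u v b \<bullet> b) = 0"
    and linP: "\<And>v. linear (\<lambda>u. P u v)" "\<And>u. linear (P u)"
    and ric: "\<And>u a. (\<Sum>b\<in>Basis. R b u a \<bullet> b) = (real DIM('e) - 1) * P u a"
    and linw: "linear w" and skew: "\<And>p q. w p \<bullet> q = - (w q \<bullet> p)"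
    and linN: "\<And>v. linear (\<lambda>u. N u v)" "\<And>u. linear (N u)"
    and integ: "\<And>u v p q. R u v (w p) \<bullet> q - R u v (w q) \<bullet> p
        = N u q * (p \<bullet> v) - N u p * (q \<bullet> v) - N v q * (p \<bullet> u) + N v p * (q \<bullet> u)"
begin

definition W :: "'e \<Rightarrow> 'e \<Rightarrow> 'e \<Rightarrow> 'e" where
  "W u v a = R u v a + P u a *\<^sub>R v - P v a *\<^sub>R u"

text \<open>The defect of the prolongation \<open>N u p = P u (w p)\<close>. It is forced to vanish
  by the quadratic condition, and by the Weyl condition when \<open>n \<ge> 3\<close>.\<close>

definition s :: "'e \<Rightarrow> 'e \<Rightarrow> real" where "s u p = N u p - P u (w p)"

definition \<Omega> :: "'e \<Rightarrow> 'e \<Rightarrow> real" where "\<Omega> u p = (\<Sum>b\<in>Basis. W u b (w b) \<bullet> p)"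

text \<open>Contracting the Bianchi identity leaves the skew part of the Ricci tensor and the trace
  of \<open>R u v\<close>; the latter vanishes because a volume form is preserved.\<close>

lemma P_sym: "P u v = P v u"
proof -
  have "(\<Sum>b\<in>Basis. (R b u v + R u v b + R v b u) \<bullet> b) = 0" by (simp add: bianchi)
  then have "(real DIM('e) - 1) * P u v + (\<Sum>b\<in>Basis. R v b u \<bullet> b) = 0"
    by (simp add: inner_add_left sum.distrib trR ric)
  moreover have "(\<Sum>b\<in>Basis. R v b u \<bullet> b) = - ((real DIM('e) - 1) * P v u)"
    unfolding ric[symmetric] skewR[of v] by (simp add: sum_negf)
  ultimately show ?thesis using dim by simp
qed

lemma w_self: "w p \<bullet> p = 0" using skew[of p p] by simp

lemma linW: "linear (\<lambda>u. W u v a)" "linear (\<lambda>v. W u v a)" "linear (W u v)"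
  unfolding W_def linear_iff
  using linR[unfolded linear_iff] linP[unfolded linear_iff] by (auto simp: algebra_simps)

lemma lins: "linear (\<lambda>u. s u v)" "linear (s u)"
  unfolding s_def linear_iff
  using linN[unfolded linear_iff] linP[unfolded linear_iff] linw[unfolded linear_iff] by (auto simp: algebra_simps)

lemma W_skew: "W u v a = - W v u a"
  unfolding W_def skewR[of u v a] by simp

lemma W_bianchi: "W u v a + W v a u + W a u v = 0"
proof -
  have "W u v a + W v a u + W a u v = R u v a + R v a u + R a u v"
    unfolding W_def by (simp add: P_sym[of v u] P_sym[of a u] P_sym[of a v])
  then show ?thesis by (simp add: bianchi)
qed

lemma W_trace: "(\<Sum>b\<in>Basis. W u b a \<bullet> b) = 0" "(\<Sum>b\<in>Basis. W b u a \<bullet> b) = 0"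
proof -
  have "(\<Sum>b\<in>Basis. W b u a \<bullet> b)
      = (\<Sum>b\<in>Basis. R b u a \<bullet> b) + (\<Sum>b\<in>Basis. P b a * (u \<bullet> b)) - (\<Sum>b::'e\<in>Basis. P u a * (b \<bullet> b))"
    unfolding W_def by (simp add: inner_simps sum.distrib sum_subtractf)
  also have "\<dots> = 0"
    unfolding ric sum_Basis_inner[OF linP(1)] by (simp add: left_diff_distrib)
  finally show 1: "(\<Sum>b\<in>Basis. W b u a \<bullet> b) = 0" .
  have "(\<Sum>b\<in>Basis. W u b a \<bullet> b) = - (\<Sum>b\<in>Basis. W b u a \<bullet> b)"
    unfolding W_skew[of u] by (simp add: sum_negf)
  then show "(\<Sum>b\<in>Basis. W u b a \<bullet> b) = 0" using 1 by simp
qed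

lemma W_trace3: "(\<Sum>b\<in>Basis. W u v b \<bullet> b) = 0"
proof -
  have "(\<Sum>b\<in>Basis. W u v b \<bullet> b)
      = (\<Sum>b\<in>Basis. R u v b \<bullet> b) + (\<Sum>b\<in>Basis. P u b * (v \<bullet> b)) - (\<Sum>b\<in>Basis. P v b * (u \<bullet> b))"
    unfolding W_def by (simp add: inner_simps sum.distrib sum_subtractf)
  then show ?thesis unfolding trR sum_Basis_inner[OF linP(2)] using P_sym[of u v] by simp
qed

text \<open>The Schouten terms that turn \<open>R\<close> into \<open>W\<close> have the same shape
  as the right side of \<open>integ\<close>, so they merge with \<open>N\<close> into
  \<open>s\<close>.\<close>

lemma integ_W: "W u v (w p) \<bullet> q - W u v (w q) \<bullet> p
    = s u q * (p \<bullet> v) - s u p * (q \<bullet> v) - s v q * (p \<bullet> u) + s v p * (q \<bullet> u)"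
  using integ[of u v p q] unfolding W_def s_def
  by (simp add: inner_simps inner_commute[of u] inner_commute[of v] algebra_simps)

text \<open>Contract \<open>integ_W\<close> over \<open>v = q = b\<close>; the first term on the
  left becomes a trace of \<open>W\<close> and vanishes.\<close>

lemma \<Omega>_s_trace: "\<Omega> u p = (real DIM('e) - 2) * s u p + (\<Sum>b\<in>Basis. s b b) * (p \<bullet> u)"
proof -
  have "(\<Sum>b\<in>Basis. W u b (w p) \<bullet> b - W u b (w b) \<bullet> p)
      = (\<Sum>b\<in>Basis. s u b * (p \<bullet> b) - s u p * (b \<bullet> b) - s b b * (p \<bullet> u) + s b p * (u \<bullet> b))"
    by (rule sum.cong[OF refl], subst integ_W) (simp add: inner_commute)
  also have "\<dots> = s u p - real DIM('e) * s u p - (\<Sum>b\<in>Basis. s b b) * (p \<bullet> u) + s u p"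
    by (simp add: sum.distrib sum_subtractf sum_Basis_inner[OF lins(1)] sum_Basis_inner[OF lins(2)] sum_distrib_right)
  finally show ?thesis
    by (simp add: sum_subtractf W_trace \<Omega>_def algebra_simps)
qed

text \<open>A second contraction kills \<open>\<Omega>\<close> too, by trace-freeness of
  \<open>W\<close>, and leaves \<open>(n - 2) + n = 2n - 2\<close> times the trace of
  \<open>s\<close>.\<close>

lemma s_trace: "(\<Sum>b\<in>Basis. s b b) = 0"
proof -
  have "(\<Sum>c\<in>Basis. \<Omega> c c) = (\<Sum>b\<in>Basis. \<Sum>c\<in>Basis. W c b (w b) \<bullet> c)"
    unfolding \<Omega>_def by (rule sum.swap)
  also have "\<dots> = 0" by (simp add: W_trace)
  finally have "(\<Sum>c\<in>Basis. (real DIM('e) - 2) * s c c + (\<Sum>b\<in>Basis. s b b) * (c \<bullet> c)) = 0"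
    by (simp only: \<Omega>_s_trace)
  moreover have "(\<Sum>c::'e\<in>Basis. (\<Sum>b\<in>Basis. s b b) * (c \<bullet> c)) = real DIM('e) * (\<Sum>b\<in>Basis. s b b)"
    by simp
  ultimately have "(2 * real DIM('e) - 2) * (\<Sum>b\<in>Basis. s b b) = 0"
    by (simp only: sum.distrib sum_distrib_left[symmetric]) (simp add: algebra_simps)
  then show ?thesis using dim by simp
qed

lemma \<Omega>_s: "\<Omega> u p = (real DIM('e) - 2) * s u p"
  using \<Omega>_s_trace s_trace by simp

text \<open>\<open>\<Omega>\<close> links the quadratic condition to the Weyl condition: integrability alone gives
  \<open>\<Omega> = (n - 2) s\<close>, whereas tracing the polarised condition \<open>T p p u v = s u p (p \<bullet> v) + s v p (p \<bullet> u)\<close>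
  gives \<open>-3 \<Omega> = (n + 2) s\<close>. Hence \<open>s = 0\<close>. Conversely \<open>T p p u v = 0\<close> gives
  \<open>\<Omega> = 0\<close>, which implies \<open>s = 0\<close> only for \<open>n > 2\<close>.\<close>
lemma polarised_trace:
  "(\<Sum>b\<in>Basis. W b (w b) v \<bullet> p + W v (w b) b \<bullet> p + W b (w p) v \<bullet> b + W v (w p) b \<bullet> b) = - 3 * \<Omega> v p"
proof -
  have l: "linear (\<lambda>a. W v a b \<bullet> p)" "linear (\<lambda>b. W v a b \<bullet> p)" for a b
    using linW unfolding linear_iff by (auto simp: inner_simps)
  have 1: "(\<Sum>b\<in>Basis. W v (w b) b \<bullet> p) = - \<Omega> v p"
    unfolding \<Omega>_def using sum_Basis_skew[OF skew, of "\<lambda>a b. W v a b \<bullet> p"] l by simp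
  \<comment> \<open>By the Bianchi identity the first sum is \<open>- \<Omega> - \<Omega>\<close>.
    Together with the \<open>- \<Omega>\<close> of the second it gives the factor
    \<open>- 3\<close>; the remaining two sums are traces of \<open>W\<close>.\<close>
  have "W b (w b) v = W v (w b) b - W v b (w b)" for b
    using W_bianchi[of b "w b" v] W_skew[of "w b" v b] by (simp add: algebra_simps eq_neg_iff_add_eq_0)
  then have "(\<Sum>b\<in>Basis. W b (w b) v \<bullet> p) = - 2 * \<Omega> v p"
    using 1 by (simp add: inner_simps sum_subtractf \<Omega>_def)
  then show ?thesis using 1 by (simp add: sum.distrib W_trace W_trace3)
qed

text \<open>Symmetrised in \<open>p\<close> and \<open>q\<close> and evaluated on basis vectors,
  this is four times the index expression of the Weyl condition, see
  \<open>weyl_index\<close>.\<close>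

definition T :: "'e \<Rightarrow> 'e \<Rightarrow> 'e \<Rightarrow> 'e \<Rightarrow> real" where
  "T p q u v = W u (w q) v \<bullet> p + W v (w q) u \<bullet> p"

lemma polarise: "T p q u v + T q p u v = T (p + q) (p + q) u v - T p p u v - T q q u v"
  using linW(2)[unfolded linear_iff] linw[unfolded linear_iff] unfolding T_def
  by (simp add: inner_simps)

lemma sum_T: "(\<Sum>b\<in>Basis. T p b b v + T b p b v) = - 3 * \<Omega> v p"
  using polarised_trace[of v p] unfolding T_def by (simp add: sum.distrib)

lemma R_T: "R u (w p) v \<bullet> p + R v (w p) u \<bullet> p
    = T p p u v + P u (w p) * (p \<bullet> v) + P v (w p) * (p \<bullet> u)"
  using w_self[of p] unfolding T_def W_def
  by (simp add: inner_simps P_sym[of "w p"] inner_commute[of u] inner_commute[of v] algebra_simps)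

lemma quadratic_of_weyl:
  assumes n: "DIM('e) \<ge> 3" and T: "\<And>p u v. T p p u v = 0"
  shows "R u (w p) v \<bullet> p + R v (w p) u \<bullet> p = N u p * (p \<bullet> v) + N v p * (p \<bullet> u)"
proof -
  have "T p q u v + T q p u v = 0" for p q u v by (simp add: polarise T)
  then have "\<Omega> v p = 0" for v p using sum_T[of p v] by simp
  then have "s v p = 0" for v p using \<Omega>_s[of v p] n by simp
  then show ?thesis using R_T[of u p v] T by (simp add: s_def)
qed

lemma weyl_of_quadratic:
  assumes q: "\<And>u v p. R u (w p) v \<bullet> p + R v (w p) u \<bullet> p = N u p * (p \<bullet> v) + N v p * (p \<bullet> u)"
  shows "T p q u v + T q p u v = 0"
proof -
  have T: "T p p u v = s u p * (p \<bullet> v) + s v p * (p \<bullet> u)" for p u v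
    using R_T[of u p v] q[of u p v] by (simp add: s_def algebra_simps)
  have pol: "T p q u v + T q p u v = s u q * (p \<bullet> v) + s u p * (q \<bullet> v) + s v q * (p \<bullet> u) + s v p * (q \<bullet> u)" for p q u v
    using lins(2)[unfolded linear_iff] by (simp add: polarise T inner_simps algebra_simps)
  have z: "s v p = 0" for v p
  proof -
    have "- 3 * \<Omega> v p = (\<Sum>b\<in>Basis. T p b b v + T b p b v)" by (rule sum_T[symmetric])
    also have "\<dots> = (\<Sum>b\<in>Basis. s b b * (p \<bullet> v) + s b p * (v \<bullet> b) + s v b * (p \<bullet> b) + s v p * (b \<bullet> b))"
      by (simp add: pol inner_commute)
    also have "\<dots> = (2 + real DIM('e)) * s v p"
      unfolding sum.distrib sum_Basis_inner[OF lins(1)] sum_Basis_inner[OF lins(2)]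
        sum_distrib_right[symmetric] s_trace by (simp add: algebra_simps)
    \<comment> \<open>From \<open>- 3 * \<Omega> = (n + 2) s\<close> and
      \<open>\<Omega> = (n - 2) s\<close>: the factor is \<open>(n + 2) + 3 (n - 2)\<close>, which
      is nonzero in dimension 2 as well.\<close>
    finally have "(4 * real DIM('e) - 4) * s v p = 0" by (simp add: \<Omega>_s algebra_simps)
    then show ?thesis using dim by simp
  qed
  show ?thesis by (simp add: pol z)
qed

end

subsection \<open>Christoffel symbols as bilinear maps\<close>

text \<open>Contracting the derivative index of the Christoffel symbols leaves a matrix, which acts
  on vectors by \<open>*v\<close> and on covectors by \<open>v*\<close>. Thus
  \<open>cm G u *v a\<close> is the connection term of the derivative of \<open>a\<close> along
  \<open>u\<close>.\<close>

definition cm :: "real^'n^'n^'n \<Rightarrow> real^'n::finite \<Rightarrow> real^'n^'n" where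
  "cm G u = (\<Sum>A\<in>UNIV. u $ A *\<^sub>R G $ A)"

lemma bounded_bilinear_cm: "bounded_bilinear (cm :: real^'n^'n^'n \<Rightarrow> real^'n::finite \<Rightarrow> _)"
  by (subst bilinear_conv_bounded_bilinear[symmetric])
     (simp add: bilinear_def linear_iff cm_def algebra_simps sum.distrib scaleR_sum_right)

lemma bounded_bilinear_mv: "bounded_bilinear ((*v) :: real^'n^'m \<Rightarrow> real^'n \<Rightarrow> real^'m::finite)"
  by (subst bilinear_conv_bounded_bilinear[symmetric])
     (simp add: bilinear_def linear_iff algebra_simps scaleR_matrix_vector_assoc matrix_vector_mult_scaleR)

lemma bounded_bilinear_vm: "bounded_bilinear ((v*) :: real^'m \<Rightarrow> real^'n^'m \<Rightarrow> real^'n::finite)"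
  by (subst bilinear_conv_bounded_bilinear[symmetric])
     (simp add: bilinear_def linear_iff vector_matrix_mult_def vec_eq_iff algebra_simps sum.distrib sum_distrib_left)

lemmas cm_simps =
  bounded_bilinear.add_left[OF bounded_bilinear_cm] bounded_bilinear.add_right[OF bounded_bilinear_cm]
  bounded_bilinear.diff_left[OF bounded_bilinear_cm] bounded_bilinear.diff_right[OF bounded_bilinear_cm]
  bounded_bilinear.scaleR_left[OF bounded_bilinear_cm] bounded_bilinear.scaleR_right[OF bounded_bilinear_cm]
  bounded_bilinear.minus_left[OF bounded_bilinear_cm] bounded_bilinear.minus_right[OF bounded_bilinear_cm]
  bounded_bilinear.zero_left[OF bounded_bilinear_cm] bounded_bilinear.zero_right[OF bounded_bilinear_cm]

lemmas mv_simps =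
  bounded_bilinear.add_left[OF bounded_bilinear_mv] bounded_bilinear.add_right[OF bounded_bilinear_mv]
  bounded_bilinear.diff_left[OF bounded_bilinear_mv] bounded_bilinear.diff_right[OF bounded_bilinear_mv]
  bounded_bilinear.scaleR_left[OF bounded_bilinear_mv] bounded_bilinear.scaleR_right[OF bounded_bilinear_mv]
  bounded_bilinear.minus_left[OF bounded_bilinear_mv] bounded_bilinear.minus_right[OF bounded_bilinear_mv]
  bounded_bilinear.zero_left[OF bounded_bilinear_mv] bounded_bilinear.zero_right[OF bounded_bilinear_mv]

lemmas vm_simps =
  bounded_bilinear.add_left[OF bounded_bilinear_vm] bounded_bilinear.add_right[OF bounded_bilinear_vm]
  bounded_bilinear.diff_left[OF bounded_bilinear_vm] bounded_bilinear.diff_right[OF bounded_bilinear_vm]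
  bounded_bilinear.scaleR_left[OF bounded_bilinear_vm] bounded_bilinear.scaleR_right[OF bounded_bilinear_vm]
  bounded_bilinear.minus_left[OF bounded_bilinear_vm] bounded_bilinear.minus_right[OF bounded_bilinear_vm]
  bounded_bilinear.zero_left[OF bounded_bilinear_vm] bounded_bilinear.zero_right[OF bounded_bilinear_vm]

lemma cm_nth: "cm G u $ C $ B = (\<Sum>A\<in>UNIV. u $ A * G $ A $ C $ B)"
  by (simp add: cm_def)

lemma cm_axis: "cm G (axis A 1) = G $ A"
  by (simp add: vec_eq_iff cm_nth axis_def if_distrib[of "\<lambda>x. x * _"] cong: if_cong)

lemma mv_axis: "(M *v axis B 1) $ C = M $ C $ B" for M :: "real^'n^'m"
  by (simp add: matrix_vector_mult_def axis_def if_distrib[of "\<lambda>x. _ * x"] cong: if_cong)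

lemma cm_sym:
  assumes "\<And>A B C. G $ A $ C $ B = G $ B $ C $ A"
  shows "cm G u *v v = cm G v *v u"
proof -
  have "(cm G u *v v) $ C = (cm G v *v u) $ C" for C
  proof -
    have "(cm G u *v v) $ C = (\<Sum>B\<in>UNIV. \<Sum>A\<in>UNIV. u $ A * G $ A $ C $ B * v $ B)"
      by (simp add: matrix_vector_mult_def cm_nth sum_distrib_right)
    also have "\<dots> = (\<Sum>B\<in>UNIV. \<Sum>A\<in>UNIV. v $ A * G $ A $ C $ B * u $ B)"
      by (subst sum.swap, intro sum.cong refl, subst assms) (simp add: mult_ac)
    finally show ?thesis by (simp add: matrix_vector_mult_def cm_nth sum_distrib_right)
  qed
  then show ?thesis by (simp add: vec_eq_iff)
qed

lemma Basis_axis: "(Basis :: (real^'n) set) = range (\<lambda>i. axis i 1)"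
  by (auto simp: Basis_vec_def)

lemma sum_Basis_axis:
  fixes f :: "real^'n \<Rightarrow> 'b::comm_monoid_add"
  shows "(\<Sum>b\<in>Basis. f b) = (\<Sum>i\<in>UNIV. f (axis i 1))"
  by (subst Basis_axis, subst sum.reindex) (auto simp: inj_on_def axis_eq_axis)

lemma dot_rmul_vm: "y \<bullet> (x v* A) = x \<bullet> (A *v (y::real^'n))"
  using dot_lmul_matrix[of x A y] by (simp add: inner_commute)

lemma matrix_fd_works: "f differentiable at x \<Longrightarrow> matrix (fd f x) *v u = fd f x u" for f :: "real^'n \<Rightarrow> real^'m"
  by (simp add: matrix_works linear_fd)

lemma smooth_on_matrix_fd:
  fixes f :: "real^'n \<Rightarrow> real^'m"
  assumes "open S" "smooth_on f S"
  shows "smooth_on (\<lambda>x. matrix (fd f x)) S"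
  by (intro smooth_on_vec assms(1)) (simp add: matrix_def smooth_on_nth[OF assms(1) smooth_on_fd[OF assms(2)]])

lemma fd_bounded_linear:
  "bounded_linear L \<Longrightarrow> f differentiable at x \<Longrightarrow> fd (\<lambda>y. L (f y)) x u = L (fd f x u)"
  using fd_eq[OF bounded_linear.has_derivative[OF _ has_derivative_fd]] by metis

lemma fd_matrix_fd:
  fixes f :: "real^'n \<Rightarrow> real^'m"
  assumes S: "open S" "x \<in> S" and f: "smooth_on f S"
  shows "fd (\<lambda>y. matrix (fd f y)) x u *v a = fd (\<lambda>y. fd f y a) x u"
proof -
  have "fd (\<lambda>y. matrix (fd f y) *v a) x u = fd (\<lambda>y. matrix (fd f y)) x u *v a"
    by (rule fd_bounded_linear[OF bounded_bilinear.bounded_linear_left[OF bounded_bilinear_mv]])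
       (rule smooth_on_differentiable[OF smooth_on_matrix_fd[OF S(1) f] S(2)])
  moreover have "fd (\<lambda>y. matrix (fd f y) *v a) x = fd (\<lambda>y. fd f y a) x"
    by (rule fd_cong[OF S]) (rule matrix_fd_works[OF smooth_on_differentiable[OF f]])
  ultimately show ?thesis by simp
qed

subsection \<open>The Patterson--Walker metric in a chart\<close>

text \<open>The symmetrisation of \<open>pw_formula\<close> is left out here; both agree for
  symmetric Christoffel symbols (\<open>pw_formula_pwf\<close>), and this form is the easier one to
  differentiate.\<close>

definition pwf :: "(real^'n \<Rightarrow> real^'n^'n^'n) \<Rightarrow> (real^'n::finite) \<times> (real^'n) \<Rightarrow>
    (real^'n) \<times> (real^'n) \<Rightarrow> (real^'n) \<times> (real^'n) \<Rightarrow> real" where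
  "pwf G z a b = fst a \<bullet> snd b + snd a \<bullet> fst b - 2 * (snd z \<bullet> (cm (G (fst z)) (fst a) *v fst b))"

text \<open>\<open>v\<^sup>A h\<^sub>A - p\<^sub>A D\<^sub>B v\<^sup>A \<partial>\<^sup>B + w\<^sup>A\<^sup>B p\<^sub>A h\<^sub>B + \<alpha>\<^sub>A \<partial>\<^sup>A + (s - \<nu>\<^sup>A p\<^sub>A) p\<^sub>B \<partial>\<^sup>B\<close>, where \<open>\<partial>\<^sup>A = \<partial>/\<partial>p\<^sub>A\<close>: the Christoffel
  symbols in the first two terms cancel.\<close>
definition std_field :: "(real^'n \<Rightarrow> real^'n^'n^'n) \<Rightarrow> (real^'n \<Rightarrow> real^'n) \<Rightarrow> (real^'n \<Rightarrow> real^'n^'n) \<Rightarrow>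
    (real^'n \<Rightarrow> real^'n) \<Rightarrow> (real^'n \<Rightarrow> real) \<Rightarrow> (real^'n \<Rightarrow> real^'n) \<Rightarrow>
    (real^'n::finite) \<times> (real^'n) \<Rightarrow> (real^'n) \<times> (real^'n)" where
  "std_field G v w \<alpha> s \<nu> z = (case z of (x, p) \<Rightarrow>
     (v x + p v* w x,
      \<alpha> x - p v* matrix (fd v x) + s x *\<^sub>R p + p v* cm (G x) (p v* w x) - (\<nu> x \<bullet> p) *\<^sub>R p))"

definition riem :: "(real^'n \<Rightarrow> real^'n^'n^'n) \<Rightarrow> real^'n::finite \<Rightarrow> real^'n \<Rightarrow> real^'n \<Rightarrow> real^'n \<Rightarrow> real^'n" where
  "riem G x u v a = cm (fd G x u) v *v a - cm (fd G x v) u *v a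
     + cm (G x) u *v (cm (G x) v *v a) - cm (G x) v *v (cm (G x) u *v a)"

text \<open>The Lie derivative of the connection in coordinates: the formula for a tensor with these
  slots, plus the second derivative of \<open>v\<close> that compensates the inhomogeneous
  transformation of Christoffel symbols. It is the left side of the symmetry equation, see
  \<open>lie_diff_lie_conn\<close>.\<close>

definition lie_conn :: "(real^'n \<Rightarrow> real^'n) \<Rightarrow> (real^'n \<Rightarrow> real^'n^'n^'n) \<Rightarrow> real^'n::finite \<Rightarrow> real^'n \<Rightarrow> real^'n \<Rightarrow> real^'n" where
  "lie_conn v G x u a = cm (fd G x (v x)) u *v a - fd v x (cm (G x) u *v a)
     + cm (G x) (fd v x u) *v a + cm (G x) u *v (fd v x a) + fd (\<lambda>y. fd v y a) x u"

text \<open>\<open>q\<^sub>B p\<^sub>A u\<^sup>C D\<^sub>C w\<^sup>A\<^sup>B\<close> for skew \<open>w\<close>.\<close>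
definition nabla_w :: "(real^'n \<Rightarrow> real^'n^'n^'n) \<Rightarrow> (real^'n \<Rightarrow> real^'n^'n) \<Rightarrow> real^'n::finite \<Rightarrow> real^'n \<Rightarrow> real^'n \<Rightarrow> real^'n \<Rightarrow> real" where
  "nabla_w G w x u p q = p \<bullet> (fd w x u *v q) + q \<bullet> (cm (G x) u *v (p v* w x)) - p \<bullet> (cm (G x) u *v (q v* w x))"

lemma has_derivative_fst_comp: "f differentiable at x \<Longrightarrow> ((\<lambda>z. f (fst z)) has_derivative (\<lambda>a. fd f x (fst a))) (at (x, p))"
  by (rule has_derivative_compose[where f = fst and x = "(x, p)", simplified])
     (auto intro: has_derivative_fst has_derivative_ident has_derivative_fd)

lemma fd_pwf:
  assumes "G differentiable at x"
  shows "fd (\<lambda>z. pwf G z a b) (x, p) = (\<lambda>c. - 2 * (snd c \<bullet> (cm (G x) (fst a) *v fst b)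
    + p \<bullet> (cm (fd G x (fst c)) (fst a) *v fst b)))"
  unfolding pwf_def
  by (rule fd_eq)
     (auto intro!: derivative_eq_intros has_derivative_fst_comp[OF assms] bounded_bilinear.FDERIV[OF bounded_bilinear_mv]
        bounded_bilinear.FDERIV[OF bounded_bilinear_cm] simp: cm_simps mv_simps inner_simps)

lemma fd_std_field:
  assumes "G differentiable at x" "v differentiable at x" "w differentiable at x" "\<alpha> differentiable at x"
    "s differentiable at x" "\<nu> differentiable at x" "(\<lambda>x. matrix (fd v x)) differentiable at x"
  shows "fd (std_field G v w \<alpha> s \<nu>) (x, p) (u, q) =
    (fd v x u + (p v* fd w x u + q v* w x),
     fd \<alpha> x u - (p v* fd (\<lambda>x. matrix (fd v x)) x u + q v* matrix (fd v x)) + (s x *\<^sub>R q + fd s x u *\<^sub>R p)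
       + (p v* (cm (G x) (p v* fd w x u + q v* w x) + cm (fd G x u) (p v* w x)) + q v* cm (G x) (p v* w x))
       - ((\<nu> x \<bullet> p) *\<^sub>R q + (\<nu> x \<bullet> q + fd \<nu> x u \<bullet> p) *\<^sub>R p))"
proof -
  note d = assms[THEN has_derivative_fst_comp]
  have s: "(snd has_derivative snd) (at (x, p))" by (intro derivative_intros)
  have 1: "((\<lambda>z. snd z v* w (fst z)) has_derivative (\<lambda>a. p v* fd w x (fst a) + snd a v* w x)) (at (x, p))"
    using bounded_bilinear.FDERIV[OF bounded_bilinear_vm s d(3)] by simp
  have 2: "((\<lambda>z. snd z v* matrix (fd v (fst z))) has_derivative
      (\<lambda>a. p v* fd (\<lambda>x. matrix (fd v x)) x (fst a) + snd a v* matrix (fd v x))) (at (x, p))"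
    using bounded_bilinear.FDERIV[OF bounded_bilinear_vm s d(7)] by simp
  have 3: "((\<lambda>z. snd z v* cm (G (fst z)) (snd z v* w (fst z))) has_derivative
      (\<lambda>a. p v* (cm (G x) (p v* fd w x (fst a) + snd a v* w x) + cm (fd G x (fst a)) (p v* w x))
         + snd a v* cm (G x) (p v* w x))) (at (x, p))"
    using bounded_bilinear.FDERIV[OF bounded_bilinear_vm s bounded_bilinear.FDERIV[OF bounded_bilinear_cm d(1) 1]]
    by simp
  have 4: "((\<lambda>z. (\<nu> (fst z) \<bullet> snd z) *\<^sub>R snd z) has_derivative
      (\<lambda>a. (\<nu> x \<bullet> p) *\<^sub>R snd a + (\<nu> x \<bullet> snd a + fd \<nu> x (fst a) \<bullet> p) *\<^sub>R p)) (at (x, p))"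
    using has_derivative_scaleR[OF has_derivative_inner[OF d(6) s] s] by simp
  have 5: "((\<lambda>z. s (fst z) *\<^sub>R snd z) has_derivative (\<lambda>a. s x *\<^sub>R snd a + fd s x (fst a) *\<^sub>R p)) (at (x, p))"
    using has_derivative_scaleR[OF d(5) s] by simp
  have "std_field G v w \<alpha> s \<nu> = (\<lambda>z. (v (fst z) + snd z v* w (fst z),
      \<alpha> (fst z) - snd z v* matrix (fd v (fst z)) + s (fst z) *\<^sub>R snd z
       + snd z v* cm (G (fst z)) (snd z v* w (fst z)) - (\<nu> (fst z) \<bullet> snd z) *\<^sub>R snd z))"
    by (auto simp: std_field_def)
  then show ?thesis
    using fd_eq[OF has_derivative_Pair[OF has_derivative_add[OF d(2) 1]
      has_derivative_diff[OF has_derivative_add[OF has_derivative_add[OF has_derivative_diff[OF d(4) 2] 5] 3] 4]]]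
    by simp
qed

lemma skew_mv:
  fixes W :: "real^'n^'n"
  assumes "transpose W = - W"
  shows "W *v a = - (a v* W)"
proof -
  have "a v* W = transpose W *v a" by simp
  then show ?thesis unfolding assms by (simp add: mv_simps)
qed

lemma skew_vm:
  fixes W :: "real^'n^'n"
  assumes "transpose W = - W"
  shows "(p v* W) \<bullet> q = - ((q v* W) \<bullet> p)"
proof -
  have "(p v* W) \<bullet> q = p \<bullet> (W *v q)" by (rule dot_lmul_matrix)
  then show ?thesis by (simp add: skew_mv[OF assms] inner_commute)
qed

lemma transpose_scaleR: "transpose (c *\<^sub>R B) = c *\<^sub>R transpose B" for B :: "real^'n^'m"
  by (simp add: transpose_def vec_eq_iff)

lemma bounded_linear_cm: "bounded_linear (\<lambda>M. cm M u *v a)" for u a :: "real^'n"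
  by (intro bounded_linear_compose[OF bounded_bilinear.bounded_linear_left[OF bounded_bilinear_mv]]
      bounded_bilinear.bounded_linear_left[OF bounded_bilinear_cm])

lemma fd_cm_sym:
  assumes U: "open U" "x \<in> U" and "smooth_on G U"
    and sym: "\<And>y a b. y \<in> U \<Longrightarrow> cm (G y) a *v b = cm (G y) b *v a"
  shows "cm (fd G x r) a *v b = cm (fd G x r) b *v a"
proof -
  have "fd (\<lambda>y. cm (G y) a *v b) x r = fd (\<lambda>y. cm (G y) b *v a) x r"
    by (rule fun_cong[OF fd_cong[OF U sym]])
  then show ?thesis
    using fd_bounded_linear[OF bounded_linear_cm smooth_on_differentiable[OF assms(3) U(2)]] by simp
qed

text \<open>The formula that serves both directions. For a field in normal form whose
  \<open>w\<close> satisfies \<open>nw\<close>, the vertical and mixed components are already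
  conformal, so that what exceeds the multiple of the metric involves only \<open>u\<close> and
  \<open>u'\<close>: \<open>\<alpha>\<close> in fibre degree 0, \<open>v\<close> and
  \<open>s\<close> in degree 1, \<open>w\<close> and \<open>\<nu>\<close> in degree 2.\<close>

lemma lie_std_field:
  fixes G :: "real^'n \<Rightarrow> real^'n^'n^'n::finite"
  assumes U: "open U" "x \<in> U" and sm: "smooth_on G U" "smooth_on v U" "smooth_on w U" "smooth_on \<alpha> U"
      "smooth_on s U" "smooth_on \<nu> U"
    and sym: "\<And>y u v. y \<in> U \<Longrightarrow> cm (G y) u *v v = cm (G y) v *v u"
    and skew: "transpose (w x) = - w x"
    and nw: "\<And>u p q. nabla_w G w x u p q = (\<nu> x \<bullet> q) * (p \<bullet> u) - (\<nu> x \<bullet> p) * (q \<bullet> u)"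
  shows "lie_metric (std_field G v w \<alpha> s \<nu>) (pwf G) (x, p) (u, q) (u', q') =
      (s x - 2 * (\<nu> x \<bullet> p)) * pwf G (x, p) (u, q) (u', q')
      + (fd \<alpha> x u \<bullet> u' + fd \<alpha> x u' \<bullet> u - 2 * (\<alpha> x \<bullet> (cm (G x) u *v u')))
      + (fd s x u * (p \<bullet> u') + fd s x u' * (p \<bullet> u) - 2 * (p \<bullet> lie_conn v G x u u'))
      + (p \<bullet> riem G x u (p v* w x) u' + p \<bullet> riem G x u' (p v* w x) u
         - (p \<bullet> u') * (p \<bullet> (fd \<nu> x u + cm (G x) u *v \<nu> x))
         - (p \<bullet> u) * (p \<bullet> (fd \<nu> x u' + cm (G x) u' *v \<nu> x)))"
proof -
  note df = sm[THEN smooth_on_differentiable, OF U(2)]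
  note dm = smooth_on_differentiable[OF smooth_on_matrix_fd[OF U(1) sm(2)] U(2)]
  note fds = fd_std_field[OF df(1,2,3,4,5,6) dm]
  have dsym: "cm (fd G x r) a *v b = cm (fd G x r) b *v a" for r a b
    by (rule fd_cm_sym[OF U sm(1) sym])
  have sym2: "cm (G x) (a v* M) *v b = cm (G x) b *v (a v* M)" for a b and M :: "real^'n^'n"
    by (rule sym[OF U(2)])
  have dsym2: "cm (fd G x r) (a v* M) *v b = cm (fd G x r) b *v (a v* M)" for a b r and M :: "real^'n^'n"
    by (rule dsym)
  note sk = skew_mv[OF skew]
  have yp: "p \<bullet> (p v* w x) = 0" for p
    using skew_vm[OF skew, of p p] by (simp add: inner_commute)
  have skq: "q \<bullet> (w x *v q') = - (q' \<bullet> (w x *v q))" for q q'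
    using skew_vm[OF skew, of q q'] by (simp add: dot_lmul_matrix)
  \<comment> \<open>The equation for \<open>w\<close> with \<open>p v* cm (G x) a\<close> as second
    covector: a derivative of \<open>w\<close> that meets a Christoffel symbol is traded for
    \<open>\<nu>\<close> and for products of two Christoffel symbols.\<close>
  have nw1: "p \<bullet> (cm (G x) a *v (p v* fd w x b)) =
      (p \<bullet> (cm (G x) a *v \<nu> x)) * (p \<bullet> b) - (\<nu> x \<bullet> p) * (p \<bullet> (cm (G x) a *v b))
      - p \<bullet> (cm (G x) a *v (cm (G x) b *v (p v* w x))) + p \<bullet> (cm (G x) b *v ((p v* cm (G x) a) v* w x))" for a b
  proof -
    have "p \<bullet> (cm (G x) a *v (p v* fd w x b)) = p \<bullet> (fd w x b *v (p v* cm (G x) a))"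
      by (metis dot_lmul_matrix inner_commute)
    moreover have "z \<bullet> (p v* cm (G x) a) = p \<bullet> (cm (G x) a *v z)" for z
      by (metis dot_lmul_matrix inner_commute)
    ultimately show ?thesis using nw[of b p "p v* cm (G x) a"] unfolding nabla_w_def
      by (simp add: dot_lmul_matrix)
  qed
  \<comment> \<open>Skew in \<open>a\<close> and \<open>b\<close>, since \<open>w\<close> sits
    between the two Christoffel symbols; these terms therefore disappear from the sum over
    \<open>(u, u')\<close> and \<open>(u', u)\<close>.\<close>
  have ww: "p \<bullet> (cm (G x) b *v ((p v* cm (G x) a) v* w x)) = - (p \<bullet> (cm (G x) a *v ((p v* cm (G x) b) v* w x)))" for a b
  proof -
    have "p \<bullet> (cm (G x) b *v ((p v* cm (G x) a) v* w x)) = (p v* cm (G x) b) \<bullet> ((p v* cm (G x) a) v* w x)"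
      by (simp add: dot_lmul_matrix)
    also have "\<dots> = - ((p v* cm (G x) a) \<bullet> ((p v* cm (G x) b) v* w x))"
      using skq[of "p v* cm (G x) b" "p v* cm (G x) a"] by (simp add: sk)
    finally show ?thesis by (simp add: dot_lmul_matrix)
  qed
  show ?thesis
    using nw[of u p q'] nw[of u' p q] nw1[of u u'] nw1[of u' u] ww[of u u'] skq[of q q']
      fd_commute[OF U sm(2), of u u'] yp[of p]
    unfolding lie_metric_def fd_pwf[OF df(1)] fds nabla_w_def riem_def lie_conn_def
    apply (simp add: pwf_def std_field_def)
    apply (simp add: cm_simps mv_simps vm_simps inner_simps dot_lmul_matrix dot_rmul_vm fd_matrix_fd[OF U sm(2)]
      matrix_fd_works[OF df(2)] sym2 dsym2 linear_add[OF linear_fd[OF df(1)]])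
    apply (simp add: sym[OF U(2), of u' u] dsym[of _ u' u] algebra_simps)
    by (simp add: inner_commute)
qed

lemma trace_commute:
  fixes f g :: "'e::euclidean_space \<Rightarrow> 'e"
  assumes "linear f" "linear g"
  shows "(\<Sum>b\<in>Basis. f (g b) \<bullet> b) = (\<Sum>b\<in>Basis. g (f b) \<bullet> b)"
proof -
  have ex: "h (k b) \<bullet> b = (\<Sum>c\<in>Basis. (k b \<bullet> c) * (h c \<bullet> b))" if "linear h" for h k :: "'e \<Rightarrow> 'e" and b
    by (subst linear_euclidean_expand[OF that]) (simp add: inner_sum_left)
  show ?thesis
    unfolding ex[OF assms(1), of g] ex[OF assms(2), of f] by (subst sum.swap) (simp add: mult.commute)
qed

lemma linear_cm: "linear (\<lambda>a. cm M u *v a)" "linear (\<lambda>u. cm M u *v a)"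
  by (simp_all add: linear_iff cm_simps mv_simps)

text \<open>\<open>\<phi>\<close> is the logarithm of the coordinate density of the parallel volume
  form; that the form is parallel says that its derivative is the trace of the Christoffel
  symbols.\<close>

locale special_chart =
  fixes U :: "(real^'n::finite) set" and G :: "real^'n \<Rightarrow> real^'n^'n^'n" and \<phi> :: "real^'n \<Rightarrow> real"
  assumes U: "open U" and smG: "smooth_on G U" and sm\<phi>: "smooth_on \<phi> U"
    and sym: "\<And>x u v. x \<in> U \<Longrightarrow> cm (G x) u *v v = cm (G x) v *v u"
    and trace: "\<And>x u. x \<in> U \<Longrightarrow> (\<Sum>b\<in>Basis. (cm (G x) u *v b) \<bullet> b) = fd \<phi> x u"
    and dim: "CARD('n) \<ge> 2"
begin

text \<open>The covariant divergence, with the trace of the Christoffel symbols already replaced by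
  the derivative of \<open>\<phi>\<close>.\<close>

definition divg :: "(real^'n \<Rightarrow> real^'n) \<Rightarrow> real^'n \<Rightarrow> real" where
  "divg v x = (\<Sum>b\<in>Basis. fd v x b \<bullet> b) + fd \<phi> x (v x)"

definition rho :: "real^'n \<Rightarrow> real^'n \<Rightarrow> real^'n \<Rightarrow> real" where
  "rho x u a = 1 / (real CARD('n) - 1) * (\<Sum>b\<in>Basis. riem G x b u a \<bullet> b)"

lemma dG: "x \<in> U \<Longrightarrow> G differentiable at x"
  using smooth_on_differentiable[OF smG] .

lemma linear_dG: "x \<in> U \<Longrightarrow> linear (fd G x)"
  using linear_fd[OF dG] .

lemmas fd_G_sym = fd_cm_sym[OF U _ smG sym]

lemma trace_fd:
  assumes x: "x \<in> U"
  shows "(\<Sum>b\<in>Basis. (cm (fd G x u) v *v b) \<bullet> b) = fd (\<lambda>y. fd \<phi> y v) x u"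
proof -
  have bl: "bounded_linear (\<lambda>M. \<Sum>b\<in>Basis. (cm M v *v b) \<bullet> b)"
    by (intro bounded_linear_sum bounded_linear_compose[OF bounded_linear_inner_left] bounded_linear_cm)
  have "fd (\<lambda>y. \<Sum>b\<in>Basis. (cm (G y) v *v b) \<bullet> b) x u = fd (\<lambda>y. fd \<phi> y v) x u"
    by (rule fun_cong[OF fd_cong[OF U x]]) (rule trace)
  then show ?thesis using fd_bounded_linear[OF bl dG[OF x]] by simp
qed

lemma riem_linear:
  assumes x: "x \<in> U"
  shows "linear (\<lambda>u. riem G x u v a)" "linear (\<lambda>v. riem G x u v a)" "linear (riem G x u v)"
  unfolding riem_def linear_iff
  by (simp_all add: linear_add[OF linear_dG[OF x]] linear_scale[OF linear_dG[OF x]] cm_simps mv_simps algebra_simps)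

lemma riem_skew: "riem G x u v a = - riem G x v u a"
  by (simp add: riem_def)

lemma riem_bianchi:
  assumes x: "x \<in> U"
  shows "riem G x u v a + riem G x v a u + riem G x a u v = 0"
  unfolding riem_def
  by (simp add: sym[OF x, of v u] sym[OF x, of a u] sym[OF x, of a v]
      fd_G_sym[OF x, of _ v u] fd_G_sym[OF x, of _ a u] fd_G_sym[OF x, of _ a v])

text \<open>The derivative terms give the skew part of the Hessian of \<open>\<phi>\<close>, the
  quadratic terms the trace of a commutator.\<close>

lemma riem_trace:
  assumes x: "x \<in> U"
  shows "(\<Sum>b\<in>Basis. riem G x u v b \<bullet> b) = 0"
proof -
  have "(\<Sum>b\<in>Basis. riem G x u v b \<bullet> b)
    = (\<Sum>b\<in>Basis. (cm (fd G x u) v *v b) \<bullet> b) - (\<Sum>b\<in>Basis. (cm (fd G x v) u *v b) \<bullet> b)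
      + (\<Sum>b\<in>Basis. (cm (G x) u *v (cm (G x) v *v b)) \<bullet> b) - (\<Sum>b\<in>Basis. (cm (G x) v *v (cm (G x) u *v b)) \<bullet> b)"
    unfolding riem_def by (simp add: inner_simps sum.distrib sum_subtractf)
  then show ?thesis
    using fd_commute[OF U x sm\<phi>, of u v] trace_commute[OF linear_cm(1)[of "G x" u] linear_cm(1)[of "G x" v]]
    by (simp add: trace_fd[OF x])
qed

text \<open>In the trace, the two terms that compose \<open>cm (G x) u\<close> with
  \<open>fd v x\<close> cancel as the trace of a commutator; the other three add up to the
  derivative of the divergence. This is how the divergence enters the conformal factor.\<close>

lemma lie_conn_trace:
  assumes x: "x \<in> U" and v: "smooth_on v U"
  shows "(\<Sum>b\<in>Basis. lie_conn v G x u b \<bullet> b) = fd (divg v) x u"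
proof -
  have dv: "v differentiable at x" by (rule smooth_on_differentiable[OF v x])
  have d2: "((\<lambda>y. fd v y b) has_derivative fd (\<lambda>y. fd v y b) x) (at x)" for b
    by (rule smooth_on_has_derivative[OF smooth_on_fd[OF v] x])
  have d\<phi>: "((\<lambda>y. fd \<phi> y (v y)) has_derivative (\<lambda>r. fd (\<lambda>y. fd \<phi> y (v x)) x r + fd \<phi> x (fd v x r))) (at x)"
    by (rule has_derivative_linear_family[OF U x])
       (auto intro: linear_fd smooth_on_differentiable[OF sm\<phi>] smooth_on_differentiable[OF smooth_on_fd[OF sm\<phi>] x]
          has_derivative_fd[OF dv])
  have "((\<lambda>y. \<Sum>b\<in>Basis. fd v y b \<bullet> b) has_derivative (\<lambda>r. \<Sum>b\<in>Basis. fd (\<lambda>y. fd v y b) x r \<bullet> b)) (at x)"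
    by (intro has_derivative_sum has_derivative_inner_left d2)
  then have "fd (divg v) x u = (\<Sum>b\<in>Basis. fd (\<lambda>y. fd v y b) x u \<bullet> b)
      + (fd (\<lambda>y. fd \<phi> y (v x)) x u + fd \<phi> x (fd v x u))"
    unfolding divg_def[abs_def] using fd_eq[OF has_derivative_add[OF _ d\<phi>]] by simp
  moreover have "(\<Sum>b\<in>Basis. lie_conn v G x u b \<bullet> b)
    = (\<Sum>b\<in>Basis. (cm (fd G x (v x)) u *v b) \<bullet> b) - (\<Sum>b\<in>Basis. fd v x (cm (G x) u *v b) \<bullet> b)
      + (\<Sum>b\<in>Basis. (cm (G x) (fd v x u) *v b) \<bullet> b) + (\<Sum>b\<in>Basis. (cm (G x) u *v (fd v x b)) \<bullet> b)
      + (\<Sum>b\<in>Basis. fd (\<lambda>y. fd v y b) x u \<bullet> b)"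
    unfolding lie_conn_def by (simp add: inner_simps sum.distrib sum_subtractf)
  ultimately show ?thesis
    using trace_commute[OF linear_cm(1)[of "G x" u] linear_fd[OF dv]] fd_commute[OF U x sm\<phi>, of u "v x"]
    by (simp add: trace_fd[OF x] trace[OF x])
qed

text \<open>The Ricci identity for the equation of \<open>w\<close>: differentiate the equation once
  more and antisymmetrise in the two directions, so that the second derivatives of \<open>w\<close>
  cancel and the curvature remains.\<close>

lemma curvature_instance:
  assumes x: "x \<in> U" and w: "smooth_on w U" and \<nu>: "smooth_on \<nu> U"
    and skew: "\<And>y. y \<in> U \<Longrightarrow> transpose (w y) = - w y"
    and nw: "\<And>y u p q. y \<in> U \<Longrightarrow> nabla_w G w y u p q = (\<nu> y \<bullet> q) * (p \<bullet> u) - (\<nu> y \<bullet> p) * (q \<bullet> u)"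
  shows "projective_curvature (riem G x) (rho x) (\<lambda>p. p v* w x) (\<lambda>u p. p \<bullet> (fd \<nu> x u + cm (G x) u *v \<nu> x))"
proof (rule projective_curvature.intro)
  show skw: "(p v* w x) \<bullet> q = - ((q v* w x) \<bullet> p)" for p q
    by (rule skew_vm[OF skew[OF x]])
  show "DIM(real^'n) \<ge> 2" using dim by simp
  show "linear (\<lambda>u. riem G x u v a)" for v a by (rule riem_linear[OF x])
  show "linear (\<lambda>v. riem G x u v a)" for u a by (rule riem_linear[OF x])
  show "linear (riem G x u v)" for u v by (rule riem_linear[OF x])
  show "riem G x u v a = - riem G x v u a" for u v a by (rule riem_skew)
  show "riem G x u v a + riem G x v a u + riem G x a u v = 0" for u v a by (rule riem_bianchi[OF x])
  show "(\<Sum>b\<in>Basis. riem G x u v b \<bullet> b) = 0" for u v by (rule riem_trace[OF x])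
  have "linear (\<lambda>u. rho x u v) \<and> linear (rho x u)" for u v
    unfolding rho_def using riem_linear[OF x, unfolded linear_iff]
    by (auto simp: linear_iff inner_simps sum.distrib sum_distrib_left algebra_simps add_divide_distrib)
  then show "linear (\<lambda>u. rho x u v)" "linear (rho x v)" for v by blast+
  show "(\<Sum>b\<in>Basis. riem G x b u a \<bullet> b) = (real DIM(real^'n) - 1) * rho x u a" for u a
    using dim by (simp add: rho_def)
  show "linear (\<lambda>p. p v* w x)" by (simp add: linear_iff vm_simps)
  have l\<nu>: "linear (fd \<nu> x)" by (rule linear_fd[OF smooth_on_differentiable[OF \<nu> x]])
  show "linear (\<lambda>u. p \<bullet> (fd \<nu> x u + cm (G x) u *v \<nu> x))" "linear (\<lambda>q. q \<bullet> (fd \<nu> x p + cm (G x) p *v \<nu> x))" for p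
    by (simp_all add: linear_iff linear_add[OF l\<nu>] linear_scale[OF l\<nu>] cm_simps mv_simps inner_simps algebra_simps)
  have D: "p \<bullet> (fd (\<lambda>y. fd w y v) x u *v q)
      + (q \<bullet> (cm (fd G x u) v *v (p v* w x)) + q \<bullet> (cm (G x) v *v (p v* fd w x u)))
      - (p \<bullet> (cm (fd G x u) v *v (q v* w x)) + p \<bullet> (cm (G x) v *v (q v* fd w x u)))
      - ((fd \<nu> x u \<bullet> q) * (p \<bullet> v) - (fd \<nu> x u \<bullet> p) * (q \<bullet> v)) = 0" for u v p q
  proof -
    define F where "F y = nabla_w G w y v p q - ((\<nu> y \<bullet> q) * (p \<bullet> v) - (\<nu> y \<bullet> p) * (q \<bullet> v))" for y
    have hw: "(w has_derivative fd w x) (at x)" and hG: "(G has_derivative fd G x) (at x)"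
      and h\<nu>: "(\<nu> has_derivative fd \<nu> x) (at x)"
      and hw2: "((\<lambda>y. fd w y v) has_derivative fd (\<lambda>y. fd w y v) x) (at x)"
      using smooth_on_has_derivative[OF w x] smooth_on_has_derivative[OF smG x]
        smooth_on_has_derivative[OF \<nu> x] smooth_on_has_derivative[OF smooth_on_fd[OF w] x] by blast+
    have 1: "((\<lambda>y. cm (G y) v *v (a v* w y)) has_derivative
        (\<lambda>r. cm (G x) v *v (a v* fd w x r) + cm (fd G x r) v *v (a v* w x))) (at x)" for a
      by (rule bounded_bilinear.FDERIV[OF bounded_bilinear_mv
            bounded_linear.has_derivative[OF bounded_bilinear.bounded_linear_left[OF bounded_bilinear_cm] hG]
            bounded_linear.has_derivative[OF bounded_bilinear.bounded_linear_right[OF bounded_bilinear_vm] hw]])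
    have 2: "((\<lambda>y. fd w y v *v q) has_derivative (\<lambda>r. fd (\<lambda>y. fd w y v) x r *v q)) (at x)"
      by (rule bounded_linear.has_derivative[OF bounded_bilinear.bounded_linear_left[OF bounded_bilinear_mv] hw2])
    have hF: "(F has_derivative (\<lambda>u. p \<bullet> (fd (\<lambda>y. fd w y v) x u *v q)
      + (q \<bullet> (cm (G x) v *v (p v* fd w x u) + cm (fd G x u) v *v (p v* w x)))
      - (p \<bullet> (cm (G x) v *v (q v* fd w x u) + cm (fd G x u) v *v (q v* w x)))
      - ((fd \<nu> x u \<bullet> q) * (p \<bullet> v) - (fd \<nu> x u \<bullet> p) * (q \<bullet> v)))) (at x)"
      unfolding F_def nabla_w_def
      by (intro has_derivative_add has_derivative_diff has_derivative_inner_right has_derivative_mult_left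
          has_derivative_inner_left 1 2 h\<nu>)
    have "fd F x = fd (\<lambda>y. 0) x"
      by (rule fd_cong[OF U x]) (simp add: F_def nw)
    then have "fd F x u = 0" by simp
    then have "p \<bullet> (fd (\<lambda>y. fd w y v) x u *v q)
      + (q \<bullet> (cm (G x) v *v (p v* fd w x u) + cm (fd G x u) v *v (p v* w x)))
      - (p \<bullet> (cm (G x) v *v (q v* fd w x u) + cm (fd G x u) v *v (q v* w x)))
      - ((fd \<nu> x u \<bullet> q) * (p \<bullet> v) - (fd \<nu> x u \<bullet> p) * (q \<bullet> v)) = 0"
      unfolding fd_eq[OF hF] .
    then show ?thesis by (simp add: inner_add_right algebra_simps)
  qed
  have nw1: "q \<bullet> (cm (G x) v *v (p v* fd w x u)) =
      (q \<bullet> (cm (G x) v *v \<nu> x)) * (p \<bullet> u) - (\<nu> x \<bullet> p) * (q \<bullet> (cm (G x) v *v u))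
      - q \<bullet> (cm (G x) v *v (cm (G x) u *v (p v* w x))) + p \<bullet> (cm (G x) u *v ((q v* cm (G x) v) v* w x))" for u v p q
  proof -
    have "q \<bullet> (cm (G x) v *v (p v* fd w x u)) = p \<bullet> (fd w x u *v (q v* cm (G x) v))"
      by (metis dot_lmul_matrix inner_commute)
    moreover have "z \<bullet> (q v* cm (G x) v) = q \<bullet> (cm (G x) v *v z)" for z
      by (metis dot_lmul_matrix inner_commute)
    ultimately show ?thesis using nw[OF x, of u p "q v* cm (G x) v"] unfolding nabla_w_def
      by (simp add: dot_lmul_matrix)
  qed
  have ww: "p \<bullet> (cm (G x) u *v ((q v* cm (G x) v) v* w x)) = - (q \<bullet> (cm (G x) v *v ((p v* cm (G x) u) v* w x)))" for u v p q
    using skw[of "q v* cm (G x) v" "p v* cm (G x) u"]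
    unfolding dot_lmul_matrix[of p, symmetric] dot_lmul_matrix[of q, symmetric]
    by (simp only: inner_commute[of "p v* cm (G x) u"] inner_commute[of "q v* cm (G x) v"])
  show "riem G x u v (p v* w x) \<bullet> q - riem G x u v (q v* w x) \<bullet> p =
      q \<bullet> (fd \<nu> x u + cm (G x) u *v \<nu> x) * (p \<bullet> v) - p \<bullet> (fd \<nu> x u + cm (G x) u *v \<nu> x) * (q \<bullet> v)
      - q \<bullet> (fd \<nu> x v + cm (G x) v *v \<nu> x) * (p \<bullet> u) + p \<bullet> (fd \<nu> x v + cm (G x) v *v \<nu> x) * (q \<bullet> u)" for u v p q
  proof -
    note e = sym[OF x, of v u]
    note n = nw1[of q v p u] nw1[of q u p v] nw1[of p v q u] nw1[of p u q v]
    note n' = n[unfolded e]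
    have d: "D' \<bullet> q = q \<bullet> D'" for D' :: "real^'n" and q by (rule inner_commute)
    \<comment> \<open>Antisymmetrise \<open>D\<close> in \<open>u\<close> and \<open>v\<close>. The
      instances of \<open>nw1\<close> remove the first derivatives of \<open>w\<close>, and those of
      \<open>ww\<close> remove the terms with a Christoffel symbol on each side of
      \<open>w\<close>.\<close>
    show ?thesis
      using D[of p u v q] D[of p v u q] n' ww[of p u q v] ww[of p v q u] ww[of q u p v] ww[of q v p u]
      unfolding fd_commute[OF U x w, of v u] d[of "fd \<nu> x _"] d[of "cm (G x) _ *v _"] d[of "cm (fd G x _) _ *v _"]
        riem_def inner_add_right inner_diff_right inner_add_left inner_diff_left distrib_right
      by linarith
  qed
qed

end

section \<open>Conformal Killing fields along the fibres of the cotangent bundle\<close>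

text \<open>Along the segment from \<open>q\<close> to \<open>p\<close> the component of
  \<open>f\<close> in direction \<open>p - q\<close> has zero derivative. Comparing
  \<open>p\<close>, \<open>q\<close> and 0 then makes \<open>(f p - f 0) \<bullet> q\<close> skew in
  \<open>p\<close> and \<open>q\<close>; being linear in \<open>q\<close>, it is linear in
  \<open>p\<close> as well.\<close>

lemma skew_derivative_affine:
  fixes f :: "'e::euclidean_space \<Rightarrow> 'e"
  assumes f: "\<And>p. (f has_derivative f' p) (at p)" and skew: "\<And>p q. f' p q \<bullet> q = 0"
  shows "linear (\<lambda>p. f p - f 0)" and "(f p - f 0) \<bullet> q = - ((f q - f 0) \<bullet> p)"
proof -
  have orth: "(f p - f q) \<bullet> (p - q) = 0" for p q
  proof -
    define h where "h t = f (q + t *\<^sub>R (p - q)) \<bullet> (p - q)" for t :: real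
    have "(h has_derivative (\<lambda>r. 0)) (at t)" for t
    proof -
      have "((\<lambda>t. q + t *\<^sub>R (p - q)) has_derivative (\<lambda>r. r *\<^sub>R (p - q))) (at t)"
        by (auto intro!: derivative_eq_intros)
      from has_derivative_inner_left[OF has_derivative_compose[OF this f], of "p - q"]
      have "(h has_derivative (\<lambda>r. f' (q + t *\<^sub>R (p - q)) (r *\<^sub>R (p - q)) \<bullet> (p - q))) (at t)"
        unfolding h_def .
      moreover have "f' (q + t *\<^sub>R (p - q)) (r *\<^sub>R (p - q)) \<bullet> (p - q) = 0" for r
        using skew by (simp add: linear_scale[OF has_derivative_linear[OF f]])
      ultimately show ?thesis by simp
    qed
    then have "h 1 = h 0"
      using has_derivative_zero_unique[of UNIV h 1 0] by auto
    then show ?thesis by (simp add: h_def inner_diff_left)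
  qed
  have self: "(f p - f 0) \<bullet> p = 0" for p using orth[of p 0] by simp
  show sk: "(f p - f 0) \<bullet> q = - ((f q - f 0) \<bullet> p)" for p q
    using orth[of p q] self[of p] self[of q] by (simp add: inner_simps)
  show "linear (\<lambda>p. f p - f 0)"
  proof (rule linearI; rule vector_eq_rdot[THEN iffD1]; rule allI)
    fix a b z :: 'e and c :: real
    show "(f (a + b) - f 0) \<bullet> z = (f a - f 0 + (f b - f 0)) \<bullet> z"
      using sk[of "a + b" z] sk[of a z] sk[of b z] by (simp add: inner_add_left inner_add_right)
    show "(f (c *\<^sub>R a) - f 0) \<bullet> z = (c *\<^sub>R (f a - f 0)) \<bullet> z"
      using sk[of "c *\<^sub>R a" z] sk[of a z] by (simp del: inner_diff_left)
  qed
qed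

lemma vm_nth: "(p v* M) $ B = (\<Sum>A\<in>UNIV. p $ A * M $ A $ B)" for M :: "real^'n^'m"
  by (simp add: vector_matrix_mult_def mult.commute)

lemma vm_axis: "(axis A 1 v* M) $ B = M $ A $ B" for M :: "real^'n^'m"
  by (simp add: vm_nth axis_def if_distrib[of "\<lambda>x. x * _"] cong: if_cong)

lemma linear_axis_expand:
  fixes f :: "real^'n \<Rightarrow> 'b::real_vector"
  assumes "linear f"
  shows "f p = (\<Sum>A\<in>UNIV. p $ A *\<^sub>R f (axis A 1))"
  using linear_euclidean_expand[OF assms, of p] by (simp add: sum_Basis_axis inner_axis)

definition fibre_v :: "((real^'n) \<times> (real^'n) \<Rightarrow> (real^'n) \<times> (real^'n)) \<Rightarrow> real^'n::finite \<Rightarrow> real^'n" where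
  "fibre_v Y x = fst (Y (x, 0))"

definition fibre_w :: "((real^'n) \<times> (real^'n) \<Rightarrow> (real^'n) \<times> (real^'n)) \<Rightarrow> real^'n::finite \<Rightarrow> real^'n^'n" where
  "fibre_w Y x = (\<chi> A. fst (Y (x, axis A 1)) - fst (Y (x, 0)))"

definition fibre_a :: "((real^'n) \<times> (real^'n) \<Rightarrow> (real^'n) \<times> (real^'n)) \<Rightarrow> real^'n::finite \<Rightarrow> real^'n" where
  "fibre_a Y x = snd (Y (x, 0))"

text \<open>The factor \<open>- 1 / 2\<close> matches the conformal factor
  \<open>s - 2 (\<nu> \<bullet> p)\<close> of \<open>lie_std_field\<close>.\<close>

definition fibre_nu :: "((real^'n) \<times> (real^'n) \<Rightarrow> real) \<Rightarrow> real^'n::finite \<Rightarrow> real^'n" where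
  "fibre_nu l x = (\<chi> A. - (1 / 2) * fd l (x, 0) (0, axis A 1))"

context special_chart
begin

lemma lie_pwf:
  assumes "x \<in> U"
  shows "lie_metric Y (pwf G) (x, p) a b =
    - 2 * (snd (Y (x, p)) \<bullet> (cm (G x) (fst a) *v fst b) + p \<bullet> (cm (fd G x (fst (Y (x, p)))) (fst a) *v fst b))
    + pwf G (x, p) (fd Y (x, p) a) b + pwf G (x, p) a (fd Y (x, p) b)"
  unfolding lie_metric_def fd_pwf[OF dG[OF assms]] by simp

end

locale killing_chart = special_chart U G \<phi>
  for U :: "(real^'n::finite) set" and G \<phi> +
  fixes Y :: "(real^'n) \<times> (real^'n) \<Rightarrow> (real^'n) \<times> (real^'n)" and l :: "(real^'n) \<times> (real^'n) \<Rightarrow> real"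
  assumes smY: "smooth_on Y (U \<times> UNIV)" and sml: "smooth_on l (U \<times> UNIV)"
    and lie: "\<And>x p a b. x \<in> U \<Longrightarrow> lie_metric Y (pwf G) (x, p) a b = l (x, p) * pwf G (x, p) a b"
begin

abbreviation "v \<equiv> fibre_v Y"
abbreviation "w \<equiv> fibre_w Y"
abbreviation "\<alpha> \<equiv> fibre_a Y"
abbreviation "\<nu> \<equiv> fibre_nu l"
abbreviation "l0 \<equiv> (\<lambda>x. l (x, 0))"

lemma open_UU: "open (U \<times> UNIV :: ((real^'n) \<times> (real^'n)) set)"
  using U by (simp add: open_Times)

lemma dY: "x \<in> U \<Longrightarrow> (Y has_derivative fd Y (x, p)) (at (x, p))"
  by (rule smooth_on_has_derivative[OF smY]) simp

lemma smooth_slice: "smooth_on f (U \<times> UNIV) \<Longrightarrow> smooth_on (\<lambda>x. f (x, p :: real^'n)) U"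
  by (rule smooth_on_compose[OF _ _ U open_UU]) (auto intro: smooth_on_Pair[OF U smooth_on_ident smooth_on_const])

lemma has_derivative_base:
  fixes f :: "(real^'n) \<times> (real^'n) \<Rightarrow> 'b::real_normed_vector"
  shows "(f has_derivative f') (at (x, p)) \<Longrightarrow> ((\<lambda>y. f (y, p)) has_derivative (\<lambda>u. f' (u, 0))) (at x)"
  by (rule has_derivative_compose[where f = "\<lambda>y. (y, p)"]) (auto intro!: derivative_eq_intros)

lemma has_derivative_fibre:
  fixes f :: "(real^'n) \<times> (real^'n) \<Rightarrow> 'b::real_normed_vector"
  shows "(f has_derivative f') (at (x, p)) \<Longrightarrow> ((\<lambda>y. f (x, y)) has_derivative (\<lambda>u. f' (0, u))) (at p)"
  by (rule has_derivative_compose[where f = "\<lambda>y. (x, y)"]) (auto intro!: derivative_eq_intros)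

lemma smooth_v: "smooth_on v U"
  unfolding fibre_v_def by (rule smooth_on_fst[OF U smooth_slice[OF smY]])

lemma smooth_a: "smooth_on \<alpha> U"
  unfolding fibre_a_def by (rule smooth_on_snd[OF U smooth_slice[OF smY]])

lemma smooth_w: "smooth_on w U"
  unfolding fibre_w_def
  by (rule smooth_on_vec[OF U]) (simp, intro smooth_on_diff U smooth_on_fst smooth_slice[OF smY])

lemma smooth_l0: "smooth_on l0 U"
  by (rule smooth_slice[OF sml])

lemma smooth_nu: "smooth_on \<nu> U"
  unfolding fibre_nu_def
  by (rule smooth_on_vec[OF U])
     (simp add: smooth_on_minus[OF U smooth_on_divide[OF U smooth_slice[OF smooth_on_fd[OF sml]]]])

lemma vertical_skew: "x \<in> U \<Longrightarrow> fst (fd Y (x, p) (0, q)) \<bullet> q = 0"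
  using lie[of x p "(0, q)" "(0, q)"] lie_pwf[of x Y p "(0, q)" "(0, q)"]
  by (simp add: pwf_def mv_simps cm_simps inner_commute)

lemma fst_Y:
  assumes x: "x \<in> U"
  shows "fst (Y (x, p)) = v x + p v* w x" and skew_w: "transpose (w x) = - w x"
proof -
  have d: "((\<lambda>p. fst (Y (x, p))) has_derivative (\<lambda>q. fst (fd Y (x, p) (0, q)))) (at p)" for p
    by (rule has_derivative_fst[OF has_derivative_fibre[OF dY[OF x]]])
  note aff = skew_derivative_affine[OF d vertical_skew[OF x]]
  have "p v* w x = fst (Y (x, p)) - fst (Y (x, 0))" for p
    using linear_axis_expand[OF aff(1), of p] by (simp add: fibre_w_def vec_eq_iff vm_nth)
  then show "fst (Y (x, p)) = v x + p v* w x" by (simp add: fibre_v_def)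
  show "transpose (w x) = - w x"
    using aff(2)[of "axis _ 1" "axis _ 1"] by (simp add: vec_eq_iff transpose_def fibre_w_def inner_axis)
qed

lemma skew_dw:
  assumes x: "x \<in> U"
  shows "p \<bullet> (fd w x u *v q) = - (q \<bullet> (fd w x u *v p))"
proof -
  have bl: "bounded_linear (\<lambda>M. p \<bullet> (M *v q))" for p q :: "real^'n"
    by (intro bounded_linear_compose[OF bounded_linear_inner_right]
        bounded_bilinear.bounded_linear_left[OF bounded_bilinear_mv])
  have dw: "w differentiable at x" by (rule smooth_on_differentiable[OF smooth_w x])
  have "fd (\<lambda>y. p \<bullet> (w y *v q)) x u = fd (\<lambda>y. - (q \<bullet> (w y *v p))) x u"
  proof (rule fun_cong[OF fd_cong[OF U x]])
    fix y assume y: "y \<in> U"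
    show "p \<bullet> (w y *v q) = - (q \<bullet> (w y *v p))"
      using skew_vm[OF skew_w[OF y], of p q] by (simp add: dot_lmul_matrix)
  qed
  then show ?thesis
    using fd_bounded_linear[OF bl dw] fd_bounded_linear[OF bounded_linear_minus[OF bl] dw] by simp
qed

lemma fst_dY:
  assumes x: "x \<in> U"
  shows "fst (fd Y (x, p) (0, q)) = q v* w x" "fst (fd Y (x, p) (u, 0)) = fd v x u + p v* fd w x u"
proof -
  have 1: "((\<lambda>p. fst (Y (x, p))) has_derivative (\<lambda>q. fst (fd Y (x, p) (0, q)))) (at p)"
    by (rule has_derivative_fst[OF has_derivative_fibre[OF dY[OF x]]])
  have "((\<lambda>p. v x + p v* w x) has_derivative (\<lambda>q. 0 + q v* w x)) (at p)"
    by (intro has_derivative_add has_derivative_const bounded_linear_imp_has_derivative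
        bounded_bilinear.bounded_linear_left[OF bounded_bilinear_vm])
  then have "(\<lambda>q. fst (fd Y (x, p) (0, q))) = (\<lambda>q. 0 + q v* w x)"
    using has_derivative_unique[OF 1] by (simp add: fst_Y[OF x])
  then show "fst (fd Y (x, p) (0, q)) = q v* w x" by (metis add_0)
  have 2: "((\<lambda>y. fst (Y (y, p))) has_derivative (\<lambda>u. fst (fd Y (x, p) (u, 0)))) (at x)"
    by (rule has_derivative_fst[OF has_derivative_base[OF dY[OF x]]])
  have "((\<lambda>y. v y + p v* w y) has_derivative (\<lambda>u. fd v x u + p v* fd w x u)) (at x)"
    by (intro has_derivative_add smooth_on_has_derivative[OF smooth_v x]
        bounded_linear.has_derivative[OF bounded_bilinear.bounded_linear_right[OF bounded_bilinear_vm]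
          smooth_on_has_derivative[OF smooth_w x]])
  then have "((\<lambda>y. fst (Y (y, p))) has_derivative (\<lambda>u. fd v x u + p v* fd w x u)) (at x)"
    by (rule has_derivative_transform_within_open[OF _ U x]) (simp add: fst_Y)
  from has_derivative_unique[OF 2 this]
  show "fst (fd Y (x, p) (u, 0)) = fd v x u + p v* fd w x u" by metis
qed

text \<open>The mixed component of the equation, taken on \<open>(u, 0)\<close> and
  \<open>(0, q)\<close>.\<close>

lemma snd_dY:
  assumes x: "x \<in> U"
  shows "snd (fd Y (x, p) (0, q)) \<bullet> u =
    l (x, p) * (u \<bullet> q) - fd v x u \<bullet> q - p \<bullet> (fd w x u *v q) + 2 * (p \<bullet> (cm (G x) u *v (q v* w x)))"
  using lie[OF x, of p "(u, 0)" "(0, q)"] lie_pwf[OF x, of Y p "(u, 0)" "(0, q)"]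
  by (simp add: pwf_def fst_dY[OF x] mv_simps inner_simps dot_lmul_matrix)
     (simp add: inner_commute)

text \<open>The fibre component of \<open>Y\<close> along \<open>u\<close>, with the terms of the
  normal form that come from \<open>v\<close> and the connection moved to its side. What is left of
  its fibre derivative is the conformal factor and the covariant derivative of \<open>w\<close>, see
  \<open>dh\<close>.\<close>

definition "h x u p = snd (Y (x, p)) \<bullet> u + p \<bullet> fd v x u - p \<bullet> (cm (G x) u *v (p v* w x))"

lemma dh:
  assumes x: "x \<in> U"
  shows "(h x u has_derivative (\<lambda>q. l (x, p) * (u \<bullet> q) - nabla_w G w x u p q)) (at p)"
proof -
  have 1: "((\<lambda>p. snd (Y (x, p)) \<bullet> u) has_derivative (\<lambda>q. snd (fd Y (x, p) (0, q)) \<bullet> u)) (at p)"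
    by (rule has_derivative_inner_left[OF has_derivative_snd[OF has_derivative_fibre[OF dY[OF x]]]])
  have 2: "((\<lambda>p. p \<bullet> fd v x u) has_derivative (\<lambda>q. q \<bullet> fd v x u)) (at p)"
    by (rule has_derivative_inner_left[OF has_derivative_ident])
  have 3: "((\<lambda>p. cm (G x) u *v (p v* w x)) has_derivative (\<lambda>q. cm (G x) u *v (q v* w x))) (at p)"
    by (rule bounded_linear_imp_has_derivative[OF bounded_linear_compose[OF
        bounded_bilinear.bounded_linear_right[OF bounded_bilinear_mv]
        bounded_bilinear.bounded_linear_left[OF bounded_bilinear_vm]]])
  have "(h x u has_derivative (\<lambda>q. snd (fd Y (x, p) (0, q)) \<bullet> u + q \<bullet> fd v x u
      - (p \<bullet> (cm (G x) u *v (q v* w x)) + q \<bullet> (cm (G x) u *v (p v* w x))))) (at p)"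
    unfolding h_def[abs_def]
    by (intro has_derivative_diff has_derivative_add 1 2 has_derivative_inner[OF has_derivative_ident 3])
  then show ?thesis
    by (rule has_derivative_eq_rhs) (simp add: fun_eq_iff snd_dY[OF x] nabla_w_def inner_commute[of "fd v x u"] algebra_simps)
qed

lemma linear_nabla_w: "linear (\<lambda>p. nabla_w G w x u p q)" "linear (\<lambda>q. nabla_w G w x u p q)"
  by (simp_all add: linear_iff nabla_w_def mv_simps vm_simps inner_simps algebra_simps)

lemma nabla_w_skew: "x \<in> U \<Longrightarrow> nabla_w G w x u p q = - nabla_w G w x u q p"
  using skew_dw[of x p u q] by (simp add: nabla_w_def)

lemma smooth_h:
  assumes x: "x \<in> U"
  shows "smooth_on (h x u) UNIV"
proof -
  have sl: "smooth_on (\<lambda>p. f (x, p)) UNIV" if "smooth_on f (U \<times> UNIV)" for f :: "(real^'n) \<times> (real^'n) \<Rightarrow> (real^'n) \<times> (real^'n)"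
    by (rule smooth_on_compose[OF that _ open_UNIV open_UU])
       (use x in \<open>auto intro: smooth_on_Pair[OF open_UNIV smooth_on_const smooth_on_ident]\<close>)
  show ?thesis
    unfolding h_def[abs_def]
    by (intro smooth_on_diff smooth_on_add smooth_on_inner open_UNIV smooth_on_snd sl[OF smY] smooth_on_const
        smooth_on_ident smooth_on_linear[OF bounded_linear_compose[OF
        bounded_bilinear.bounded_linear_right[OF bounded_bilinear_mv]
        bounded_bilinear.bounded_linear_left[OF bounded_bilinear_vm]]])
qed

lemma dl: "x \<in> U \<Longrightarrow> ((\<lambda>p. l (x, p)) has_derivative (\<lambda>q. fd l (x, p) (0, q))) (at p)"
  by (rule has_derivative_fibre[OF smooth_on_has_derivative[OF sml]]) simp

text \<open>The mixed second fibre derivatives of \<open>h x u\<close> agree; as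
  \<open>nabla_w\<close> is skew in its two covectors, its contributions add up instead of
  cancelling. The left side does not contain \<open>p\<close>.\<close>

lemma nabla_w_dl:
  assumes x: "x \<in> U"
  shows "2 * nabla_w G w x u r q = fd l (x, p) (0, r) * (u \<bullet> q) - fd l (x, p) (0, q) * (u \<bullet> r)"
proof -
  have e: "fd (\<lambda>p. fd (h x u) p q) p r = fd l (x, p) (0, r) * (u \<bullet> q) - nabla_w G w x u r q" for q r
  proof -
    have "((\<lambda>p. l (x, p) * (u \<bullet> q) - nabla_w G w x u p q) has_derivative
        (\<lambda>r. fd l (x, p) (0, r) * (u \<bullet> q) - nabla_w G w x u r q)) (at p)"
      by (intro has_derivative_diff has_derivative_mult_left dl[OF x] linear_imp_has_derivative linear_nabla_w)
    moreover have "(\<lambda>p. fd (h x u) p q) = (\<lambda>p. l (x, p) * (u \<bullet> q) - nabla_w G w x u p q)"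
      by (simp add: fd_eq[OF dh[OF x]])
    ultimately show ?thesis using fd_eq by (metis (no_types, lifting))
  qed
  have "fd (\<lambda>p. fd (h x u) p q) p r = fd (\<lambda>p. fd (h x u) p r) p q"
    by (rule fd_commute[OF open_UNIV UNIV_I smooth_h[OF x]])
  then show ?thesis using e nabla_w_skew[OF x, of u r q] by simp
qed

text \<open>The trace of \<open>nabla_w_dl\<close> expresses \<open>(n - 1)\<close> times the fibre
  derivative of \<open>l\<close> by a quantity independent of \<open>p\<close>, so this derivative
  is the same at \<open>p\<close> and at 0.\<close>

lemma dl_const:
  assumes x: "x \<in> U"
  shows "fd l (x, p) (0, r) = - 2 * (\<nu> x \<bullet> r)"
proof -
  have lin: "linear (\<lambda>r. fd l (x, p) (0, r))" for p using dl[OF x] has_derivative_linear by blast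
  have t: "(\<Sum>b\<in>Basis. 2 * nabla_w G w x b r b) = (real CARD('n) - 1) * fd l (x, p) (0, r)" for p
  proof -
    have "(\<Sum>b\<in>Basis. 2 * nabla_w G w x b r b)
        = (\<Sum>b\<in>Basis. fd l (x, p) (0, r) * (b \<bullet> b) - fd l (x, p) (0, b) * (r \<bullet> b))"
      by (simp add: nabla_w_dl[OF x, of _ r _ p] inner_commute)
    also have "\<dots> = real CARD('n) * fd l (x, p) (0, r) - fd l (x, p) (0, r)"
      unfolding sum_subtractf sum_Basis_inner[OF lin] by simp
    finally show ?thesis by (simp add: algebra_simps)
  qed
  have "fd l (x, p) (0, r) = fd l (x, 0) (0, r)"
    using t[of p] t[of 0] dim by simp
  also have "\<dots> = - 2 * (\<nu> x \<bullet> r)"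
    using linear_axis_expand[OF lin[of 0], of r]
    by (simp add: fibre_nu_def inner_vec_def sum_distrib_left mult.commute)
  finally show ?thesis .
qed

lemma nabla_w_nu: "x \<in> U \<Longrightarrow> nabla_w G w x u p q = (\<nu> x \<bullet> q) * (p \<bullet> u) - (\<nu> x \<bullet> p) * (q \<bullet> u)"
  using nabla_w_dl[of x u p q 0] dl_const[of x 0] by (simp add: inner_commute)

lemma l_affine:
  assumes x: "x \<in> U"
  shows "l (x, p) = l0 x - 2 * (\<nu> x \<bullet> p)"
proof -
  have "((\<lambda>p. l (x, p) + 2 * (\<nu> x \<bullet> p)) has_derivative (\<lambda>q. fd l (x, p) (0, q) + 2 * (\<nu> x \<bullet> q))) (at p)" for p
    by (intro has_derivative_add dl[OF x] has_derivative_mult_right has_derivative_inner_right has_derivative_ident)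
  then have "((\<lambda>p. l (x, p) + 2 * (\<nu> x \<bullet> p)) has_derivative (\<lambda>q. 0)) (at p)" for p
    by (simp add: dl_const[OF x])
  then show ?thesis
    using has_derivative_zero_unique[of UNIV "\<lambda>p. l (x, p) + 2 * (\<nu> x \<bullet> p)" p 0] by auto
qed

text \<open>Since \<open>l\<close> is affine on fibres, the fibre derivative of \<open>h\<close> is
  affine and \<open>h\<close> is quadratic. Integrating from the zero section gives the constant
  term \<open>\<alpha>\<close>, the linear coefficient \<open>l0\<close> and the quadratic term
  \<open>- (\<nu> \<bullet> p) (u \<bullet> p)\<close>.\<close>

lemma Y_std:
  assumes x: "x \<in> U"
  shows "Y (x, p) = std_field G v w \<alpha> l0 \<nu> (x, p)"
proof -
  have dv: "v differentiable at x" by (rule smooth_on_differentiable[OF smooth_v x])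
  have "snd (Y (x, p)) \<bullet> u = snd (std_field G v w \<alpha> l0 \<nu> (x, p)) \<bullet> u" for u
  proof -
    define k where "k p = h x u p - (l0 x * (u \<bullet> p) - (\<nu> x \<bullet> p) * (u \<bullet> p))" for p
    have "(k has_derivative (\<lambda>q. (l (x, p) * (u \<bullet> q) - nabla_w G w x u p q)
        - (l0 x * (u \<bullet> q) - ((\<nu> x \<bullet> p) * (u \<bullet> q) + (\<nu> x \<bullet> q) * (u \<bullet> p))))) (at p)" for p
      unfolding k_def
      by (intro has_derivative_diff dh[OF x] has_derivative_mult has_derivative_mult_right
          has_derivative_inner_right has_derivative_ident)
    then have "(k has_derivative (\<lambda>q. 0)) (at p)" for p
      by (rule has_derivative_eq_rhs)
         (auto simp: l_affine[OF x, of p] nabla_w_nu[OF x] inner_commute[of _ u] algebra_simps)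
    then have "k p = k 0" using has_derivative_zero_unique[of UNIV k p 0] by auto
    then have "h x u p = \<alpha> x \<bullet> u + l0 x * (u \<bullet> p) - (\<nu> x \<bullet> p) * (u \<bullet> p)"
      by (simp add: k_def h_def fibre_a_def)
    then show ?thesis
      by (simp add: h_def std_field_def inner_simps dot_lmul_matrix matrix_fd_works[OF dv]
          sym[OF x, of "p v* w x"] inner_commute[of p u])
  qed
  then have "snd (Y (x, p)) = snd (std_field G v w \<alpha> l0 \<nu> (x, p))"
    by (metis vector_eq_rdot)
  then show ?thesis using fst_Y[OF x] by (simp add: std_field_def prod_eq_iff)
qed

lemma base_equations:
  assumes x: "x \<in> U"
  shows "fd \<alpha> x u \<bullet> u' + fd \<alpha> x u' \<bullet> u = 2 * (\<alpha> x \<bullet> (cm (G x) u *v u'))"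
    and "2 *\<^sub>R lie_conn v G x u u' = fd l0 x u *\<^sub>R u' + fd l0 x u' *\<^sub>R u"
    and "p \<bullet> riem G x u (p v* w x) u' + p \<bullet> riem G x u' (p v* w x) u =
      (p \<bullet> u') * (p \<bullet> (fd \<nu> x u + cm (G x) u *v \<nu> x)) + (p \<bullet> u) * (p \<bullet> (fd \<nu> x u' + cm (G x) u' *v \<nu> x))"
proof -
  define A where "A = fd \<alpha> x u \<bullet> u' + fd \<alpha> x u' \<bullet> u - 2 * (\<alpha> x \<bullet> (cm (G x) u *v u'))"
  define B where "B = fd l0 x u *\<^sub>R u' + fd l0 x u' *\<^sub>R u - 2 *\<^sub>R lie_conn v G x u u'"
  define C where "C p = p \<bullet> riem G x u (p v* w x) u' + p \<bullet> riem G x u' (p v* w x) u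
      - (p \<bullet> u') * (p \<bullet> (fd \<nu> x u + cm (G x) u *v \<nu> x))
      - (p \<bullet> u) * (p \<bullet> (fd \<nu> x u' + cm (G x) u' *v \<nu> x))" for p
  have S: "A + p \<bullet> B + C p = 0" for p
  proof -
    have "lie_metric Y (pwf G) (x, p) (u, 0) (u', 0) = lie_metric (std_field G v w \<alpha> l0 \<nu>) (pwf G) (x, p) (u, 0) (u', 0)"
      by (rule lie_metric_cong[OF open_UU]) (use x Y_std in auto)
    also have "\<dots> = (l0 x - 2 * (\<nu> x \<bullet> p)) * pwf G (x, p) (u, 0) (u', 0) + A + p \<bullet> B + C p"
      unfolding A_def B_def C_def
      by (subst lie_std_field[OF U x smG smooth_v smooth_w smooth_a smooth_l0 smooth_nu sym skew_w[OF x] nabla_w_nu[OF x]])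
         (simp_all add: inner_simps)
    finally show ?thesis using lie[OF x, of p "(u, 0)" "(u', 0)"] l_affine[OF x, of p] by simp
  qed
  \<comment> \<open>The quadratic part is even in \<open>p\<close> and the linear part odd, so
    comparing \<open>p\<close> with \<open>- p\<close> separates them once \<open>A\<close> has been
    read off at \<open>p = 0\<close>.\<close>
  have C: "C (- p) = C p" for p
    using linear_neg[OF riem_linear(2)[OF x]] unfolding C_def by (simp add: vm_simps)
  have A: "A = 0" using S[of 0] by (simp add: C_def)
  have B: "p \<bullet> B = 0" for p using S[of p] S[of "- p"] C[of p] by simp
  have C0: "C p = 0" using S[of p] A B[of p] by simp
  show "fd \<alpha> x u \<bullet> u' + fd \<alpha> x u' \<bullet> u = 2 * (\<alpha> x \<bullet> (cm (G x) u *v u'))" using A by (simp add: A_def)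
  show "2 *\<^sub>R lie_conn v G x u u' = fd l0 x u *\<^sub>R u' + fd l0 x u' *\<^sub>R u"
    using B[of B] by (simp add: B_def)
  show "p \<bullet> riem G x u (p v* w x) u' + p \<bullet> riem G x u' (p v* w x) u =
      (p \<bullet> u') * (p \<bullet> (fd \<nu> x u + cm (G x) u *v \<nu> x)) + (p \<bullet> u) * (p \<bullet> (fd \<nu> x u' + cm (G x) u' *v \<nu> x))"
    using C0 by (simp add: C_def)
qed

lemma weyl_condition:
  assumes x: "x \<in> U"
  shows "projective_curvature.T (riem G x) (rho x) (\<lambda>p. p v* w x) p q u u'
       + projective_curvature.T (riem G x) (rho x) (\<lambda>p. p v* w x) q p u u' = 0"
proof -
  interpret C: projective_curvature "riem G x" "rho x" "\<lambda>p. p v* w x" "\<lambda>u p. p \<bullet> (fd \<nu> x u + cm (G x) u *v \<nu> x)"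
    by (rule curvature_instance[OF x smooth_w smooth_nu skew_w nabla_w_nu])
  show ?thesis
  proof (rule C.weyl_of_quadratic)
    fix u u' p :: "real^'n"
    show "riem G x u (p v* w x) u' \<bullet> p + riem G x u' (p v* w x) u \<bullet> p =
      p \<bullet> (fd \<nu> x u + cm (G x) u *v \<nu> x) * (p \<bullet> u') + p \<bullet> (fd \<nu> x u' + cm (G x) u' *v \<nu> x) * (p \<bullet> u)"
      using base_equations(3)[OF x, of p u u'] by (simp only: inner_commute mult.commute)
  qed
qed

text \<open>The trace of the degree 1 equation: the right side contributes \<open>n + 1\<close>, the
  left side the differential of the divergence. This is the origin of the coefficient
  \<open>2 / (n + 1)\<close> in the normal form of \<open>lift_zero\<close>.\<close>

lemma l0_divergence:
  assumes x: "x \<in> U"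
  shows "(real CARD('n) + 1) * fd l0 x u = 2 * fd (divg v) x u"
proof -
  have lin: "linear (fd l0 x)" by (rule linear_fd[OF smooth_on_differentiable[OF smooth_l0 x]])
  have "(\<Sum>b\<in>Basis. (2 *\<^sub>R lie_conn v G x u b) \<bullet> b) = (\<Sum>b\<in>Basis. fd l0 x u * (b \<bullet> b) + fd l0 x b * (u \<bullet> b))"
    by (simp add: base_equations(2)[OF x] inner_simps)
  also have "\<dots> = (real CARD('n) + 1) * fd l0 x u"
    unfolding sum.distrib sum_Basis_inner[OF lin] by (simp add: algebra_simps)
  finally show ?thesis by (simp add: sum_distrib_left[symmetric] lie_conn_trace[OF x smooth_v])
qed

end

section \<open>Extending the Weyl condition from basis vectors by multilinearity\<close>

lemma linear_zero_Basis:
  fixes f :: "'e::euclidean_space \<Rightarrow> 'b::real_vector"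
  assumes "linear f" "\<And>b. b \<in> Basis \<Longrightarrow> f b = 0"
  shows "f x = 0"
  using linear_euclidean_expand[OF assms(1), of x] assms(2) by simp

context projective_curvature
begin

lemma linear_T:
  "linear (\<lambda>p. T p q u v)" "linear (\<lambda>q. T p q u v)" "linear (\<lambda>u. T p q u v)" "linear (\<lambda>v. T p q u v)"
  unfolding T_def linear_iff
  using linW[unfolded linear_iff] linw[unfolded linear_iff] by (auto simp: inner_simps algebra_simps)

lemma T_zero_Basis:
  assumes "\<And>p q u v. p \<in> Basis \<Longrightarrow> q \<in> Basis \<Longrightarrow> u \<in> Basis \<Longrightarrow> v \<in> Basis \<Longrightarrow> T p q u v + T q p u v = 0"
  shows "T p p u v = 0"
proof -
  have "T p q u v + T q p u v = 0" for p q u v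
  proof (rule linear_zero_Basis[of "\<lambda>p. T p q u v + T q p u v"])
    show "linear (\<lambda>p. T p q u v + T q p u v)" for q u v by (intro linear_compose_add linear_T)
    fix p :: 'e assume p: "p \<in> Basis"
    show "T p q u v + T q p u v = 0"
    proof (rule linear_zero_Basis[of "\<lambda>q. T p q u v + T q p u v"])
      show "linear (\<lambda>q. T p q u v + T q p u v)" for u v by (intro linear_compose_add linear_T)
      fix q :: 'e assume q: "q \<in> Basis"
      show "T p q u v + T q p u v = 0"
      proof (rule linear_zero_Basis[of "\<lambda>u. T p q u v + T q p u v"])
        show "linear (\<lambda>u. T p q u v + T q p u v)" for v by (intro linear_compose_add linear_T)
        fix u :: 'e assume u: "u \<in> Basis"
        show "T p q u v + T q p u v = 0"
          by (rule linear_zero_Basis[of "\<lambda>v. T p q u v + T q p u v"]) (intro linear_compose_add linear_T, rule assms[OF p q u])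
      qed
    qed
  qed
  from this[of p p u v] show ?thesis by simp
qed

end

subsection \<open>Conformal Killing lifts in a chart\<close>

lemma lie_conn_zero: "lie_conn (\<lambda>x. 0) G x u a = 0" if "linear (fd G x)"
  by (simp add: lie_conn_def cm_simps mv_simps linear_0[OF that])

lemma matrix_zero_map: "matrix (\<lambda>x::real^'n. 0 :: real^'m) = 0"
  by (simp add: matrix_def vec_eq_iff)

context special_chart
begin

lemma smooth_divg: "smooth_on v U \<Longrightarrow> smooth_on (divg v) U"
  unfolding divg_def[abs_def]
  by (intro smooth_on_add U smooth_on_sum smooth_on_inner smooth_on_fd smooth_on_const
      smooth_on_fd_apply[OF U _ sm\<phi>])

text \<open>Tracing the hypothesis \<open>sy\<close> identifies \<open>(n + 1) \<Upsilon>\<close>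
  with the differential of the divergence. Hence the chosen coefficient of \<open>p\<close> has
  differential \<open>2 \<Upsilon>\<close>, which is what the degree 1 term of
  \<open>lie_std_field\<close> needs in order to vanish.\<close>

lemma lie_std_zero:
  assumes x: "x \<in> U" and v: "smooth_on v U" and sy: "\<And>u a. lie_conn v G x u a = (\<Upsilon> \<bullet> a) *\<^sub>R u + (\<Upsilon> \<bullet> u) *\<^sub>R a"
  shows "\<exists>c. \<forall>a b. lie_metric (std_field G v (\<lambda>x. 0) (\<lambda>x. 0) (\<lambda>x. 2 / (real CARD('n) + 1) * divg v x) (\<lambda>x. 0)) (pwf G) (x, p) a b
    = c * pwf G (x, p) a b"
proof -
  note sd = smooth_divg[OF v]
  have d: "fd (divg v) x u = (real CARD('n) + 1) * (\<Upsilon> \<bullet> u)" for u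
  proof -
    have "fd (divg v) x u = (\<Sum>b\<in>Basis. (\<Upsilon> \<bullet> b) * (u \<bullet> b) + (\<Upsilon> \<bullet> u) * (b \<bullet> b))"
      by (simp add: lie_conn_trace[OF x v, symmetric] sy inner_simps)
    also have "\<dots> = (real CARD('n) + 1) * (\<Upsilon> \<bullet> u)"
      unfolding sum.distrib sum_Basis_inner[OF bounded_linear.linear[OF bounded_linear_inner_right]]
      by (simp add: algebra_simps)
    finally show ?thesis .
  qed
  define s where "s = (\<lambda>x. 2 / (real CARD('n) + 1) * divg v x)"
  have ds: "fd s x u = 2 * (\<Upsilon> \<bullet> u)" for u
  proof -
    have "real CARD('n) + 1 \<noteq> 0" by linarith
    then show ?thesis
      unfolding s_def fd_bounded_linear[OF bounded_linear_mult_right smooth_on_differentiable[OF sd x]] d by simp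
  qed
  have ss: "smooth_on s U"
    unfolding s_def by (intro smooth_on_mult U smooth_on_const sd)
  have "lie_metric (std_field G v (\<lambda>x. 0) (\<lambda>x. 0) s (\<lambda>x. 0)) (pwf G) (x, p) (u, q) (u', q')
    = s x * pwf G (x, p) (u, q) (u', q')" for u q u' q'
    by (subst lie_std_field[OF U x smG v smooth_on_const smooth_on_const ss smooth_on_const sym])
       (simp_all add: ds sy nabla_w_def inner_simps vm_simps mv_simps linear_0[OF riem_linear(2)[OF x]] vec_eq_iff transpose_def algebra_simps)
  then show ?thesis unfolding s_def by (metis prod.collapse)
qed

lemma lie_std_minus:
  assumes x: "x \<in> U" and a: "smooth_on \<alpha> U" and k: "\<And>u u'. fd \<alpha> x u \<bullet> u' + fd \<alpha> x u' \<bullet> u = 2 * (\<alpha> x \<bullet> (cm (G x) u *v u'))"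
  shows "\<exists>c. \<forall>a b. lie_metric (std_field G (\<lambda>x. 0) (\<lambda>x. 0) \<alpha> (\<lambda>x. 0) (\<lambda>x. 0)) (pwf G) (x, p) a b = c * pwf G (x, p) a b"
proof -
  have "lie_metric (std_field G (\<lambda>x. 0) (\<lambda>x. 0) \<alpha> (\<lambda>x. 0) (\<lambda>x. 0)) (pwf G) (x, p) (u, q) (u', q')
    = 0 * pwf G (x, p) (u, q) (u', q')" for u q u' q'
    by (subst lie_std_field[OF U x smG smooth_on_const smooth_on_const a smooth_on_const smooth_on_const sym])
       (simp_all add: k lie_conn_zero[OF linear_dG[OF x]] nabla_w_def vm_simps mv_simps linear_0[OF riem_linear(2)[OF x]] vec_eq_iff transpose_def)
  then show ?thesis by (metis prod.collapse)
qed

lemma lie_std_plus: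
  assumes n: "CARD('n) \<ge> 3" and x: "x \<in> U" and w: "smooth_on w U" and \<nu>: "smooth_on \<nu> U"
    and skew: "\<And>y. y \<in> U \<Longrightarrow> transpose (w y) = - w y"
    and nw: "\<And>y u p q. y \<in> U \<Longrightarrow> nabla_w G w y u p q = (\<nu> y \<bullet> q) * (p \<bullet> u) - (\<nu> y \<bullet> p) * (q \<bullet> u)"
    and T: "\<And>p q u v. p \<in> Basis \<Longrightarrow> q \<in> Basis \<Longrightarrow> u \<in> Basis \<Longrightarrow> v \<in> Basis \<Longrightarrow>
      projective_curvature.T (riem G x) (rho x) (\<lambda>p. p v* w x) p q u v
       + projective_curvature.T (riem G x) (rho x) (\<lambda>p. p v* w x) q p u v = 0"
  shows "\<exists>c. \<forall>a b. lie_metric (std_field G (\<lambda>x. 0) w (\<lambda>x. 0) (\<lambda>x. 0) \<nu>) (pwf G) (x, p) a b = c * pwf G (x, p) a b"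
proof -
  interpret C: projective_curvature "riem G x" "rho x" "\<lambda>p. p v* w x" "\<lambda>u p. p \<bullet> (fd \<nu> x u + cm (G x) u *v \<nu> x)"
    by (rule curvature_instance[OF x w \<nu> skew nw])
  have n3: "DIM(real^'n) \<ge> 3" using n by simp
  have q: "riem G x u (p v* w x) v \<bullet> p + riem G x v (p v* w x) u \<bullet> p =
      p \<bullet> (fd \<nu> x u + cm (G x) u *v \<nu> x) * (p \<bullet> v) + p \<bullet> (fd \<nu> x v + cm (G x) v *v \<nu> x) * (p \<bullet> u)" for u v
    by (rule C.quadratic_of_weyl[OF n3 C.T_zero_Basis[OF T]])
  have "lie_metric (std_field G (\<lambda>x. 0) w (\<lambda>x. 0) (\<lambda>x. 0) \<nu>) (pwf G) (x, p) (u, q) (u', q')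
    = (- 2 * (\<nu> x \<bullet> p)) * pwf G (x, p) (u, q) (u', q')" for u q u' q'
    using q[of u u'] inner_commute[of p "riem G x u (p v* w x) u'"] inner_commute[of p "riem G x u' (p v* w x) u"]
    by (subst lie_std_field[OF U x smG smooth_on_const w smooth_on_const smooth_on_const \<nu> sym skew[OF x] nw[OF x]])
       (simp_all add: lie_conn_zero[OF linear_dG[OF x]] algebra_simps)
  then show ?thesis by (metis prod.collapse)
qed

end

subsection \<open>Translation to index notation\<close>

locale projective_manifold =
  fixes M :: "('i, 'a, 'n::finite) natlas" and P :: "('i, 'n) conn set" and D :: "('i, 'n) conn"
    and \<sigma> :: "'i \<Rightarrow> real^'n \<Rightarrow> real"
  assumes M: "oriented_manifold M" and dim: "CARD('n) \<ge> 2" and P: "projective_structure M P"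
    and DP: "D \<in> P" and special: "special_connection M D" and scale: "parallel_scale M D \<sigma>"
begin

abbreviation "U \<equiv> chart_image M"

lemma atlas: "smooth_atlas M"
  using M by (simp add: oriented_manifold_def smooth_manifold_def)

lemma U: "open (U i)" by (rule open_chart_image[OF atlas])

lemma torsion_free: "D' \<in> P \<Longrightarrow> torsion_free_connection M D'"
  using P unfolding projective_structure_def by blast

lemma smooth_conn: "D' \<in> P \<Longrightarrow> smooth_on (D' i) (U i)"
  using torsion_free unfolding torsion_free_connection_def connection_def smooth_components_def by blast

lemma sym_conn: "D' \<in> P \<Longrightarrow> D' i x $ A $ C $ B = D' i x $ B $ C $ A"
  using torsion_free unfolding torsion_free_connection_def by blast

lemmas smD = smooth_conn[OF DP]

lemma smooth_\<sigma>: "smooth_on (\<sigma> i) (U i)"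
  using scale unfolding parallel_scale_def density_def smooth_components_def by blast

lemma \<sigma>_pos: "x \<in> U i \<Longrightarrow> \<sigma> i x > 0"
  using scale unfolding parallel_scale_def by blast

text \<open>The logarithm of \<open>\<sigma>\<close> to the power \<open>- (n + 1)\<close>, which is
  the parallel volume density determined by the scale.\<close>

definition phi :: "'i \<Rightarrow> real^'n \<Rightarrow> real" where
  "phi i x = - (real CARD('n) + 1) * ln (\<sigma> i x)"

lemma fd_\<sigma>: "x \<in> U i \<Longrightarrow> fd (\<sigma> i) x u = - (\<Sum>A\<in>UNIV. u $ A * (\<Sum>C\<in>UNIV. D i x $ A $ C $ C)) * \<sigma> i x / (real CARD('n) + 1)"
proof -
  assume x: "x \<in> U i"
  have "nabla_density 1 D i (\<sigma> i) x = 0" using scale x unfolding parallel_scale_def by blast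
  then have pd: "pd A (\<sigma> i) x = - (\<Sum>C\<in>UNIV. D i x $ A $ C $ C) * \<sigma> i x / (real CARD('n) + 1)" for A
    by (simp add: nabla_density_def vec_eq_iff eq_neg_iff_add_eq_0)
  have "fd (\<sigma> i) x u = (\<Sum>A\<in>UNIV. u $ A *\<^sub>R pd A (\<sigma> i) x)"
    unfolding pd_def by (rule linear_axis_expand[OF linear_fd[OF smooth_on_differentiable[OF smooth_\<sigma> x]]])
  also have "\<dots> = (\<Sum>A\<in>UNIV. u $ A * (\<Sum>C\<in>UNIV. D i x $ A $ C $ C)) * (- \<sigma> i x / (real CARD('n) + 1))"
    unfolding pd sum_distrib_right[of _ UNIV "- \<sigma> i x / (real CARD('n) + 1)"]
    by (simp add: mult.assoc)
  finally show ?thesis by simp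
qed

lemma cm_trace: "(\<Sum>b\<in>Basis. (cm N u *v b) \<bullet> b) = (\<Sum>A\<in>UNIV. u $ A * (\<Sum>C\<in>UNIV. N $ A $ C $ C))" for u :: "real^'n"
proof -
  have "(\<Sum>b\<in>Basis. (cm N u *v b) \<bullet> b) = (\<Sum>C\<in>UNIV. cm N u $ C $ C)"
    by (simp add: sum_Basis_axis inner_axis mv_axis)
  also have "\<dots> = (\<Sum>A\<in>UNIV. \<Sum>C\<in>UNIV. u $ A * N $ A $ C $ C)"
    unfolding cm_nth by (rule sum.swap)
  finally show ?thesis by (simp add: sum_distrib_left)
qed

lemma fd_phi: "x \<in> U i \<Longrightarrow> fd (phi i) x u = - (real CARD('n) + 1) * (fd (\<sigma> i) x u / \<sigma> i x)"
proof -
  assume x: "x \<in> U i"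
  have "((\<lambda>y. - (real CARD('n) + 1) * ln (\<sigma> i y)) has_derivative
      (\<lambda>u. - (real CARD('n) + 1) * (fd (\<sigma> i) x u / \<sigma> i x))) (at x)"
    using \<sigma>_pos[OF x] smooth_on_has_derivative[OF smooth_\<sigma> x]
    by (intro has_derivative_mult_right) (auto intro!: derivative_eq_intros simp: divide_inverse)
  then show ?thesis unfolding phi_def[abs_def] by (simp add: fd_eq)
qed

lemma chart: "special_chart (U i) (D i) (phi i)"
proof
  show "open (U i)" by (rule U)
  show "smooth_on (D i) (U i)" by (rule smD)
  show "smooth_on (phi i) (U i)" unfolding phi_def[abs_def]
    by (intro smooth_on_mult U smooth_on_const smooth_on_ln_compose smooth_\<sigma> \<sigma>_pos)
  show "cm (D i x) u *v v = cm (D i x) v *v u" for x u v by (rule cm_sym) (rule sym_conn[OF DP])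
  show "2 \<le> CARD('n)" by (rule dim)
  fix x u assume x: "x \<in> U i"
  show "(\<Sum>b\<in>Basis. (cm (D i x) u *v b) \<bullet> b) = fd (phi i) x u"
  proof -
    have N: "real CARD('n) + 1 \<noteq> 0" by linarith
    have "- N * (- X * t / N / t) = X" if "t \<noteq> 0" "N \<noteq> 0" for N X t :: real
      using that by simp
    then show ?thesis
      unfolding cm_trace fd_phi[OF x] fd_\<sigma>[OF x] using N less_imp_neq[OF \<sigma>_pos[OF x], symmetric] by presburger
  qed
qed

sublocale chart: special_chart "U i" "D i" "phi i" for i by (rule chart)

lemma pd_conn:
  assumes x: "x \<in> U i"
  shows "pd A (\<lambda>y. D i y $ B $ C $ E) x = fd (D i) x (axis A 1) $ B $ C $ E"
  unfolding pd_def
  by (rule fd_bounded_linear[OF bounded_linear_compose[OF bounded_linear_vec_nth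
        bounded_linear_compose[OF bounded_linear_vec_nth bounded_linear_vec_nth]] chart.dG[OF x]])

lemma curv_riem:
  assumes x: "x \<in> U i"
  shows "curv D i x A B C E = riem (D i) x (axis A 1) (axis B 1) (axis E 1) $ C"
  unfolding curv_def pd_conn[OF x] riem_def
  by (simp add: cm_axis mv_axis matrix_vector_mult_def[of "D i x $ _" "D i x $ _ *v _"] sum_subtractf)

lemma schouten_rho: "x \<in> U i \<Longrightarrow> schouten D i x A B = chart.rho i x (axis A 1) (axis B 1)"
  by (simp add: schouten_def chart.rho_def curv_riem sum_Basis_axis inner_axis)

lemma nabla_vec_nth:
  "nabla_vec D' i v x $ A $ B = (fd v x (axis A 1) + cm (D' i x) (axis A 1) *v v x) $ B"
  by (simp add: nabla_vec_def pd_def cm_axis matrix_vector_mult_def)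

lemma nabla_biv_nth:
  assumes "transpose (w x) = - w x"
  shows "nabla_biv 0 D i w x $ C $ A $ B = nabla_w (D i) w x (axis C 1) (axis A 1) (axis B 1)"
proof -
  have sk: "w x $ E $ B = - w x $ B $ E" for E B
    using assms by (metis (mono_tags) transpose_def vec_lambda_beta vector_uminus_component minus_minus)
  have "(cm (D i x) (axis C 1) *v (axis A 1 v* w x)) $ B = (\<Sum>E\<in>UNIV. D i x $ C $ B $ E * w x $ A $ E)" for A B
    by (simp add: cm_axis matrix_vector_mult_def vm_axis)
  then show ?thesis
    by (simp add: nabla_biv_def nabla_w_def pd_def inner_axis' inner_axis mv_axis sk[of _ B] sum_negf)
qed

lemma nabla_form_nth:
  "nabla_form 0 D i \<alpha> x $ A $ B = fd \<alpha> x (axis A 1) $ B - \<alpha> x \<bullet> (cm (D i x) (axis A 1) *v axis B 1)"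
  by (simp add: nabla_form_def pd_def cm_axis inner_vec_def mv_axis mult.commute)

text \<open>The derivative of the power of the parallel scale reproduces exactly the density term of
  the weighted covariant derivative, so covariant differentiation commutes with
  trivialisation.\<close>

lemma pd_trivialize:
  assumes x: "x \<in> U i" and T: "smooth_on (T i) (U i)"
  shows "pd C (trivialize \<sigma> k T i) x = \<sigma> i x powr (- k) *\<^sub>R
    (pd C (T i) x + (k / (real CARD('n) + 1) * (\<Sum>E\<in>UNIV. D i x $ C $ E $ E)) *\<^sub>R T i x)"
proof -
  have s: "((\<lambda>y. \<sigma> i y powr (- k)) has_derivative (\<lambda>u. - k * \<sigma> i x powr (- k) * fd (\<sigma> i) x u / \<sigma> i x)) (at x)"
    using \<sigma>_pos[OF x] smooth_on_has_derivative[OF smooth_\<sigma> x]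
    by (auto intro!: derivative_eq_intros simp: powr_diff field_simps powr_minus)
  have c: "fd (\<sigma> i) x (axis C 1) = - (\<Sum>E\<in>UNIV. D i x $ C $ E $ E) * \<sigma> i x / (real CARD('n) + 1)"
    unfolding fd_\<sigma>[OF x] by (simp add: axis_def if_distrib[of "\<lambda>x. x * _"] cong: if_cong)
  have "pd C (trivialize \<sigma> k T i) x = (\<sigma> i x powr (- k)) *\<^sub>R pd C (T i) x
      + (- k * \<sigma> i x powr (- k) * fd (\<sigma> i) x (axis C 1) / \<sigma> i x) *\<^sub>R T i x"
    unfolding pd_def trivialize_def
    by (subst fd_eq[OF has_derivative_scaleR[OF s smooth_on_has_derivative[OF T x]]]) simp
  moreover have "- k * S * (- X * t / N) / t = S * (k / N * X)" if "t \<noteq> 0" for S X t N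
    using that by simp
  ultimately show ?thesis
    using \<sigma>_pos[OF x] unfolding c by (simp add: scaleR_add_right)
qed

lemma nabla_biv_trivialize:
  assumes x: "x \<in> U i" and w: "smooth_on (w i) (U i)"
  shows "nabla_biv 0 D i (trivialize \<sigma> (-2) w i) x = (\<sigma> i x)\<^sup>2 *\<^sub>R nabla_biv (-2) D i (w i) x"
proof -
  have "\<sigma> i x powr 2 = (\<sigma> i x)\<^sup>2" using \<sigma>_pos[OF x] by simp
  then show ?thesis
    unfolding nabla_biv_def vec_eq_iff
    by (simp add: pd_trivialize[OF x, of w, OF w] trivialize_def algebra_simps sum_distrib_left)
qed

lemma nabla_form_trivialize:
  assumes x: "x \<in> U i" and a: "smooth_on (\<alpha> i) (U i)"
  shows "nabla_form 0 D i (trivialize \<sigma> 2 \<alpha> i) x = (\<sigma> i x powr (-2)) *\<^sub>R nabla_form 2 D i (\<alpha> i) x"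
  unfolding nabla_form_def vec_eq_iff
  by (simp add: pd_trivialize[OF x, of \<alpha>, OF a] trivialize_def algebra_simps sum_distrib_left)

end

section \<open>Jacobians, weights and their cocycle identities\<close>

context projective_manifold
begin

lemma overlapE:
  assumes "x \<in> overlap M i j"
  obtains m where "m \<in> fst (M i)" "m \<in> fst (M j)" "x = snd (M i) m" "transition M i j x = snd (M j) m"
  using assms transition_apply[OF atlas] by (auto simp: overlap_def)

lemma dtrans_jacobian: "x \<in> overlap M i j \<Longrightarrow> dtrans M i j x u = jacobian M i j x *v u"
  unfolding jacobian_def by (simp add: matrix_works linear_dtrans[OF atlas])

lemma jacobian_matrix: "jacobian M i j x = matrix (fd (transition M i j) x)"
  by (simp add: jacobian_def dtrans_def)

lemma det_pos: "x \<in> overlap M i j \<Longrightarrow> det (jacobian M i j x) > 0"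
  using M unfolding oriented_manifold_def by blast

lemma in_overlap: "m \<in> fst (M i) \<Longrightarrow> m \<in> fst (M j) \<Longrightarrow> snd (M i) m \<in> overlap M i j"
  by (simp add: overlap_def)

text \<open>The chain rule, applied on the open set \<open>W\<close> where the change from
  \<open>i\<close> to \<open>j\<close> can be followed by the one from \<open>j\<close> to
  \<open>k\<close>; injectivity of the chart \<open>j\<close> identifies the intermediate
  points.\<close>

lemma jacobian_cocycle:
  assumes m: "m \<in> fst (M i)" "m \<in> fst (M j)" "m \<in> fst (M k)"
  shows "jacobian M i k (snd (M i) m) = jacobian M j k (snd (M j) m) ** jacobian M i j (snd (M i) m)"
proof -
  let ?x = "snd (M i) m"
  define W where "W = overlap M i j \<inter> transition M i j -` overlap M j k"
  have W: "open W"
    unfolding W_def by (rule continuous_open_preimage[OF smooth_on_continuous_on[OF smooth_transition[OF atlas]]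
          open_overlap[OF atlas] open_overlap[OF atlas]])
  have xW: "?x \<in> W"
    using m by (simp add: W_def in_overlap transition_apply[OF atlas])
  have e: "transition M i k y = transition M j k (transition M i j y)" if y: "y \<in> W" for y
  proof -
    obtain m' where m': "m' \<in> fst (M i)" "m' \<in> fst (M j)" "y = snd (M i) m'" "transition M i j y = snd (M j) m'"
      using y overlapE unfolding W_def by blast
    obtain m'' where m'': "m'' \<in> fst (M j)" "m'' \<in> fst (M k)" "transition M i j y = snd (M j) m''"
      using y unfolding W_def by (auto simp: overlap_def)
    have "m'' = m'" using m' m'' atlas unfolding smooth_atlas_def by (metis inj_onD)
    then show ?thesis using m' m'' transition_apply[OF atlas] by metis
  qed
  have d1: "(transition M i j has_derivative fd (transition M i j) ?x) (at ?x)"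
    by (rule smooth_on_has_derivative[OF smooth_transition[OF atlas] in_overlap[OF m(1,2)]])
  have d2: "(transition M j k has_derivative fd (transition M j k) (snd (M j) m)) (at (transition M i j ?x))"
    unfolding transition_apply[OF atlas m(1)]
    by (rule smooth_on_has_derivative[OF smooth_transition[OF atlas] in_overlap[OF m(2,3)]])
  have "fd (transition M i k) ?x = fd (\<lambda>y. transition M j k (transition M i j y)) ?x"
    by (rule fd_cong[OF W xW e])
  also have "\<dots> = (\<lambda>u. fd (transition M j k) (snd (M j) m) (fd (transition M i j) ?x u))"
    by (rule fd_eq[OF has_derivative_compose[OF d1 d2]])
  finally have "jacobian M i k ?x = matrix (fd (transition M j k) (snd (M j) m) \<circ> fd (transition M i j) ?x)"
    by (simp add: jacobian_matrix o_def)
  also have "\<dots> = jacobian M j k (snd (M j) m) ** jacobian M i j ?x"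
    unfolding jacobian_matrix
    by (rule matrix_compose[OF has_derivative_linear[OF d1] has_derivative_linear[OF d2, unfolded transition_apply[OF atlas m(1)]]])
  finally show ?thesis .
qed

lemma jacobian_self:
  assumes "m \<in> fst (M i)"
  shows "jacobian M i i (snd (M i) m) = mat 1"
proof -
  have x: "snd (M i) m \<in> overlap M i i" using assms by (simp add: overlap_def)
  have "fd (transition M i i) (snd (M i) m) = fd (\<lambda>x. x) (snd (M i) m)"
    by (rule fd_cong[OF open_overlap[OF atlas] x]) (auto simp: overlap_def transition_apply[OF atlas])
  then show ?thesis unfolding jacobian_matrix by (simp add: matrix_id_mat_1[unfolded id_def])
qed

lemma jacobian_inverse:
  assumes x: "x \<in> overlap M i j"
  shows "jacobian M j i (transition M i j x) ** jacobian M i j x = mat 1"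
    and "jacobian M i j x ** jacobian M j i (transition M i j x) = mat 1"
proof -
  obtain m where m: "m \<in> fst (M i)" "m \<in> fst (M j)" "x = snd (M i) m" "transition M i j x = snd (M j) m"
    using overlapE[OF x] .
  show "jacobian M j i (transition M i j x) ** jacobian M i j x = mat 1"
    using jacobian_cocycle[OF m(1,2,1)] jacobian_self[OF m(1)] m(3,4) by metis
  show "jacobian M i j x ** jacobian M j i (transition M i j x) = mat 1"
    using jacobian_cocycle[OF m(2,1,2)] jacobian_self[OF m(2)] m(3,4) by metis
qed

lemma weight_factor_pos: "x \<in> overlap M i j \<Longrightarrow> weight_factor M a i j x > 0"
  using det_pos[of x i j] unfolding weight_factor_def by simp

lemma weight_factor_cocycle:
  assumes m: "m \<in> fst (M i)" "m \<in> fst (M j)" "m \<in> fst (M k)"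
  shows "weight_factor M a i k (snd (M i) m) = weight_factor M a j k (snd (M j) m) * weight_factor M a i j (snd (M i) m)"
  unfolding weight_factor_def jacobian_cocycle[OF m] det_mul
  by (rule powr_mult)

lemma smooth_jacobian: "smooth_on (jacobian M i j) (overlap M i j)"
  unfolding jacobian_matrix[abs_def] by (rule smooth_on_matrix_fd[OF open_overlap[OF atlas] smooth_transition[OF atlas]])

lemma smooth_det:
  fixes f :: "'b::real_normed_vector \<Rightarrow> real^'m^'m"
  assumes "open S" "smooth_on f S"
  shows "smooth_on (\<lambda>x. det (f x)) S"
  unfolding det_def
  by (intro smooth_on_sum smooth_on_mult smooth_on_const smooth_on_prod smooth_on_nth assms)

lemma smooth_weight_factor: "smooth_on (weight_factor M a i j) (overlap M i j)"
  unfolding weight_factor_def[abs_def]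
  by (intro smooth_on_powr open_overlap[OF atlas] smooth_det smooth_jacobian det_pos)

text \<open>Written as the Jacobian of the reverse change of charts, so that smoothness is a matter
  of composition and not of matrix inversion.\<close>

definition invjac :: "'i \<Rightarrow> 'i \<Rightarrow> real^'n \<Rightarrow> real^'n^'n" where
  "invjac i j x = jacobian M j i (transition M i j x)"

lemma invjac: "x \<in> overlap M i j \<Longrightarrow> p v* invjac i j x v* jacobian M i j x = p"
  "x \<in> overlap M i j \<Longrightarrow> p v* jacobian M i j x v* invjac i j x = p"
  by (simp_all add: invjac_def vector_matrix_mul_assoc jacobian_inverse)

lemma jac_inj: "x \<in> overlap M i j \<Longrightarrow> p v* jacobian M i j x = q v* jacobian M i j x \<Longrightarrow> p = q"
  by (metis invjac(2))

lemma jac_eqI: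
  assumes x: "x \<in> overlap M i j" and "\<And>a. p \<bullet> (jacobian M i j x *v a) = q \<bullet> (jacobian M i j x *v a)"
  shows "p = q"
  by (rule jac_inj[OF x]) (metis assms(2) dot_lmul_matrix vector_eq_rdot)

lemma smooth_invjac: "smooth_on (invjac i j) (overlap M i j)"
  unfolding invjac_def[abs_def]
  by (rule smooth_on_compose[OF smooth_jacobian smooth_transition[OF atlas] open_overlap[OF atlas] open_overlap[OF atlas]])
     (use transition_overlap[OF atlas] in auto)

subsection \<open>The manifold of weighted covectors\<close>

abbreviation "C \<equiv> cotangent2 M"

lemma weighted_covector_component:
  assumes "weighted_covector M 2 m \<xi>" "m \<in> fst (M i)" "m \<in> fst (M j)"
  shows "\<xi> j = weight_factor M 2 i j (snd (M i) m) *\<^sub>R (\<xi> i v* invjac i j (snd (M i) m))"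
proof -
  have "\<xi> j v* jacobian M i j (snd (M i) m) = weight_factor M 2 i j (snd (M i) m) *\<^sub>R \<xi> i"
    using assms unfolding weighted_covector_def by (simp add: transpose_matrix_vector)
  then have "\<xi> j = (weight_factor M 2 i j (snd (M i) m) *\<^sub>R \<xi> i) v* invjac i j (snd (M i) m)"
    using invjac(2)[OF in_overlap[OF assms(2,3)]] by metis
  then show ?thesis by (simp add: vm_simps)
qed

text \<open>One component determines all the others; the cocycle identities for Jacobians and weight
  factors make the resulting family consistent. Thus the fibre coordinate in each chart takes every
  value.\<close>

lemma weighted_covector_exists:
  assumes m: "m \<in> fst (M i)"
  shows "\<exists>\<xi>. weighted_covector M 2 m \<xi> \<and> \<xi> i = p"
proof -
  define \<xi> where "\<xi> j = (if m \<in> fst (M j) then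
      weight_factor M 2 i j (snd (M i) m) *\<^sub>R (p v* jacobian M j i (snd (M j) m)) else 0)" for j
  have "transpose (jacobian M j k (snd (M j) m)) *v \<xi> k = weight_factor M 2 j k (snd (M j) m) *\<^sub>R \<xi> j"
    if "m \<in> fst (M j)" "m \<in> fst (M k)" for j k
    using that
    by (simp add: \<xi>_def transpose_matrix_vector vm_simps vector_matrix_mul_assoc weight_factor_cocycle[OF m that]
        jacobian_cocycle[OF that m, symmetric])
  then have "weighted_covector M 2 m \<xi>" by (simp add: weighted_covector_def \<xi>_def)
  moreover have "\<xi> i = p"
    using m jacobian_self[OF m] by (simp add: \<xi>_def weight_factor_def)
  ultimately show ?thesis by blast
qed

lemma chart_image_C: "chart_image C i = U i \<times> UNIV"
proof (intro equalityI subsetI)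
  fix z assume "z \<in> chart_image C i"
  then show "z \<in> U i \<times> UNIV" by (auto simp: chart_image_def cotangent2_def)
next
  fix z assume "z \<in> U i \<times> (UNIV :: (real^'n) set)"
  then obtain m where m: "m \<in> fst (M i)" "fst z = snd (M i) m" by (auto simp: chart_image_def)
  obtain \<xi> where "weighted_covector M 2 m \<xi>" "\<xi> i = snd z" using weighted_covector_exists[OF m(1)] by blast
  then show "z \<in> chart_image C i"
    unfolding chart_image_def using m by (intro image_eqI[of _ _ "(m, \<xi>)"]) (auto simp: cotangent2_def prod_eq_iff)
qed

lemma overlap_C: "overlap C i j = overlap M i j \<times> UNIV"
proof (intro equalityI subsetI)
  fix z assume "z \<in> overlap C i j"
  then show "z \<in> overlap M i j \<times> UNIV" by (auto simp: overlap_def cotangent2_def)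
next
  fix z assume "z \<in> overlap M i j \<times> (UNIV :: (real^'n) set)"
  then obtain m where m: "m \<in> fst (M i)" "m \<in> fst (M j)" "fst z = snd (M i) m" by (auto simp: overlap_def)
  obtain \<xi> where "weighted_covector M 2 m \<xi>" "\<xi> i = snd z" using weighted_covector_exists[OF m(1)] by blast
  then show "z \<in> overlap C i j"
    unfolding overlap_def using m by (intro image_eqI[of _ _ "(m, \<xi>)"]) (auto simp: cotangent2_def prod_eq_iff)
qed

lemma inj_C: "inj_on (snd (C i)) (fst (C i))"
proof (rule inj_onI)
  fix a b assume a: "a \<in> fst (C i)" and b: "b \<in> fst (C i)" and e: "snd (C i) a = snd (C i) b"
  obtain m \<xi> where a': "a = (m, \<xi>)" "m \<in> fst (M i)" "weighted_covector M 2 m \<xi>" using a by (auto simp: cotangent2_def)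
  obtain m' \<xi>' where b': "b = (m', \<xi>')" "m' \<in> fst (M i)" "weighted_covector M 2 m' \<xi>'" using b by (auto simp: cotangent2_def)
  have "snd (M i) m = snd (M i) m'" and \<xi>i: "\<xi> i = \<xi>' i" using e a' b' by (simp_all add: cotangent2_def)
  then have mm: "m = m'" using a' b' atlas unfolding smooth_atlas_def by (metis inj_onD)
  have "\<xi> j = \<xi>' j" for j
  proof (cases "m \<in> fst (M j)")
    case True
    then show ?thesis
      using weighted_covector_component[OF a'(3,2) True] weighted_covector_component[OF b'(3,2)] mm \<xi>i by simp
  next
    case False
    then show ?thesis using a' b' mm unfolding weighted_covector_def by simp
  qed
  then show "a = b" using a' b' mm by auto
qed

lemma transition_C:
  assumes x: "x \<in> overlap M i j"
  shows "transition C i j (x, p) = (transition M i j x, weight_factor M 2 i j x *\<^sub>R (p v* invjac i j x))"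
proof -
  obtain m where m: "m \<in> fst (M i)" "m \<in> fst (M j)" "x = snd (M i) m" "transition M i j x = snd (M j) m"
    using overlapE[OF x] .
  obtain \<xi> where \<xi>: "weighted_covector M 2 m \<xi>" "\<xi> i = p" using weighted_covector_exists[OF m(1)] by blast
  have in_C: "(m, \<xi>) \<in> fst (C i)" and s: "snd (C i) (m, \<xi>) = (x, p)" "snd (C j) (m, \<xi>) = (snd (M j) m, \<xi> j)"
    using m \<xi> by (simp_all add: cotangent2_def)
  have "transition C i j (x, p) = snd (C j) (m, \<xi>)"
    unfolding transition_def s(1)[symmetric] by (simp add: inv_into_f_f[OF inj_C in_C])
  then show ?thesis
    using weighted_covector_component[OF \<xi>(1) m(1,2)] m \<xi> s by simp
qed

lemma smooth_on_fst_compose: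
  fixes f :: "real^'n \<Rightarrow> 'b::real_normed_vector" and S :: "(real^'n) set"
  assumes "open S" "smooth_on f S"
  shows "smooth_on (\<lambda>z. f (fst z)) (S \<times> (UNIV :: (real^'n) set))"
  by (rule smooth_on_compose[OF assms(2) smooth_on_linear[OF bounded_linear_fst] _ assms(1)])
     (auto simp: assms(1) open_Times)

lemma smooth_transition_C: "smooth_on (transition C i j) (overlap C i j)"
proof (rule smooth_on_cong)
  show o: "open (overlap C i j)" unfolding overlap_C by (simp add: open_Times open_overlap[OF atlas])
  show "smooth_on (\<lambda>z. (transition M i j (fst z), weight_factor M 2 i j (fst z) *\<^sub>R (snd z v* invjac i j (fst z)))) (overlap C i j)"
    using o unfolding overlap_C
    by (intro smooth_on_Pair smooth_on_scaleR smooth_on_bilinear[OF bounded_bilinear_vm] smooth_on_linear[OF bounded_linear_snd]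
        smooth_on_fst_compose[OF open_overlap[OF atlas]] smooth_transition[OF atlas] smooth_weight_factor smooth_invjac)
  show "(transition M i j (fst z), weight_factor M 2 i j (fst z) *\<^sub>R (snd z v* invjac i j (fst z))) = transition C i j z"
    if "z \<in> overlap C i j" for z
    using that transition_C[of "fst z" i j "snd z"] unfolding overlap_C by auto
qed

lemma atlas_C: "smooth_atlas C"
  unfolding smooth_atlas_def
  using inj_C smooth_transition_C
  by (auto simp: chart_image_C overlap_C open_Times U open_overlap[OF atlas])

subsection \<open>Change of charts on the cotangent bundle\<close>

text \<open>The change of charts on the unweighted cotangent bundle; the scale intertwines it with
  that of \<open>T^*M(2)\<close>, see \<open>\<Phi>_transition\<close>.\<close>

definition \<Psi> :: "'i \<Rightarrow> 'i \<Rightarrow> (real^'n) \<times> (real^'n) \<Rightarrow> (real^'n) \<times> (real^'n)" where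
  "\<Psi> i j = (\<lambda>(x, p). (transition M i j x, p v* invjac i j x))"

lemma smooth_\<Psi>: "smooth_on (\<Psi> i j) (overlap M i j \<times> UNIV)"
proof -
  have o: "open (overlap M i j \<times> (UNIV :: (real^'n) set))" by (simp add: open_Times open_overlap[OF atlas])
  have "\<Psi> i j = (\<lambda>z. (transition M i j (fst z), snd z v* invjac i j (fst z)))" by (auto simp: \<Psi>_def)
  then show ?thesis
    by (auto intro!: smooth_on_Pair smooth_on_bilinear[OF bounded_bilinear_vm] smooth_on_linear[OF bounded_linear_snd]
        smooth_on_fst_compose[OF open_overlap[OF atlas]] smooth_transition[OF atlas] smooth_invjac o)
qed

definition hess :: "'i \<Rightarrow> 'i \<Rightarrow> real^'n \<Rightarrow> real^'n \<Rightarrow> real^'n \<Rightarrow> real^'n" where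
  "hess i j x u a = fd (\<lambda>y. fd (transition M i j) y a) x u"

lemma hess_sym: "x \<in> overlap M i j \<Longrightarrow> hess i j x u a = hess i j x a u"
  unfolding hess_def by (rule fd_commute[OF open_overlap[OF atlas] _ smooth_transition[OF atlas]])

lemma linear_hess: "x \<in> overlap M i j \<Longrightarrow> linear (\<lambda>u. hess i j x u a)" "x \<in> overlap M i j \<Longrightarrow> linear (hess i j x u)"
proof -
  assume x: "x \<in> overlap M i j"
  show 1: "linear (\<lambda>u. hess i j x u a)" for a unfolding hess_def
    by (rule linear_fd[OF smooth_on_differentiable[OF smooth_on_fd[OF smooth_transition[OF atlas]] x]])
  have "hess i j x u = (\<lambda>a. hess i j x a u)" by (rule ext) (rule hess_sym[OF x])
  then show "linear (hess i j x u)" using 1 by simp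
qed

lemma fd_jacobian:
  "x \<in> overlap M i j \<Longrightarrow> fd (jacobian M i j) x u *v a = hess i j x u a"
  unfolding jacobian_matrix[abs_def] hess_def
  by (rule fd_matrix_fd[OF open_overlap[OF atlas] _ smooth_transition[OF atlas]])

text \<open>The derivative of the inverse Jacobian never appears: the identity
  \<open>snd (\<Psi> i j z) v* jacobian M i j (fst z) = snd z\<close> is differentiated instead, and
  the result is tested on vectors of the form \<open>jacobian M i j x *v a\<close>.\<close>

lemma fd_\<Psi>:
  assumes x: "x \<in> overlap M i j"
  shows "fst (fd (\<Psi> i j) (x, p) (u, q)) = jacobian M i j x *v u"
    and "snd (fd (\<Psi> i j) (x, p) (u, q)) \<bullet> (jacobian M i j x *v a) = q \<bullet> a - (p v* invjac i j x) \<bullet> hess i j x u a"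
proof -
  have d: "(\<Psi> i j has_derivative fd (\<Psi> i j) (x, p)) (at (x, p))"
    by (rule smooth_on_has_derivative[OF smooth_\<Psi>]) (simp add: x)
  have t: "transition M i j differentiable at x" by (rule smooth_on_differentiable[OF smooth_transition[OF atlas] x])
  have J: "jacobian M i j differentiable at x" by (rule smooth_on_differentiable[OF smooth_jacobian x])
  have "((\<lambda>z. fst (\<Psi> i j z)) has_derivative (\<lambda>a. fst (fd (\<Psi> i j) (x, p) a))) (at (x, p))"
    by (rule has_derivative_fst[OF d])
  moreover have "((\<lambda>z. fst (\<Psi> i j z)) has_derivative (\<lambda>a. fd (transition M i j) x (fst a))) (at (x, p))"
    using has_derivative_fst_comp[OF t, of p] by (simp add: \<Psi>_def case_prod_unfold)
  ultimately have "fst (fd (\<Psi> i j) (x, p) a) = fd (transition M i j) x (fst a)" for a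
    using has_derivative_unique by metis
  then show "fst (fd (\<Psi> i j) (x, p) (u, q)) = jacobian M i j x *v u"
    using dtrans_jacobian[OF x, of u] by (simp add: dtrans_def)
  have 1: "((\<lambda>z. snd (\<Psi> i j z) v* jacobian M i j (fst z)) has_derivative
      (\<lambda>a. snd (\<Psi> i j (x, p)) v* fd (jacobian M i j) x (fst a) + snd (fd (\<Psi> i j) (x, p) a) v* jacobian M i j x)) (at (x, p))"
    using bounded_bilinear.FDERIV[OF bounded_bilinear_vm has_derivative_snd[OF d] has_derivative_fst_comp[OF J]] by simp
  have "((\<lambda>z. snd (\<Psi> i j z) v* jacobian M i j (fst z)) has_derivative snd) (at (x, p))"
  proof (rule has_derivative_transform_within_open)
    show "(snd has_derivative snd) (at (x, p))" by (intro derivative_intros)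
    show "open (overlap M i j \<times> (UNIV :: (real^'n) set))" by (simp add: open_Times open_overlap[OF atlas])
    show "snd z = snd (\<Psi> i j z) v* jacobian M i j (fst z)" if "z \<in> overlap M i j \<times> UNIV" for z
      using that by (auto simp: \<Psi>_def invjac)
  qed (simp add: x)
  from fun_cong[OF has_derivative_unique[OF 1 this], of "(u, q)"]
  have "p v* invjac i j x v* fd (jacobian M i j) x u + snd (fd (\<Psi> i j) (x, p) (u, q)) v* jacobian M i j x = q"
    by (simp add: \<Psi>_def)
  from arg_cong[OF this, of "\<lambda>z. z \<bullet> a"]
  have "(p v* invjac i j x v* fd (jacobian M i j) x u) \<bullet> a + (snd (fd (\<Psi> i j) (x, p) (u, q)) v* jacobian M i j x) \<bullet> a = q \<bullet> a"
    by (simp only: inner_add_left)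
  then show "snd (fd (\<Psi> i j) (x, p) (u, q)) \<bullet> (jacobian M i j x *v a) = q \<bullet> a - (p v* invjac i j x) \<bullet> hess i j x u a"
    using fd_jacobian[OF x, of u a] by (simp add: dot_lmul_matrix[of _ "jacobian M i j x"] dot_lmul_matrix[of _ "fd (jacobian M i j) x u"])
qed

lemma connection_law:
  assumes x: "x \<in> overlap M i j" and D': "D' \<in> P"
  shows "jacobian M i j x *v (cm (D' i x) u *v a) =
    hess i j x u a + cm (D' j (transition M i j x)) (jacobian M i j x *v u) *v (jacobian M i j x *v a)"
proof -
  let ?J = "jacobian M i j x"
  let ?f = "\<lambda>u a. ?J *v (cm (D' i x) u *v a)"
  let ?g = "\<lambda>u a. hess i j x u a + cm (D' j (transition M i j x)) (?J *v u) *v (?J *v a)"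
  have Jn: "?J $ E $ A = (?J *v axis A 1) $ E" for E A by (simp add: mv_axis)
  have "?f = ?g"
  proof (rule bilinear_eq_stdbasis)
    show "bilinear ?f" by (simp add: bilinear_def linear_iff cm_simps mv_simps)
    show "bilinear ?g"
      using linear_hess[OF x] by (simp add: bilinear_def linear_iff cm_simps mv_simps scaleR_add_right)
    fix b c :: "real^'n" assume "b \<in> Basis" "c \<in> Basis"
    then obtain A B where bc: "b = axis A 1" "c = axis B 1" unfolding Basis_axis by blast
    have "?f b c $ E = ?g b c $ E" for E
    proof -
      have law: "(\<Sum>C\<in>UNIV. ?J $ E $ C * D' i x $ A $ C $ B) =
        pd A (\<lambda>y. pd B (\<lambda>z. transition M i j z $ E) y) x
        + (\<Sum>C\<in>UNIV. \<Sum>F\<in>UNIV. ?J $ C $ A * ?J $ F $ B * D' j (transition M i j x) $ C $ E $ F)"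
        using torsion_free[OF D'] x unfolding torsion_free_connection_def connection_def by blast
      have p1: "pd B (\<lambda>z. transition M i j z $ E) y = fd (transition M i j) y (axis B 1) $ E" if "y \<in> overlap M i j" for y
        unfolding pd_def by (rule fd_bounded_linear[OF bounded_linear_vec_nth smooth_on_differentiable[OF smooth_transition[OF atlas] that]])
      have "pd A (\<lambda>y. pd B (\<lambda>z. transition M i j z $ E) y) x = fd (\<lambda>y. fd (transition M i j) y (axis B 1) $ E) x (axis A 1)"
        unfolding pd_def[of A] by (rule fun_cong[OF fd_cong[OF open_overlap[OF atlas] x p1]])
      also have "\<dots> = hess i j x (axis A 1) (axis B 1) $ E"
        unfolding hess_def
        by (rule fd_bounded_linear[OF bounded_linear_vec_nth smooth_on_differentiable[OF smooth_on_fd[OF smooth_transition[OF atlas]] x]])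
      finally have p2: "pd A (\<lambda>y. pd B (\<lambda>z. transition M i j z $ E) y) x = hess i j x (axis A 1) (axis B 1) $ E" .
      have l: "?f b c $ E = (\<Sum>C\<in>UNIV. ?J $ E $ C * D' i x $ A $ C $ B)"
        by (simp add: bc matrix_vector_mult_def[of ?J] cm_axis mv_axis)
      have "(cm (D' j (transition M i j x)) (?J *v axis A 1) *v (?J *v axis B 1)) $ E
         = (\<Sum>F\<in>UNIV. \<Sum>C\<in>UNIV. ?J $ C $ A * ?J $ F $ B * D' j (transition M i j x) $ C $ E $ F)"
        unfolding matrix_vector_mult_def[of "cm _ _"] cm_nth
        by (simp add: mv_axis sum_distrib_right sum_distrib_left mult_ac)
      also have "\<dots> = (\<Sum>C\<in>UNIV. \<Sum>F\<in>UNIV. ?J $ C $ A * ?J $ F $ B * D' j (transition M i j x) $ C $ E $ F)"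
        by (rule sum.swap)
      finally show ?thesis unfolding l law p2 by (simp add: bc)
    qed
    then show "?f b c = ?g b c" by (simp add: vec_eq_iff)
  qed
  then show ?thesis by meson
qed

end

section \<open>Comparing \<open>T^*M(2)\<close> with \<open>T^*M\<close> through the scale\<close>

lemma pw_formula_pwf:
  assumes "\<And>A B C. D i x $ A $ C $ B = D i x $ B $ C $ A"
  shows "pw_formula D i (x, p) a b = pwf (D i) (x, p) a b"
proof -
  obtain u q where a: "a = (u, q)" by force
  obtain u' q' where b: "b = (u', q')" by force
  have 1: "p \<bullet> (cm (D i x) y *v z) = (\<Sum>A\<in>UNIV. \<Sum>B\<in>UNIV. \<Sum>C\<in>UNIV. D i x $ A $ C $ B * p $ C * (y $ A * z $ B))" for y z
  proof -
    have "p \<bullet> (cm (D i x) y *v z) = (\<Sum>C\<in>UNIV. \<Sum>B\<in>UNIV. \<Sum>A\<in>UNIV. D i x $ A $ C $ B * p $ C * (y $ A * z $ B))"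
      by (simp add: inner_vec_def matrix_vector_mult_def cm_nth sum_distrib_left sum_distrib_right mult_ac)
    also have "\<dots> = (\<Sum>B\<in>UNIV. \<Sum>C\<in>UNIV. \<Sum>A\<in>UNIV. D i x $ A $ C $ B * p $ C * (y $ A * z $ B))"
      by (rule sum.swap)
    also have "\<dots> = (\<Sum>B\<in>UNIV. \<Sum>A\<in>UNIV. \<Sum>C\<in>UNIV. D i x $ A $ C $ B * p $ C * (y $ A * z $ B))"
      by (rule sum.cong[OF refl]) (rule sum.swap)
    also have "\<dots> = (\<Sum>A\<in>UNIV. \<Sum>B\<in>UNIV. \<Sum>C\<in>UNIV. D i x $ A $ C $ B * p $ C * (y $ A * z $ B))"
      by (rule sum.swap)
    finally show ?thesis .
  qed
  have "2 * (\<Sum>A\<in>UNIV. \<Sum>B\<in>UNIV. \<Sum>C\<in>UNIV. D i x $ A $ C $ B * p $ C * ((u $ A * u' $ B + u $ B * u' $ A) / 2))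
    = p \<bullet> (cm (D i x) u *v u') + p \<bullet> (cm (D i x) u' *v u)"
    unfolding 1 sum_distrib_left sum.distrib[symmetric]
    by (intro sum.cong refl) (simp add: distrib_left mult_ac)
  also have "\<dots> = 2 * (p \<bullet> (cm (D i x) u *v u'))"
    using cm_sym[of "D i x" u' u, OF assms] by simp
  finally show ?thesis
    by (simp add: pw_formula_def pwf_def a b inner_vec_def sum.distrib mult.commute)
qed

lemma bilinear_pwf: "bilinear (pwf G z)"
  by (simp add: bilinear_def linear_iff pwf_def cm_simps mv_simps inner_simps algebra_simps)

context projective_manifold
begin

abbreviation "UU i \<equiv> U i \<times> (UNIV :: (real^'n) set)"

lemma open_UU: "open (UU i)" by (simp add: open_Times U)

definition "\<Phi> = to_cotangent \<sigma>"
definition "\<Theta> = from_cotangent \<sigma>"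

lemma \<Phi>_apply: "\<Phi> i (x, p) = (x, \<sigma> i x powr (-2) *\<^sub>R p)"
  by (simp add: \<Phi>_def to_cotangent_def)

lemma \<Theta>_apply: "\<Theta> i (x, p) = (x, \<sigma> i x powr 2 *\<^sub>R p)"
  by (simp add: \<Theta>_def from_cotangent_def)

lemma \<Theta>\<Phi>: "z \<in> UU i \<Longrightarrow> \<Theta> i (\<Phi> i z) = z"
  using \<sigma>_pos[of "fst z" i] by (cases z) (auto simp: \<Phi>_apply \<Theta>_apply powr_minus)

lemma \<Phi>\<Theta>: "z \<in> UU i \<Longrightarrow> \<Phi> i (\<Theta> i z) = z"
  using \<sigma>_pos[of "fst z" i] by (cases z) (auto simp: \<Phi>_apply \<Theta>_apply powr_minus)

lemma \<Phi>_UU: "z \<in> UU i \<Longrightarrow> \<Phi> i z \<in> UU i" and \<Theta>_UU: "z \<in> UU i \<Longrightarrow> \<Theta> i z \<in> UU i"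
  by (cases z; auto simp: \<Phi>_apply \<Theta>_apply)+

lemma smooth_scale: "smooth_on (\<lambda>z. (fst z, \<sigma> i (fst z) powr c *\<^sub>R snd z)) (UU i)"
  using \<sigma>_pos
  by (intro smooth_on_Pair smooth_on_scaleR smooth_on_powr smooth_on_fst_compose[OF U] open_UU
      smooth_\<sigma> smooth_on_linear[OF bounded_linear_snd] smooth_on_linear[OF bounded_linear_fst]) auto

lemma smooth_\<Phi>: "smooth_on (\<Phi> i) (UU i)"
proof -
  have "\<Phi> i = (\<lambda>z. (fst z, \<sigma> i (fst z) powr (-2) *\<^sub>R snd z))" by (auto simp: \<Phi>_apply)
  then show ?thesis using smooth_scale by simp
qed

lemma smooth_\<Theta>: "smooth_on (\<Theta> i) (UU i)"
proof -
  have "\<Theta> i = (\<lambda>z. (fst z, \<sigma> i (fst z) powr 2 *\<^sub>R snd z))" by (auto simp: \<Theta>_apply)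
  then show ?thesis using smooth_scale by simp
qed

lemma fd_inverse:
  fixes f g :: "'b::real_normed_vector \<Rightarrow> 'b"
  assumes S: "open S" "z \<in> S" and f: "smooth_on f S" and g: "smooth_on g S"
    and fS: "\<And>y. y \<in> S \<Longrightarrow> f y \<in> S" and gf: "\<And>y. y \<in> S \<Longrightarrow> g (f y) = y"
  shows "fd g (f z) (fd f z a) = a"
proof -
  have "fd (\<lambda>y. g (f y)) z = (\<lambda>a. fd g (f z) (fd f z a))"
    by (rule fd_eq[OF has_derivative_compose[OF smooth_on_has_derivative[OF f S(2)] smooth_on_has_derivative[OF g fS[OF S(2)]]]])
  moreover have "fd (\<lambda>y. g (f y)) z = fd (\<lambda>y. y) z" by (rule fd_cong[OF S gf])
  ultimately have "(\<lambda>a. fd g (f z) (fd f z a)) = (\<lambda>a. a)" by simp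
  then show ?thesis by meson
qed

lemma fd_\<Theta>\<Phi>: "z \<in> UU i \<Longrightarrow> fd (\<Theta> i) (\<Phi> i z) (fd (\<Phi> i) z a) = a"
  by (rule fd_inverse[OF open_UU _ smooth_\<Phi> smooth_\<Theta> \<Phi>_UU \<Theta>\<Phi>])

lemma fd_\<Phi>\<Theta>: "z \<in> UU i \<Longrightarrow> fd (\<Phi> i) (\<Theta> i z) (fd (\<Theta> i) z a) = a"
  by (rule fd_inverse[OF open_UU _ smooth_\<Theta> smooth_\<Phi> \<Theta>_UU \<Phi>\<Theta>])

lemma fd_\<Phi>\<Theta>': "z \<in> UU i \<Longrightarrow> fd (\<Phi> i) z (fd (\<Theta> i) (\<Phi> i z) a) = a"
  using fd_\<Phi>\<Theta>[OF \<Phi>_UU, of z i a] \<Theta>\<Phi>[of z i] by simp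

lemma linear_\<Phi>: "z \<in> UU i \<Longrightarrow> linear (fd (\<Phi> i) z)"
  by (rule linear_fd[OF smooth_on_differentiable[OF smooth_\<Phi>]])

lemma linear_\<Theta>: "z \<in> UU i \<Longrightarrow> linear (fd (\<Theta> i) z)"
  by (rule linear_fd[OF smooth_on_differentiable[OF smooth_\<Theta>]])

lemma scale_transition: "x \<in> overlap M i j \<Longrightarrow> \<sigma> j (transition M i j x) = weight_factor M 1 i j x * \<sigma> i x"
  using scale unfolding parallel_scale_def density_def by blast

lemma overlap_U: "x \<in> overlap M i j \<Longrightarrow> x \<in> U i" "x \<in> overlap M i j \<Longrightarrow> transition M i j x \<in> U j"
  using overlap_subset[of M i j] overlap_subset[of M j i] transition_overlap[OF atlas, of x i j] by auto

lemma scale_law: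
  assumes x: "x \<in> overlap M i j"
  shows "\<sigma> j (transition M i j x) powr k = weight_factor M k i j x * \<sigma> i x powr k"
proof -
  have "weight_factor M k i j x = weight_factor M 1 i j x powr k"
    by (simp add: weight_factor_def powr_powr)
  then show ?thesis
    unfolding scale_transition[OF x] by (simp add: powr_mult)
qed

lemma scale_weight:
  assumes x: "x \<in> overlap M i j"
  shows "\<sigma> j (transition M i j x) powr k * weight_factor M (- k) i j x = \<sigma> i x powr k"
proof -
  have p: "weight_factor M 1 i j x > 0" "\<sigma> i x > 0"
    using weight_factor_pos[OF x] \<sigma>_pos[OF overlap_U(1)[OF x]] .
  have "weight_factor M (- k) i j x = weight_factor M 1 i j x powr (- k)"
    by (simp add: weight_factor_def powr_powr)
  then show ?thesis
    unfolding scale_transition[OF x] using p by (simp add: powr_mult powr_minus)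
qed

text \<open>The factor \<open>\<sigma>\<close> to the power \<open>- 2\<close> absorbs the weight 2
  of the fibre coordinate.\<close>

lemma \<Phi>_transition:
  assumes x: "x \<in> overlap M i j"
  shows "\<Phi> j (transition C i j (x, p)) = \<Psi> i j (\<Phi> i (x, p))"
proof -
  have "\<sigma> j (transition M i j x) powr (-2) * weight_factor M 2 i j x = \<sigma> i x powr (-2)"
    using scale_weight[OF x, of "-2"] by simp
  then show ?thesis
    by (simp add: transition_C[OF x] \<Phi>_apply \<Psi>_def vm_simps)
qed

lemma fd_\<Phi>_transition:
  assumes x: "x \<in> overlap M i j"
  shows "fd (\<Phi> j) (transition C i j (x, p)) (dtrans C i j (x, p) a) = fd (\<Psi> i j) (\<Phi> i (x, p)) (fd (\<Phi> i) (x, p) a)"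
proof -
  have xC: "(x, p) \<in> overlap C i j" using x by (simp add: overlap_C)
  have tU: "transition C i j (x, p) \<in> UU j" using x overlap_U by (simp add: transition_C)
  have "fd (\<lambda>z. \<Phi> j (transition C i j z)) (x, p) = (\<lambda>a. fd (\<Phi> j) (transition C i j (x, p)) (fd (transition C i j) (x, p) a))"
    by (rule fd_eq[OF has_derivative_compose[OF smooth_on_has_derivative[OF smooth_transition_C xC]
            smooth_on_has_derivative[OF smooth_\<Phi> tU]]])
  moreover have "fd (\<lambda>z. \<Phi> j (transition C i j z)) (x, p) = fd (\<lambda>z. \<Psi> i j (\<Phi> i z)) (x, p)"
    by (rule fd_cong[OF open_overlap[OF atlas_C] xC]) (auto simp: overlap_C \<Phi>_transition)
  moreover have "fd (\<lambda>z. \<Psi> i j (\<Phi> i z)) (x, p) = (\<lambda>a. fd (\<Psi> i j) (\<Phi> i (x, p)) (fd (\<Phi> i) (x, p) a))"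
  proof -
    have xU: "(x, p) \<in> UU i" and xo: "\<Phi> i (x, p) \<in> overlap M i j \<times> UNIV"
      using overlap_U[OF x] x by (simp_all add: \<Phi>_apply)
    show ?thesis
      by (rule fd_eq[OF has_derivative_compose[OF smooth_on_has_derivative[OF smooth_\<Phi> xU]
              smooth_on_has_derivative[OF smooth_\<Psi> xo]]])
  qed
  ultimately show ?thesis unfolding dtrans_def by metis
qed

subsection \<open>The conformal class\<close>

definition "pw = pw_metric D \<sigma>"

lemma pw_pwf: "pw i z a b = pwf (D i) (\<Phi> i z) (fd (\<Phi> i) z a) (fd (\<Phi> i) z b)"
  unfolding pw_def pw_metric_def Let_def \<Phi>_def[symmetric]
  using pw_formula_pwf[of D i "fst (\<Phi> i z)" "snd (\<Phi> i z)", OF sym_conn[OF DP]] by simp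

lemma bilinear_pw:
  assumes z: "z \<in> UU i"
  shows "bilinear (pw i z)"
proof -
  have "linear (pwf (D i) (\<Phi> i z) c)" "linear (\<lambda>a. pwf (D i) (\<Phi> i z) a c)" for c
    using bilinear_pwf[of "D i" "\<Phi> i z"] unfolding bilinear_def by blast+
  from linear_compose[OF linear_\<Phi>[OF z] this(1)] linear_compose[OF linear_\<Phi>[OF z] this(2)]
  show ?thesis unfolding pw_pwf[abs_def] bilinear_def o_def by blast
qed

lemma pwf_sym:
  "fst z \<in> U i \<Longrightarrow> pwf (D i) z a b = pwf (D i) z b a"
  using chart.sym[of "fst z" i "fst a" "fst b"] by (simp add: pwf_def inner_commute)

lemma fd_\<Phi>:
  assumes x: "x \<in> U i"
  shows "fd (\<Phi> i) (x, p) (u, q) = (u, \<sigma> i x powr (-2) *\<^sub>R (q - (2 * fd (\<sigma> i) x u / \<sigma> i x) *\<^sub>R p))"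
proof -
  have s: "((\<lambda>y. \<sigma> i y powr (-2)) has_derivative (\<lambda>u. - 2 * \<sigma> i x powr (-2) * fd (\<sigma> i) x u / \<sigma> i x)) (at x)"
    using \<sigma>_pos[OF x] smooth_on_has_derivative[OF smooth_\<sigma> x]
    by (auto intro!: derivative_eq_intros simp: powr_diff field_simps powr_minus)
  have s2: "((\<lambda>z. \<sigma> i (fst z) powr (-2)) has_derivative (\<lambda>a. - 2 * \<sigma> i x powr (-2) * fd (\<sigma> i) x (fst a) / \<sigma> i x)) (at (x, p))"
    using has_derivative_fst_comp[OF differentiableI[OF s], of p] by (simp add: fd_eq[OF s])
  have "((\<lambda>z. (fst z, \<sigma> i (fst z) powr (-2) *\<^sub>R snd z)) has_derivative
     (\<lambda>a. (fst a, \<sigma> i x powr (-2) *\<^sub>R snd a + (- 2 * \<sigma> i x powr (-2) * fd (\<sigma> i) x (fst a) / \<sigma> i x) *\<^sub>R p))) (at (x, p))"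
    using has_derivative_Pair[OF _ has_derivative_scaleR[OF s2 has_derivative_snd[OF has_derivative_ident]]]
      has_derivative_fst[OF has_derivative_ident] by fastforce
  moreover have "\<Phi> i = (\<lambda>z. (fst z, \<sigma> i (fst z) powr (-2) *\<^sub>R snd z))" by (auto simp: \<Phi>_apply)
  ultimately show ?thesis by (simp add: fd_eq algebra_simps)
qed

text \<open>Connection and logarithmic derivative of the scale stand side by side here, which makes
  a simultaneous change of both readable.\<close>

lemma pw_explicit:
  assumes x: "x \<in> U i"
  shows "pw i (x, p) (u, q) (u', q') = \<sigma> i x powr (-2) * (u \<bullet> q' + q \<bullet> u' - 2 * (p \<bullet> (cm (D i x) u *v u'))
    - 2 * (fd (\<sigma> i) x u / \<sigma> i x) * (p \<bullet> u') - 2 * (fd (\<sigma> i) x u' / \<sigma> i x) * (p \<bullet> u))"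
  unfolding pw_pwf fd_\<Phi>[OF x]
  by (simp add: pwf_def \<Phi>_apply inner_simps inner_commute algebra_simps)

lemma smooth_pw: "smooth_on (\<lambda>z. pw i z a b) (UU i)"
proof (rule smooth_on_cong[OF open_UU])
  show "pwf (D i) (\<Phi> i z) (fd (\<Phi> i) z a) (fd (\<Phi> i) z b) = pw i z a b" for z by (simp add: pw_pwf)
  have G: "smooth_on (\<lambda>z. D i (fst z)) (UU i)" by (rule smooth_on_fst_compose[OF U smD])
  have f: "smooth_on (\<lambda>z. fd (\<Phi> i) z a) (UU i)" for a by (rule smooth_on_fd[OF smooth_\<Phi>])
  have fst: "fst (\<Phi> i z) = fst z" for z by (cases z) (simp add: \<Phi>_apply)
  show "smooth_on (\<lambda>z. pwf (D i) (\<Phi> i z) (fd (\<Phi> i) z a) (fd (\<Phi> i) z b)) (UU i)"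
    unfolding pwf_def fst
    by (intro smooth_on_diff smooth_on_add smooth_on_mult smooth_on_inner smooth_on_const smooth_on_fst smooth_on_snd
        smooth_on_bilinear[OF bounded_bilinear_mv] smooth_on_bilinear[OF bounded_bilinear_cm] G f smooth_\<Phi> open_UU)
qed

text \<open>The inhomogeneous term of the Christoffel symbols, doubled in the metric, cancels
  against the Hessians of the change of charts, one from each of the two pairings of a vertical with
  a horizontal component.\<close>

lemma pwf_\<Psi>:
  assumes x: "x \<in> overlap M i j"
  shows "pwf (D j) (\<Psi> i j (x, p)) (fd (\<Psi> i j) (x, p) a) (fd (\<Psi> i j) (x, p) b) = pwf (D i) (x, p) a b"
proof -
  obtain u q where a: "a = (u, q)" by force
  obtain u' q' where b: "b = (u', q')" by force
  have "(p v* invjac i j x) \<bullet> (jacobian M i j x *v (cm (D i x) u *v u')) = p \<bullet> (cm (D i x) u *v u')"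
    using dot_lmul_matrix[of "p v* invjac i j x" "jacobian M i j x"] invjac(1)[OF x, of p] by simp
  then have "(p v* invjac i j x) \<bullet> (cm (D j (transition M i j x)) (jacobian M i j x *v u) *v (jacobian M i j x *v u'))
    = p \<bullet> (cm (D i x) u *v u') - (p v* invjac i j x) \<bullet> hess i j x u u'"
    unfolding connection_law[OF x DP] by (simp add: inner_add_right)
  moreover have "fst (\<Psi> i j (x, p)) = transition M i j x" "snd (\<Psi> i j (x, p)) = p v* invjac i j x"
    by (simp_all add: \<Psi>_def)
  ultimately show ?thesis
    using fd_\<Psi>(2)[OF x, of p u q u'] fd_\<Psi>(2)[OF x, of p u' q' u] hess_sym[OF x, of u u']
    by (simp add: pwf_def a b fd_\<Psi>(1)[OF x] inner_commute)
qed

lemma pwf_nondegenerate: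
  assumes "\<And>b. pwf G z a b = 0"
  shows "a = 0"
proof -
  have "fst a \<bullet> q = 0" for q using assms[of "(0, q)"] by (simp add: pwf_def mv_simps)
  then have f: "fst a = 0" by (metis inner_eq_zero_iff)
  have "snd a \<bullet> u = 0" for u using assms[of "(u, 0)"] f by (simp add: pwf_def mv_simps cm_simps)
  then have "snd a = 0" by (metis inner_eq_zero_iff)
  then show ?thesis using f by (simp add: prod_eq_iff)
qed

lemma metric_pw: "metric C pw"
  unfolding metric_def
proof (intro conjI allI ballI impI)
  show "smooth_on (\<lambda>z. pw i z u v) (chart_image C i)" for i u v
    unfolding chart_image_C by (rule smooth_pw)
  fix i z assume "z \<in> chart_image C i"
  then have z: "z \<in> UU i" by (simp add: chart_image_C)
  show "bilinear (pw i z)" by (rule bilinear_pw[OF z])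
  show "pw i z u v = pw i z v u" for u v
    unfolding pw_pwf by (rule pwf_sym) (use \<Phi>_UU[OF z] in auto)
  fix u assume n: "\<forall>v. pw i z u v = 0"
  have "pwf (D i) (\<Phi> i z) (fd (\<Phi> i) z u) b = 0" for b
    using n[rule_format, of "fd (\<Theta> i) (\<Phi> i z) b"] fd_\<Phi>\<Theta>'[OF z, of b] by (simp add: pw_pwf)
  then have "fd (\<Phi> i) z u = 0" by (rule pwf_nondegenerate)
  then show "u = 0" using fd_\<Theta>\<Phi>[OF z, of u] linear_0[OF linear_\<Theta>[OF \<Phi>_UU[OF z]]] by simp
next
  fix i j z u v assume "z \<in> overlap C i j"
  then obtain x p where z: "z = (x, p)" and x: "x \<in> overlap M i j" by (auto simp: overlap_C)
  show "pw j (transition C i j z) (dtrans C i j z u) (dtrans C i j z v) = pw i z u v"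
    unfolding pw_pwf z fd_\<Phi>_transition[OF x] \<Phi>_transition[OF x] \<Phi>_apply by (rule pwf_\<Psi>[OF x])
qed

text \<open>\<open>P\<close> is given through some unnamed representative, so the one-form relating
  \<open>D\<close> to \<open>D'\<close> arises as the difference of two.\<close>

lemma projective_difference:
  assumes "D' \<in> P"
  obtains \<Upsilon> where "one_form M 0 \<Upsilon>"
    "\<And>i x u a. x \<in> U i \<Longrightarrow> cm (D' i x) u *v a = cm (D i x) u *v a + (\<Upsilon> i x \<bullet> u) *\<^sub>R a + (\<Upsilon> i x \<bullet> a) *\<^sub>R u"
proof -
  obtain D0 where D0: "P = {D'. torsion_free_connection M D' \<and> projectively_equivalent M D0 D'}"
    using P unfolding projective_structure_def by blast
  obtain \<Upsilon>1 where f1: "one_form M 0 \<Upsilon>1"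
    and 1: "\<And>i x A B C. x \<in> U i \<Longrightarrow> D i x $ A $ B $ C = D0 i x $ A $ B $ C + \<Upsilon>1 i x $ A * kd B C + kd A B * \<Upsilon>1 i x $ C"
    using DP unfolding D0 projectively_equivalent_def by blast
  obtain \<Upsilon>2 where f2: "one_form M 0 \<Upsilon>2"
    and 2: "\<And>i x A B C. x \<in> U i \<Longrightarrow> D' i x $ A $ B $ C = D0 i x $ A $ B $ C + \<Upsilon>2 i x $ A * kd B C + kd A B * \<Upsilon>2 i x $ C"
    using assms unfolding D0 projectively_equivalent_def by blast
  define \<Upsilon> where "\<Upsilon> i x = \<Upsilon>2 i x - \<Upsilon>1 i x" for i x
  have "one_form M 0 \<Upsilon>"
    using f1 f2 unfolding one_form_def smooth_components_def \<Upsilon>_def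
    by (simp add: smooth_on_diff[OF U] mv_simps scaleR_diff_right transpose_matrix_vector vm_simps)
  moreover have "cm (D' i x) u *v a = cm (D i x) u *v a + (\<Upsilon> i x \<bullet> u) *\<^sub>R a + (\<Upsilon> i x \<bullet> a) *\<^sub>R u" if x: "x \<in> U i" for i x u a
  proof -
    have e: "D' i x $ A $ B $ C = D i x $ A $ B $ C + \<Upsilon> i x $ A * kd B C + kd A B * \<Upsilon> i x $ C" for A B C
      unfolding 1[OF x] 2[OF x] \<Upsilon>_def by (simp add: algebra_simps)
    have "(\<lambda>u a. cm (D' i x) u *v a) = (\<lambda>u a. cm (D i x) u *v a + (\<Upsilon> i x \<bullet> u) *\<^sub>R a + (\<Upsilon> i x \<bullet> a) *\<^sub>R u)"
    proof (rule bilinear_eq_stdbasis)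
      show "bilinear (\<lambda>u a. cm (D' i x) u *v a)" by (simp add: bilinear_def linear_iff cm_simps mv_simps)
      show "bilinear (\<lambda>u a. cm (D i x) u *v a + (\<Upsilon> i x \<bullet> u) *\<^sub>R a + (\<Upsilon> i x \<bullet> a) *\<^sub>R u)"
        by (simp add: bilinear_def linear_iff cm_simps mv_simps inner_simps algebra_simps)
      fix b c :: "real^'n" assume "b \<in> Basis" "c \<in> Basis"
      then obtain A B where bc: "b = axis A 1" "c = axis B 1" unfolding Basis_axis by blast
      show "cm (D' i x) b *v c = cm (D i x) b *v c + (\<Upsilon> i x \<bullet> b) *\<^sub>R c + (\<Upsilon> i x \<bullet> c) *\<^sub>R b"
        by (simp add: bc vec_eq_iff cm_axis mv_axis e inner_axis) (simp add: axis_def kd_def)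
    qed
    then show ?thesis by meson
  qed
  ultimately show ?thesis by (rule that)
qed

text \<open>Tracing the projective change shows that the logarithmic derivative of the scale changes
  by \<open>- \<Upsilon>\<close>. In \<open>pw_explicit\<close> this cancels the change of the
  Christoffel term, and only the ratio of the powers of the scales survives.\<close>

lemma pw_conformal:
  assumes D': "D' \<in> P" "special_connection M D'" and \<sigma>': "parallel_scale M D' \<sigma>'" and z: "z \<in> UU i"
  shows "pw_metric D' \<sigma>' i z a b = (\<sigma> i (fst z) / \<sigma>' i (fst z))\<^sup>2 * pw i z a b"
proof -
  interpret D': projective_manifold M P D' \<sigma>'
    by unfold_locales (use M dim P D' \<sigma>' in auto)
  obtain x p where zx: "z = (x, p)" and x: "x \<in> U i" using z by auto
  obtain u q where a: "a = (u, q)" by force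
  obtain u' q' where b: "b = (u', q')" by force
  obtain \<Upsilon> where Y: "\<And>u a. cm (D' i x) u *v a = cm (D i x) u *v a + (\<Upsilon> \<bullet> u) *\<^sub>R a + (\<Upsilon> \<bullet> a) *\<^sub>R u"
    using projective_difference[OF D'(1)] x by metis
  have pos: "\<sigma> i x > 0" "\<sigma>' i x > 0" using \<sigma>_pos[OF x] D'.\<sigma>_pos[OF x] .
  have t: "fd (\<sigma>' i) x u / \<sigma>' i x = fd (\<sigma> i) x u / \<sigma> i x - \<Upsilon> \<bullet> u" for u
  proof -
    have N: "real CARD('n) + 1 \<noteq> 0" by linarith
    have "(\<Sum>b\<in>Basis. (cm (D' i x) u *v b) \<bullet> b)
       = (\<Sum>b\<in>Basis. (cm (D i x) u *v b) \<bullet> b) + (\<Sum>b::real^'n\<in>Basis. (\<Upsilon> \<bullet> u) * (b \<bullet> b)) + (\<Sum>b\<in>Basis. (\<Upsilon> \<bullet> b) * (u \<bullet> b))"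
      by (simp add: Y inner_simps sum.distrib)
    then have "- (real CARD('n) + 1) * (fd (\<sigma>' i) x u / \<sigma>' i x)
       = - (real CARD('n) + 1) * (fd (\<sigma> i) x u / \<sigma> i x) + (real CARD('n) + 1) * (\<Upsilon> \<bullet> u)"
      unfolding chart.trace[OF x] D'.chart.trace[OF x] fd_phi[OF x] D'.fd_phi[OF x]
        sum_Basis_inner[OF bounded_linear.linear[OF bounded_linear_inner_right]]
      by (simp add: algebra_simps)
    moreover have "A = B - Z" if "- N * A = - N * B + N * Z" "N \<noteq> 0" for N A B Z :: real
    proof -
      have "N * (A - (B - Z)) = 0" using that(1) by (simp add: algebra_simps)
      then show ?thesis using that(2) by simp
    qed
    ultimately show ?thesis using N by blast
  qed
  have s: "\<sigma>' i x powr (-2) = (\<sigma> i x / \<sigma>' i x)\<^sup>2 * \<sigma> i x powr (-2)"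
    using pos by (simp add: powr_minus power_divide field_simps)
  have "pw_metric D' \<sigma>' i (x, p) (u, q) (u', q') = D'.pw i (x, p) (u, q) (u', q')" by (simp add: D'.pw_def)
  also have "\<dots> = (\<sigma> i x / \<sigma>' i x)\<^sup>2 * pw i (x, p) (u, q) (u', q')"
    unfolding pw_explicit[OF x] D'.pw_explicit[OF x] Y t s
    by (simp add: inner_simps algebra_simps)
  finally show ?thesis by (simp add: zx a b)
qed

lemma pw_class_conformal:
  assumes g: "g \<in> pw_class M P"
  shows "metric C g \<and> (\<forall>i. \<exists>F. smooth_on F (chart_image C i) \<and>
    (\<forall>z\<in>chart_image C i. F z > 0 \<and> (\<forall>a b. g i z a b = F z * pw i z a b)))"
proof (intro conjI allI)
  show "metric C g" using g by (simp add: pw_class_def)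
  fix i
  obtain D' \<sigma>' f where D': "D' \<in> P" "special_connection M D'" "parallel_scale M D' \<sigma>'"
    and f: "scalar_field C f" "\<And>i z. z \<in> chart_image C i \<Longrightarrow> f i z > 0 \<and> (\<forall>a b. g i z a b = f i z * pw_metric D' \<sigma>' i z a b)"
    using g unfolding pw_class_def conformal_to_def by blast
  interpret D': projective_manifold M P D' \<sigma>'
    by unfold_locales (use M dim P D' in auto)
  define F where "F z = f i z * (\<sigma> i (fst z) / \<sigma>' i (fst z))\<^sup>2" for z
  have pos: "\<sigma> i x > 0" "\<sigma>' i x > 0" if "x \<in> U i" for x using \<sigma>_pos[OF that] D'.\<sigma>_pos[OF that] .
  have sf: "smooth_on (f i) (UU i)"
    using f(1) unfolding scalar_field_def smooth_components_def chart_image_C by blast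
  have "smooth_on F (UU i)"
    unfolding F_def power2_eq_square
    by (intro smooth_on_mult sf open_UU smooth_on_divide smooth_on_fst_compose[OF U] smooth_\<sigma> D'.smooth_\<sigma>)
       (use pos in force)+
  moreover have "F z > 0 \<and> (\<forall>a b. g i z a b = F z * pw i z a b)" if z: "z \<in> UU i" for z
    using f(2)[of z i] z pos[of "fst z"] pw_conformal[OF D' z] by (auto simp: F_def chart_image_C)
  ultimately show "\<exists>F. smooth_on F (chart_image C i) \<and>
    (\<forall>z\<in>chart_image C i. F z > 0 \<and> (\<forall>a b. g i z a b = F z * pw i z a b))"
    unfolding chart_image_C by blast
qed

lemma pw_in_class: "pw \<in> pw_class M P"
proof -
  define f where "f i z = (if z \<in> chart_image C i then 1 else 0 :: real)" for i z
  have "smooth_on (f i) (chart_image C i)" for i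
    by (rule smooth_on_cong[OF open_chart_image[OF atlas_C], where f = "\<lambda>_. 1"]) (simp_all add: f_def)
  moreover have "f j (transition C i j z) = f i z" if "z \<in> overlap C i j" for i j z
    using subsetD[OF overlap_subset that] subsetD[OF overlap_subset transition_overlap[OF atlas_C that]]
    by (simp add: f_def)
  ultimately have "scalar_field C f"
    by (simp add: scalar_field_def smooth_components_def f_def)
  then have "conformal_to C (pw_metric D \<sigma>) pw"
    unfolding conformal_to_def by (intro exI[of _ f]) (simp add: f_def pw_def)
  then show ?thesis
    unfolding pw_class_def using metric_pw DP special scale by blast
qed

subsection \<open>Transport between the cotangent bundles\<close>

lemma transport_eq: "z \<in> UU i \<Longrightarrow> transport M \<sigma> Y i z = fd (\<Theta> i) (\<Phi> i z) (Y i (\<Phi> i z))"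
  by (simp add: transport_def restrict_chart_def chart_image_C \<Phi>_def \<Theta>_def)

lemma transport_off: "z \<notin> UU i \<Longrightarrow> transport M \<sigma> Y i z = 0"
  by (simp add: transport_def restrict_chart_def chart_image_C)

lemma smooth_transport:
  assumes Y: "smooth_on (Y i) (UU i)"
  shows "smooth_on (transport M \<sigma> Y i) (UU i)"
proof (rule smooth_on_cong[OF open_UU])
  show "fd (\<Theta> i) (\<Phi> i z) (Y i (\<Phi> i z)) = transport M \<sigma> Y i z" if "z \<in> UU i" for z
    using transport_eq[OF that] by simp
  show "smooth_on (\<lambda>z. fd (\<Theta> i) (\<Phi> i z) (Y i (\<Phi> i z))) (UU i)"
    by (rule smooth_on_compose[OF smooth_on_fd_apply[OF open_UU Y smooth_\<Theta>] smooth_\<Phi> open_UU open_UU])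
       (use \<Phi>_UU in blast)
qed

lemma vector_field_transport:
  assumes Y: "\<And>i. smooth_on (Y i) (UU i)"
    and law: "\<And>i j x p. x \<in> overlap M i j \<Longrightarrow> Y j (\<Psi> i j (x, p)) = fd (\<Psi> i j) (x, p) (Y i (x, p))"
  shows "vector_field C (transport M \<sigma> Y)"
  unfolding vector_field_def smooth_components_def
proof (intro conjI allI ballI impI)
  show "smooth_on (transport M \<sigma> Y i) (chart_image C i)" for i
    unfolding chart_image_C by (rule smooth_transport[OF Y])
  show "transport M \<sigma> Y i z = 0" if "z \<notin> chart_image C i" for i z
    using that transport_off by (simp add: chart_image_C)
  fix i j z assume "z \<in> overlap C i j"
  then obtain x p where z: "z = (x, p)" and x: "x \<in> overlap M i j" by (auto simp: overlap_C)
  let ?t = "transition C i j (x, p)" and ?\<zeta> = "\<Phi> i (x, p)"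
  have zU: "(x, p) \<in> UU i" and tU: "?t \<in> UU j" using x overlap_U by (simp_all add: transition_C)
  have "transport M \<sigma> Y j ?t = fd (\<Theta> j) (\<Phi> j ?t) (Y j (\<Psi> i j ?\<zeta>))"
    unfolding transport_eq[OF tU] by (simp only: \<Phi>_transition[OF x])
  also have "Y j (\<Psi> i j ?\<zeta>) = fd (\<Psi> i j) ?\<zeta> (Y i ?\<zeta>)"
    unfolding \<Phi>_apply by (rule law[OF x])
  also have "\<dots> = fd (\<Psi> i j) ?\<zeta> (fd (\<Phi> i) (x, p) (transport M \<sigma> Y i (x, p)))"
    unfolding transport_eq[OF zU] by (simp only: fd_\<Phi>\<Theta>'[OF zU])
  also have "\<dots> = fd (\<Phi> j) ?t (dtrans C i j (x, p) (transport M \<sigma> Y i (x, p)))"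
    by (simp only: fd_\<Phi>_transition[OF x])
  finally show "transport M \<sigma> Y j (transition C i j z) = dtrans C i j z (transport M \<sigma> Y i z)"
    unfolding z by (simp only: fd_\<Theta>\<Phi>[OF tU])
qed

text \<open>What a lift has to satisfy on \<open>T^*M\<close>: smoothness, compatibility with
  \<open>\<Psi>\<close>, and the pointwise equation for \<open>pwf\<close>. Naturality under
  \<open>\<Phi>\<close> and \<open>pw_class_conformal\<close> extend it to every metric of the class
  on \<open>T^*M(2)\<close>.\<close>

lemma killing_transport:
  assumes Y: "\<And>i. smooth_on (Y i) (UU i)"
    and law: "\<And>i j x p. x \<in> overlap M i j \<Longrightarrow> Y j (\<Psi> i j (x, p)) = fd (\<Psi> i j) (x, p) (Y i (x, p))"
    and lie: "\<And>i x p. x \<in> U i \<Longrightarrow> \<exists>c. \<forall>a b. lie_metric (Y i) (pwf (D i)) (x, p) a b = c * pwf (D i) (x, p) a b"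
  shows "conformal_killing C (pw_class M P) (transport M \<sigma> Y)"
proof (rule conformal_killingI[OF atlas_C vector_field_transport[OF Y law] pw_class_conformal])
  show "smooth_on (\<lambda>z. pw i z u v) (chart_image C i)" for i u v
    unfolding chart_image_C by (rule smooth_pw)
  fix i z assume "z \<in> chart_image C i"
  then have z: "z \<in> UU i" by (simp add: chart_image_C)
  obtain c where c: "\<And>a b. lie_metric (Y i) (pwf (D i)) (\<Phi> i z) a b = c * pwf (D i) (\<Phi> i z) a b"
    using lie[of "fst (\<Phi> i z)" i "snd (\<Phi> i z)"] \<Phi>_UU[OF z] by (auto simp: mem_Times_iff)
  have "lie_metric (transport M \<sigma> Y i) (pw i) z a b = lie_metric (Y i) (pwf (D i)) (\<Phi> i z) (fd (\<Phi> i) z a) (fd (\<Phi> i) z b)" for a b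
  proof (rule lie_metric_natural[OF open_UU z smooth_\<Phi>])
    show "transport M \<sigma> Y i differentiable at z" by (rule smooth_on_differentiable[OF smooth_transport[of Y, OF Y] z])
    show "Y i differentiable at (\<Phi> i z)" by (rule smooth_on_differentiable[OF Y \<Phi>_UU[OF z]])
    show "Y i (\<Phi> i y) = fd (\<Phi> i) y (transport M \<sigma> Y i y)" if "y \<in> UU i" for y
      unfolding transport_eq[OF that] by (simp only: fd_\<Phi>\<Theta>'[OF that])
    show "(\<lambda>y. pwf (D i) y u v) differentiable at (\<Phi> i z)" for u v
    proof -
      have "smooth_on (\<lambda>y. pwf (D i) y u v) (UU i)"
        unfolding pwf_def
        by (intro smooth_on_diff smooth_on_mult smooth_on_inner smooth_on_const
            smooth_on_bilinear[OF bounded_bilinear_mv] smooth_on_bilinear[OF bounded_bilinear_cm]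
            smooth_on_fst_compose[OF U smD] smooth_on_linear[OF bounded_linear_snd] open_UU)
      then show ?thesis using \<Phi>_UU[OF z] by (rule smooth_on_differentiable)
    qed
    show "bilinear (pwf (D i) (\<Phi> i y))" for y by (rule bilinear_pwf)
  qed (rule pw_pwf)
  then show "\<exists>c. \<forall>u v. lie_metric (transport M \<sigma> Y i) (pw i) z u v = c * pw i z u v"
    using c pw_pwf by auto
qed

end

subsection \<open>The Lie derivative of a connection\<close>

text \<open>All derivatives of \<open>X\<close> cancel, the second ones by symmetry, so the
  commutator is tensorial in \<open>X\<close> and equals the Lie derivative of the
  connection.\<close>

lemma lie_diff_lie_conn:
  fixes D :: "('i, 'n::finite) conn"
  assumes S: "open S" "x \<in> S" and D: "smooth_on (D i) S" and v: "smooth_on v S" and X: "smooth_on X S"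
  shows "lie_tensor v (nabla_vec D i X) x $ A $ B - nabla_vec D i (lie_vec v X) x $ A $ B
    = lie_conn v (D i) x (axis A 1) (X x) $ B"
proof -
  let ?G = "D i" and ?e = "\<lambda>A::'n. axis A (1::real)"
  have T: "nabla_vec D i X y $ A = fd X y (?e A) + cm (?G y) (?e A) *v X y" for y A
    by (simp add: vec_eq_iff nabla_vec_def pd_def cm_axis matrix_vector_mult_def)
  have dX: "(X has_derivative fd X x) (at x)" and dv: "(v has_derivative fd v x) (at x)"
    and dG: "(?G has_derivative fd ?G x) (at x)"
    using X v D S(2) by (auto intro: smooth_on_has_derivative)
  have d2X: "((\<lambda>y. fd X y c) has_derivative fd (\<lambda>y. fd X y c) x) (at x)" for c
    by (rule smooth_on_has_derivative[OF smooth_on_fd[OF X] S(2)])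
  have d2v: "((\<lambda>y. fd v y c) has_derivative fd (\<lambda>y. fd v y c) x) (at x)" for c
    by (rule smooth_on_has_derivative[OF smooth_on_fd[OF v] S(2)])
  have linX: "linear (fd X y)" "linear (fd v y)" if "y \<in> S" for y
    using that X v by (auto intro: linear_fd smooth_on_differentiable)
  have dT: "((\<lambda>y. nabla_vec D i X y $ A) has_derivative
      (\<lambda>u. fd (\<lambda>y. fd X y (?e A)) x u + (cm (?G x) (?e A) *v fd X x u + cm (fd ?G x u) (?e A) *v X x))) (at x)" for A
    unfolding T
    by (intro has_derivative_add d2X bounded_bilinear.FDERIV[OF bounded_bilinear_mv
          bounded_linear.has_derivative[OF bounded_bilinear.bounded_linear_left[OF bounded_bilinear_cm] dG] dX])
  have smT: "smooth_on (nabla_vec D i X) S"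
  proof (rule smooth_on_vec[OF S(1)])
    show "smooth_on (\<lambda>y. nabla_vec D i X y $ A) S" for A
      unfolding T by (intro smooth_on_add S smooth_on_fd X smooth_on_bilinear[OF bounded_bilinear_mv]
          smooth_on_bilinear[OF bounded_bilinear_cm] D smooth_on_const)
  qed
  have dTn: "nabla_vec D i X differentiable at x" by (rule smooth_on_differentiable[OF smT S(2)])
  have dTA: "fd (nabla_vec D i X) x u $ A = fd (\<lambda>y. fd X y (?e A)) x u + (cm (?G x) (?e A) *v fd X x u + cm (fd ?G x u) (?e A) *v X x)" for u A
    using fd_bounded_linear[OF bounded_linear_vec_nth dTn] fd_eq[OF dT] by metis
  have 1: "(\<Sum>C\<in>UNIV. v x $ C * pd C (nabla_vec D i X) x $ A $ B) = fd (nabla_vec D i X) x (v x) $ A $ B"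
    unfolding pd_def by (subst (2) linear_axis_expand[OF linear_fd[OF dTn]]) simp
  have linT: "linear (\<lambda>u. fd X x u + cm (?G x) u *v X x)"
    using linX(1)[OF S(2)] by (simp add: linear_iff cm_simps mv_simps algebra_simps)
  have 2: "(\<Sum>C\<in>UNIV. pd A v x $ C * nabla_vec D i X x $ C $ B) = (fd X x (fd v x (?e A)) + cm (?G x) (fd v x (?e A)) *v X x) $ B"
    unfolding pd_def T by (subst (2) linear_axis_expand[OF linT]) simp
  have 3: "(\<Sum>C\<in>UNIV. pd C v x $ B * nabla_vec D i X x $ A $ C) = fd v x (fd X x (?e A) + cm (?G x) (?e A) *v X x) $ B"
    unfolding pd_def T by (subst (2) linear_axis_expand[OF linX(2)[OF S(2)]]) (simp add: mult.commute)
  have dL: "((\<lambda>y. lie_vec v X y) has_derivative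
      (\<lambda>u. (fd (\<lambda>y. fd X y (v x)) x u + fd X x (fd v x u)) - (fd (\<lambda>y. fd v y (X x)) x u + fd v x (fd X x u)))) (at x)"
    unfolding lie_vec_def
    by (intro has_derivative_diff has_derivative_linear_family[OF S] linX differentiableI[OF d2X] differentiableI[OF d2v] dX dv)
  have 4: "nabla_vec D i (lie_vec v X) x $ A = (fd (\<lambda>y. fd X y (v x)) x (?e A) + fd X x (fd v x (?e A)))
      - (fd (\<lambda>y. fd v y (X x)) x (?e A) + fd v x (fd X x (?e A))) + cm (?G x) (?e A) *v (fd X x (v x) - fd v x (X x))"
    by (simp add: vec_eq_iff nabla_vec_def pd_def fd_eq[OF dL, unfolded eta_contract_eq] cm_axis matrix_vector_mult_def lie_vec_def)
  show ?thesis
    using fd_commute[OF S X, of "?e A" "v x"]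
    unfolding lie_tensor_def lie_conn_def
    by (simp add: 1 2 3 4 dTA mv_simps linear_add[OF linX(2)[OF S(2)]])
qed

lemma trace_conjugate:
  fixes J K :: "real^'n^'n"
  assumes N: "linear N" "linear N'" and J: "J ** K = mat 1" "K ** J = mat 1" and c: "\<And>a. N' (J *v a) = J *v N a"
  shows "(\<Sum>b\<in>Basis. N' b \<bullet> b) = (\<Sum>b\<in>Basis. N b \<bullet> b)"
proof -
  have l: "linear (\<lambda>a. J *v N a)" "linear ((*v) K)"
    using N(1) by (simp_all add: linear_iff mv_simps)
  have "N' b = J *v N (K *v b)" for b
    using c[of "K *v b"] J by (simp add: matrix_vector_mul_assoc)
  then have "(\<Sum>b\<in>Basis. N' b \<bullet> b) = (\<Sum>b\<in>Basis. (K *v (J *v N b)) \<bullet> b)"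
    using trace_commute[OF l] by simp
  then show ?thesis using J by (simp add: matrix_vector_mul_assoc)
qed

context projective_manifold
begin

subsection \<open>Lifts as standard fields\<close>

lemma smooth_std_field:
  assumes "smooth_on v (U i)" "smooth_on w (U i)" "smooth_on \<alpha> (U i)" "smooth_on s (U i)" "smooth_on \<nu> (U i)"
  shows "smooth_on (std_field (D i) v w \<alpha> s \<nu>) (UU i)"
proof -
  have "std_field (D i) v w \<alpha> s \<nu> = (\<lambda>z. (v (fst z) + snd z v* w (fst z),
      \<alpha> (fst z) - snd z v* matrix (fd v (fst z)) + s (fst z) *\<^sub>R snd z
       + snd z v* cm (D i (fst z)) (snd z v* w (fst z)) - (\<nu> (fst z) \<bullet> snd z) *\<^sub>R snd z))"
    by (auto simp: std_field_def)
  then show ?thesis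
    by (simp only:) (intro smooth_on_Pair smooth_on_add smooth_on_diff smooth_on_scaleR smooth_on_inner
        smooth_on_bilinear[OF bounded_bilinear_vm] smooth_on_bilinear[OF bounded_bilinear_cm]
        smooth_on_fst_compose[OF U] smooth_on_matrix_fd[OF U] smooth_on_linear[OF bounded_linear_snd]
        open_UU assms smD)
qed

lemma transport_cong:
  assumes "\<And>i x p. x \<in> U i \<Longrightarrow> Y i (x, p) = Y' i (x, p)"
  shows "transport M \<sigma> Y = transport M \<sigma> Y'"
proof (intro ext)
  fix i z
  show "transport M \<sigma> Y i z = transport M \<sigma> Y' i z"
  proof (cases "z \<in> UU i")
    case True
    then show ?thesis
      using assms[of "fst z" i] by (cases z) (auto simp: transport_eq \<Phi>_apply)
  qed (simp add: transport_off)
qed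

lemma sum_hor: "(\<Sum>A\<in>UNIV. y $ A *\<^sub>R hor D i (x, p) A) = (y, p v* cm (D i x) y)"
proof -
  have h: "hor D i (x, p) A = (axis A 1, p v* D i x $ A)" for A
    by (simp add: hor_def vec_eq_iff vm_nth mult.commute)
  have "linear (\<lambda>y. (y, p v* cm (D i x) y))"
    by (simp add: linear_iff cm_simps vm_simps)
  from linear_axis_expand[OF this, of y] show ?thesis by (simp add: h cm_axis)
qed

lemma lift_zero_transport:
  assumes v: "\<And>i. smooth_on (v i) (U i)"
  shows "lift_zero M D \<sigma> v = transport M \<sigma> (\<lambda>i. std_field (D i) (v i) (\<lambda>x. 0) (\<lambda>x. 0)
    (\<lambda>x. 2 / (real CARD('n) + 1) * chart.divg i (v i) x) (\<lambda>x. 0))"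
  unfolding lift_zero_def
proof (rule transport_cong)
  fix i :: 'i and x p :: "real^'n" assume x: "x \<in> U i"
  let ?n = "real CARD('n)"
  let ?Dv = "nabla_vec D i (v i) x"
  have dv: "v i differentiable at x" by (rule smooth_on_differentiable[OF v x])
  define \<psi> where "\<psi> = 1 / ?n * (\<Sum>C\<in>UNIV. ?Dv $ C $ C)"
  have Dv: "?Dv $ A $ B = (fd (v i) x (axis A 1) + cm (D i x) (v i x) *v axis A 1) $ B" for A B
    unfolding nabla_vec_nth chart.sym[OF x, of "axis A 1"] ..
  have "chart.divg i (v i) x = (\<Sum>C\<in>UNIV. ?Dv $ C $ C)"
    unfolding chart.divg_def chart.trace[OF x, symmetric] sum.distrib[symmetric] Dv
    by (simp add: sum_Basis_axis inner_axis)
  then have d: "chart.divg i (v i) x = ?n * \<psi>" using dim by (simp add: \<psi>_def)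
  have q: "(\<chi> B. \<Sum>A\<in>UNIV. (?Dv $ B $ A - kd B A * \<psi>) * p $ A) = p v* matrix (fd (v i) x) + p v* cm (D i x) (v i x) - \<psi> *\<^sub>R p"
  proof -
    have "(\<Sum>A\<in>UNIV. (?Dv $ B $ A - kd B A * \<psi>) * p $ A) = (p v* matrix (fd (v i) x) + p v* cm (D i x) (v i x) - \<psi> *\<^sub>R p) $ B" for B
    proof -
      have "(\<Sum>A\<in>UNIV. kd B A * \<psi> * p $ A) = \<psi> * p $ B"
        by (simp add: kd_def if_distrib[of "\<lambda>x. x * _"] cong: if_cong)
      then show ?thesis
        unfolding Dv
        by (simp add: left_diff_distrib right_diff_distrib sum_subtractf vm_nth matrix_def mv_axis distrib_right distrib_left sum.distrib mult.commute)
    qed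
    then show ?thesis by (simp add: vec_eq_iff)
  qed
  \<comment> \<open>The trace part removed from \<open>\<phi>\<close> gives back
    \<open>\<psi>\<close>, and the multiple of the Euler field \<open>2p\<close> adds
    \<open>(n - 1) / (n + 1) \<psi>\<close>. The sum is \<open>2n / (n + 1) \<psi>\<close>, where
    \<open>n \<psi>\<close> is the divergence.\<close>
  have r: "2 / (?n + 1) * (?n * \<psi>) = \<psi> + (?n - 1) / (2 * (?n + 1)) * \<psi> * 2"
  proof -
    have "?n + 1 \<noteq> 0" by linarith
    then show ?thesis by (simp add: divide_simps) (simp add: algebra_simps)
  qed
  have "(\<Sum>A\<in>UNIV. v i x $ A *\<^sub>R hor D i (x, p) A) - (0, \<chi> B. \<Sum>A\<in>UNIV. (?Dv $ B $ A - kd B A * \<psi>) * p $ A)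
      + ((?n - 1) / (2 * (?n + 1)) * \<psi>) *\<^sub>R (0, 2 *\<^sub>R p)
    = std_field (D i) (v i) (\<lambda>x. 0) (\<lambda>x. 0) (\<lambda>x. 2 / (?n + 1) * chart.divg i (v i) x) (\<lambda>x. 0) (x, p)"
    unfolding sum_hor q std_field_def prod.case d r
    by (simp add: vm_simps cm_simps scaleR_add_left)
  then show "(case (x, p) of (x, p) \<Rightarrow> let n = real CARD('n); Dv = nabla_vec D i (v i) x; \<psi> = 1 / n * (\<Sum>C\<in>UNIV. Dv $ C $ C);
       \<phi> = \<lambda>A B. Dv $ A $ B - kd A B * \<psi>
     in (\<Sum>A\<in>UNIV. v i x $ A *\<^sub>R hor D i (x, p) A) - (0, \<chi> B. \<Sum>A\<in>UNIV. \<phi> B A * p $ A)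
        + ((n - 1) / (2 * (n + 1)) * \<psi>) *\<^sub>R (0, 2 *\<^sub>R p))
    = std_field (D i) (v i) (\<lambda>x. 0) (\<lambda>x. 0) (\<lambda>x. 2 / (real CARD('n) + 1) * chart.divg i (v i) x) (\<lambda>x. 0) (x, p)"
    by (simp only: prod.case Let_def \<psi>_def)
qed

definition biv_nu :: "('i \<Rightarrow> real^'n \<Rightarrow> real^'n^'n) \<Rightarrow> 'i \<Rightarrow> real^'n \<Rightarrow> real^'n" where
  "biv_nu w' i x = (\<chi> A. 1 / (real CARD('n) - 1) * (\<Sum>C\<in>UNIV. nabla_biv 0 D i (w' i) x $ C $ C $ A))"

lemma lift_plus_transport:
  "lift_plus M D \<sigma> w = transport M \<sigma> (\<lambda>i. std_field (D i) (\<lambda>x. 0) (trivialize \<sigma> (-2) w i) (\<lambda>x. 0) (\<lambda>x. 0)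
    (biv_nu (trivialize \<sigma> (-2) w) i))"
  unfolding lift_plus_def
proof (rule transport_cong)
  fix i :: 'i and x p :: "real^'n" assume x: "x \<in> U i"
  let ?w = "trivialize \<sigma> (-2) w"
  have "(\<Sum>A\<in>UNIV. \<Sum>B\<in>UNIV. (?w i x $ A $ B * p $ A) *\<^sub>R hor D i (x, p) B)
    = (\<Sum>B\<in>UNIV. (p v* ?w i x) $ B *\<^sub>R hor D i (x, p) B)"
    by (subst sum.swap) (simp add: vm_nth scaleR_sum_left mult.commute)
  also have "\<dots> = (p v* ?w i x, p v* cm (D i x) (p v* ?w i x))" by (rule sum_hor)
  finally have h: "(\<Sum>A\<in>UNIV. \<Sum>B\<in>UNIV. (?w i x $ A $ B * p $ A) *\<^sub>R hor D i (x, p) B) = (p v* ?w i x, p v* cm (D i x) (p v* ?w i x))" .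
  have n: "(\<Sum>B\<in>UNIV. 1 / (real CARD('n) - 1) * (\<Sum>C\<in>UNIV. nabla_biv 0 D i (?w i) x $ C $ C $ B) * p $ B) = biv_nu ?w i x \<bullet> p"
    by (simp add: inner_vec_def biv_nu_def)
  show "(case (x, p) of (x, p) \<Rightarrow> let w' = ?w; \<nu> = \<lambda>A. 1 / (real CARD('n) - 1) * (\<Sum>C\<in>UNIV. nabla_biv 0 D i (w' i) x $ C $ C $ A)
     in (\<Sum>A\<in>UNIV. \<Sum>B\<in>UNIV. (w' i x $ A $ B * p $ A) *\<^sub>R hor D i (x, p) B) - (1 / 2 * (\<Sum>B\<in>UNIV. \<nu> B * p $ B)) *\<^sub>R (0, 2 *\<^sub>R p))
    = std_field (D i) (\<lambda>x. 0) (?w i) (\<lambda>x. 0) (\<lambda>x. 0) (biv_nu ?w i) (x, p)"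
    unfolding prod.case Let_def h n by (simp add: std_field_def matrix_zero_map vm_simps)
qed

lemma lift_minus_transport:
  "lift_minus M \<sigma> \<alpha> = transport M \<sigma> (\<lambda>i. std_field (D i) (\<lambda>x. 0) (\<lambda>x. 0) (trivialize \<sigma> 2 \<alpha> i) (\<lambda>x. 0) (\<lambda>x. 0))"
  unfolding lift_minus_def
  by (rule transport_cong) (simp add: std_field_def matrix_zero_map vm_simps cm_simps)

subsection \<open>Transformation laws\<close>

lemma fd_transition: "x \<in> overlap M i j \<Longrightarrow> fd (transition M i j) x u = jacobian M i j x *v u"
  using dtrans_jacobian by (simp add: dtrans_def)

lemma has_derivative_transition:
  "x \<in> overlap M i j \<Longrightarrow> (transition M i j has_derivative (\<lambda>u. jacobian M i j x *v u)) (at x)"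
  using smooth_on_has_derivative[OF smooth_transition[OF atlas], of x i j] fd_transition[of x i j] by (simp add: eta_contract_eq[symmetric] fun_eq_iff has_derivative_eq_rhs)

lemma fd_vector_law:
  assumes x: "x \<in> overlap M i j" and v: "\<And>i. smooth_on (v i) (U i)"
    and law: "\<And>y. y \<in> overlap M i j \<Longrightarrow> v j (transition M i j y) = jacobian M i j y *v v i y"
  shows "fd (v j) (transition M i j x) (jacobian M i j x *v a) = hess i j x a (v i x) + jacobian M i j x *v fd (v i) x a"
proof -
  note o = open_overlap[OF atlas, of i j]
  have 1: "((\<lambda>y. v j (transition M i j y)) has_derivative (\<lambda>a. fd (v j) (transition M i j x) (jacobian M i j x *v a))) (at x)"
    by (rule has_derivative_compose[OF has_derivative_transition[OF x] smooth_on_has_derivative[OF v overlap_U(2)[OF x]]])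
  have "((\<lambda>y. jacobian M i j y *v v i y) has_derivative
      (\<lambda>a. jacobian M i j x *v fd (v i) x a + fd (jacobian M i j) x a *v v i x)) (at x)"
    by (rule bounded_bilinear.FDERIV[OF bounded_bilinear_mv smooth_on_has_derivative[OF smooth_jacobian x]
          smooth_on_has_derivative[OF v overlap_U(1)[OF x]]])
  then have "((\<lambda>y. v j (transition M i j y)) has_derivative
      (\<lambda>a. jacobian M i j x *v fd (v i) x a + fd (jacobian M i j) x a *v v i x)) (at x)"
    by (rule has_derivative_transform_within_open[OF _ o x]) (simp only: law)
  have e: "fd (v j) (transition M i j x) (jacobian M i j x *v a)
      = jacobian M i j x *v fd (v i) x a + fd (jacobian M i j) x a *v v i x"
    by (rule fun_cong[OF has_derivative_unique[OF 1 \<open>((\<lambda>y. v j (transition M i j y)) has_derivative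
      (\<lambda>a. jacobian M i j x *v fd (v i) x a + fd (jacobian M i j) x a *v v i x)) (at x)\<close>]])
  show ?thesis unfolding e fd_jacobian[OF x] by (rule add.commute)
qed

text \<open>The divergence is the trace of the endomorphism sending \<open>a\<close> to the
  covariant derivative of \<open>v\<close> along \<open>a\<close>; a change of charts conjugates it
  by the Jacobian, the Hessians of \<open>fd_vector_law\<close> and \<open>connection_law\<close>
  cancelling each other.\<close>

lemma divg_law:
  assumes x: "x \<in> overlap M i j" and v: "\<And>i. smooth_on (v i) (U i)"
    and law: "\<And>y. y \<in> overlap M i j \<Longrightarrow> v j (transition M i j y) = jacobian M i j y *v v i y"
  shows "chart.divg j (v j) (transition M i j x) = chart.divg i (v i) x"
proof -
  have d: "chart.divg k (v k) y = (\<Sum>b\<in>Basis. (fd (v k) y b + cm (D k y) (v k y) *v b) \<bullet> b)" if "y \<in> U k" for k y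
    unfolding chart.divg_def chart.trace[OF that, symmetric] by (simp add: inner_add_left sum.distrib)
  have l: "linear (\<lambda>b. fd (v k) y b + cm (D k y) (v k y) *v b)" if "y \<in> U k" for k y
    by (intro linear_compose_add linear_fd[OF smooth_on_differentiable[OF v that]] linear_cm(1))
  show ?thesis
    unfolding d[OF overlap_U(1)[OF x]] d[OF overlap_U(2)[OF x]]
  proof (rule trace_conjugate[OF l[OF overlap_U(1)[OF x]] l[OF overlap_U(2)[OF x]] jacobian_inverse(2,1)[OF x]])
    fix a
    have f: "fd (v j) (transition M i j x) (jacobian M i j x *v a) = hess i j x a (v i x) + jacobian M i j x *v fd (v i) x a"
      by (rule fd_vector_law[OF x v law])
    show "fd (v j) (transition M i j x) (jacobian M i j x *v a) + cm (D j (transition M i j x)) (v j (transition M i j x)) *v (jacobian M i j x *v a)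
      = jacobian M i j x *v (fd (v i) x a + cm (D i x) (v i x) *v a)"
      unfolding f law[OF x] mv_simps connection_law[OF x DP] hess_sym[OF x, of "v i x"]
      by simp
  qed
qed

lemma p_jac: "x \<in> overlap M i j \<Longrightarrow> (p v* invjac i j x) \<bullet> (jacobian M i j x *v a) = p \<bullet> a"
  using dot_lmul_matrix[of "p v* invjac i j x" "jacobian M i j x" a] invjac(1)[of x i j p] by simp

text \<open>In the fibre component the derivative of \<open>v\<close> contributes the Hessian in
  direction \<open>v\<close>, the Christoffel term the one in direction \<open>p v* w\<close>.
  Together they form the Hessian in the direction of the base component, as \<open>fd_\<Psi>\<close>
  requires.\<close>

lemma std_field_law:
  assumes x: "x \<in> overlap M i j"
    and smv: "\<And>i. smooth_on (v i) (U i)"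
    and v: "\<And>y. y \<in> overlap M i j \<Longrightarrow> v j (transition M i j y) = jacobian M i j y *v v i y"
    and w: "\<And>p. (p v* invjac i j x) v* w j (transition M i j x) = jacobian M i j x *v (p v* w i x)"
    and \<alpha>: "\<alpha> j (transition M i j x) v* jacobian M i j x = \<alpha> i x"
    and s: "s j (transition M i j x) = s i x"
    and \<nu>: "\<nu> j (transition M i j x) = jacobian M i j x *v \<nu> i x"
  shows "std_field (D j) (v j) (w j) (\<alpha> j) (s j) (\<nu> j) (\<Psi> i j (x, p))
    = fd (\<Psi> i j) (x, p) (std_field (D i) (v i) (w i) (\<alpha> i) (s i) (\<nu> i) (x, p))"
proof -
  let ?J = "jacobian M i j x" and ?t = "transition M i j x" and ?p = "p v* invjac i j x"
  let ?Y = "std_field (D i) (v i) (w i) (\<alpha> i) (s i) (\<nu> i) (x, p)"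
  let ?Z = "std_field (D j) (v j) (w j) (\<alpha> j) (s j) (\<nu> j) (\<Psi> i j (x, p))"
  obtain u q where Y: "?Y = (u, q)" by force
  have uq: "u = v i x + p v* w i x"
    "q = \<alpha> i x - p v* matrix (fd (v i) x) + s i x *\<^sub>R p + p v* cm (D i x) (p v* w i x) - (\<nu> i x \<bullet> p) *\<^sub>R p"
    using Y by (simp_all add: std_field_def)
  have Z: "?Z = (v j ?t + ?p v* w j ?t, \<alpha> j ?t - ?p v* matrix (fd (v j) ?t) + s j ?t *\<^sub>R ?p
      + ?p v* cm (D j ?t) (?p v* w j ?t) - (\<nu> j ?t \<bullet> ?p) *\<^sub>R ?p)"
    by (simp add: \<Psi>_def std_field_def)
  have dv: "v i differentiable at x" "v j differentiable at ?t"
    using smooth_on_differentiable[OF smv] overlap_U[OF x] by blast+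
  have "fst ?Z = fst (fd (\<Psi> i j) (x, p) (u, q))"
    unfolding Z fd_\<Psi>(1)[OF x] uq by (simp add: v[OF x] w mv_simps)
  moreover have "snd ?Z = snd (fd (\<Psi> i j) (x, p) (u, q))"
  proof (rule jac_eqI[OF x])
    fix a
    have n: "\<nu> j ?t \<bullet> ?p = \<nu> i x \<bullet> p"
      using p_jac[OF x, of p "\<nu> i x"] by (simp add: \<nu> inner_commute)
    have al: "\<alpha> j ?t \<bullet> (?J *v a) = \<alpha> i x \<bullet> a"
      using dot_lmul_matrix[of "\<alpha> j ?t" ?J a] \<alpha> by simp
    have g: "?p \<bullet> (cm (D j ?t) (?J *v (p v* w i x)) *v (?J *v a)) = p \<bullet> (cm (D i x) (p v* w i x) *v a) - ?p \<bullet> hess i j x (p v* w i x) a"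
    proof -
      have "?p \<bullet> (?J *v (cm (D i x) (p v* w i x) *v a))
          = ?p \<bullet> hess i j x (p v* w i x) a + ?p \<bullet> (cm (D j ?t) (?J *v (p v* w i x)) *v (?J *v a))"
        unfolding connection_law[OF x DP] by (rule inner_add_right)
      then show ?thesis by (simp add: p_jac[OF x])
    qed
    have f: "fd (v j) ?t (?J *v a) = hess i j x a (v i x) + ?J *v fd (v i) x a"
      by (rule fd_vector_law[OF x smv v])
    have dvj: "(?p v* matrix (fd (v j) ?t)) \<bullet> (?J *v a) = ?p \<bullet> hess i j x (v i x) a + p \<bullet> fd (v i) x a"
      unfolding dot_lmul_matrix[of ?p "matrix _"] matrix_fd_works[OF dv(2)] f inner_add_right p_jac[OF x] hess_sym[OF x, of a] ..
    have hs: "hess i j x u a = hess i j x (v i x) a + hess i j x (p v* w i x) a"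
      unfolding uq by (rule linear_add[OF linear_hess(1)[OF x]])
    have "snd ?Z \<bullet> (?J *v a) = \<alpha> i x \<bullet> a - (?p \<bullet> hess i j x (v i x) a + p \<bullet> fd (v i) x a) + s i x * (p \<bullet> a)
       + (p \<bullet> (cm (D i x) (p v* w i x) *v a) - ?p \<bullet> hess i j x (p v* w i x) a) - (\<nu> i x \<bullet> p) * (p \<bullet> a)"
      unfolding Z snd_conv inner_add_left inner_diff_left inner_scaleR_left al dvj p_jac[OF x] s n
        dot_lmul_matrix[of ?p "cm (D j ?t) _"] w g ..
    also have "\<dots> = q \<bullet> a - ?p \<bullet> hess i j x u a"
      unfolding uq(2) hs by (simp add: inner_simps dot_lmul_matrix matrix_fd_works[OF dv(1)])
    finally show "snd ?Z \<bullet> (?J *v a) = snd (fd (\<Psi> i j) (x, p) (u, q)) \<bullet> (?J *v a)"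
      unfolding fd_\<Psi>(2)[OF x] .
  qed
  ultimately show ?thesis unfolding Y by (simp add: prod_eq_iff)
qed

end

section \<open>Weighted one-forms and the lift of Killing forms\<close>

lemma bilinear_zero_axis:
  fixes f :: "real^'n \<Rightarrow> real^'n \<Rightarrow> 'b::real_vector"
  assumes "\<And>a. linear (\<lambda>u. f u a)" "\<And>u. linear (f u)" "\<And>A B. f (axis A 1) (axis B 1) = 0"
  shows "f u a = 0"
  by (subst linear_axis_expand[OF assms(1)], subst linear_axis_expand[OF assms(2)]) (simp add: assms(3))

lemma linear_nabla_w_fibre: "linear (\<lambda>p. nabla_w G w x u p q)" "linear (\<lambda>q. nabla_w G w x u p q)"
  by (simp_all add: linear_iff nabla_w_def mv_simps vm_simps inner_simps algebra_simps)

lemma linear_nabla_w_base: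
  assumes "w differentiable at x"
  shows "linear (\<lambda>u. nabla_w G w x u p q)"
  by (simp add: linear_iff nabla_w_def linear_add[OF linear_fd[OF assms]] linear_scale[OF linear_fd[OF assms]]
      cm_simps mv_simps inner_simps algebra_simps)

context projective_manifold
begin

lemma smooth_trivialize: "smooth_on (T i) (U i) \<Longrightarrow> smooth_on (trivialize \<sigma> k T i) (U i)"
  unfolding trivialize_def by (intro smooth_on_scaleR smooth_on_powr U smooth_\<sigma> \<sigma>_pos)

lemma one_form_smooth: "one_form M k \<alpha> \<Longrightarrow> smooth_on (\<alpha> i) (U i)"
  unfolding one_form_def smooth_components_def by blast

lemma one_form_law:
  assumes "one_form M k \<alpha>" "x \<in> overlap M i j"
  shows "\<alpha> j (transition M i j x) v* jacobian M i j x = weight_factor M k i j x *\<^sub>R \<alpha> i x"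
proof -
  have "transpose (jacobian M i j x) *v \<alpha> j (transition M i j x) = weight_factor M k i j x *\<^sub>R \<alpha> i x"
    using assms unfolding one_form_def by blast
  then show ?thesis by (simp only: transpose_matrix_vector)
qed

lemma trivialize_form_law:
  assumes a: "one_form M 2 \<alpha>" and x: "x \<in> overlap M i j"
  shows "trivialize \<sigma> 2 \<alpha> j (transition M i j x) v* jacobian M i j x = trivialize \<sigma> 2 \<alpha> i x"
  using scale_weight[OF x, of "- 2"] by (simp add: trivialize_def vm_simps one_form_law[OF a x])

lemma killing_form_equation:
  assumes a: "smooth_on (\<alpha> i) (U i)" and x: "x \<in> U i"
  shows "(\<forall>A B. (nabla_form 2 D i (\<alpha> i) x $ A $ B + nabla_form 2 D i (\<alpha> i) x $ B $ A) / 2 = 0) \<longleftrightarrow>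
    (\<forall>u u'. fd (trivialize \<sigma> 2 \<alpha> i) x u \<bullet> u' + fd (trivialize \<sigma> 2 \<alpha> i) x u' \<bullet> u
      = 2 * (trivialize \<sigma> 2 \<alpha> i x \<bullet> (cm (D i x) u *v u')))" (is "?L \<longleftrightarrow> ?R")
proof -
  let ?a = "trivialize \<sigma> 2 \<alpha> i"
  define f where "f u u' = fd ?a x u \<bullet> u' + fd ?a x u' \<bullet> u - 2 * (?a x \<bullet> (cm (D i x) u *v u'))" for u u'
  have l: "linear (fd ?a x)" by (rule linear_fd[OF smooth_on_differentiable[OF smooth_trivialize[where T = \<alpha>, OF a] x]])
  have e: "f (axis A 1) (axis B 1) = \<sigma> i x powr (-2) * (nabla_form 2 D i (\<alpha> i) x $ A $ B + nabla_form 2 D i (\<alpha> i) x $ B $ A)" for A B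
  proof -
    have "\<sigma> i x powr (-2) * (nabla_form 2 D i (\<alpha> i) x $ A $ B + nabla_form 2 D i (\<alpha> i) x $ B $ A)
      = nabla_form 0 D i ?a x $ A $ B + nabla_form 0 D i ?a x $ B $ A"
      by (simp add: nabla_form_trivialize[where \<alpha> = \<alpha>, OF x a] distrib_left)
    then show ?thesis
      using chart.sym[OF x, of "axis A 1" "axis B 1"] by (simp add: nabla_form_nth f_def inner_axis)
  qed
  have z: "f u u' = 0" if "\<And>A B. f (axis A 1) (axis B 1) = 0" for u u'
  proof (rule bilinear_zero_axis[of f])
    show "linear (\<lambda>u. f u a)" "linear (f a)" for a
      unfolding f_def linear_iff
      by (simp_all add: linear_add[OF l] linear_scale[OF l] cm_simps mv_simps inner_simps algebra_simps)
  qed (rule that)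
  have s: "\<sigma> i x powr (-2) \<noteq> 0" using \<sigma>_pos[OF x] by simp
  have "?L \<longleftrightarrow> (\<forall>A B. f (axis A 1) (axis B 1) = 0)" unfolding e using s by simp
  also have "\<dots> \<longleftrightarrow> (\<forall>u u'. f u u' = 0)" using z by blast
  finally show ?thesis by (simp add: f_def)
qed

lemma killing_lift_minus:
  assumes "killing_form M D \<alpha>"
  shows "conformal_killing C (pw_class M P) (lift_minus M \<sigma> \<alpha>)"
  unfolding lift_minus_transport
proof (rule killing_transport)
  have a: "one_form M 2 \<alpha>" using assms by (simp add: killing_form_def)
  note sa = one_form_smooth[OF a]
  show "smooth_on (std_field (D i) (\<lambda>x. 0) (\<lambda>x. 0) (trivialize \<sigma> 2 \<alpha> i) (\<lambda>x. 0) (\<lambda>x. 0)) (UU i)" for i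
    by (intro smooth_std_field smooth_on_const smooth_trivialize sa)
  show "std_field (D j) (\<lambda>x. 0) (\<lambda>x. 0) (trivialize \<sigma> 2 \<alpha> j) (\<lambda>x. 0) (\<lambda>x. 0) (\<Psi> i j (x, p))
    = fd (\<Psi> i j) (x, p) (std_field (D i) (\<lambda>x. 0) (\<lambda>x. 0) (trivialize \<sigma> 2 \<alpha> i) (\<lambda>x. 0) (\<lambda>x. 0) (x, p))"
    if x: "x \<in> overlap M i j" for i j x p
    by (rule std_field_law[OF x, where v = "\<lambda>_ _. 0" and w = "\<lambda>_ _. 0" and s = "\<lambda>_ _. 0" and \<nu> = "\<lambda>_ _. 0" and \<alpha> = "trivialize \<sigma> 2 \<alpha>"])
       (simp_all add: mv_simps vm_simps trivialize_form_law[OF a x])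
  show "\<exists>c. \<forall>a b. lie_metric (std_field (D i) (\<lambda>x. 0) (\<lambda>x. 0) (trivialize \<sigma> 2 \<alpha> i) (\<lambda>x. 0) (\<lambda>x. 0)) (pwf (D i)) (x, p) a b
    = c * pwf (D i) (x, p) a b" if x: "x \<in> U i" for i x p
  proof (rule chart.lie_std_minus[OF x smooth_trivialize[where T = \<alpha>, OF sa]])
    have "\<forall>A B. (nabla_form 2 D i (\<alpha> i) x $ A $ B + nabla_form 2 D i (\<alpha> i) x $ B $ A) / 2 = 0"
      using assms x unfolding killing_form_def by blast
    then show "fd (trivialize \<sigma> 2 \<alpha> i) x u \<bullet> u' + fd (trivialize \<sigma> 2 \<alpha> i) x u' \<bullet> u
      = 2 * (trivialize \<sigma> 2 \<alpha> i x \<bullet> (cm (D i x) u *v u'))" for u u'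
      unfolding killing_form_equation[where \<alpha> = \<alpha>, OF sa x] by blast
  qed
qed

subsection \<open>Infinitesimal symmetries\<close>

lemma vector_law: "vector_field M v \<Longrightarrow> x \<in> overlap M i j \<Longrightarrow> v j (transition M i j x) = jacobian M i j x *v v i x"
  using vector_fieldD(3)[of M v x i j] dtrans_jacobian[of x i j "v i x"] by simp

lemma sum_kd: "(\<Sum>C\<in>UNIV. (kd A B * y $ C + kd C B * y $ A) * a $ C) = ((y \<bullet> a) *\<^sub>R axis A 1 + (y \<bullet> axis A 1) *\<^sub>R a) $ B"
  for y a :: "real^'n" and A B :: 'n
proof -
  have "(\<Sum>C\<in>UNIV. (kd A B * y $ C + kd C B * y $ A) * a $ C)
      = kd A B * (\<Sum>C\<in>UNIV. y $ C * a $ C) + (\<Sum>C\<in>UNIV. kd C B * y $ A * a $ C)"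
    by (simp add: distrib_right sum.distrib sum_distrib_left mult.assoc)
  also have "(\<Sum>C\<in>UNIV. kd C B * y $ A * a $ C) = y $ A * a $ B"
    by (simp add: kd_def if_distrib[of "\<lambda>x. x * _"] cong: if_cong)
  finally show ?thesis by (simp add: inner_vec_def[of y a] inner_axis) (simp add: axis_def kd_def)
qed

lemma infinitesimal_symmetry_lie_conn:
  assumes v: "infinitesimal_symmetry M P v" and D': "D' \<in> P"
  shows "\<exists>\<Upsilon>. one_form M 0 \<Upsilon> \<and> (\<forall>i. \<forall>x\<in>U i. \<forall>u a. lie_conn (v i) (D' i) x u a = (\<Upsilon> i x \<bullet> a) *\<^sub>R u + (\<Upsilon> i x \<bullet> u) *\<^sub>R a)"
proof -
  have vf: "vector_field M v" using v by (simp add: infinitesimal_symmetry_def)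
  obtain \<Upsilon> where Y: "one_form M 0 \<Upsilon>" and e: "\<And>i X x A B. smooth_on X (U i) \<Longrightarrow> x \<in> U i \<Longrightarrow>
      lie_tensor (v i) (nabla_vec D' i X) x $ A $ B - nabla_vec D' i (lie_vec (v i) X) x $ A $ B =
      (\<Sum>C\<in>UNIV. (kd A B * \<Upsilon> i x $ C + kd C B * \<Upsilon> i x $ A) * X x $ C)"
    using v D' unfolding infinitesimal_symmetry_def by blast
  have "lie_conn (v i) (D' i) x u a = (\<Upsilon> i x \<bullet> a) *\<^sub>R u + (\<Upsilon> i x \<bullet> u) *\<^sub>R a" if x: "x \<in> U i" for i x u a
  proof -
    \<comment> \<open>Constant test fields suffice: by \<open>lie_diff_lie_conn\<close> the
      commutator depends on the value of the test field only.\<close>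
    have ax: "lie_conn (v i) (D' i) x (axis A 1) a = (\<Upsilon> i x \<bullet> a) *\<^sub>R axis A 1 + (\<Upsilon> i x \<bullet> axis A 1) *\<^sub>R a" for A
    proof (rule vec_eq_iff[THEN iffD2], rule allI)
      show "lie_conn (v i) (D' i) x (axis A 1) a $ B = ((\<Upsilon> i x \<bullet> a) *\<^sub>R axis A 1 + (\<Upsilon> i x \<bullet> axis A 1) *\<^sub>R a) $ B" for B
        using lie_diff_lie_conn[where D = D', OF U x smooth_conn[OF D'] vector_fieldD(1)[OF vf] smooth_on_const[of a "U i"], of A B]
          e[OF smooth_on_const[of a "U i"] x, of A B] unfolding sum_kd by (simp only:)
    qed
    have dv: "v i differentiable at x" and dG: "D' i differentiable at x"
      and d2: "(\<lambda>y. fd (v i) y a) differentiable at x"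
      using smooth_on_differentiable[OF vector_fieldD(1)[OF vf] x] smooth_on_differentiable[OF smooth_conn[OF D'] x]
        smooth_on_differentiable[OF smooth_on_fd[OF vector_fieldD(1)[OF vf]] x] by blast+
    have l1: "linear (\<lambda>u. lie_conn (v i) (D' i) x u a)"
      by (simp add: linear_iff lie_conn_def linear_add[OF linear_fd[OF dv]] linear_scale[OF linear_fd[OF dv]]
          linear_add[OF linear_fd[OF d2]] linear_scale[OF linear_fd[OF d2]] cm_simps mv_simps algebra_simps)
    have l2: "linear (\<lambda>u. (\<Upsilon> i x \<bullet> a) *\<^sub>R u + (\<Upsilon> i x \<bullet> u) *\<^sub>R a)"
      by (simp add: linear_iff inner_simps algebra_simps)
    show ?thesis
      by (subst linear_axis_expand[OF l1], subst linear_axis_expand[OF l2]) (simp add: ax)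
  qed
  then show ?thesis using Y by blast
qed

lemma std_zero_law:
  assumes v: "vector_field M v" and x: "x \<in> overlap M i j"
  shows "std_field (D j) (v j) (\<lambda>x. 0) (\<lambda>x. 0) (\<lambda>x. 2 / (real CARD('n) + 1) * chart.divg j (v j) x) (\<lambda>x. 0) (\<Psi> i j (x, p))
    = fd (\<Psi> i j) (x, p) (std_field (D i) (v i) (\<lambda>x. 0) (\<lambda>x. 0) (\<lambda>x. 2 / (real CARD('n) + 1) * chart.divg i (v i) x) (\<lambda>x. 0) (x, p))"
proof -
  note sv = vector_fieldD(1)[OF v] and lv = vector_law[OF v]
  have "chart.divg j (v j) (transition M i j x) = chart.divg i (v i) x" by (rule divg_law[OF x sv lv])
  then show ?thesis
    by (intro std_field_law[OF x sv lv, where w = "\<lambda>_ _. 0" and \<alpha> = "\<lambda>_ _. 0" and \<nu> = "\<lambda>_ _. 0"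
          and s = "\<lambda>i x. 2 / (real CARD('n) + 1) * chart.divg i (v i) x"])
       (simp_all add: mv_simps vm_simps)
qed

lemma killing_lift_zero:
  assumes v: "infinitesimal_symmetry M P v"
  shows "conformal_killing C (pw_class M P) (lift_zero M D \<sigma> v)"
proof -
  have vf: "vector_field M v" using v by (simp add: infinitesimal_symmetry_def)
  note sv = vector_fieldD(1)[OF vf]
  obtain \<Upsilon> where Y: "\<And>i x u a. x \<in> U i \<Longrightarrow> lie_conn (v i) (D i) x u a = (\<Upsilon> i x \<bullet> a) *\<^sub>R u + (\<Upsilon> i x \<bullet> u) *\<^sub>R a"
    using infinitesimal_symmetry_lie_conn[OF v DP] by blast
  show ?thesis
    unfolding lift_zero_transport[OF sv]
  proof (rule killing_transport)
    show "smooth_on (std_field (D i) (v i) (\<lambda>x. 0) (\<lambda>x. 0) (\<lambda>x. 2 / (real CARD('n) + 1) * chart.divg i (v i) x) (\<lambda>x. 0)) (UU i)" for i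
      by (intro smooth_std_field smooth_on_const smooth_on_mult U sv chart.smooth_divg)
    show "\<exists>c. \<forall>a b. lie_metric (std_field (D i) (v i) (\<lambda>x. 0) (\<lambda>x. 0) (\<lambda>x. 2 / (real CARD('n) + 1) * chart.divg i (v i) x) (\<lambda>x. 0))
        (pwf (D i)) (x, p) a b = c * pwf (D i) (x, p) a b" if x: "x \<in> U i" for i x p
      by (rule chart.lie_std_zero[OF x sv Y[OF x]])
  qed (rule std_zero_law[OF vf])
qed

subsection \<open>Bivectors\<close>

lemma bivector_smooth: "bivector M k w \<Longrightarrow> smooth_on (w i) (U i)"
  unfolding bivector_def smooth_components_def by blast

lemma trivialize_skew: "bivector M k w \<Longrightarrow> transpose (trivialize \<sigma> l w i x) = - trivialize \<sigma> l w i x"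
proof -
  assume "bivector M k w"
  then have sk: "transpose (w i x) = - w i x" unfolding bivector_def by blast
  show ?thesis by (simp only: trivialize_def transpose_scaleR sk scaleR_minus_right)
qed

lemma trivialize_biv_law:
  assumes w: "bivector M (-2) w" and x: "x \<in> overlap M i j"
  shows "trivialize \<sigma> (-2) w j (transition M i j x)
    = jacobian M i j x ** trivialize \<sigma> (-2) w i x ** transpose (jacobian M i j x)"
proof -
  have "w j (transition M i j x) = weight_factor M (-2) i j x *\<^sub>R (jacobian M i j x ** w i x ** transpose (jacobian M i j x))"
    using w x unfolding bivector_def by blast
  then have "trivialize \<sigma> (-2) w j (transition M i j x)
    = (\<sigma> j (transition M i j x) powr 2 * weight_factor M (-2) i j x) *\<^sub>R (jacobian M i j x ** w i x ** transpose (jacobian M i j x))"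
    by (simp add: trivialize_def)
  then show ?thesis
    unfolding scale_weight[OF x, of 2]
    by (simp add: trivialize_def matrix_matrix_mult_def vec_eq_iff sum_distrib_left sum_distrib_right mult_ac)
qed

lemma vm_biv_law:
  assumes w: "bivector M (-2) w" and x: "x \<in> overlap M i j"
  shows "p v* trivialize \<sigma> (-2) w j (transition M i j x)
    = jacobian M i j x *v ((p v* jacobian M i j x) v* trivialize \<sigma> (-2) w i x)"
  unfolding trivialize_biv_law[OF w x] by (simp add: vector_matrix_mul_assoc[symmetric])

lemma smooth_biv_nu:
  assumes "\<And>i. smooth_on (w' i) (U i)"
  shows "smooth_on (biv_nu w' i) (U i)"
proof (rule smooth_on_vec[OF U])
  show "smooth_on (\<lambda>x. biv_nu w' i x $ A) (U i)" for A
    unfolding biv_nu_def nabla_biv_def vec_lambda_beta pd_def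
    by (intro smooth_on_mult smooth_on_sum smooth_on_add smooth_on_const U smooth_on_nth smooth_on_fd assms smD)
qed

lemma nabla_w_index:
  assumes w: "w' differentiable at x" and skew: "transpose (w' x) = - w' x"
  shows "(\<forall>A B C. nabla_biv 0 D i w' x $ C $ A $ B = kd C A * \<nu> $ B - kd C B * \<nu> $ A) \<longleftrightarrow>
    (\<forall>u p q. nabla_w (D i) w' x u p q = (\<nu> \<bullet> q) * (p \<bullet> u) - (\<nu> \<bullet> p) * (q \<bullet> u))"
proof -
  define f where "f u p q = nabla_w (D i) w' x u p q - ((\<nu> \<bullet> q) * (p \<bullet> u) - (\<nu> \<bullet> p) * (q \<bullet> u))" for u p q
  have l1: "linear (\<lambda>u. f u p q)" and l2: "linear (\<lambda>p. f u p q)" and l3: "linear (\<lambda>q. f u p q)" for u p q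
    unfolding f_def
    by (intro linear_compose_sub linear_nabla_w_base[OF w] linear_nabla_w_fibre;
        simp add: linear_iff inner_simps algebra_simps)+
  have axis_kd: "axis A (1::real) $ C = kd C A" for A C :: 'n
    by (simp add: axis_def kd_def)
  have e: "f (axis C 1) (axis A 1) (axis B 1) = nabla_biv 0 D i w' x $ C $ A $ B - (kd C A * \<nu> $ B - kd C B * \<nu> $ A)" for A B C
    unfolding f_def nabla_biv_nth[where w = w', OF skew] by (simp add: inner_axis axis_kd)
  have "f u p q = 0" if "\<And>A B C. f (axis C 1) (axis A 1) (axis B 1) = 0" for u p q
    by (subst linear_axis_expand[OF l1], subst linear_axis_expand[OF l2], subst linear_axis_expand[OF l3]) (simp add: that)
  then have "(\<forall>A B C. f (axis C 1) (axis A 1) (axis B 1) = 0) \<longleftrightarrow> (\<forall>u p q. f u p q = 0)" by blast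
  then show ?thesis unfolding e by (simp add: f_def)
qed

text \<open>The equation contracts the second upper index of the derivative, \<open>\<nu>\<close>
  the first. Skewness of the right side supplies the sign that turns the coefficient
  \<open>- 1 / (n - 1)\<close> into that of \<open>\<nu>\<close>; the square of the scale comes from
  the weight.\<close>

lemma bivector_equation:
  assumes w: "bivector M (-2) w" and x: "x \<in> U i"
    and eq: "let Dw = nabla_biv (-2) D i (w i) x in \<forall>A B C. Dw $ C $ A $ B = - (2 / (real CARD('n) - 1)) *
      ((kd C A * (\<Sum>Q\<in>UNIV. Dw $ Q $ B $ Q) - kd C B * (\<Sum>Q\<in>UNIV. Dw $ Q $ A $ Q)) / 2)"
  shows "nabla_w (D i) (trivialize \<sigma> (-2) w i) x u p q
    = (biv_nu (trivialize \<sigma> (-2) w) i x \<bullet> q) * (p \<bullet> u) - (biv_nu (trivialize \<sigma> (-2) w) i x \<bullet> p) * (q \<bullet> u)"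
proof -
  let ?w = "trivialize \<sigma> (-2) w"
  let ?N = "nabla_biv 0 D i (?w i) x" and ?D = "nabla_biv (-2) D i (w i) x"
  define c where "c = real CARD('n) - 1"
  define t where "t A = (\<Sum>Q\<in>UNIV. ?D $ Q $ A $ Q)" for A
  have N: "?N $ C $ A $ B = (\<sigma> i x)\<^sup>2 * ?D $ C $ A $ B" for A B C
    by (simp add: nabla_biv_trivialize[where w = w, OF x bivector_smooth[OF w]])
  have D: "?D $ C $ A $ B = - (1 / c) * (kd C A * t B - kd C B * t A)" for A B C
  proof -
    have "?D $ C $ A $ B = - (2 / c) * ((kd C A * t B - kd C B * t A) / 2)"
      using eq unfolding Let_def c_def t_def by blast
    also have "- (2 / c) * (z / 2) = - (1 / c) * z" for z by simp
    finally show ?thesis .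
  qed
  have c: "c > 0" using dim by (simp add: c_def)
  have nu: "biv_nu ?w i x $ A = - (\<sigma> i x)\<^sup>2 * t A / c" for A
  proof -
    have "?D $ Q $ Q $ A = - (?D $ Q $ A $ Q)" for Q unfolding D by (simp add: diff_divide_distrib)
    then have "(\<Sum>Q\<in>UNIV. ?N $ Q $ Q $ A) = - (\<sigma> i x)\<^sup>2 * t A"
      unfolding N t_def by (simp add: sum_negf sum_distrib_left)
    then show ?thesis by (simp add: biv_nu_def c_def)
  qed
  have "\<forall>A B C. ?N $ C $ A $ B = kd C A * biv_nu ?w i x $ B - kd C B * biv_nu ?w i x $ A"
    unfolding N D nu using c by (simp add: field_simps)
  then have "\<forall>u p q. nabla_w (D i) (?w i) x u p q = (biv_nu ?w i x \<bullet> q) * (p \<bullet> u) - (biv_nu ?w i x \<bullet> p) * (q \<bullet> u)"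
    by (rule nabla_w_index[where w' = "?w i", OF smooth_on_differentiable[OF smooth_trivialize[where T = w, OF bivector_smooth[OF w]] x]
        trivialize_skew[OF w], THEN iffD1])
  from this[rule_format, of u p q] show ?thesis .
qed

text \<open>The map \<open>p v* w'\<close> enters the second slot of the Weyl tensor through the
  second index of \<open>w'\<close>, whereas the index expression contracts first with first. The
  signs from skewness of \<open>w'\<close> and of the Weyl tensor cancel.\<close>

lemma weyl_index:
  fixes A C E F :: 'n
  assumes inst: "projective_curvature (riem (D i) x) (chart.rho i x) (\<lambda>p. p v* w' ) N" and x: "x \<in> U i"
    and skew: "transpose w' = - w'"
  shows "projective_curvature.T (riem (D i) x) (chart.rho i x) (\<lambda>p. p v* w') (axis E 1) (axis A 1) (axis C 1) (axis F 1)
    + projective_curvature.T (riem (D i) x) (chart.rho i x) (\<lambda>p. p v* w') (axis A 1) (axis E 1) (axis C 1) (axis F 1)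
    = (\<Sum>B\<in>UNIV. w' $ B $ A * proj_weyl D i x B C E F + w' $ B $ E * proj_weyl D i x B C A F
       + w' $ B $ A * proj_weyl D i x B F E C + w' $ B $ E * proj_weyl D i x B F A C)"
proof -
  interpret K: projective_curvature "riem (D i) x" "chart.rho i x" "\<lambda>p. p v* w'" N by (rule inst)
  have W: "K.W (axis A 1) (axis B 1) (axis F 1) $ C = proj_weyl D i x A B C F" for A B C F
    unfolding K.W_def proj_weyl_def by (simp add: curv_riem[OF x] schouten_rho[OF x]) (simp add: axis_def kd_def)
  have sk: "w' $ A $ B = - w' $ B $ A" for A B
    using skew by (metis (mono_tags) transpose_def vec_lambda_beta vector_uminus_component minus_minus)
  have y: "K.W (axis C 1) (axis A 1 v* w') (axis F 1) \<bullet> axis E 1 = (\<Sum>B\<in>UNIV. w' $ B $ A * proj_weyl D i x B C E F)" for A C E F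
  proof -
    have "K.W (axis C 1) (axis A 1 v* w') (axis F 1) = (\<Sum>B\<in>UNIV. w' $ A $ B *\<^sub>R K.W (axis C 1) (axis B 1) (axis F 1))"
      by (subst linear_axis_expand[OF K.linW(2)]) (simp add: vm_axis)
    also have "\<dots> = (\<Sum>B\<in>UNIV. w' $ B $ A *\<^sub>R K.W (axis B 1) (axis C 1) (axis F 1))"
      unfolding sk[of A] K.W_skew[of "axis C 1"] by simp
    finally show ?thesis by (simp add: inner_axis W)
  qed
  show ?thesis unfolding K.T_def y by (simp add: sum.distrib)
qed

lemma weyl_condition_iff:
  fixes A C E F :: 'n
  assumes w: "bivector M (-2) w" and x: "x \<in> U i"
    and inst: "projective_curvature (riem (D i) x) (chart.rho i x) (\<lambda>p. p v* trivialize \<sigma> (-2) w i x) N"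
  shows "(\<Sum>B\<in>UNIV. w i x $ B $ A * proj_weyl D i x B C E F + w i x $ B $ E * proj_weyl D i x B C A F
       + w i x $ B $ A * proj_weyl D i x B F E C + w i x $ B $ E * proj_weyl D i x B F A C) / 4 = 0 \<longleftrightarrow>
    projective_curvature.T (riem (D i) x) (chart.rho i x) (\<lambda>p. p v* trivialize \<sigma> (-2) w i x) (axis E 1) (axis A 1) (axis C 1) (axis F 1)
    + projective_curvature.T (riem (D i) x) (chart.rho i x) (\<lambda>p. p v* trivialize \<sigma> (-2) w i x) (axis A 1) (axis E 1) (axis C 1) (axis F 1) = 0"
proof -
  have t: "trivialize \<sigma> (-2) w i x $ A $ B = (\<sigma> i x powr 2) * w i x $ A $ B" for A B
    by (simp add: trivialize_def)
  have "\<sigma> i x powr 2 \<noteq> 0" using \<sigma>_pos[OF x] by simp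
  moreover have "(\<Sum>B\<in>UNIV. (\<sigma> i x powr 2) * w i x $ B $ A * proj_weyl D i x B C E F + (\<sigma> i x powr 2) * w i x $ B $ E * proj_weyl D i x B C A F
       + (\<sigma> i x powr 2) * w i x $ B $ A * proj_weyl D i x B F E C + (\<sigma> i x powr 2) * w i x $ B $ E * proj_weyl D i x B F A C)
    = (\<sigma> i x powr 2) * (\<Sum>B\<in>UNIV. w i x $ B $ A * proj_weyl D i x B C E F + w i x $ B $ E * proj_weyl D i x B C A F
       + w i x $ B $ A * proj_weyl D i x B F E C + w i x $ B $ E * proj_weyl D i x B F A C)"
    unfolding sum_distrib_left by (rule sum.cong) (simp_all only: distrib_left mult.assoc)
  ultimately show ?thesis
    unfolding weyl_index[OF inst x trivialize_skew[OF w]] t by simp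
qed

text \<open>The law of \<open>w\<close>, paired with two fixed covectors, is differentiated; the
  derivative of the Jacobian is the Hessian that \<open>connection_law\<close> removes
  again.\<close>

lemma nabla_w_law:
  assumes x: "x \<in> overlap M i j" and sw: "\<And>i. smooth_on (w' i) (U i)"
    and law: "\<And>y p. y \<in> overlap M i j \<Longrightarrow>
      p v* w' j (transition M i j y) = jacobian M i j y *v ((p v* jacobian M i j y) v* w' i y)"
    and skew: "transpose (w' i x) = - w' i x"
  shows "nabla_w (D j) (w' j) (transition M i j x) (jacobian M i j x *v u) p q
    = nabla_w (D i) (w' i) x u (p v* jacobian M i j x) (q v* jacobian M i j x)"
proof -
  let ?J = "jacobian M i j x" and ?t = "transition M i j x"
  let ?p = "p v* ?J" and ?q = "q v* ?J"
  note skw = skew_vm[OF skew]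
  have Jd: "a \<bullet> (?J *v b) = (a v* ?J) \<bullet> b" for a b by (simp only: dot_lmul_matrix)
  have dJ: "(jacobian M i j has_derivative fd (jacobian M i j) x) (at x)"
    by (rule smooth_on_has_derivative[OF smooth_jacobian x])
  have dw: "(w' i has_derivative fd (w' i) x) (at x)"
    by (rule smooth_on_has_derivative[OF sw overlap_U(1)[OF x]])
  have dwj: "(w' j has_derivative fd (w' j) ?t) (at ?t)"
    by (rule smooth_on_has_derivative[OF sw overlap_U(2)[OF x]])
  have a: "((\<lambda>y. b v* jacobian M i j y) has_derivative (\<lambda>u. b v* fd (jacobian M i j) x u)) (at x)" for b
    by (rule bounded_linear.has_derivative[OF bounded_bilinear.bounded_linear_right[OF bounded_bilinear_vm] dJ])
  have F1: "((\<lambda>y. p \<bullet> (w' j (transition M i j y) *v q)) has_derivative (\<lambda>u. p \<bullet> (fd (w' j) ?t (?J *v u) *v q))) (at x)"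
    by (intro has_derivative_inner_right bounded_linear.has_derivative[OF bounded_bilinear.bounded_linear_left[OF bounded_bilinear_mv]]
        has_derivative_compose[OF has_derivative_transition[OF x] dwj])
  have "((\<lambda>y. ((p v* jacobian M i j y) v* w' i y) \<bullet> (q v* jacobian M i j y)) has_derivative
      (\<lambda>u. (?p v* w' i x) \<bullet> (q v* fd (jacobian M i j) x u)
         + (?p v* fd (w' i) x u + (p v* fd (jacobian M i j) x u) v* w' i x) \<bullet> ?q)) (at x)"
    by (rule has_derivative_inner[OF bounded_bilinear.FDERIV[OF bounded_bilinear_vm a dw] a])
  then have F2: "((\<lambda>y. p \<bullet> (w' j (transition M i j y) *v q)) has_derivative
      (\<lambda>u. (?p v* w' i x) \<bullet> (q v* fd (jacobian M i j) x u)
         + (?p v* fd (w' i) x u + (p v* fd (jacobian M i j) x u) v* w' i x) \<bullet> ?q)) (at x)"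
  proof (rule has_derivative_transform_within_open[OF _ open_overlap[OF atlas] x])
    fix y assume y: "y \<in> overlap M i j"
    have "p \<bullet> (w' j (transition M i j y) *v q) = (p v* w' j (transition M i j y)) \<bullet> q" by (simp only: dot_lmul_matrix)
    also have "\<dots> = ((p v* jacobian M i j y) v* w' i y) \<bullet> (q v* jacobian M i j y)"
      unfolding law[OF y] by (simp only: dot_lmul_matrix[of q] inner_commute)
    finally show "((p v* jacobian M i j y) v* w' i y) \<bullet> (q v* jacobian M i j y) = p \<bullet> (w' j (transition M i j y) *v q)" ..
  qed
  have h: "b \<bullet> (a v* fd (jacobian M i j) x u) = a \<bullet> hess i j x u b" for a b
  proof -
    have "b \<bullet> (a v* fd (jacobian M i j) x u) = a \<bullet> (fd (jacobian M i j) x u *v b)"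
      by (simp only: inner_commute[of b] dot_lmul_matrix)
    then show ?thesis by (simp only: fd_jacobian[OF x])
  qed
  have D: "p \<bullet> (fd (w' j) ?t (?J *v u) *v q) = q \<bullet> hess i j x u (?p v* w' i x) + ?p \<bullet> (fd (w' i) x u *v ?q)
      - p \<bullet> hess i j x u (?q v* w' i x)"
  proof -
    have "p \<bullet> (fd (w' j) ?t (?J *v u) *v q) = (?p v* w' i x) \<bullet> (q v* fd (jacobian M i j) x u)
         + (?p v* fd (w' i) x u + (p v* fd (jacobian M i j) x u) v* w' i x) \<bullet> ?q"
      by (rule fun_cong[OF has_derivative_unique[OF F1 F2]])
    then show ?thesis
      by (simp only: inner_add_left h skw[of "p v* fd (jacobian M i j) x u"] dot_lmul_matrix[of ?p "fd (w' i) x u"])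
  qed
  have G: "b \<bullet> (cm (D j ?t) (?J *v u) *v (?J *v z)) = (b v* ?J) \<bullet> (cm (D i x) u *v z) - b \<bullet> hess i j x u z" for b z
  proof -
    have "b \<bullet> (?J *v (cm (D i x) u *v z)) = b \<bullet> hess i j x u z + b \<bullet> (cm (D j ?t) (?J *v u) *v (?J *v z))"
      unfolding connection_law[OF x DP] by (rule inner_add_right)
    then show ?thesis unfolding Jd by simp
  qed
  show ?thesis
    unfolding nabla_w_def D law[OF x] G by simp
qed

text \<open>\<open>\<nu>\<close> is determined by its equation: the two candidates in one chart
  differ by a \<open>d\<close> with \<open>(d \<bullet> q) * (p \<bullet> u) = (d \<bullet> p) * (q
  \<bullet> u)\<close>, whose trace over \<open>p = u\<close> is
  \<open>(n - 1) (d \<bullet> q) = 0\<close>. So the law follows from \<open>nabla_w_law\<close>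
  without transforming the formula for \<open>biv_nu\<close>.\<close>

lemma nu_law:
  assumes x: "x \<in> overlap M i j" and sw: "\<And>i. smooth_on (w' i) (U i)"
    and law: "\<And>y p. y \<in> overlap M i j \<Longrightarrow>
      p v* w' j (transition M i j y) = jacobian M i j y *v ((p v* jacobian M i j y) v* w' i y)"
    and skew: "transpose (w' i x) = - w' i x"
    and nw: "\<And>k y u p q. y \<in> U k \<Longrightarrow> nabla_w (D k) (w' k) y u p q = (\<nu> k y \<bullet> q) * (p \<bullet> u) - (\<nu> k y \<bullet> p) * (q \<bullet> u)"
  shows "\<nu> j (transition M i j x) = jacobian M i j x *v \<nu> i x"
proof -
  let ?J = "jacobian M i j x" and ?t = "transition M i j x" and ?K = "invjac i j x"
  define d where "d = ?K *v \<nu> j ?t - \<nu> i x"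
  have e: "(d \<bullet> q) * (p \<bullet> u) = (d \<bullet> p) * (q \<bullet> u)" for p q u
  proof -
    have n: "\<nu> j ?t \<bullet> (q v* ?K) = (?K *v \<nu> j ?t) \<bullet> q" for q
      by (simp only: inner_commute[of "\<nu> j ?t"] inner_commute[of "?K *v \<nu> j ?t"] dot_lmul_matrix)
    have "(\<nu> j ?t \<bullet> (q v* ?K)) * ((p v* ?K) \<bullet> (?J *v u)) - (\<nu> j ?t \<bullet> (p v* ?K)) * ((q v* ?K) \<bullet> (?J *v u))
      = (\<nu> i x \<bullet> q) * (p \<bullet> u) - (\<nu> i x \<bullet> p) * (q \<bullet> u)"
      using nabla_w_law[OF x sw law skew, of u "p v* ?K" "q v* ?K"]
      unfolding nw[OF overlap_U(1)[OF x]] nw[OF overlap_U(2)[OF x]] invjac(1)[OF x] .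
    then show ?thesis
      unfolding p_jac[OF x] n d_def by (simp add: inner_diff_left left_diff_distrib)
  qed
  have "d \<bullet> q = 0" for q
  proof -
    have "(\<Sum>b::real^'n\<in>Basis. (d \<bullet> q) * (b \<bullet> b)) = (\<Sum>b\<in>Basis. (d \<bullet> b) * (q \<bullet> b))"
      by (rule sum.cong[OF refl]) (rule e)
    also have "\<dots> = d \<bullet> q"
      by (rule sum_Basis_inner[OF bounded_linear.linear[OF bounded_linear_inner_right]])
    finally have "(real CARD('n) - 1) * (d \<bullet> q) = 0" by (simp add: algebra_simps)
    then show ?thesis using dim by simp
  qed
  then have "d = 0" by (metis inner_eq_zero_iff)
  then have "?J *v (?K *v \<nu> j ?t) = ?J *v \<nu> i x" by (simp add: d_def)
  then show ?thesis
    using jacobian_inverse(2)[OF x] by (simp add: matrix_vector_mul_assoc invjac_def)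
qed

lemma bivector_solution_equation:
  assumes "bivector_solution M D w" and x: "x \<in> U i"
  shows "nabla_w (D i) (trivialize \<sigma> (-2) w i) x u p q
    = (biv_nu (trivialize \<sigma> (-2) w) i x \<bullet> q) * (p \<bullet> u) - (biv_nu (trivialize \<sigma> (-2) w) i x \<bullet> p) * (q \<bullet> u)"
proof (rule bivector_equation[OF _ x])
  show "bivector M (-2) w" using assms unfolding bivector_solution_def by blast
  show "let Dw = nabla_biv (-2) D i (w i) x in \<forall>A B C. Dw $ C $ A $ B = - (2 / (real CARD('n) - 1)) *
      ((kd C A * (\<Sum>Q\<in>UNIV. Dw $ Q $ B $ Q) - kd C B * (\<Sum>Q\<in>UNIV. Dw $ Q $ A $ Q)) / 2)"
    using assms(1)[unfolded bivector_solution_def, THEN conjunct2, rule_format, OF x] by (rule conjunct1)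
qed

lemma std_plus_law:
  assumes w: "bivector_solution M D w" and x: "x \<in> overlap M i j"
  shows "(p v* invjac i j x) v* trivialize \<sigma> (-2) w j (transition M i j x) = jacobian M i j x *v (p v* trivialize \<sigma> (-2) w i x)"
    and "biv_nu (trivialize \<sigma> (-2) w) j (transition M i j x) = jacobian M i j x *v biv_nu (trivialize \<sigma> (-2) w) i x"
proof -
  have b: "bivector M (-2) w" using w unfolding bivector_solution_def by blast
  show "(p v* invjac i j x) v* trivialize \<sigma> (-2) w j (transition M i j x) = jacobian M i j x *v (p v* trivialize \<sigma> (-2) w i x)"
    unfolding vm_biv_law[OF b x] invjac(1)[OF x] ..
  show "biv_nu (trivialize \<sigma> (-2) w) j (transition M i j x) = jacobian M i j x *v biv_nu (trivialize \<sigma> (-2) w) i x"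
    by (rule nu_law[where w' = "trivialize \<sigma> (-2) w", OF x smooth_trivialize[where T = w, OF bivector_smooth[OF b]] vm_biv_law[OF b]
          trivialize_skew[OF b] bivector_solution_equation[OF w]])
qed

lemma killing_lift_plus:
  assumes n: "CARD('n) \<ge> 3" and w: "bivector_solution M D w"
  shows "conformal_killing C (pw_class M P) (lift_plus M D \<sigma> w)"
  unfolding lift_plus_transport
proof (rule killing_transport)
  have b: "bivector M (-2) w" using w unfolding bivector_solution_def by blast
  let ?w = "trivialize \<sigma> (-2) w"
  have sw: "smooth_on (?w i) (U i)" for i by (rule smooth_trivialize[where T = w, OF bivector_smooth[OF b]])
  show "smooth_on (std_field (D i) (\<lambda>x. 0) (?w i) (\<lambda>x. 0) (\<lambda>x. 0) (biv_nu ?w i)) (UU i)" for i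
    by (intro smooth_std_field smooth_on_const sw smooth_biv_nu)
  show "std_field (D j) (\<lambda>x. 0) (?w j) (\<lambda>x. 0) (\<lambda>x. 0) (biv_nu ?w j) (\<Psi> i j (x, p))
    = fd (\<Psi> i j) (x, p) (std_field (D i) (\<lambda>x. 0) (?w i) (\<lambda>x. 0) (\<lambda>x. 0) (biv_nu ?w i) (x, p))"
    if x: "x \<in> overlap M i j" for i j x p
    by (rule std_field_law[OF x, where v = "\<lambda>_ _. 0" and w = ?w and s = "\<lambda>_ _. 0" and \<nu> = "biv_nu ?w" and \<alpha> = "\<lambda>_ _. 0"])
       (simp_all add: mv_simps vm_simps std_plus_law[OF w x])
  show "\<exists>c. \<forall>a b. lie_metric (std_field (D i) (\<lambda>x. 0) (?w i) (\<lambda>x. 0) (\<lambda>x. 0) (biv_nu ?w i)) (pwf (D i)) (x, p) a b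
    = c * pwf (D i) (x, p) a b" if x: "x \<in> U i" for i x p
  proof (rule chart.lie_std_plus[OF n x sw smooth_biv_nu[of ?w, OF sw] trivialize_skew[OF b] bivector_solution_equation[OF w]])
    note inst = chart.curvature_instance[OF x sw smooth_biv_nu[of ?w, OF sw] trivialize_skew[OF b] bivector_solution_equation[OF w]]
    fix p q u v :: "real^'n" assume "p \<in> Basis" "q \<in> Basis" "u \<in> Basis" "v \<in> Basis"
    then obtain A B E F where ax: "p = axis E 1" "q = axis A 1" "u = axis B 1" "v = axis F 1"
      unfolding Basis_axis by blast
    show "projective_curvature.T (riem (D i) x) (chart.rho i x) (\<lambda>p. p v* ?w i x) p q u v
        + projective_curvature.T (riem (D i) x) (chart.rho i x) (\<lambda>p. p v* ?w i x) q p u v = 0"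
      unfolding ax
      by (rule weyl_condition_iff[OF b x inst, THEN iffD1], assumption,
          rule w[unfolded bivector_solution_def, THEN conjunct2, rule_format, OF x, THEN conjunct2, rule_format])
  qed
qed

subsection \<open>Change of connection within the projective class\<close>

text \<open>Both additional terms are built from the Lie derivative of \<open>\<Upsilon>\<close>
  along \<open>v\<close> and are of pure trace type. Hence the symmetry condition does not depend on
  the representative of the projective class.\<close>

lemma lie_conn_change:
  assumes D': "D' \<in> P" and v: "smooth_on v (U i)" and \<Upsilon>: "smooth_on (\<Upsilon> i) (U i)" and x: "x \<in> U i"
    and e: "\<And>x u a. x \<in> U i \<Longrightarrow> cm (D' i x) u *v a = cm (D i x) u *v a + (\<Upsilon> i x \<bullet> u) *\<^sub>R a + (\<Upsilon> i x \<bullet> a) *\<^sub>R u"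
  shows "lie_conn v (D' i) x u a = lie_conn v (D i) x u a
    + (fd (\<Upsilon> i) x (v x) \<bullet> u + \<Upsilon> i x \<bullet> fd v x u) *\<^sub>R a + (fd (\<Upsilon> i) x (v x) \<bullet> a + \<Upsilon> i x \<bullet> fd v x a) *\<^sub>R u"
proof -
  have lv: "linear (fd v x)" by (rule linear_fd[OF smooth_on_differentiable[OF v x]])
  have c: "fd (\<lambda>y. cm (D' i y) u *v a) x r = fd (\<lambda>y. cm (D i y) u *v a + (\<Upsilon> i y \<bullet> u) *\<^sub>R a + (\<Upsilon> i y \<bullet> a) *\<^sub>R u) x r" for r
    by (rule fun_cong[OF fd_cong[OF U x e]])
  have h: "((\<lambda>y. cm (D i y) u *v a + (\<Upsilon> i y \<bullet> u) *\<^sub>R a + (\<Upsilon> i y \<bullet> a) *\<^sub>R u) has_derivative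
     (\<lambda>r. cm (fd (D i) x r) u *v a + (fd (\<Upsilon> i) x r \<bullet> u) *\<^sub>R a + (fd (\<Upsilon> i) x r \<bullet> a) *\<^sub>R u)) (at x)"
    by (intro has_derivative_add bounded_linear.has_derivative[OF bounded_linear_cm smooth_on_has_derivative[OF smD x]]
        has_derivative_scaleR_left has_derivative_inner_left smooth_on_has_derivative[OF \<Upsilon> x])
  have f: "cm (fd (D' i) x r) u *v a = cm (fd (D i) x r) u *v a + (fd (\<Upsilon> i) x r \<bullet> u) *\<^sub>R a + (fd (\<Upsilon> i) x r \<bullet> a) *\<^sub>R u" for r
  proof -
    have "cm (fd (D' i) x r) u *v a = fd (\<lambda>y. cm (D' i y) u *v a) x r"
      by (rule fd_bounded_linear[OF bounded_linear_cm smooth_on_differentiable[OF smooth_conn[OF D'] x], symmetric])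
    then show ?thesis by (simp only: c fd_eq[OF h])
  qed
  show ?thesis
    unfolding lie_conn_def f e[OF x]
    by (simp add: linear_add[OF lv] linear_scale[OF lv] algebra_simps)
qed

lemma infinitesimal_symmetryI:
  assumes v: "vector_field M v"
    and lc: "\<And>i x u a. x \<in> U i \<Longrightarrow> (real CARD('n) + 1) *\<^sub>R lie_conn (v i) (D i) x u a
      = fd (chart.divg i (v i)) x u *\<^sub>R a + fd (chart.divg i (v i)) x a *\<^sub>R u"
  shows "infinitesimal_symmetry M P v"
  unfolding infinitesimal_symmetry_def
proof (intro conjI v ballI)
  note sv = vector_fieldD(1)[OF v]
  define N where "N = real CARD('n) + 1"
  have N: "N \<noteq> 0" unfolding N_def by linarith
  fix D' assume D': "D' \<in> P"
  obtain \<Upsilon> where f: "one_form M 0 \<Upsilon>"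
    and e: "\<And>i x u a. x \<in> U i \<Longrightarrow> cm (D' i x) u *v a = cm (D i x) u *v a + (\<Upsilon> i x \<bullet> u) *\<^sub>R a + (\<Upsilon> i x \<bullet> a) *\<^sub>R u"
    using projective_difference[OF D'] by metis
  note s\<Upsilon> = one_form_smooth[OF f]
  \<comment> \<open>The required one-form for \<open>D'\<close>: the differential of the divergence
    over \<open>n + 1\<close>, which serves for \<open>D\<close>, plus the Lie derivative of
    \<open>\<Upsilon>\<close> along \<open>v\<close>.\<close>
  define L where "L i x u = fd (chart.divg i (v i)) x u / N + (fd (\<Upsilon> i) x (v i x) \<bullet> u + \<Upsilon> i x \<bullet> fd (v i) x u)" for i x u
  define \<Lambda> where "\<Lambda> i x = (if x \<in> U i then (\<chi> A. L i x (axis A 1)) else 0)" for i x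
  have linL: "linear (L i x)" if x: "x \<in> U i" for i x
  proof -
    have "linear (fd (chart.divg i (v i)) x)" "linear (fd (v i) x)"
      using linear_fd[OF smooth_on_differentiable[OF chart.smooth_divg[OF sv] x]] linear_fd[OF smooth_on_differentiable[OF sv x]] .
    then show ?thesis unfolding L_def linear_iff by (simp add: inner_simps add_divide_distrib algebra_simps)
  qed
  have \<Lambda>: "\<Lambda> i x \<bullet> u = L i x u" if x: "x \<in> U i" for i x u
    using linear_axis_expand[OF linL[OF x], of u] x by (simp add: \<Lambda>_def inner_vec_def mult.commute)
  have smL: "smooth_on (\<lambda>x. L i x u) (U i)" for i u
    unfolding L_def
    by (intro smooth_on_add smooth_on_divide smooth_on_inner smooth_on_const U smooth_on_fd chart.smooth_divg sv
        smooth_on_fd_apply s\<Upsilon> N)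
  have sm: "smooth_on (\<Lambda> i) (U i)" for i
    by (rule smooth_on_cong[OF U, where f = "\<lambda>x. (\<chi> A. L i x (axis A 1))"])
       (simp_all add: \<Lambda>_def smooth_on_vec[OF U] smL)
  \<comment> \<open>Both summands are invariant: the Hessian that \<open>fd (\<Upsilon> i)\<close>
    acquires under the change of charts is the one that \<open>fd (v j)\<close> acquires.\<close>
  have law: "\<Lambda> j (transition M i j x) v* jacobian M i j x = \<Lambda> i x" if x: "x \<in> overlap M i j" for i j x
  proof (rule vector_eq_rdot[THEN iffD1], rule allI)
    fix u
    let ?J = "jacobian M i j x" and ?t = "transition M i j x"
    note xi = overlap_U(1)[OF x] and xj = overlap_U(2)[OF x]
    have flaw: "\<Upsilon> j (transition M i j y) v* jacobian M i j y = \<Upsilon> i y" if "y \<in> overlap M i j" for y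
      using one_form_law[OF f that] det_pos[OF that] by (simp add: weight_factor_def)
    have 1: "((\<lambda>y. chart.divg j (v j) (transition M i j y)) has_derivative (\<lambda>u. fd (chart.divg j (v j)) ?t (?J *v u))) (at x)"
      by (rule has_derivative_compose[OF has_derivative_transition[OF x] smooth_on_has_derivative[OF chart.smooth_divg[OF sv] xj]])
    have "(chart.divg i (v i) has_derivative (\<lambda>u. fd (chart.divg j (v j)) ?t (?J *v u))) (at x)"
      by (rule has_derivative_transform_within_open[OF 1 open_overlap[OF atlas] x])
         (rule divg_law[OF _ sv vector_law[OF v]])
    then have d: "fd (chart.divg j (v j)) ?t (?J *v u) = fd (chart.divg i (v i)) x u" by (simp add: fd_eq)
    have 2: "((\<lambda>y. \<Upsilon> j (transition M i j y) v* jacobian M i j y) has_derivative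
        (\<lambda>r. \<Upsilon> j ?t v* fd (jacobian M i j) x r + fd (\<Upsilon> j) ?t (?J *v r) v* ?J)) (at x)"
      by (rule bounded_bilinear.FDERIV[OF bounded_bilinear_vm
            has_derivative_compose[OF has_derivative_transition[OF x] smooth_on_has_derivative[OF s\<Upsilon> xj]]
            smooth_on_has_derivative[OF smooth_jacobian x]])
    have "(\<Upsilon> i has_derivative (\<lambda>r. \<Upsilon> j ?t v* fd (jacobian M i j) x r + fd (\<Upsilon> j) ?t (?J *v r) v* ?J)) (at x)"
      by (rule has_derivative_transform_within_open[OF 2 open_overlap[OF atlas] x flaw])
    then have y: "fd (\<Upsilon> i) x r = \<Upsilon> j ?t v* fd (jacobian M i j) x r + fd (\<Upsilon> j) ?t (?J *v r) v* ?J" for r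
      by (simp add: fd_eq)
    have fv: "fd (v j) ?t (?J *v u) = hess i j x u (v i x) + ?J *v fd (v i) x u"
      by (rule fd_vector_law[OF x sv vector_law[OF v]])
    have Yv: "\<Upsilon> i x \<bullet> b = \<Upsilon> j ?t \<bullet> (?J *v b)" for b
      unfolding flaw[OF x, symmetric] by (rule dot_lmul_matrix)
    have yv: "fd (\<Upsilon> i) x (v i x) \<bullet> u = \<Upsilon> j ?t \<bullet> hess i j x (v i x) u + fd (\<Upsilon> j) ?t (v j ?t) \<bullet> (?J *v u)"
      unfolding y inner_add_left dot_lmul_matrix fd_jacobian[OF x] vector_law[OF v x] ..
    have "(\<Lambda> j ?t v* ?J) \<bullet> u = L j ?t (?J *v u)"
      unfolding dot_lmul_matrix by (rule \<Lambda>[OF xj])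
    also have "\<dots> = L i x u"
      unfolding L_def d fv inner_add_right yv Yv hess_sym[OF x, of "v i x" u] by simp
    finally show "(\<Lambda> j ?t v* ?J) \<bullet> u = \<Lambda> i x \<bullet> u" by (simp only: \<Lambda>[OF xi])
  qed
  have form: "one_form M 0 \<Lambda>"
    unfolding one_form_def smooth_components_def
  proof (intro conjI allI ballI impI sm)
    show "\<Lambda> i x = 0" if "x \<notin> U i" for i x using that by (simp add: \<Lambda>_def)
    show "transpose (jacobian M i j x) *v \<Lambda> j (transition M i j x) = weight_factor M 0 i j x *\<^sub>R \<Lambda> i x"
      if x: "x \<in> overlap M i j" for i j x
      using law[OF x] det_pos[OF x] by (simp add: weight_factor_def)
  qed
  have main: "lie_conn (v i) (D' i) x u a = (\<Lambda> i x \<bullet> a) *\<^sub>R u + (\<Lambda> i x \<bullet> u) *\<^sub>R a" if x: "x \<in> U i" for i x u a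
  proof -
    have "N *\<^sub>R lie_conn (v i) (D i) x u a = fd (chart.divg i (v i)) x u *\<^sub>R a + fd (chart.divg i (v i)) x a *\<^sub>R u"
      unfolding N_def by (rule lc[OF x])
    then have "lie_conn (v i) (D i) x u a = inverse N *\<^sub>R (fd (chart.divg i (v i)) x u *\<^sub>R a + fd (chart.divg i (v i)) x a *\<^sub>R u)"
      using N by (metis scaleR_scaleR left_inverse scaleR_one)
    then have "lie_conn (v i) (D i) x u a = (fd (chart.divg i (v i)) x u / N) *\<^sub>R a + (fd (chart.divg i (v i)) x a / N) *\<^sub>R u"
      by (simp add: scaleR_add_right divide_inverse mult.commute)
    moreover have "lie_conn (v i) (D' i) x u a = lie_conn (v i) (D i) x u a
      + (fd (\<Upsilon> i) x (v i x) \<bullet> u + \<Upsilon> i x \<bullet> fd (v i) x u) *\<^sub>R a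
      + (fd (\<Upsilon> i) x (v i x) \<bullet> a + \<Upsilon> i x \<bullet> fd (v i) x a) *\<^sub>R u"
      by (rule lie_conn_change[where \<Upsilon> = \<Upsilon> and i = i and D' = D', OF D' sv s\<Upsilon> x e])
    ultimately show ?thesis
      unfolding \<Lambda>[OF x] L_def by (simp add: scaleR_add_left)
  qed
  show "\<exists>\<Upsilon>. one_form M 0 \<Upsilon> \<and> (\<forall>i X. smooth_on X (U i) \<longrightarrow> (\<forall>x\<in>U i. \<forall>A B.
      lie_tensor (v i) (nabla_vec D' i X) x $ A $ B - nabla_vec D' i (lie_vec (v i) X) x $ A $ B =
      (\<Sum>C\<in>UNIV. (kd A B * \<Upsilon> i x $ C + kd C B * \<Upsilon> i x $ A) * X x $ C)))"
  proof (intro exI[of _ \<Lambda>] conjI form allI impI ballI)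
    fix i and X :: "real^'n \<Rightarrow> real^'n" and x A B assume X: "smooth_on X (U i)" and x: "x \<in> U i"
    show "lie_tensor (v i) (nabla_vec D' i X) x $ A $ B - nabla_vec D' i (lie_vec (v i) X) x $ A $ B =
      (\<Sum>C\<in>UNIV. (kd A B * \<Lambda> i x $ C + kd C B * \<Lambda> i x $ A) * X x $ C)"
      unfolding lie_diff_lie_conn[where D = D', OF U x smooth_conn[OF D'] sv X] main[OF x] sum_kd ..
  qed
qed

end

subsection \<open>Locally constant functions\<close>

text \<open>On a coordinate ball a vanishing derivative makes \<open>f\<close> constant, so
  \<open>S Q\<close> is open for every predicate \<open>Q\<close>. The points where \<open>f\<close>
  equals \<open>c\<close> and those where it differs then split the space into two open sets, the
  first of which contains \<open>m0\<close>.\<close>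

lemma connected_atlas_constant:
  fixes A :: "('i, 'a, 'e::euclidean_space) atlas" and f :: "'i \<Rightarrow> 'e \<Rightarrow> real"
  assumes A: "smooth_atlas A" and ne: "points A \<noteq> {}" and conn: "connected_space (atlas_topology A)"
    and law: "\<And>i j x. x \<in> overlap A i j \<Longrightarrow> f j (transition A i j x) = f i x"
    and d: "\<And>i x. x \<in> chart_image A i \<Longrightarrow> (f i has_derivative (\<lambda>u. 0)) (at x)"
  shows "\<exists>c. \<forall>i. \<forall>x\<in>chart_image A i. f i x = c"
proof -
  obtain i0 m0 where m0: "m0 \<in> fst (A i0)" using ne by (auto simp: points_def)
  define c where "c = f i0 (snd (A i0) m0)"
  define S where "S Q = {m. \<exists>i. m \<in> fst (A i) \<and> Q (f i (snd (A i) m))}" for Q :: "real \<Rightarrow> bool"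
  have ind: "f i (snd (A i) m) = f j (snd (A j) m)" if "m \<in> fst (A i)" "m \<in> fst (A j)" for i j m
    using law[of "snd (A i) m" i j] that transition_apply[OF A that(1)] by (auto simp: overlap_def)
  have op: "openin (atlas_topology A) (S Q)" for Q
  proof (subst openin_subopen, intro ballI)
    fix m assume "m \<in> S Q"
    then obtain i where i: "m \<in> fst (A i)" "Q (f i (snd (A i) m))" by (auto simp: S_def)
    let ?x = "snd (A i) m"
    have "?x \<in> chart_image A i" using i by (simp add: chart_image_def)
    then obtain e where e: "e > 0" "ball ?x e \<subseteq> chart_image A i" using open_chart_image[OF A] openE by blast
    have "f i y = f i ?x" if "y \<in> ball ?x e" for y
    proof (rule has_derivative_zero_unique[of "ball ?x e"])
      show "(f i has_derivative (\<lambda>h. 0)) (at z within ball ?x e)" if "z \<in> ball ?x e" for z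
        by (rule has_derivative_at_withinI[OF d[OF subsetD[OF e(2) that]]])
    qed (use that e in auto)
    then have "fst (A i) \<inter> snd (A i) -` ball ?x e \<subseteq> S Q" using i by (auto simp: S_def)
    moreover have "openin (atlas_topology A) (fst (A i) \<inter> snd (A i) -` ball ?x e)"
      unfolding atlas_topology_def by (rule topology_generated_by_Basis) blast
    ultimately show "\<exists>T. openin (atlas_topology A) T \<and> m \<in> T \<and> T \<subseteq> S Q"
      using i(1) e(1) by (intro exI[of _ "fst (A i) \<inter> snd (A i) -` ball ?x e"]) auto
  qed
  have top: "topspace (atlas_topology A) = points A"
    unfolding atlas_topology_def topology_generated_by_topspace points_def by (auto intro: open_UNIV)
  have un: "S (\<lambda>y. y = c) \<union> S (\<lambda>y. y \<noteq> c) = topspace (atlas_topology A)"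
    unfolding top by (auto simp: S_def points_def)
  have dis: "S (\<lambda>y. y = c) \<inter> S (\<lambda>y. y \<noteq> c) = {}" using ind by (auto simp: S_def)
  have "m0 \<in> S (\<lambda>y. y = c)" using m0 by (auto simp: S_def c_def)
  then have empty: "S (\<lambda>y. y \<noteq> c) = {}"
    using conn op un dis unfolding connected_space_eq by blast
  have fc: "f i x = c" if x: "x \<in> chart_image A i" for i x
  proof (rule ccontr)
    assume n: "f i x \<noteq> c"
    obtain m where "m \<in> fst (A i)" "x = snd (A i) m" using x by (auto simp: chart_image_def)
    then have "m \<in> S (\<lambda>y. y \<noteq> c)" using n unfolding S_def by blast
    then show False using empty by simp
  qed
  show ?thesis by (intro exI[of _ c] allI ballI fc)
qed

section \<open>Sums of lifts and uniqueness of their components\<close>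

lemma std_field_split:
  "std_field G v w \<alpha> (\<lambda>x. s x + k x) \<nu> (x, p) = std_field G (\<lambda>x. 0) w (\<lambda>x. 0) (\<lambda>x. 0) \<nu> (x, p)
    + std_field G v (\<lambda>x. 0) (\<lambda>x. 0) s (\<lambda>x. 0) (x, p) + std_field G (\<lambda>x. 0) (\<lambda>x. 0) \<alpha> (\<lambda>x. 0) (\<lambda>x. 0) (x, p) + (0, k x *\<^sub>R p)"
  by (simp add: std_field_def matrix_zero_map vm_simps cm_simps scaleR_add_left)

context projective_manifold
begin

text \<open>The sum of the three lifts and of \<open>c\<close> times the Euler field as a single
  normal form; the summand \<open>2 * c\<close> is due to the Euler field being
  \<open>2p\<close>.\<close>

definition total_field :: "('i \<Rightarrow> real^'n \<Rightarrow> real^'n^'n) \<Rightarrow> ('i \<Rightarrow> real^'n \<Rightarrow> real^'n) \<Rightarrow> ('i \<Rightarrow> real^'n \<Rightarrow> real^'n) \<Rightarrow> real \<Rightarrow>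
    'i \<Rightarrow> (real^'n) \<times> (real^'n) \<Rightarrow> (real^'n) \<times> (real^'n)" where
  "total_field w v \<alpha> c i = std_field (D i) (v i) (trivialize \<sigma> (-2) w i) (trivialize \<sigma> 2 \<alpha> i)
     (\<lambda>x. 2 / (real CARD('n) + 1) * chart.divg i (v i) x + 2 * c) (biv_nu (trivialize \<sigma> (-2) w) i)"

lemma total_lift:
  assumes v: "\<And>i. smooth_on (v i) (U i)"
  shows "lift_plus M D \<sigma> w i z + lift_zero M D \<sigma> v i z + lift_minus M \<sigma> \<alpha> i z + c *\<^sub>R euler_field M i z
    = transport M \<sigma> (total_field w v \<alpha> c) i z"
proof (cases "z \<in> UU i")
  case True
  obtain x p where z: "z = (x, p)" and x: "x \<in> U i" using True by auto
  have lin: "linear (fd (\<Theta> i) (\<Phi> i z))" by (rule linear_\<Theta>[OF \<Phi>_UU[OF True]])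
  have e: "c *\<^sub>R euler_field M i z = fd (\<Theta> i) (\<Phi> i z) (0, (2 * c) *\<^sub>R (\<sigma> i x powr (-2) *\<^sub>R p))"
  proof -
    have "fd (\<Phi> i) z (0, (2 * c) *\<^sub>R p) = (0, (2 * c) *\<^sub>R (\<sigma> i x powr (-2) *\<^sub>R p))"
      unfolding z fd_\<Phi>[OF x] by (simp add: linear_0[OF linear_fd[OF smooth_on_differentiable[OF smooth_\<sigma> x]]] mult.commute)
    then have "fd (\<Theta> i) (\<Phi> i z) (0, (2 * c) *\<^sub>R (\<sigma> i x powr (-2) *\<^sub>R p)) = (0, (2 * c) *\<^sub>R p)"
      using fd_\<Theta>\<Phi>[OF True, of "(0, (2 * c) *\<^sub>R p)"] by simp
    then show ?thesis
      using x by (simp add: z euler_field_def restrict_chart_def chart_image_C mult.commute)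
  qed
  have pz: "\<Phi> i z = (x, \<sigma> i x powr (-2) *\<^sub>R p)" by (simp add: z \<Phi>_apply)
  show ?thesis
    unfolding lift_plus_transport lift_zero_transport[OF v] lift_minus_transport transport_eq[OF True] e
      linear_add[OF lin, symmetric]
    unfolding pz total_field_def std_field_split ..
next
  case False
  then show ?thesis
    unfolding lift_plus_transport lift_zero_transport[OF v] lift_minus_transport
    by (simp add: transport_off euler_field_def restrict_chart_def chart_image_C)
qed

lemma transport_inj:
  assumes "transport M \<sigma> Y = transport M \<sigma> Y'" and z: "z \<in> UU i"
  shows "Y i z = Y' i z"
proof -
  have "transport M \<sigma> Y i (\<Theta> i z) = transport M \<sigma> Y' i (\<Theta> i z)" using assms by simp
  then have "fd (\<Theta> i) z (Y i z) = fd (\<Theta> i) z (Y' i z)"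
    unfolding transport_eq[OF \<Theta>_UU[OF z]] \<Phi>\<Theta>[OF z] .
  then have "fd (\<Phi> i) (\<Theta> i z) (fd (\<Theta> i) z (Y i z)) = fd (\<Phi> i) (\<Theta> i z) (fd (\<Theta> i) z (Y' i z))" by simp
  then show ?thesis unfolding fd_\<Phi>\<Theta>[OF z] .
qed

lemma trivialize_inj:
  assumes x: "x \<in> U i" and e: "trivialize \<sigma> k T i x = trivialize \<sigma> k T' i x"
  shows "T i x = T' i x"
  using e \<sigma>_pos[OF x] by (simp add: trivialize_def)

text \<open>On the zero section one reads off \<open>v\<close> and \<open>\<alpha>\<close>, from the
  base component at general \<open>p\<close> also \<open>w\<close>. Only then can \<open>c\<close>
  be isolated, at one point of the manifold and one nonzero covector. Off the chart images the
  components agree because they vanish.\<close>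

lemma total_field_unique:
  assumes ne: "points M \<noteq> {}"
    and w: "bivector_solution M D w" and v: "infinitesimal_symmetry M P v" and a: "killing_form M D \<alpha>"
    and w': "bivector_solution M D w'" and v': "infinitesimal_symmetry M P v'" and a': "killing_form M D \<alpha>'"
    and e: "transport M \<sigma> (total_field w v \<alpha> c) = transport M \<sigma> (total_field w' v' \<alpha>' c')"
  shows "w = w' \<and> v = v' \<and> \<alpha> = \<alpha>' \<and> c = c'"
proof -
  have t: "total_field w v \<alpha> c i (x, p) = total_field w' v' \<alpha>' c' i (x, p)" if "x \<in> U i" for i x p
    by (rule transport_inj[OF e]) (use that in simp)
  have off: "T i x = 0" if "smooth_components M T" "x \<notin> U i" for T :: "'i \<Rightarrow> real^'n \<Rightarrow> 'b::real_normed_vector" and i x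
    using that unfolding smooth_components_def by blast
  have sw: "smooth_components M w" "smooth_components M w'"
    using w w' unfolding bivector_solution_def bivector_def by blast+
  have sv: "smooth_components M v" "smooth_components M v'"
    using v v' unfolding infinitesimal_symmetry_def vector_field_def by blast+
  have sa: "smooth_components M \<alpha>" "smooth_components M \<alpha>'"
    using a a' unfolding killing_form_def one_form_def by blast+
  have vv: "v i x = v' i x" for i x
  proof (cases "x \<in> U i")
    case True
    from t[OF True, of 0] show ?thesis by (simp add: total_field_def std_field_def vm_simps)
  qed (simp add: off sv)
  have ww: "w i x = w' i x" for i x
  proof (cases "x \<in> U i")
    case True
    have "p v* trivialize \<sigma> (-2) w i x = p v* trivialize \<sigma> (-2) w' i x" for p
      using t[OF True, of p] by (simp add: total_field_def std_field_def vv)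
    then have "trivialize \<sigma> (-2) w i x = trivialize \<sigma> (-2) w' i x"
      by (metis vm_axis vec_eq_iff)
    then show ?thesis by (rule trivialize_inj[OF True])
  qed (simp add: off sw)
  have aa: "\<alpha> i x = \<alpha>' i x" for i x
  proof (cases "x \<in> U i")
    case True
    have "trivialize \<sigma> 2 \<alpha> i x = trivialize \<sigma> 2 \<alpha>' i x"
      using t[OF True, of 0] by (simp add: total_field_def std_field_def vm_simps)
    then show ?thesis by (rule trivialize_inj[OF True])
  qed (simp add: off sa)
  have wva: "w = w'" "v = v'" "\<alpha> = \<alpha>'" using ww vv aa by (auto intro!: ext)
  obtain i m where "m \<in> fst (M i)" using ne by (auto simp: points_def)
  then have x: "snd (M i) m \<in> U i" by (simp add: chart_image_def)
  obtain A :: 'n where True by simp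
  have "(2 * c) *\<^sub>R axis A (1::real) = (2 * c') *\<^sub>R axis A 1"
    using t[OF x, of "axis A 1"] unfolding wva total_field_def std_field_split by simp
  then have "c = c'" by (simp add: axis_eq_0_iff)
  then show ?thesis using wva by simp
qed

end

section \<open>From a conformal Killing field to its components on the base\<close>

locale conformal_field = projective_manifold M P D \<sigma>
  for M :: "('i, 'a, 'n::finite) natlas" and P D \<sigma> +
  fixes X :: "'i \<Rightarrow> (real^'n) \<times> (real^'n) \<Rightarrow> (real^'n) \<times> (real^'n)" and l :: "'i \<Rightarrow> (real^'n) \<times> (real^'n) \<Rightarrow> real"
  assumes X: "vector_field C X" and l: "\<And>i. smooth_on (l i) (UU i)"
    and lieX: "\<And>i z a b. z \<in> UU i \<Longrightarrow> lie_metric (X i) (pw i) z a b = l i z * pw i z a b"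
begin

text \<open>The field \<open>X\<close> pushed forward to \<open>T^*M\<close>, where the chart
  analysis of \<open>killing_chart\<close> applies.\<close>

definition Y :: "'i \<Rightarrow> (real^'n) \<times> (real^'n) \<Rightarrow> (real^'n) \<times> (real^'n)" where
  "Y i \<zeta> = fd (\<Phi> i) (\<Theta> i \<zeta>) (X i (\<Theta> i \<zeta>))"

lemma smooth_X: "smooth_on (X i) (UU i)"
  using vector_fieldD(1)[OF X, of i] by (simp only: chart_image_C)

lemma smooth_Y: "smooth_on (Y i) (UU i)"
proof -
  have "smooth_on (\<lambda>\<zeta>. fd (\<Phi> i) (\<Theta> i \<zeta>) (X i (\<Theta> i \<zeta>))) (UU i)"
    by (rule smooth_on_compose[OF smooth_on_fd_apply[OF open_UU smooth_X smooth_\<Phi>] smooth_\<Theta> open_UU open_UU])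
       (use \<Theta>_UU in blast)
  then show ?thesis by (simp add: Y_def[abs_def])
qed

lemma X_transport: "X = transport M \<sigma> Y"
proof (intro ext)
  fix i z
  show "X i z = transport M \<sigma> Y i z"
  proof (cases "z \<in> UU i")
    case True
    show ?thesis unfolding transport_eq[OF True] Y_def \<Theta>\<Phi>[OF True] fd_\<Theta>\<Phi>[OF True] ..
  next
    case False
    then show ?thesis using vector_fieldD(2)[OF X, of z i] by (simp add: transport_off chart_image_C)
  qed
qed

lemma X_\<Theta>: "\<zeta> \<in> UU i \<Longrightarrow> X i (\<Theta> i \<zeta>) = fd (\<Theta> i) \<zeta> (Y i \<zeta>)"
  unfolding Y_def using fd_\<Theta>\<Phi>[OF \<Theta>_UU, of \<zeta> i] \<Phi>\<Theta>[of \<zeta> i] by simp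

lemma lie_Y:
  assumes z: "z \<in> UU i"
  shows "lie_metric (Y i) (pwf (D i)) z a b = l i (\<Theta> i z) * pwf (D i) z a b"
proof -
  have h: "pwf (D i) y u v = pw i (\<Theta> i y) (fd (\<Theta> i) y u) (fd (\<Theta> i) y v)" if "y \<in> UU i" for y u v
    unfolding pw_pwf \<Phi>\<Theta>[OF that] fd_\<Phi>\<Theta>[OF that] ..
  have "lie_metric (Y i) (pwf (D i)) z a b = lie_metric (X i) (pw i) (\<Theta> i z) (fd (\<Theta> i) z a) (fd (\<Theta> i) z b)"
  proof (rule lie_metric_natural[OF open_UU z smooth_\<Theta>])
    show "Y i differentiable at z" by (rule smooth_on_differentiable[OF smooth_Y z])
    show "X i differentiable at (\<Theta> i z)" by (rule smooth_on_differentiable[OF smooth_X \<Theta>_UU[OF z]])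
    show "(\<lambda>y. pw i y u v) differentiable at (\<Theta> i z)" for u v
      by (rule smooth_on_differentiable[OF smooth_pw \<Theta>_UU[OF z]])
    show "bilinear (pw i (\<Theta> i y))" if "y \<in> UU i" for y by (rule bilinear_pw[OF \<Theta>_UU[OF that]])
  qed (rule X_\<Theta> h; assumption)+
  then show ?thesis unfolding lieX[OF \<Theta>_UU[OF z]] h[OF z] .
qed

lemma Y_law:
  assumes x: "x \<in> overlap M i j"
  shows "Y j (\<Psi> i j (x, p)) = fd (\<Psi> i j) (x, p) (Y i (x, p))"
proof -
  let ?\<zeta> = "(x, p)"
  obtain q where q: "\<Theta> i ?\<zeta> = (x, q)" by (simp add: \<Theta>_apply)
  have zU: "?\<zeta> \<in> UU i" using overlap_U[OF x] by simp
  have qp: "\<Phi> i (x, q) = ?\<zeta>" using \<Phi>\<Theta>[OF zU] q by simp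
  have tU: "transition C i j (x, q) \<in> UU j" using overlap_U(2)[OF x] by (simp add: transition_C[OF x])
  have t: "\<Theta> j (\<Psi> i j ?\<zeta>) = transition C i j (x, q)"
    using \<Theta>\<Phi>[OF tU] unfolding \<Phi>_transition[OF x] qp .
  have xC: "(x, q) \<in> overlap C i j" using x by (simp add: overlap_C)
  have "Y j (\<Psi> i j ?\<zeta>) = fd (\<Phi> j) (transition C i j (x, q)) (dtrans C i j (x, q) (X i (x, q)))"
    unfolding Y_def t vector_fieldD(3)[OF X xC] ..
  also have "\<dots> = fd (\<Psi> i j) ?\<zeta> (fd (\<Phi> i) (x, q) (X i (x, q)))"
    unfolding fd_\<Phi>_transition[OF x] qp ..
  finally show ?thesis unfolding Y_def q .
qed

lemma chart_field: "killing_chart (U i) (D i) (phi i) (Y i) (\<lambda>\<zeta>. l i (\<Theta> i \<zeta>))"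
proof
  show "smooth_on (Y i) (UU i)" by (rule smooth_Y)
  show "smooth_on (\<lambda>\<zeta>. l i (\<Theta> i \<zeta>)) (UU i)"
    by (rule smooth_on_compose[OF l smooth_\<Theta> open_UU open_UU]) (use \<Theta>_UU in blast)
  show "lie_metric (Y i) (pwf (D i)) (x, p) a b = l i (\<Theta> i (x, p)) * pwf (D i) (x, p) a b" if "x \<in> U i" for x p a b
    by (rule lie_Y) (use that in simp)
qed

sublocale K: killing_chart "U i" "D i" "phi i" "Y i" "\<lambda>\<zeta>. l i (\<Theta> i \<zeta>)" for i
  by (rule chart_field)

text \<open>This and the next two definitions turn the unweighted fibre components into weighted
  fields: the power of the scale undoes \<open>trivialize\<close>, and the value 0 off the chart
  image meets the convention for components.\<close>

definition vv :: "'i \<Rightarrow> real^'n \<Rightarrow> real^'n" where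
  "vv i x = (if x \<in> U i then fibre_v (Y i) x else 0)"

definition ww :: "'i \<Rightarrow> real^'n \<Rightarrow> real^'n^'n" where
  "ww i x = (if x \<in> U i then \<sigma> i x powr (-2) *\<^sub>R fibre_w (Y i) x else 0)"

definition aa :: "'i \<Rightarrow> real^'n \<Rightarrow> real^'n" where
  "aa i x = (if x \<in> U i then \<sigma> i x powr 2 *\<^sub>R fibre_a (Y i) x else 0)"

lemma triv_ww: "x \<in> U i \<Longrightarrow> trivialize \<sigma> (-2) ww i x = fibre_w (Y i) x"
  using \<sigma>_pos[of x i] by (simp add: trivialize_def ww_def powr_minus)

lemma triv_aa: "x \<in> U i \<Longrightarrow> trivialize \<sigma> 2 aa i x = fibre_a (Y i) x"
  using \<sigma>_pos[of x i] by (simp add: trivialize_def aa_def powr_minus)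

lemma smooth_vv: "smooth_on (vv i) (U i)"
  by (rule smooth_on_cong[OF U _ K.smooth_v]) (simp add: vv_def)

lemma smooth_ww: "smooth_on (ww i) (U i)"
proof (rule smooth_on_cong[OF U])
  show "smooth_on (\<lambda>x. \<sigma> i x powr (-2) *\<^sub>R fibre_w (Y i) x) (U i)"
    by (intro smooth_on_scaleR smooth_on_powr U smooth_\<sigma> \<sigma>_pos K.smooth_w)
qed (simp add: ww_def)

lemma smooth_aa: "smooth_on (aa i) (U i)"
proof (rule smooth_on_cong[OF U])
  show "smooth_on (\<lambda>x. \<sigma> i x powr 2 *\<^sub>R fibre_a (Y i) x) (U i)"
    by (intro smooth_on_scaleR smooth_on_powr U smooth_\<sigma> \<sigma>_pos K.smooth_a)
qed (simp add: aa_def)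

lemma fst_law:
  assumes x: "x \<in> overlap M i j"
  shows "fibre_v (Y j) (transition M i j x) + (p v* invjac i j x) v* fibre_w (Y j) (transition M i j x)
    = jacobian M i j x *v (fibre_v (Y i) x + p v* fibre_w (Y i) x)"
proof -
  obtain u q where Yi: "Y i (x, p) = (u, q)" by force
  have "fst (Y j (\<Psi> i j (x, p))) = jacobian M i j x *v fst (Y i (x, p))"
    unfolding Y_law[OF x] Yi by (simp add: fd_\<Psi>(1)[OF x])
  then show ?thesis
    by (simp add: \<Psi>_def K.fst_Y[OF overlap_U(1)[OF x]] K.fst_Y[OF overlap_U(2)[OF x]])
qed

lemma vv_law:
  assumes x: "x \<in> overlap M i j"
  shows "vv j (transition M i j x) = jacobian M i j x *v vv i x"
  using fst_law[OF x, of 0] overlap_U[OF x] by (simp add: vv_def vm_simps)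

lemma fibre_w_law:
  assumes x: "x \<in> overlap M i j"
  shows "p v* fibre_w (Y j) (transition M i j x) = jacobian M i j x *v ((p v* jacobian M i j x) v* fibre_w (Y i) x)"
proof -
  have "jacobian M i j x *v fibre_v (Y i) x = fibre_v (Y j) (transition M i j x)"
    using fst_law[OF x, of 0] by (simp add: vm_simps)
  then show ?thesis
    using fst_law[OF x, of "p v* jacobian M i j x"] invjac(2)[OF x, of p] by (simp add: mv_simps)
qed

lemma fibre_a_law:
  assumes x: "x \<in> overlap M i j"
  shows "fibre_a (Y j) (transition M i j x) v* jacobian M i j x = fibre_a (Y i) x"
proof (rule vector_eq_rdot[THEN iffD1], rule allI)
  fix b
  obtain u q where Yi: "Y i (x, 0) = (u, q)" by force
  have "snd (Y j (\<Psi> i j (x, 0))) \<bullet> (jacobian M i j x *v b) = q \<bullet> b"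
    unfolding Y_law[OF x] Yi by (simp add: fd_\<Psi>(2)[OF x] vm_simps)
  then show "(fibre_a (Y j) (transition M i j x) v* jacobian M i j x) \<bullet> b = fibre_a (Y i) x \<bullet> b"
    by (simp add: \<Psi>_def vm_simps fibre_a_def Yi dot_lmul_matrix)
qed

lemma vector_field_vv: "vector_field M vv"
  unfolding vector_field_def smooth_components_def
  using smooth_vv vv_law dtrans_jacobian by (simp add: vv_def)

lemma fd_vv: "x \<in> U i \<Longrightarrow> fd (vv i) x = fd (fibre_v (Y i)) x"
  by (rule fd_cong[OF U], assumption) (simp add: vv_def)

lemma fd_divg_vv: "x \<in> U i \<Longrightarrow> fd (chart.divg i (vv i)) x = fd (chart.divg i (fibre_v (Y i))) x"
  by (rule fd_cong[OF U], assumption) (simp add: chart.divg_def fd_vv, simp add: vv_def)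

lemma symmetry_vv: "infinitesimal_symmetry M P vv"
proof (rule infinitesimal_symmetryI[OF vector_field_vv])
  fix i x u a assume x: "x \<in> U i"
  have "fd (\<lambda>y. fd (vv i) y b) x r = fd (\<lambda>y. fd (fibre_v (Y i)) y b) x r" for b r
    by (rule fun_cong[OF fd_cong[OF U x]]) (simp add: fd_vv)
  then have lc: "lie_conn (vv i) (D i) x u a = lie_conn (fibre_v (Y i)) (D i) x u a"
    unfolding lie_conn_def fd_vv[OF x] using x by (simp add: vv_def)
  define N where "N = real CARD('n) + 1"
  have "2 *\<^sub>R (N *\<^sub>R lie_conn (vv i) (D i) x u a) = N *\<^sub>R (2 *\<^sub>R lie_conn (fibre_v (Y i)) (D i) x u a)"
    unfolding lc by simp
  also have "\<dots> = (N * fd (\<lambda>x. l i (\<Theta> i (x, 0))) x u) *\<^sub>R a + (N * fd (\<lambda>x. l i (\<Theta> i (x, 0))) x a) *\<^sub>R u"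
    unfolding K.base_equations(2)[OF x] by (simp add: scaleR_add_right)
  also have "\<dots> = 2 *\<^sub>R (fd (chart.divg i (vv i)) x u *\<^sub>R a + fd (chart.divg i (vv i)) x a *\<^sub>R u)"
    unfolding N_def K.l0_divergence[OF x] fd_divg_vv[OF x] by (simp add: scaleR_add_right)
  finally have two: "2 *\<^sub>R (N *\<^sub>R lie_conn (vv i) (D i) x u a)
    = 2 *\<^sub>R (fd (chart.divg i (vv i)) x u *\<^sub>R a + fd (chart.divg i (vv i)) x a *\<^sub>R u)" .
  show "(real CARD('n) + 1) *\<^sub>R lie_conn (vv i) (D i) x u a
      = fd (chart.divg i (vv i)) x u *\<^sub>R a + fd (chart.divg i (vv i)) x a *\<^sub>R u"
    by (rule scaleR_left_imp_eq[OF _ two[unfolded N_def]]) simp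
qed

lemma one_form_aa: "one_form M 2 aa"
  unfolding one_form_def smooth_components_def
proof (intro conjI allI ballI impI smooth_aa)
  show "aa i x = 0" if "x \<notin> U i" for i x using that by (simp add: aa_def)
  show "transpose (jacobian M i j x) *v aa j (transition M i j x) = weight_factor M 2 i j x *\<^sub>R aa i x"
    if x: "x \<in> overlap M i j" for i j x
    using overlap_U[OF x] scale_law[OF x, of 2]
    by (simp add: aa_def transpose_matrix_vector vm_simps fibre_a_law[OF x])
qed

lemma killing_aa: "killing_form M D aa"
  unfolding killing_form_def
proof (intro conjI one_form_aa allI ballI)
  fix i x A B assume x: "x \<in> U i"
  have c: "fd (trivialize \<sigma> 2 aa i) x = fd (fibre_a (Y i)) x"
    by (rule fd_cong[OF U x]) (rule triv_aa)
  have "\<forall>u u'. fd (trivialize \<sigma> 2 aa i) x u \<bullet> u' + fd (trivialize \<sigma> 2 aa i) x u' \<bullet> u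
      = 2 * (trivialize \<sigma> 2 aa i x \<bullet> (cm (D i x) u *v u'))"
    unfolding c triv_aa[OF x] using K.base_equations(1)[OF x] by blast
  from killing_form_equation[where \<alpha> = aa, OF smooth_aa x, THEN iffD2, OF this]
  show "(nabla_form 2 D i (aa i) x $ A $ B + nabla_form 2 D i (aa i) x $ B $ A) / 2 = 0" by blast
qed

lemma matrix_eq_vm: "(\<And>p. p v* A = p v* B) \<Longrightarrow> A = B" for A B :: "real^'n^'n"
  by (metis vm_axis vec_eq_iff)

lemma bivector_ww: "bivector M (-2) ww"
  unfolding bivector_def smooth_components_def
proof (intro conjI allI ballI impI smooth_ww)
  show "ww i x = 0" if "x \<notin> U i" for i x using that by (simp add: ww_def)
  show "transpose (ww i x) = - ww i x" for i x
  proof (cases "x \<in> U i")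
    case True
    then show ?thesis using K.skew_w[OF True] by (simp add: ww_def transpose_scaleR)
  next
    case False
    then show ?thesis by (simp add: ww_def transpose_def vec_eq_iff)
  qed
  fix i j x assume x: "x \<in> overlap M i j"
  let ?J = "jacobian M i j x"
  have "fibre_w (Y j) (transition M i j x) = ?J ** fibre_w (Y i) x ** transpose ?J"
    by (rule matrix_eq_vm) (simp add: fibre_w_law[OF x] vector_matrix_mul_assoc[symmetric])
  moreover have "c *\<^sub>R (?J ** B ** transpose ?J) = ?J ** (c *\<^sub>R B) ** transpose ?J" for c B
    by (simp add: matrix_matrix_mult_def vec_eq_iff sum_distrib_left sum_distrib_right mult_ac)
  ultimately show "ww j (transition M i j x) = weight_factor M (-2) i j x *\<^sub>R (?J ** ww i x ** transpose ?J)"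
    using overlap_U[OF x] scale_law[OF x, of "-2"] by (simp add: ww_def)
qed

lemma fd_triv_ww: "x \<in> U i \<Longrightarrow> fd (trivialize \<sigma> (-2) ww i) x = fd (fibre_w (Y i)) x"
  by (rule fd_cong[OF U _ triv_ww])

lemma nabla_triv_ww:
  "x \<in> U i \<Longrightarrow> nabla_w (D i) (trivialize \<sigma> (-2) ww i) x u p q = nabla_w (D i) (fibre_w (Y i)) x u p q"
  by (simp add: nabla_w_def fd_triv_ww triv_ww)

lemma nabla_biv_ww:
  assumes x: "x \<in> U i"
  shows "nabla_biv 0 D i (trivialize \<sigma> (-2) ww i) x $ F $ A $ B
    = kd F A * fibre_nu (\<lambda>\<zeta>. l i (\<Theta> i \<zeta>)) x $ B - kd F B * fibre_nu (\<lambda>\<zeta>. l i (\<Theta> i \<zeta>)) x $ A"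
proof -
  have "\<forall>A B C. nabla_biv 0 D i (trivialize \<sigma> (-2) ww i) x $ C $ A $ B
    = kd C A * fibre_nu (\<lambda>\<zeta>. l i (\<Theta> i \<zeta>)) x $ B - kd C B * fibre_nu (\<lambda>\<zeta>. l i (\<Theta> i \<zeta>)) x $ A"
    by (rule nabla_w_index[where w' = "trivialize \<sigma> (-2) ww i", OF smooth_on_differentiable[OF smooth_trivialize[where T = ww, OF smooth_ww] x]
          trivialize_skew[OF bivector_ww], THEN iffD2])
       (simp add: nabla_triv_ww[OF x] K.nabla_w_nu[OF x])
  then show ?thesis by simp
qed

lemma sum_kd_left: "(\<Sum>Q\<in>UNIV. kd Q B * f Q) = f B" for f :: "'n \<Rightarrow> real"
  by (simp add: kd_def if_distrib[of "\<lambda>x. x * _"] cong: if_cong)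

lemma biv_nu_ww:
  assumes x: "x \<in> U i"
  shows "biv_nu (trivialize \<sigma> (-2) ww) i x = fibre_nu (\<lambda>\<zeta>. l i (\<Theta> i \<zeta>)) x"
proof -
  have "(\<Sum>C\<in>UNIV. nabla_biv 0 D i (trivialize \<sigma> (-2) ww i) x $ C $ C $ A)
      = (real CARD('n) - 1) * fibre_nu (\<lambda>\<zeta>. l i (\<Theta> i \<zeta>)) x $ A" for A
    unfolding nabla_biv_ww[OF x] sum_subtractf sum_kd_left by (simp add: kd_def left_diff_distrib)
  then show ?thesis using dim by (simp add: biv_nu_def vec_eq_iff)
qed

lemma solution_ww: "bivector_solution M D ww"
  unfolding bivector_solution_def
proof (intro conjI bivector_ww allI ballI)
  fix i x assume x: "x \<in> U i"
  let ?D = "nabla_biv (-2) D i (ww i) x"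
  let ?n = "fibre_nu (\<lambda>\<zeta>. l i (\<Theta> i \<zeta>)) x"
  define c where "c = real CARD('n) - 1"
  define r where "r = inverse ((\<sigma> i x)\<^sup>2)"
  have c: "c > 0" using dim by (simp add: c_def)
  have D: "?D $ F $ A $ B = r * (kd F A * ?n $ B - kd F B * ?n $ A)" for F A B
  proof -
    have "(\<sigma> i x)\<^sup>2 * ?D $ F $ A $ B = kd F A * ?n $ B - kd F B * ?n $ A"
      using nabla_biv_ww[OF x, of F A B] by (simp add: nabla_biv_trivialize[where w = ww, OF x smooth_ww])
    then show ?thesis using \<sigma>_pos[OF x] by (simp add: r_def field_simps)
  qed
  have S: "(\<Sum>Q\<in>UNIV. ?D $ Q $ B $ Q) = - c * r * ?n $ B" for B
  proof -
    have "(\<Sum>Q\<in>UNIV. ?D $ Q $ B $ Q) = r * ((\<Sum>Q\<in>UNIV. kd Q B * ?n $ Q) - (\<Sum>Q::'n\<in>UNIV. kd Q Q * ?n $ B))"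
      unfolding D by (simp add: sum_distrib_left sum_subtractf right_diff_distrib)
    also have "\<dots> = - c * r * ?n $ B" unfolding sum_kd_left by (simp add: kd_def c_def algebra_simps)
    finally show ?thesis .
  qed
  have "?D $ F $ A $ B = - (2 / c) * ((kd F A * (\<Sum>Q\<in>UNIV. ?D $ Q $ B $ Q) - kd F B * (\<Sum>Q\<in>UNIV. ?D $ Q $ A $ Q)) / 2)" for F A B
    unfolding S unfolding D using c by (simp add: field_simps)
  then show "let Dw = ?D in \<forall>A B C. Dw $ C $ A $ B = - (2 / (real CARD('n) - 1)) *
      ((kd C A * (\<Sum>Q\<in>UNIV. Dw $ Q $ B $ Q) - kd C B * (\<Sum>Q\<in>UNIV. Dw $ Q $ A $ Q)) / 2)"
    unfolding Let_def c_def by blast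
  fix A F E G :: 'n
  have inst: "projective_curvature (riem (D i) x) (chart.rho i x) (\<lambda>p. p v* trivialize \<sigma> (-2) ww i x)
      (\<lambda>u p. p \<bullet> (fd (fibre_nu (\<lambda>\<zeta>. l i (\<Theta> i \<zeta>))) x u + cm (D i x) u *v ?n))"
    unfolding triv_ww[OF x] by (rule chart.curvature_instance[OF x K.smooth_w K.smooth_nu K.skew_w K.nabla_w_nu])
  show "(\<Sum>B\<in>UNIV. ww i x $ B $ A * proj_weyl D i x B F E G + ww i x $ B $ E * proj_weyl D i x B F A G
       + ww i x $ B $ A * proj_weyl D i x B G E F + ww i x $ B $ E * proj_weyl D i x B G A F) / 4 = 0"
    unfolding weyl_condition_iff[OF bivector_ww x inst] triv_ww[OF x] by (rule K.weyl_condition[OF x])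
qed

text \<open>The part of the conformal factor on the zero section that the symmetry does not account
  for; it will be \<open>2 c\<close>.\<close>

definition cc :: "'i \<Rightarrow> real^'n \<Rightarrow> real" where
  "cc i x = l i (\<Theta> i (x, 0)) - 2 / (real CARD('n) + 1) * chart.divg i (vv i) x"

lemma Y_cc:
  assumes x: "x \<in> U i"
  shows "Y i (x, p) = total_field ww vv aa (cc i x / 2) i (x, p)"
proof -
  have "a + 2 * ((b - a) / 2) = b" for a b :: real by (simp add: field_simps)
  then show ?thesis
    unfolding K.Y_std[OF x] total_field_def std_field_def prod.case triv_ww[OF x] triv_aa[OF x] biv_nu_ww[OF x] cc_def
    using x fd_vv[OF x] by (simp only: vv_def if_True)
qed

lemma total_field_cc: "total_field w v \<alpha> c i (x, p) = total_field w v \<alpha> 0 i (x, p) + (0, (2 * c) *\<^sub>R p)"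
  by (simp add: total_field_def std_field_def scaleR_add_left)

lemma total_law:
  assumes x: "x \<in> overlap M i j"
  shows "total_field ww vv aa 0 j (\<Psi> i j (x, p)) = fd (\<Psi> i j) (x, p) (total_field ww vv aa 0 i (x, p))"
  unfolding total_field_def
  by (rule std_field_law[OF x smooth_vv vv_law, where w = "trivialize \<sigma> (-2) ww" and \<alpha> = "trivialize \<sigma> 2 aa"
        and \<nu> = "biv_nu (trivialize \<sigma> (-2) ww)" and s = "\<lambda>i x. 2 / (real CARD('n) + 1) * chart.divg i (vv i) x + 2 * 0"])
     (simp_all add: std_plus_law[OF solution_ww x] trivialize_form_law[OF one_form_aa x] divg_law[OF x smooth_vv vv_law])

text \<open>\<open>Y\<close> and the total field with constant 0 obey the same law under a change of
  charts, hence so does their difference \<open>(0, cc i x *\<^sub>R p)\<close>. Pairing it with the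
  Jacobian applied to a nonzero \<open>p\<close> isolates the coefficient.\<close>

lemma cc_law:
  assumes x: "x \<in> overlap M i j"
  shows "cc j (transition M i j x) = cc i x"
proof -
  obtain A :: 'n where True by simp
  define p :: "real^'n" where "p = axis A 1"
  let ?p = "p v* invjac i j x" and ?t = "transition M i j x"
  have lin: "linear (fd (\<Psi> i j) (x, p))"
    by (rule linear_fd[OF smooth_on_differentiable[OF smooth_\<Psi>]]) (simp add: x)
  have P: "\<Psi> i j (x, p) = (?t, ?p)" by (simp add: \<Psi>_def)
  have "Y j (\<Psi> i j (x, p)) = total_field ww vv aa 0 j (\<Psi> i j (x, p)) + (0, cc j ?t *\<^sub>R ?p)"
    unfolding P Y_cc[OF overlap_U(2)[OF x]] by (subst total_field_cc) simp
  moreover have "Y i (x, p) = total_field ww vv aa 0 i (x, p) + (0, cc i x *\<^sub>R p)"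
    unfolding Y_cc[OF overlap_U(1)[OF x]] by (subst total_field_cc) simp
  ultimately have "(0, cc j ?t *\<^sub>R ?p) = fd (\<Psi> i j) (x, p) (0, cc i x *\<^sub>R p)"
    using Y_law[OF x, of p] unfolding total_law[OF x] by (simp add: linear_add[OF lin])
  then have "snd (0 :: real^'n, cc j ?t *\<^sub>R ?p) \<bullet> (jacobian M i j x *v p) = snd (fd (\<Psi> i j) (x, p) (0, cc i x *\<^sub>R p)) \<bullet> (jacobian M i j x *v p)"
    by simp
  then have "cc j ?t * (p \<bullet> p) = cc i x * (p \<bullet> p)"
    unfolding fd_\<Psi>(2)[OF x] by (simp add: p_jac[OF x] linear_0[OF linear_hess(1)[OF x]])
  moreover have "p \<bullet> p \<noteq> 0" by (simp add: p_def axis_eq_0_iff)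
  ultimately show ?thesis by simp
qed

text \<open>A restatement of \<open>l0_divergence\<close>: the trace of the symmetry equation fixes
  the conformal factor up to a locally constant term.\<close>

lemma cc_deriv:
  assumes x: "x \<in> U i"
  shows "(cc i has_derivative (\<lambda>u. 0)) (at x)"
proof -
  define N where "N = real CARD('n) + 1"
  have N: "N \<noteq> 0" unfolding N_def by linarith
  have "(cc i has_derivative (\<lambda>u. fd (\<lambda>x. l i (\<Theta> i (x, 0))) x u - 2 / N * fd (chart.divg i (vv i)) x u)) (at x)"
    unfolding cc_def[abs_def] N_def
    by (intro has_derivative_diff has_derivative_mult_right smooth_on_has_derivative[OF K.smooth_l0 x]
        smooth_on_has_derivative[OF chart.smooth_divg[OF smooth_vv] x])
  moreover have "fd (\<lambda>x. l i (\<Theta> i (x, 0))) x u - 2 / N * fd (chart.divg i (vv i)) x u = 0" for u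
    using K.l0_divergence[OF x, of u] N unfolding fd_divg_vv[OF x] N_def[symmetric] by (simp add: field_simps)
  ultimately show ?thesis by simp
qed

lemma decomposition:
  assumes "points M \<noteq> {}" "connected_space (atlas_topology M)"
  shows "\<exists>c. X = transport M \<sigma> (total_field ww vv aa c)"
proof -
  obtain c where c: "\<And>i x. x \<in> U i \<Longrightarrow> cc i x = c"
    using connected_atlas_constant[OF atlas assms cc_law cc_deriv] by blast
  have "transport M \<sigma> Y = transport M \<sigma> (total_field ww vv aa (c / 2))"
    by (rule transport_cong) (simp add: Y_cc c)
  then show ?thesis using X_transport by metis
qed

end

theorem theorem3:
  fixes M :: "('i, 'a, 'n::finite) natlas"
    and P :: "('i, 'n) conn set"
    and D :: "('i, 'n) conn"
    and \<sigma> :: "'i \<Rightarrow> real^'n \<Rightarrow> real"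
  assumes "oriented_manifold M"
    and "CARD('n) \<ge> 2"
    and "projective_structure M P"
    and "D \<in> P" and "special_connection M D"
    and "parallel_scale M D \<sigma>"
  shows "(\<forall>v. infinitesimal_symmetry M P v \<longrightarrow>
            conformal_killing (cotangent2 M) (pw_class M P) (lift_zero M D \<sigma> v)) \<and>
         (CARD('n) \<ge> 3 \<longrightarrow> (\<forall>w. bivector_solution M D w \<longrightarrow>
            conformal_killing (cotangent2 M) (pw_class M P) (lift_plus M D \<sigma> w))) \<and>
         (\<forall>\<alpha>. killing_form M D \<alpha> \<longrightarrow>
            conformal_killing (cotangent2 M) (pw_class M P) (lift_minus M \<sigma> \<alpha>)) \<and>
         (points M \<noteq> {} \<and> connected_space (atlas_topology M) \<longrightarrow>
           (\<forall>X. conformal_killing (cotangent2 M) (pw_class M P) X \<longrightarrow>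
             (\<exists>!q. case q of (w, v, \<alpha>, c) \<Rightarrow>
                bivector_solution M D w \<and> infinitesimal_symmetry M P v \<and> killing_form M D \<alpha> \<and>
                X = (\<lambda>i z. lift_plus M D \<sigma> w i z + lift_zero M D \<sigma> v i z
                         + lift_minus M \<sigma> \<alpha> i z + (c::real) *\<^sub>R euler_field M i z))))"
proof -
  interpret pm: projective_manifold M P D \<sigma>
    using assms by (intro projective_manifold.intro)
  have lifts: "(\<lambda>i z. lift_plus M D \<sigma> w i z + lift_zero M D \<sigma> v i z + lift_minus M \<sigma> \<alpha> i z + c *\<^sub>R euler_field M i z)
      = transport M \<sigma> (pm.total_field w v \<alpha> c)" if "infinitesimal_symmetry M P v" for w v \<alpha> c
  proof (intro ext)
    have "vector_field M v" using that by (simp add: infinitesimal_symmetry_def)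
    then show "lift_plus M D \<sigma> w i z + lift_zero M D \<sigma> v i z + lift_minus M \<sigma> \<alpha> i z + c *\<^sub>R euler_field M i z
      = transport M \<sigma> (pm.total_field w v \<alpha> c) i z" for i z
      by (intro pm.total_lift vector_fieldD(1))
  qed
  show ?thesis
  proof (intro conjI allI impI)
    show "conformal_killing (cotangent2 M) (pw_class M P) (lift_zero M D \<sigma> v)"
      if "infinitesimal_symmetry M P v" for v
      by (rule pm.killing_lift_zero[OF that])
    show "conformal_killing (cotangent2 M) (pw_class M P) (lift_plus M D \<sigma> w)"
      if "3 \<le> CARD('n)" "bivector_solution M D w" for w
      by (rule pm.killing_lift_plus[OF that])
    show "conformal_killing (cotangent2 M) (pw_class M P) (lift_minus M \<sigma> \<alpha>)"
      if "killing_form M D \<alpha>" for \<alpha>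
      by (rule pm.killing_lift_minus[OF that])
    fix X assume conn: "points M \<noteq> {} \<and> connected_space (atlas_topology M)"
      and X: "conformal_killing (cotangent2 M) (pw_class M P) X"
    \<comment> \<open>One metric of the class suffices in this direction; the one chosen is the
      Patterson--Walker metric of \<open>D\<close> itself.\<close>
    obtain l where l: "scalar_field (cotangent2 M) l"
      and lie: "\<And>i z a b. z \<in> chart_image (cotangent2 M) i \<Longrightarrow>
        lie_metric (X i) (pm.pw i) z a b = l i z * pm.pw i z a b"
      using X pm.pw_in_class unfolding conformal_killing_def by metis
    interpret cf: conformal_field M P D \<sigma> X l
    proof
      show "vector_field (cotangent2 M) X" using X by (simp add: conformal_killing_def)
      show "smooth_on (l i) (chart_image M i \<times> UNIV)" for i
        using l unfolding scalar_field_def smooth_components_def pm.chart_image_C by blast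
      show "lie_metric (X i) (pm.pw i) z a b = l i z * pm.pw i z a b" if "z \<in> chart_image M i \<times> UNIV" for i z a b
        by (rule lie) (use that in \<open>simp add: pm.chart_image_C\<close>)
    qed
    obtain c where c: "X = transport M \<sigma> (pm.total_field cf.ww cf.vv cf.aa c)"
      using cf.decomposition conn by blast
    show "\<exists>!q. case q of (w, v, \<alpha>, c) \<Rightarrow>
        bivector_solution M D w \<and> infinitesimal_symmetry M P v \<and> killing_form M D \<alpha> \<and>
        X = (\<lambda>i z. lift_plus M D \<sigma> w i z + lift_zero M D \<sigma> v i z
                 + lift_minus M \<sigma> \<alpha> i z + (c::real) *\<^sub>R euler_field M i z)"
    proof (rule ex1I[of _ "(cf.ww, cf.vv, cf.aa, c)"])
      show "case (cf.ww, cf.vv, cf.aa, c) of (w, v, \<alpha>, c) \<Rightarrow>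
        bivector_solution M D w \<and> infinitesimal_symmetry M P v \<and> killing_form M D \<alpha> \<and>
        X = (\<lambda>i z. lift_plus M D \<sigma> w i z + lift_zero M D \<sigma> v i z
                 + lift_minus M \<sigma> \<alpha> i z + c *\<^sub>R euler_field M i z)"
        unfolding prod.case lifts[OF cf.symmetry_vv]
        by (intro conjI cf.solution_ww cf.symmetry_vv cf.killing_aa c)
      fix q :: "('i \<Rightarrow> real^'n \<Rightarrow> real^'n^'n) \<times> ('i \<Rightarrow> real^'n \<Rightarrow> real^'n) \<times> ('i \<Rightarrow> real^'n \<Rightarrow> real^'n) \<times> real"
      obtain w v \<alpha> k where q: "q = (w, v, \<alpha>, k)" by (metis prod.collapse)
      assume "case q of (w, v, \<alpha>, c) \<Rightarrow>
        bivector_solution M D w \<and> infinitesimal_symmetry M P v \<and> killing_form M D \<alpha> \<and>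
        X = (\<lambda>i z. lift_plus M D \<sigma> w i z + lift_zero M D \<sigma> v i z
                 + lift_minus M \<sigma> \<alpha> i z + c *\<^sub>R euler_field M i z)"
      then have s: "bivector_solution M D w" "infinitesimal_symmetry M P v" "killing_form M D \<alpha>"
        and e: "X = (\<lambda>i z. lift_plus M D \<sigma> w i z + lift_zero M D \<sigma> v i z
                 + lift_minus M \<sigma> \<alpha> i z + k *\<^sub>R euler_field M i z)"
        unfolding q prod.case by blast+
      have "transport M \<sigma> (pm.total_field w v \<alpha> k) = transport M \<sigma> (pm.total_field cf.ww cf.vv cf.aa c)"
        using e c unfolding lifts[OF s(2)] by (rule trans[OF sym])
      then show "q = (cf.ww, cf.vv, cf.aa, c)"
        using pm.total_field_unique[OF conjunct1[OF conn] s cf.solution_ww cf.symmetry_vv cf.killing_aa]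
        unfolding q by blast
    qed
  qed
qed

end
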